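(* Let $A$ be an infinite set and let $\delta=\sqrt{\sinh 1-1}$. There exist one-one maps $$\Phi^{(p)}: B_{l^p(A)}\to L^\infty_{(p)}(\Omega_A,\mathbb{P}_A)\quad (1\le p\le 2),\qquad \Phi^{(p)}:B_{l^p(A)}\to M_{(p)}(\Omega_A)\quad(2<p\le\infty),$$ such that $$\|\Phi^{(p)}(\mathbf{x})\|_{L^\infty_{(p)}}\le \frac{2\sqrt e}{1-\delta^{2/p}},\quad \mathbf{x}\in B_{l^p(A)},\ 1\le p\le 2,$$ $$\|\Phi^{(p)}(\mathbf{x})\|_{M_{(p)}}\le 4\Big(\frac{1+\delta^2}{1-\delta^2}\Big)^{1/p},\quad \mathbf{x}\in B_{l^p(A)},\ 2<p\le\infty,$$ $$\Phi^{(p)}(-\mathbf{x})=-\Phi^{(p)}(\mathbf{x}),\quad \mathbf{x}\in B_{l^p(A)},\ 1\le p\le\infty,$$ and $$\sum_{\alpha\in A}\mathbf{x}(\alpha)\overline{\mathbf{y}(\alpha)}=\int_{\Omega_A}\Phi^{(p)}(\mathbf{x})\,d\Phi^{(q)}(\overline{\mathbf{y}}),\quad \mathbf{x}\in B_{l^p(A)},\ \mathbf{y}\in B_{l^q(A)},\ \tfrac1p+\tfrac1q=1,\ 1\le p\le 2\le q\le\infty,$$ where $d\Phi^{(2)}:=\Phi^{(2)}\,d\mathbb{P}_A$ and the integral is understood as $\sum_{w\in W_A}\widehat{\Phi^{(p)}(\mathbf{x})}(w)\,\widehat{\Phi^{(q)}(\overline{\mathbf{y}})}(w)$ (Parseval's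 formula). Moreover, for every $p\in[1,\infty]$, $\Phi^{(p)}$ is weakly continuous (weak topology on the domain, weak* topology on the range), and the map $\mathbf{x}\mapsto\widehat{\Phi^{(p)}(\mathbf{x})}$ is continuous from $B_{l^p(A)}$ with the $l^p(A)$-norm to $l^p(W_A)$ with its norm.
   Context: Scalars are complex. $B_{l^p(A)}$ is the closed unit ball of $l^p(A)$ (complex-valued functions on $A$). $\Omega_A=\{-1,1\}^A$ is the compact abelian group with coordinatewise multiplication; $\mathbb{P}_A$ is its normalized Haar measure; $M(\Omega_A)$ is the space of regular complex Borel measures on $\Omega_A$ with total variation norm $\|\cdot\|_M$. For $\alpha\in A$, $r_\alpha(\omega)=\omega(\alpha)$. $W_A$ (the Walsh characters) is the set of all finite products $\prod_{\alpha\in F}r_\alpha$, $F\subset A$ finite (empty product $=1$); it is the character group of $\Omega_A$. Walsh transforms: $\hat\mu(w)=\int w\,d\mu$ for $\mu\in M(\Omega_A)$, $\hat f=\widehat{f\,d\mathbb{P}_A}$ for $f\in L^1(\Omega_A,\mathbb{P}_A)$. For $1\le p\le2$: $L^\infty_{(p)}(\Omega_A,\mathbb{P}_A)=\{f\in L^\infty(\Omega_A,\mathbb{P}_A):\hat f\in l^p(W_A)\}$ with norm $\|f\|_{L^\infty_{(p)}}=\max\{\|f\|_{L^\infty},\|\hat f\|_p\}$. For $2<p\le\infty$: $M_{(p)}(\Omega_A)=\{\mu\in M(\Omega_A):\hat\mu\in l^p(W_A)\}$ with norm $\|\mu\|_{M_{(p)}}=\max\{\|\mu\|_M,\|\hat\mu\|_p\}$.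 The weak* topology on the range is that inherited from $L^\infty(\Omega_A,\mathbb{P}_A)=L^1(\Omega_A,\mathbb{P}_A)^*$ when $1\le p\le2$, and from $M(\Omega_A)=C(\Omega_A)^*$ when $2<p\le\infty$. *)

theory Defs
  imports "HOL-Analysis.Analysis" "HOL-Probability.Essential_Supremum"
begin

definition cube :: "'a set \<Rightarrow> ('a \<Rightarrow> complex) set"
  where "cube A = (\<Pi>\<^sub>E \<alpha>\<in>A. {-1, 1})"

definition cube_topology :: "'a set \<Rightarrow> ('a \<Rightarrow> complex) topology"
  where "cube_topology A = product_topology (\<lambda>\<alpha>. discrete_topology {-1, 1}) A"

text \<open>For uncountable \<open>A\<close> the Borel sets form a strictly larger sigma-algebra than the one
  generated by the coordinates, so this is not the product measurable space \<open>PiM\<close>.\<close>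

definition cube_borel :: "'a set \<Rightarrow> ('a \<Rightarrow> complex) measure"
  where "cube_borel A = sigma (cube A) {U. openin (cube_topology A) U}"

definition cube_mult :: "'a set \<Rightarrow> ('a \<Rightarrow> complex) \<Rightarrow> ('a \<Rightarrow> complex) \<Rightarrow> ('a \<Rightarrow> complex)"
  where "cube_mult A \<omega> \<eta> = (\<lambda>\<alpha>\<in>A. \<omega> \<alpha> * \<eta> \<alpha>)"

definition rademacher :: "'a \<Rightarrow> ('a \<Rightarrow> complex) \<Rightarrow> complex"
  where "rademacher \<alpha> \<omega> = \<omega> \<alpha>"

definition walsh :: "'a set \<Rightarrow> (('a \<Rightarrow> complex) \<Rightarrow> complex) set"
  where "walsh A = {(\<lambda>\<omega>\<in>cube A. \<Prod>\<alpha>\<in>F. rademacher \<alpha> \<omega>) | F. finite F \<and> F \<subseteq> A}"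

text \<open>A complex measure on the measurable space of \<open>M\<close> is a set function; it is normalised to be
  \<open>0\<close> on non-measurable sets, so that equality of complex measures is equality of functions.\<close>

definition complex_measures :: "'b measure \<Rightarrow> ('b set \<Rightarrow> complex) set"
  where "complex_measures M =
    {\<mu>. (\<forall>E. E \<notin> sets M \<longrightarrow> \<mu> E = 0) \<and>
        (\<forall>E :: nat \<Rightarrow> 'b set. range E \<subseteq> sets M \<and> disjoint_family E \<longrightarrow>
           (\<lambda>n. \<mu> (E n)) sums \<mu> (\<Union>n. E n))}"

text \<open>The supremum is over a bounded set whenever \<open>\<mu>\<close> is a complex measure.\<close>

definition total_variation :: "'b measure \<Rightarrow> ('b set \<Rightarrow> complex) \<Rightarrow> 'b set \<Rightarrow> real"
  where "total_variation M \<mu> E =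
    (SUP \<P>\<in>{\<P>. finite \<P> \<and> disjoint \<P> \<and> \<P> \<subseteq> sets M \<and> \<Union>\<P> = E}. \<Sum>F\<in>\<P>. cmod (\<mu> F))"

text \<open>The upper variation of a real measure, i.e. the positive part of its Jordan decomposition;
  \<open>ennreal\<close> truncates the negative values at \<open>0\<close>.\<close>

definition upper_variation :: "'b measure \<Rightarrow> ('b set \<Rightarrow> real) \<Rightarrow> 'b measure"
  where "upper_variation M \<nu> =
    measure_of (space M) (sets M) (\<lambda>E. SUP F\<in>{F \<in> sets M. F \<subseteq> E}. ennreal (\<nu> F))"

text \<open>The integral of \<open>f\<close> with respect to \<open>\<mu>\<close>, through the Jordan decompositions of the real and
  imaginary parts of \<open>\<mu>\<close>.\<close>

definition complex_measure_integral ::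
    "'b measure \<Rightarrow> ('b set \<Rightarrow> complex) \<Rightarrow> ('b \<Rightarrow> complex) \<Rightarrow> complex"
  where "complex_measure_integral M \<mu> f =
    ((LINT \<omega>|upper_variation M (\<lambda>E. Re (\<mu> E)). f \<omega>)
      - (LINT \<omega>|upper_variation M (\<lambda>E. - Re (\<mu> E)). f \<omega>))
    + \<i> * ((LINT \<omega>|upper_variation M (\<lambda>E. Im (\<mu> E)). f \<omega>)
      - (LINT \<omega>|upper_variation M (\<lambda>E. - Im (\<mu> E)). f \<omega>))"

text \<open>The complex measure \<open>f dP\<close>.\<close>

definition density_measure :: "'b measure \<Rightarrow> ('b \<Rightarrow> complex) \<Rightarrow> 'b set \<Rightarrow> complex"
  where "density_measure P f E = (if E \<in> sets P then set_lebesgue_integral P E f else 0)"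

definition regular_set_function :: "'b topology \<Rightarrow> 'b set set \<Rightarrow> ('b set \<Rightarrow> real) \<Rightarrow> bool"
  where "regular_set_function X \<B> \<nu> \<longleftrightarrow>
    (\<forall>E\<in>\<B>. \<forall>\<epsilon>>0. \<exists>K U. compactin X K \<and> openin X U \<and> K \<subseteq> E \<and> E \<subseteq> U \<and> \<nu> (U - K) < \<epsilon>)"

definition regular_complex_measures :: "'a set \<Rightarrow> (('a \<Rightarrow> complex) set \<Rightarrow> complex) set"
  where "regular_complex_measures A =
    {\<mu> \<in> complex_measures (cube_borel A).
       regular_set_function (cube_topology A) (sets (cube_borel A))
         (total_variation (cube_borel A) \<mu>)}"

definition variation_norm :: "'a set \<Rightarrow> (('a \<Rightarrow> complex) set \<Rightarrow> complex) \<Rightarrow> real"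
  where "variation_norm A \<mu> = total_variation (cube_borel A) \<mu> (cube A)"

definition normalized_haar :: "'a set \<Rightarrow> ('a \<Rightarrow> complex) measure \<Rightarrow> bool"
  where "normalized_haar A P \<longleftrightarrow>
    space P = cube A \<and> sets P = sets (cube_borel A) \<and> emeasure P (cube A) = 1 \<and>
    regular_set_function (cube_topology A) (sets P) (measure P) \<and>
    (\<forall>\<omega>\<in>cube A. \<forall>E\<in>sets P. emeasure P (cube_mult A \<omega> ` E) = emeasure P E)"

text \<open>Transforms are extended by \<open>0\<close> off the set of Walsh characters.\<close>

definition walsh_transform ::
    "'a set \<Rightarrow> (('a \<Rightarrow> complex) set \<Rightarrow> complex) \<Rightarrow> (('a \<Rightarrow> complex) \<Rightarrow> complex) \<Rightarrow> complex"
  where "walsh_transform A \<mu> w =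
    (if w \<in> walsh A then complex_measure_integral (cube_borel A) \<mu> w else 0)"

text \<open>\<open>l\<^sup>p(S)\<close> for \<open>1 \<le> p \<le> \<infinity>\<close>: a function on \<open>S\<close> is represented by its extension by \<open>0\<close> to the
  whole type.\<close>

definition lp_space :: "ennreal \<Rightarrow> 'i set \<Rightarrow> ('i \<Rightarrow> complex) set"
  where "lp_space p S =
    {x. (\<forall>i. i \<notin> S \<longrightarrow> x i = 0) \<and>
        (if p = \<infinity> then bdd_above ((\<lambda>i. cmod (x i)) ` S)
         else (\<lambda>i. cmod (x i) powr enn2real p) summable_on S)}"

definition lp_norm :: "ennreal \<Rightarrow> 'i set \<Rightarrow> ('i \<Rightarrow> complex) \<Rightarrow> real"
  where "lp_norm p S x =
    (if p = \<infinity> then (SUP i\<in>S. cmod (x i))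
     else (\<Sum>\<^sub>\<infinity>i\<in>S. cmod (x i) powr enn2real p) powr (1 / enn2real p))"

definition lp_ball :: "ennreal \<Rightarrow> 'i set \<Rightarrow> ('i \<Rightarrow> complex) set"
  where "lp_ball p S = {x \<in> lp_space p S. lp_norm p S x \<le> 1}"

text \<open>Elements of \<open>L\<^sup>\<infinity>\<close> are represented by functions; equality in \<open>L\<^sup>\<infinity>\<close> is equality almost
  everywhere.\<close>

definition Linf_norm :: "'b measure \<Rightarrow> ('b \<Rightarrow> complex) \<Rightarrow> real"
  where "Linf_norm P f = real_of_ereal (esssup P (\<lambda>\<omega>. ereal (cmod (f \<omega>))))"

definition Linf_space :: "'b measure \<Rightarrow> ('b \<Rightarrow> complex) set"
  where "Linf_space P = {f \<in> borel_measurable P. esssup P (\<lambda>\<omega>. ereal (cmod (f \<omega>))) < \<infinity>}"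

definition Linf_p_space ::
    "'a set \<Rightarrow> ('a \<Rightarrow> complex) measure \<Rightarrow> ennreal \<Rightarrow> (('a \<Rightarrow> complex) \<Rightarrow> complex) set"
  where "Linf_p_space A P p =
    {f \<in> Linf_space P. walsh_transform A (density_measure P f) \<in> lp_space p (walsh A)}"

definition Linf_p_norm ::
    "'a set \<Rightarrow> ('a \<Rightarrow> complex) measure \<Rightarrow> ennreal \<Rightarrow> (('a \<Rightarrow> complex) \<Rightarrow> complex) \<Rightarrow> real"
  where "Linf_p_norm A P p f =
    max (Linf_norm P f) (lp_norm p (walsh A) (walsh_transform A (density_measure P f)))"

definition M_p_space :: "'a set \<Rightarrow> ennreal \<Rightarrow> (('a \<Rightarrow> complex) set \<Rightarrow> complex) set"
  where "M_p_space A p =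
    {\<mu> \<in> regular_complex_measures A. walsh_transform A \<mu> \<in> lp_space p (walsh A)}"

definition M_p_norm :: "'a set \<Rightarrow> ennreal \<Rightarrow> (('a \<Rightarrow> complex) set \<Rightarrow> complex) \<Rightarrow> real"
  where "M_p_norm A p \<mu> =
    max (variation_norm A \<mu>) (lp_norm p (walsh A) (walsh_transform A \<mu>))"

text \<open>The coarsest topology on \<open>S\<close> for which all the functions \<open>e i\<close>, \<open>i \<in> I\<close>, are continuous.\<close>

definition initial_topology :: "'s set \<Rightarrow> 'i set \<Rightarrow> ('i \<Rightarrow> 's \<Rightarrow> complex) \<Rightarrow> 's topology"
  where "initial_topology S I e =
    pullback_topology S (\<lambda>s. \<lambda>i\<in>I. e i s) (product_topology (\<lambda>i. euclidean) I)"

text \<open>The bounded linear functionals on \<open>l\<^sup>p(S)\<close>; for \<open>p = \<infinity>\<close> this is the full dual of \<open>l\<^sup>\<infinity>(S)\<close>.\<close>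

definition lp_dual :: "ennreal \<Rightarrow> 'i set \<Rightarrow> (('i \<Rightarrow> complex) \<Rightarrow> complex) set"
  where "lp_dual p S =
    {\<phi>. (\<forall>x\<in>lp_space p S. \<forall>y\<in>lp_space p S. \<phi> (\<lambda>i. x i + y i) = \<phi> x + \<phi> y) \<and>
        (\<forall>c. \<forall>x\<in>lp_space p S. \<phi> (\<lambda>i. c * x i) = c * \<phi> x) \<and>
        (\<exists>C. \<forall>x\<in>lp_space p S. cmod (\<phi> x) \<le> C * lp_norm p S x)}"

definition weak_ball_topology :: "ennreal \<Rightarrow> 'i set \<Rightarrow> ('i \<Rightarrow> complex) topology"
  where "weak_ball_topology p S = initial_topology (lp_ball p S) (lp_dual p S) (\<lambda>\<phi> x. \<phi> x)"

definition weak_star_Linf_topology ::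
    "'a set \<Rightarrow> ('a \<Rightarrow> complex) measure \<Rightarrow> ennreal \<Rightarrow> (('a \<Rightarrow> complex) \<Rightarrow> complex) topology"
  where "weak_star_Linf_topology A P p =
    initial_topology (Linf_p_space A P p) {g. integrable P g} (\<lambda>g f. LINT \<omega>|P. f \<omega> * g \<omega>)"

definition weak_star_M_topology ::
    "'a set \<Rightarrow> ennreal \<Rightarrow> (('a \<Rightarrow> complex) set \<Rightarrow> complex) topology"
  where "weak_star_M_topology A p =
    initial_topology (M_p_space A p) {g. continuous_map (cube_topology A) euclidean g}
      (\<lambda>g \<mu>. complex_measure_integral (cube_borel A) \<mu> g)"

end

theory Submission
  imports Defs "HOL-Probability.Probability_Measure"
begin

text \<open>For coefficients \<open>z\<close> on \<open>A\<close>, the odd part of the Riesz product \<open>\<Prod>(1 + z\<^sub>\<alpha> r\<^sub>\<alpha>)\<close> is a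
  measure, and that of \<open>\<Prod>(1 + \<i> z\<^sub>\<alpha> r\<^sub>\<alpha>)\<close>, for square summable \<open>z\<close>, a bounded function. Pairing two
  such objects by Parseval's formula gives the bilinear form of their coefficients plus an error,
  the sum over odd sets \<open>F\<close> with at least three elements of the products over \<open>F\<close>. Split \<open>A\<close> into
  infinitely many disjoint copies (levels) of the family of its finite subsets. The coefficients
  of level \<open>j + 1\<close> are the products of those of level \<open>j\<close> over such \<open>F\<close>, with signs chosen so that
  their contribution to the pairing cancels the error of level \<open>j\<close>; the sum then telescopes to
  the pairing of the given vectors, put on level \<open>0\<close>. The \<open>p\<close>-th powers of the products over odd
  \<open>F\<close> with at least three elements sum up to at most \<open>sinh 1 - 1 = \<delta>\<^sup>2\<close> times the \<open>p\<close>-th power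
  of the norm, so that the levels decay geometrically. The Walsh coefficients are finite products
  of coordinates, hence weakly continuous, and the maps are uniformly bounded, so weak* continuity
  can be tested on Walsh polynomials.\<close>

section \<open>Integration against complex measures\<close>

text \<open>The bound for an imaginary product needs square sums at most 1, so on the function side
  each level is rescaled by 1 / \<delta>^(2/p) to stay in the unit ball, gets a product of its own,
  and the products are summed with weights \<delta>^(2j/p). The geometric series explains 1 -
  \<delta>^(2/p); sqrt e bounds one product, and 2 counts real and imaginary parts. The coefficients
  therefore vanish on sets that mix levels, so the other factor may be arbitrary there: on the
  measure side a single Riesz product carries all levels. Its arguments are halved, which puts 2 /
  2^k on a set of k elements; since 2k \<le> 2^k for k \<ge> 1, the map is Lipschitz in the sup
  norm, which settles p = \<infinity>. The recursion works with real vectors, because positivity of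
  Riesz products and the constant modulus of imaginary ones depend on it; complex vectors enter by
  bilinearity. \<open>A\<close> may be uncountable, with more Borel sets than the coordinates
  generate: hence an extension from clopen sets to Borel measures, regularity in the approximation
  arguments, and a reduction of nets of finite sets to sequences.\<close>

lemma nn_integral_sum_measures_cong:
  fixes u :: "'b \<Rightarrow> ennreal"
  assumes s: "sets N1 = sets M" "sets N2 = sets M" "sets N3 = sets M" "sets N4 = sets M"
    and eq: "\<And>E. E \<in> sets M \<Longrightarrow> emeasure N1 E + emeasure N2 E = emeasure N3 E + emeasure N4 E"
    and u: "u \<in> borel_measurable M"
  shows "(\<integral>\<^sup>+x. u x \<partial>N1) + (\<integral>\<^sup>+x. u x \<partial>N2) = (\<integral>\<^sup>+x. u x \<partial>N3) + (\<integral>\<^sup>+x. u x \<partial>N4)"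
  using u
proof (induction rule: borel_measurable_induct)
  case (cong f g)
  have sp: "space N1 = space M" "space N2 = space M" "space N3 = space M" "space N4 = space M"
    using s by (auto dest: sets_eq_imp_space_eq)
  have "(\<integral>\<^sup>+x. f x \<partial>N) = (\<integral>\<^sup>+x. g x \<partial>N)" if "space N = space M" for N
    by (rule nn_integral_cong) (use that cong in auto)
  then show ?case using cong sp by metis
next
  case (set E)
  then show ?case using eq s by simp
next
  case (mult u c)
  have "u \<in> borel_measurable N1" "u \<in> borel_measurable N2" "u \<in> borel_measurable N3" "u \<in> borel_measurable N4"
    using mult.hyps s by (simp_all cong: measurable_cong_sets)
  then show ?case using mult.IH
    by (simp add: nn_integral_cmult flip: distrib_left)
next
  case (add u v)
  have "u \<in> borel_measurable N" "v \<in> borel_measurable N" if "sets N = sets M" for N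
    using add.hyps that by (simp_all cong: measurable_cong_sets)
  then have "(\<integral>\<^sup>+x. v x + u x \<partial>N) = (\<integral>\<^sup>+x. v x \<partial>N) + (\<integral>\<^sup>+x. u x \<partial>N)" if "sets N = sets M" for N
    using that by (simp add: nn_integral_add)
  then show ?case using add.IH s by (simp add: ac_simps)
next
  case (seq U)
  have 1: "(\<integral>\<^sup>+x. (SUP i. U i) x \<partial>N) = (SUP i. \<integral>\<^sup>+x. U i x \<partial>N)" if "sets N = sets M" for N
  proof -
    have "U i \<in> borel_measurable N" for i
      using seq.hyps that by (simp cong: measurable_cong_sets)
    then show ?thesis using nn_integral_monotone_convergence_SUP[OF seq.hyps(3), of N]
      by (simp add: image_comp)
  qed
  have inc: "incseq (\<lambda>i. \<integral>\<^sup>+x. U i x \<partial>N)" for N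
    using seq.hyps(3) by (auto simp: incseq_def le_fun_def intro!: nn_integral_mono)
  show ?case
    unfolding s[THEN 1] by (simp add: ennreal_SUP_add[OF inc inc, symmetric] seq.IH)
qed

text \<open>Adding the bound \<open>C\<close> makes the integrand nonnegative, so that nonnegative
  integrals can be compared; the extra terms cancel because the sums of the total masses agree. Sums
  of two measures on either side stand for an equality of differences, which extended nonnegative
  reals could not express.\<close>

lemma integral_sum_measures_cong_real:
  fixes f :: "'b \<Rightarrow> real"
  assumes fin: "finite_measure N1" "finite_measure N2" "finite_measure N3" "finite_measure N4"
    and s: "sets N1 = sets M" "sets N2 = sets M" "sets N3 = sets M" "sets N4 = sets M"
    and eq: "\<And>E. E \<in> sets M \<Longrightarrow> measure N1 E + measure N2 E = measure N3 E + measure N4 E"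
    and f: "f \<in> borel_measurable M" and b: "\<And>x. x \<in> space M \<Longrightarrow> \<bar>f x\<bar> \<le> C"
  shows "(\<integral>x. f x \<partial>N1) + (\<integral>x. f x \<partial>N2) = (\<integral>x. f x \<partial>N3) + (\<integral>x. f x \<partial>N4)"
proof -
  have eq': "emeasure N1 E + emeasure N2 E = emeasure N3 E + emeasure N4 E" if "E \<in> sets M" for E
    using eq[OF that] fin by (simp add: finite_measure.emeasure_eq_measure flip: ennreal_plus)
  have int: "integrable N f" "integrable N (\<lambda>x. f x + C)"
    and val: "(\<integral>\<^sup>+x. ennreal (f x + C) \<partial>N) = ennreal ((\<integral>x. f x \<partial>N) + C * measure N (space M))"
    and nn: "0 \<le> (\<integral>x. f x \<partial>N) + C * measure N (space M)"
    if "finite_measure N" "sets N = sets M" for N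
  proof -
    interpret finite_measure N by fact
    have sp: "space N = space M" using that by (auto dest: sets_eq_imp_space_eq)
    have "f \<in> borel_measurable N" using f that by (simp cong: measurable_cong_sets)
    then show i: "integrable N f"
      by (intro integrable_const_bound[where B=C]) (use b sp in auto)
    then show i2: "integrable N (\<lambda>x. f x + C)" by simp
    have ge: "0 \<le> f x + C" if "x \<in> space N" for x
      using b[of x] that sp by (auto simp: abs_le_iff)
    have "(\<integral>x. f x + C \<partial>N) = (\<integral>x. f x \<partial>N) + C * measure N (space M)"
      using i by (simp add: sp mult.commute)
    then show "(\<integral>\<^sup>+x. ennreal (f x + C) \<partial>N) = ennreal ((\<integral>x. f x \<partial>N) + C * measure N (space M))"
      and "0 \<le> (\<integral>x. f x \<partial>N) + C * measure N (space M)"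
      using nn_integral_eq_integral[OF i2] ge Bochner_Integration.integral_nonneg[of N "\<lambda>x. f x + C"]
      by (auto simp: AE_I2)
  qed
  have "(\<integral>\<^sup>+x. ennreal (f x + C) \<partial>N1) + (\<integral>\<^sup>+x. ennreal (f x + C) \<partial>N2)
      = (\<integral>\<^sup>+x. ennreal (f x + C) \<partial>N3) + (\<integral>\<^sup>+x. ennreal (f x + C) \<partial>N4)"
    by (rule nn_integral_sum_measures_cong[OF s eq']) (use f in simp_all)
  then have "(\<integral>x. f x \<partial>N1) + C * measure N1 (space M) + ((\<integral>x. f x \<partial>N2) + C * measure N2 (space M))
     = (\<integral>x. f x \<partial>N3) + C * measure N3 (space M) + ((\<integral>x. f x \<partial>N4) + C * measure N4 (space M))"
    using val nn fin s by (simp flip: ennreal_plus)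
  moreover have "C * (measure N1 (space M) + measure N2 (space M)) = C * (measure N3 (space M) + measure N4 (space M))"
    using eq[of "space M"] by simp
  ultimately show ?thesis by (simp add: algebra_simps)
qed

lemma integral_sum_measures_cong:
  fixes f :: "'b \<Rightarrow> complex"
  assumes fin: "finite_measure N1" "finite_measure N2" "finite_measure N3" "finite_measure N4"
    and s: "sets N1 = sets M" "sets N2 = sets M" "sets N3 = sets M" "sets N4 = sets M"
    and eq: "\<And>E. E \<in> sets M \<Longrightarrow> measure N1 E + measure N2 E = measure N3 E + measure N4 E"
    and f: "f \<in> borel_measurable M" and b: "\<And>x. x \<in> space M \<Longrightarrow> cmod (f x) \<le> C"
  shows "(\<integral>x. f x \<partial>N1) + (\<integral>x. f x \<partial>N2) = (\<integral>x. f x \<partial>N3) + (\<integral>x. f x \<partial>N4)"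
proof -
  have int: "integrable N f" if "finite_measure N" "sets N = sets M" for N
  proof -
    interpret finite_measure N by fact
    have sp: "space N = space M" using that by (auto dest: sets_eq_imp_space_eq)
    have "f \<in> borel_measurable N" using f that by (simp cong: measurable_cong_sets)
    then show i: "integrable N f"
      by (intro integrable_const_bound[where B=C]) (use b sp in auto)
  qed
  have re: "(\<integral>x. Re (f x) \<partial>N1) + (\<integral>x. Re (f x) \<partial>N2) = (\<integral>x. Re (f x) \<partial>N3) + (\<integral>x. Re (f x) \<partial>N4)"
    by (rule integral_sum_measures_cong_real[OF fin s eq, where C=C])
       (use f b abs_Re_le_cmod order_trans in \<open>auto, blast\<close>)
  have im: "(\<integral>x. Im (f x) \<partial>N1) + (\<integral>x. Im (f x) \<partial>N2) = (\<integral>x. Im (f x) \<partial>N3) + (\<integral>x. Im (f x) \<partial>N4)"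
    by (rule integral_sum_measures_cong_real[OF fin s eq, where C=C])
       (use f b abs_Im_le_cmod order_trans in \<open>auto, blast\<close>)
  show ?thesis
    by (rule complex_eqI) (use re im int fin s in \<open>simp_all\<close>)
qed

text \<open>\<open>Y\<close> is the positive set of a Hahn decomposition of \<open>N1 - N2\<close>.
  Cutting down to \<open>Y\<close> discards only nonpositive mass, and enlarging inside
  \<open>Y\<close> adds only nonnegative mass, so the supremum defining the upper variation of
  \<open>E\<close> is attained at \<open>E \<inter> Y\<close>. That value is countably additive in
  \<open>E\<close>, which turns the supremum formula into a genuine measure.\<close>

lemma upper_variation_diff:
  assumes fin: "finite_measure N1" "finite_measure N2"
    and s: "sets N1 = sets M" "sets N2 = sets M"
    and eq0: "\<forall>E\<in>sets M. \<nu> E = measure N1 E - measure N2 E"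
    and Y: "Y \<in> sets M"
    and pos0: "\<forall>X\<in>sets M. X \<subseteq> Y \<longrightarrow> measure N2 X \<le> measure N1 X"
    and neg0: "\<forall>X\<in>sets M. X \<inter> Y = {} \<longrightarrow> measure N1 X \<le> measure N2 X"
  shows "finite_measure (upper_variation M \<nu>)" "sets (upper_variation M \<nu>) = sets M"
    and "\<And>E. E \<in> sets M \<Longrightarrow> measure (upper_variation M \<nu>) E = \<nu> (E \<inter> Y)"
proof -
  note eq = eq0[rule_format] and pos = pos0[rule_format] and neg = neg0[rule_format]
  interpret N1: finite_measure N1 by fact
  interpret N2: finite_measure N2 by fact
  define g where "g E = (SUP F\<in>{F \<in> sets M. F \<subseteq> E}. ennreal (\<nu> F))" for E
  have nn: "0 \<le> \<nu> (E \<inter> Y)" if "E \<in> sets M" for E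
    using eq[of "E \<inter> Y"] pos[of "E \<inter> Y"] that Y by auto
  have g: "g E = ennreal (\<nu> (E \<inter> Y))" if E: "E \<in> sets M" for E
    unfolding g_def
  proof (rule SUP_eqI)
    fix F assume "F \<in> {F \<in> sets M. F \<subseteq> E}"
    then have F: "F \<in> sets M" "F \<subseteq> E" by auto
    have split: "measure N X = measure N (X \<inter> Y) + measure N (X - Y)"
      if "finite_measure N" "sets N = sets M" "X \<in> sets M" for N X
      using finite_measure.finite_measure_Union[OF that(1), of "X \<inter> Y" "X - Y"] that Y
      by (simp add: Int_Diff_Un Int_Diff_disjoint)
    have "\<nu> F \<le> \<nu> (F \<inter> Y)"
      using split[OF fin(1) s(1) F(1)] split[OF fin(2) s(2) F(1)] neg[of "F - Y"] eq[OF F(1)] eq[of "F \<inter> Y"] F Y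
      by auto
    also have "\<dots> \<le> \<nu> (E \<inter> Y)"
    proof -
      have "measure N (E \<inter> Y) = measure N (F \<inter> Y) + measure N ((E - F) \<inter> Y)"
        if "finite_measure N" "sets N = sets M" for N
      proof -
        have "E \<inter> Y = (F \<inter> Y) \<union> ((E - F) \<inter> Y)" using F by auto
        then show ?thesis
          using finite_measure.finite_measure_Union[OF that(1), of "F \<inter> Y" "(E - F) \<inter> Y"] that E F Y by auto
      qed
      from this[OF fin(1) s(1)] this[OF fin(2) s(2)] show ?thesis
        using pos[of "(E - F) \<inter> Y"] eq[of "E \<inter> Y"] eq[of "F \<inter> Y"] E F Y by auto
    qed
    finally show "ennreal (\<nu> F) \<le> ennreal (\<nu> (E \<inter> Y))" by (rule ennreal_leI)
  next
    fix y assume "\<And>i. i \<in> {F \<in> sets M. F \<subseteq> E} \<Longrightarrow> ennreal (\<nu> i) \<le> y"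
    then show "ennreal (\<nu> (E \<inter> Y)) \<le> y" using E Y by auto
  qed
  have ca: "countably_additive (sets M) g"
  proof (rule countably_additiveI)
    fix B :: "nat \<Rightarrow> 'a set" assume B: "range B \<subseteq> sets M" "disjoint_family B" "(\<Union>i. B i) \<in> sets M"
    have BY: "range (\<lambda>i. B i \<inter> Y) \<subseteq> sets M" "disjoint_family (\<lambda>i. B i \<inter> Y)"
      using B Y by (auto simp: disjoint_family_on_def)
    have "(\<lambda>i. \<nu> (B i \<inter> Y)) sums \<nu> (\<Union>i. B i \<inter> Y)"
    proof -
      have "(\<lambda>i. measure N1 (B i \<inter> Y) - measure N2 (B i \<inter> Y)) sums
          (measure N1 (\<Union>i. B i \<inter> Y) - measure N2 (\<Union>i. B i \<inter> Y))"
        using BY s by (intro sums_diff N1.finite_measure_UNION N2.finite_measure_UNION) auto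
      moreover have "\<nu> (B i \<inter> Y) = measure N1 (B i \<inter> Y) - measure N2 (B i \<inter> Y)" for i
        using BY(1) by (intro eq) auto
      moreover have "(\<Union>i. B i \<inter> Y) \<in> sets M" using BY(1) by (intro sets.countable_UN) auto
      ultimately show ?thesis using eq by simp
    qed
    then have "(\<Sum>i. ennreal (\<nu> (B i \<inter> Y))) = ennreal (\<nu> (\<Union>i. B i \<inter> Y))"
      using B nn by (intro suminf_ennreal_eq) auto
    then show "(\<Sum>i. g (B i)) = g (\<Union>i. B i)"
      using B g by (auto simp: image_subset_iff)
  qed
  have p: "positive (sets M) g"
    using g[of "{}"] eq[of "{}"] by (simp add: positive_def)
  have em: "emeasure (upper_variation M \<nu>) E = g E" if "E \<in> sets M" for E
    unfolding upper_variation_def g_def[abs_def, symmetric]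
    by (intro emeasure_measure_of_sigma sets.sigma_algebra_axioms p ca that)
  show st: "sets (upper_variation M \<nu>) = sets M"
    by (simp add: upper_variation_def sets.sigma_sets_eq sets.space_closed)
  show "measure (upper_variation M \<nu>) E = \<nu> (E \<inter> Y)" if "E \<in> sets M" for E
    using em[OF that] g[OF that] nn[OF that] by (simp add: measure_def)
  show "finite_measure (upper_variation M \<nu>)"
    by (rule finite_measureI)
      (use em[of "space M"] g[of "space M"] st in \<open>auto simp: sets_eq_imp_space_eq[OF st]\<close>)
qed

text \<open>Any decomposition of a real measure into a difference of finite measures, and not only
  the Jordan decomposition, computes the integral.\<close>

lemma integral_upper_variation_diff:
  fixes f :: "'b \<Rightarrow> complex"
  assumes fin: "finite_measure N1" "finite_measure N2"
    and s: "sets N1 = sets M" "sets N2 = sets M"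
    and eq: "\<And>E. E \<in> sets M \<Longrightarrow> \<nu> E = measure N1 E - measure N2 E"
    and f: "f \<in> borel_measurable M" and b: "\<And>x. x \<in> space M \<Longrightarrow> cmod (f x) \<le> C"
  shows "(LINT x|upper_variation M \<nu>. f x) - (LINT x|upper_variation M (\<lambda>E. - \<nu> E). f x)
    = (\<integral>x. f x \<partial>N1) - (\<integral>x. f x \<partial>N2)"
proof -
  interpret N1: finite_measure N1 by fact
  interpret N2: finite_measure N2 by fact
  obtain Y where Y: "Y \<in> sets N1" "\<And>X. X \<in> sets N1 \<Longrightarrow> X \<subseteq> Y \<Longrightarrow> N2 X \<le> N1 X"
      "\<And>X. X \<in> sets N1 \<Longrightarrow> X \<inter> Y = {} \<Longrightarrow> N1 X \<le> N2 X"
    using finite_unsigned_Hahn_decomposition[OF fin] s by auto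
  have pos: "measure N2 X \<le> measure N1 X" if "X \<in> sets M" "X \<subseteq> Y" for X
    using Y(2)[of X] that s by (simp add: N1.emeasure_eq_measure N2.emeasure_eq_measure)
  have neg: "measure N1 X \<le> measure N2 X" if "X \<in> sets M" "X \<inter> Y = {}" for X
    using Y(3)[of X] that s by (simp add: N1.emeasure_eq_measure N2.emeasure_eq_measure)
  have YM: "Y \<in> sets M" using Y s by simp
  have eq': "- \<nu> E = measure N2 E - measure N1 E" if "E \<in> sets M" for E
    using eq[OF that] by simp
  have up: "finite_measure (upper_variation M \<nu>)" "sets (upper_variation M \<nu>) = sets M"
    "\<And>E. E \<in> sets M \<Longrightarrow> measure (upper_variation M \<nu>) E = \<nu> (E \<inter> Y)"
    using upper_variation_diff[OF fin s _ YM, of \<nu>] eq pos neg by simp_all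
  have Yc: "space M - Y \<in> sets M" using YM by auto
  have pos': "measure N1 X \<le> measure N2 X" if "X \<in> sets M" "X \<subseteq> space M - Y" for X
    by (rule neg) (use that in blast)+
  have neg': "measure N2 X \<le> measure N1 X" if "X \<in> sets M" "X \<inter> (space M - Y) = {}" for X
    by (rule pos) (use that sets.sets_into_space[OF that(1)] in blast)+
  have dn: "finite_measure (upper_variation M (\<lambda>E. - \<nu> E))" "sets (upper_variation M (\<lambda>E. - \<nu> E)) = sets M"
    "\<And>E. E \<in> sets M \<Longrightarrow> measure (upper_variation M (\<lambda>E. - \<nu> E)) E = - \<nu> (E \<inter> (space M - Y))"
    using upper_variation_diff[OF fin(2,1) s(2,1) _ Yc, of "\<lambda>E. - \<nu> E"] eq' pos' neg' by simp_all
  \<comment> \<open>\<open>N1\<close> and \<open>N2\<close> exceed the two variations by one and the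
    same set function; moving the subtracted terms across gives an identity between sums of finite
    measures, the form that the comparison of integrals accepts.\<close>
  have m: "measure (upper_variation M \<nu>) E + measure N2 E
      = measure (upper_variation M (\<lambda>E. - \<nu> E)) E + measure N1 E" if E: "E \<in> sets M" for E
  proof -
    have "E = (E \<inter> Y) \<union> (E \<inter> (space M - Y))" using sets.sets_into_space[OF E] by auto
    then have "measure N E = measure N (E \<inter> Y) + measure N (E \<inter> (space M - Y))"
      if "finite_measure N" "sets N = sets M" for N
      using finite_measure.finite_measure_Union[OF that(1), of "E \<inter> Y" "E \<inter> (space M - Y)"] that E YM
      by auto
    from this[OF fin(1) s(1)] this[OF fin(2) s(2)] show ?thesis
      using up(3)[OF E] dn(3)[OF E] eq[of "E \<inter> Y"] eq[of "E \<inter> (space M - Y)"] E YM by auto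
  qed
  have "(LINT x|upper_variation M \<nu>. f x) + (\<integral>x. f x \<partial>N2)
      = (LINT x|upper_variation M (\<lambda>E. - \<nu> E). f x) + (\<integral>x. f x \<partial>N1)"
    by (rule integral_sum_measures_cong[where M=M and C=C]) (use up dn fin s m f b in auto)
  then show ?thesis by (simp add: algebra_simps)
qed

lemma complex_measure_integral_eq:
  fixes f :: "'b \<Rightarrow> complex"
  assumes fin: "finite_measure N1" "finite_measure N2" "finite_measure N3" "finite_measure N4"
    and s: "sets N1 = sets M" "sets N2 = sets M" "sets N3 = sets M" "sets N4 = sets M"
    and eq: "\<And>E. E \<in> sets M \<Longrightarrow>
      \<mu> E = complex_of_real (measure N1 E - measure N2 E) + \<i> * complex_of_real (measure N3 E - measure N4 E)"
    and f: "f \<in> borel_measurable M" and b: "\<And>x. x \<in> space M \<Longrightarrow> cmod (f x) \<le> C"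
  shows "complex_measure_integral M \<mu> f
    = (\<integral>x. f x \<partial>N1) - (\<integral>x. f x \<partial>N2) + \<i> * ((\<integral>x. f x \<partial>N3) - (\<integral>x. f x \<partial>N4))"
proof -
  have "Re (\<mu> E) = measure N1 E - measure N2 E" "Im (\<mu> E) = measure N3 E - measure N4 E"
    if "E \<in> sets M" for E
    using eq[OF that] by simp_all
  then show ?thesis
    unfolding complex_measure_integral_def
    using integral_upper_variation_diff[OF fin(1,2) s(1,2) _ f b, of "\<lambda>E. Re (\<mu> E)"]
      integral_upper_variation_diff[OF fin(3,4) s(3,4) _ f b, of "\<lambda>E. Im (\<mu> E)"] by simp
qed

text \<open>The positive and negative parts of the real and imaginary part of \<open>f\<close> are
  densities of four finite measures, and such a decomposition computes the integral whether or not
  it is the Jordan one. This ties the Walsh transform of a function, defined through Jordan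
  decompositions, to an ordinary integral.\<close>

lemma complex_measure_integral_density:
  fixes f g :: "'b \<Rightarrow> complex"
  assumes P: "finite_measure P" and sP: "sets P = sets M"
    and f: "f \<in> borel_measurable M" "\<And>x. x \<in> space M \<Longrightarrow> cmod (f x) \<le> D"
    and g: "g \<in> borel_measurable M" and b: "\<And>x. x \<in> space M \<Longrightarrow> cmod (g x) \<le> C"
  shows "complex_measure_integral M (density_measure P f) g = (\<integral>x. f x * g x \<partial>P)"
proof -
  interpret finite_measure P by fact
  have sp: "space P = space M" using sP by (auto dest: sets_eq_imp_space_eq)
  have [measurable]: "f \<in> borel_measurable P" "g \<in> borel_measurable P"
    using f g sP by (simp_all cong: measurable_cong_sets)
  define h :: "nat \<Rightarrow> 'b \<Rightarrow> real" where "h k x = (if k = 0 then max 0 (Re (f x)) else if k = 1 then max 0 (- Re (f x))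
    else if k = 2 then max 0 (Im (f x)) else max 0 (- Im (f x)))" for k x
  have hm[measurable]: "h k \<in> borel_measurable P" for k
    unfolding h_def by (cases "k = 0"; cases "k = 1"; cases "k = 2"; simp)
  have h0: "0 \<le> h k x" for k x by (simp add: h_def)
  have hD: "h k x \<le> D" if "x \<in> space P" for k x
  proof -
    have "cmod (f x) \<le> D" using f that sp by auto
    then have "\<bar>Re (f x)\<bar> \<le> D" "\<bar>Im (f x)\<bar> \<le> D" using abs_Re_le_cmod abs_Im_le_cmod order_trans by blast+
    then show ?thesis by (auto simp: h_def abs_le_iff)
  qed
  have hint: "integrable P (\<lambda>x. h k x *\<^sub>R g x)" for k
  proof (intro integrable_const_bound[where B="D * C"] AE_I2)
    fix x assume x: "x \<in> space P"
    show "norm (h k x *\<^sub>R g x) \<le> D * C"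
      using hD[OF x, of k] b[of x] h0[of k x] x sp norm_ge_zero[of "g x"]
      by (auto intro!: mult_mono)
  qed measurable
  have hint1: "integrable P (h k)" for k
    by (intro integrable_const_bound[where B=D] AE_I2) (use hD h0 in auto)
  have fm: "finite_measure (density P (h k))" for k
    by (rule finite_measureI) (use nn_integral_eq_integral[OF hint1 AE_I2[OF h0], of k] in
      \<open>auto simp: emeasure_density cong: nn_integral_cong\<close>)
  have md: "measure (density P (h k)) E = (\<integral>x. indicator E x * h k x \<partial>P)" if "E \<in> sets P" for k E
  proof -
    have i: "integrable P (\<lambda>x. indicator E x * h k x)"
      using integrable_real_mult_indicator[OF that hint1] by (simp add: mult.commute)
    have "emeasure (density P (h k)) E = (\<integral>\<^sup>+x. ennreal (indicator E x * h k x) \<partial>P)"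
      using that by (simp add: emeasure_density) (intro nn_integral_cong, auto simp: indicator_def)
    also have "\<dots> = ennreal (\<integral>x. indicator E x * h k x \<partial>P)"
      by (rule nn_integral_eq_integral[OF i]) (use h0 in auto)
    finally show ?thesis using h0 by (simp add: measure_def Bochner_Integration.integral_nonneg)
  qed
  have dec: "f x = complex_of_real (h 0 x - h 1 x) + \<i> * complex_of_real (h 2 x - h 3 x)" for x
    by (simp add: h_def complex_eq_iff max_def)
  have eq: "density_measure P f E = complex_of_real (measure (density P (h 0)) E - measure (density P (h 1)) E)
      + \<i> * complex_of_real (measure (density P (h 2)) E - measure (density P (h 3)) E)" if E: "E \<in> sets M" for E
  proof -
    have EP: "E \<in> sets P" using E sP by simp
    have i: "integrable P (\<lambda>x. complex_of_real (indicator E x * h k x))" for k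
      using integrable_real_mult_indicator[OF EP hint1[of k]]
      by (intro integrable_of_real) (simp add: mult.commute)
    have "density_measure P f E = (\<integral>x. (complex_of_real (indicator E x * h 0 x) - complex_of_real (indicator E x * h 1 x)) +
       \<i> * (complex_of_real (indicator E x * h 2 x) - complex_of_real (indicator E x * h 3 x)) \<partial>P)"
      using EP unfolding density_measure_def set_lebesgue_integral_def
      by (simp, intro Bochner_Integration.integral_cong refl, subst dec)
         (auto simp: indicator_def scaleR_conv_of_real)
    also have "\<dots> = ((\<integral>x. complex_of_real (indicator E x * h 0 x) \<partial>P) - (\<integral>x. complex_of_real (indicator E x * h 1 x) \<partial>P))
        + \<i> * ((\<integral>x. complex_of_real (indicator E x * h 2 x) \<partial>P) - (\<integral>x. complex_of_real (indicator E x * h 3 x) \<partial>P))"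
      using i by (simp only: Bochner_Integration.integral_add Bochner_Integration.integral_diff
          Bochner_Integration.integral_mult_right Bochner_Integration.integrable_diff
          Bochner_Integration.integrable_mult_right integral_mult_right_zero)
    finally show ?thesis by (simp only: integral_complex_of_real md[OF EP] of_real_diff)
  qed
  have "complex_measure_integral M (density_measure P f) g
    = (\<integral>x. g x \<partial>density P (h 0)) - (\<integral>x. g x \<partial>density P (h 1))
      + \<i> * ((\<integral>x. g x \<partial>density P (h 2)) - (\<integral>x. g x \<partial>density P (h 3)))"
    by (rule complex_measure_integral_eq[OF fm fm fm fm]) (use sP eq g b in auto)
  also have "\<dots> = (\<integral>x. h 0 x *\<^sub>R g x \<partial>P) - (\<integral>x. h 1 x *\<^sub>R g x \<partial>P)
      + \<i> * ((\<integral>x. h 2 x *\<^sub>R g x \<partial>P) - (\<integral>x. h 3 x *\<^sub>R g x \<partial>P))"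
    using h0 by (simp add: integral_density)
  also have "\<dots> = (\<integral>x. h 0 x *\<^sub>R g x - h 1 x *\<^sub>R g x + \<i> * (h 2 x *\<^sub>R g x - h 3 x *\<^sub>R g x) \<partial>P)"
    using hint by (simp only: Bochner_Integration.integral_add Bochner_Integration.integral_diff
          Bochner_Integration.integral_mult_right Bochner_Integration.integrable_diff
          Bochner_Integration.integrable_mult_right integral_mult_right_zero)
  also have "\<dots> = (\<integral>x. f x * g x \<partial>P)"
    by (intro Bochner_Integration.integral_cong refl, subst dec) (simp add: scaleR_conv_of_real algebra_simps)
  finally show ?thesis .
qed

section \<open>Regular measures from contents on clopen sets\<close>

definition clopenin :: "'b topology \<Rightarrow> 'b set \<Rightarrow> bool"
  where "clopenin X C \<longleftrightarrow> openin X C \<and> closedin X C"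

lemma clopenin_Un: "clopenin X C \<Longrightarrow> clopenin X D \<Longrightarrow> clopenin X (C \<union> D)"
  and clopenin_Int: "clopenin X C \<Longrightarrow> clopenin X D \<Longrightarrow> clopenin X (C \<inter> D)"
  and clopenin_Diff: "clopenin X C \<Longrightarrow> clopenin X D \<Longrightarrow> clopenin X (C - D)"
  and clopenin_empty: "clopenin X {}"
  and clopenin_topspace: "clopenin X (topspace X)"
  by (auto simp: clopenin_def openin_diff closedin_diff)

lemma clopenin_UN: "finite I \<Longrightarrow> (\<And>i. i \<in> I \<Longrightarrow> clopenin X (C i)) \<Longrightarrow> clopenin X (\<Union>i\<in>I. C i)"
  by (induction I rule: finite_induct) (auto simp: clopenin_empty intro!: clopenin_Un)

text \<open>Finite additivity on clopen sets already forces countable subadditivity, because a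
  clopen set is compact and countable open covers of it reduce to finite ones. The extension passes
  through open sets instead of starting from the algebra of clopen sets, since the latter generates
  only the Baire sets, in general fewer than the Borel sets.\<close>

locale clopen_content =
  fixes X :: "'b topology" and L :: "'b set \<Rightarrow> real"
  assumes compact: "compact_space X"
    and base: "\<And>U x. openin X U \<Longrightarrow> x \<in> U \<Longrightarrow> \<exists>C. clopenin X C \<and> x \<in> C \<and> C \<subseteq> U"
    and nn: "\<And>C. clopenin X C \<Longrightarrow> 0 \<le> L C"
    and add: "\<And>C D. clopenin X C \<Longrightarrow> clopenin X D \<Longrightarrow> C \<inter> D = {} \<Longrightarrow> L (C \<union> D) = L C + L D"
begin

lemma L_empty: "L {} = 0"
  using add[of "{}" "{}"] by (simp add: clopenin_empty)

lemma L_mono: "L C \<le> L D" if "clopenin X C" "clopenin X D" "C \<subseteq> D"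
  using add[of C "D - C"] nn[of "D - C"] that clopenin_Diff[of X D C]
  by (simp add: Un_absorb1)

lemma L_UN: "finite I \<Longrightarrow> (\<And>i. i \<in> I \<Longrightarrow> clopenin X (C i)) \<Longrightarrow> L (\<Union>i\<in>I. C i) \<le> (\<Sum>i\<in>I. L (C i))"
proof (induction I rule: finite_induct)
  case empty
  then show ?case by (simp add: L_empty)
next
  case (insert i I)
  let ?U = "\<Union>i\<in>I. C i"
  have c: "clopenin X ?U" "clopenin X (C i)" using insert by (auto intro!: clopenin_UN)
  have "L (C i \<union> ?U) = L (C i) + L (?U - C i)"
    using add[OF c(2) clopenin_Diff[OF c]] by simp
  moreover have "L (?U - C i) \<le> L ?U"
    using c by (intro L_mono clopenin_Diff) auto
  ultimately show ?case using insert by auto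
qed

text \<open>As in the Riesz representation theorem there are two steps: \<open>inner\<close> values
  open sets by their clopen subsets, \<open>outer\<close> values arbitrary sets by their open
  supersets. \<open>inner\<close> is meaningful for open sets only.\<close>

definition inner :: "'b set \<Rightarrow> ennreal"
  where "inner U = (SUP C\<in>{C. clopenin X C \<and> C \<subseteq> U}. ennreal (L C))"

definition outer :: "'b set \<Rightarrow> ennreal"
  where "outer E = (INF U\<in>{U. openin X U \<and> E \<subseteq> U}. inner U)"

lemma inner_mono: "U \<subseteq> V \<Longrightarrow> inner U \<le> inner V"
  unfolding inner_def by (intro SUP_subset_mono) auto

lemma inner_clopen: "clopenin X C \<Longrightarrow> inner C = ennreal (L C)"
  unfolding inner_def by (intro antisym SUP_least SUP_upper) (auto intro!: ennreal_leI L_mono)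

lemma outer_open: "openin X U \<Longrightarrow> outer U = inner U"
  unfolding outer_def by (intro antisym INF_greatest INF_lower) (auto intro!: inner_mono)

lemma outer_mono: "E \<subseteq> F \<Longrightarrow> outer E \<le> outer F"
  unfolding outer_def by (intro INF_superset_mono) auto

text \<open>A clopen subset of the union is compact, hence covered by finitely many clopen sets each
  lying in some \<open>U n\<close>. Collecting those assigned to the same index leaves one clopen
  set \<open>W k\<close> inside \<open>U k\<close> per index, and finite subadditivity
  applies.\<close>

lemma inner_UN: 
  assumes U: "\<And>n::nat. openin X (U n)"
  shows "inner (\<Union>n. U n) \<le> (\<Sum>n. inner (U n))"
  unfolding inner_def[of "\<Union>n. U n"]
proof (rule SUP_least)
  fix C assume "C \<in> {C. clopenin X C \<and> C \<subseteq> (\<Union>n. U n)}"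
  then have C: "clopenin X C" "C \<subseteq> (\<Union>n. U n)" by auto
  then have "compactin X C"
    using closedin_compact_space[OF compact] by (auto simp: clopenin_def)
  define \<D> where "\<D> = {D. clopenin X D \<and> (\<exists>n. D \<subseteq> U n)}"
  have "C \<subseteq> \<Union>\<D>"
  proof
    fix x assume "x \<in> C"
    then obtain n where "x \<in> U n" using C by auto
    then obtain D where "clopenin X D" "x \<in> D" "D \<subseteq> U n" using base[OF U] by blast
    then show "x \<in> \<Union>\<D>" unfolding \<D>_def by blast
  qed
  then obtain \<F> where F: "finite \<F>" "\<F> \<subseteq> \<D>" "C \<subseteq> \<Union>\<F>"
    using compactinD[OF \<open>compactin X C\<close>, of \<D>] by (auto simp: \<D>_def clopenin_def)
  obtain n where n: "\<And>D. D \<in> \<F> \<Longrightarrow> D \<subseteq> U (n D)"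
  proof -
    have "\<forall>D\<in>\<F>. \<exists>n. D \<subseteq> U n" using F(2) unfolding \<D>_def by blast
    then show ?thesis using that by metis
  qed
  define W where "W k = \<Union>{D\<in>\<F>. n D = k}" for k
  have Wc: "clopenin X (W k)" for k
    unfolding W_def using clopenin_UN[of "{D\<in>\<F>. n D = k}" X "\<lambda>D. D"] F by (auto simp: \<D>_def)
  have WU: "W k \<subseteq> U k" for k unfolding W_def using n by auto
  have "C \<subseteq> (\<Union>k\<in>n ` \<F>. W k)" using F(3) unfolding W_def by blast
  then have "L C \<le> L (\<Union>k\<in>n ` \<F>. W k)"
    using F Wc C by (intro L_mono clopenin_UN) auto
  also have "\<dots> \<le> (\<Sum>k\<in>n ` \<F>. L (W k))" using F Wc by (intro L_UN) auto
  finally have "ennreal (L C) \<le> (\<Sum>k\<in>n ` \<F>. ennreal (L (W k)))"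
    using Wc nn by (simp add: ennreal_leI sum_ennreal)
  also have "\<dots> \<le> (\<Sum>k\<in>n ` \<F>. inner (U k))"
    using Wc WU by (intro sum_mono) (auto simp: inner_clopen[symmetric] intro!: inner_mono)
  also have "\<dots> \<le> (\<Sum>n. inner (U n))"
    using F by (intro sum_le_suminf) auto
  finally show "ennreal (L C) \<le> (\<Sum>n. inner (U n))" .
qed

lemma outer_UN:
  assumes E: "\<And>n::nat. E n \<subseteq> topspace X"
  shows "outer (\<Union>n. E n) \<le> (\<Sum>n. outer (E n))"
proof (rule ennreal_le_epsilon)
  fix e :: real assume fin: "(\<Sum>n. outer (E n)) < top" and e: "0 < e"
  have "\<exists>U. openin X U \<and> E n \<subseteq> U \<and> inner U \<le> outer (E n) + e * (1/2) ^ Suc n" for n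
  proof -
    have "outer (E n) \<noteq> top"
      using fin ennreal_suminf_lessD[OF fin, of n] by auto
    then have "outer (E n) < outer (E n) + e * (1/2) ^ Suc n"
      using e by (cases "outer (E n)") (auto simp: ennreal_less_iff simp flip: ennreal_plus)
    then show ?thesis unfolding outer_def[of "E n"] INF_less_iff
      using less_imp_le by auto
  qed
  then obtain U where U: "\<And>n. openin X (U n)" "\<And>n. E n \<subseteq> U n"
    "\<And>n. inner (U n) \<le> outer (E n) + e * (1/2) ^ Suc n" by metis
  have "outer (\<Union>n. E n) \<le> outer (\<Union>n. U n)" using U by (intro outer_mono) auto
  also have "\<dots> = inner (\<Union>n. U n)" using U by (intro outer_open) auto
  also have "\<dots> \<le> (\<Sum>n. inner (U n))" using U by (intro inner_UN)
  also have "\<dots> \<le> (\<Sum>n. outer (E n) + e * (1/2) ^ Suc n)" using U by (intro suminf_le) auto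
  also have "\<dots> = (\<Sum>n. outer (E n)) + (\<Sum>n. ennreal (e * (1/2) ^ Suc n))"
    by (intro suminf_add[symmetric]) auto
  also have "(\<Sum>n. ennreal (e * (1/2) ^ Suc n)) = ennreal e"
    using e sums_mult[OF power_half_series, of e] by (intro suminf_ennreal_eq) auto
  finally show "outer (\<Union>n. E n) \<le> (\<Sum>n. outer (E n)) + ennreal e" .
qed

lemma outer_empty: "outer {} = 0"
  using outer_open[of "{}"] inner_clopen[OF clopenin_empty] by (simp add: L_empty)

lemma outer_measure_space_outer: "outer_measure_space (Pow (topspace X)) outer"
  unfolding outer_measure_space_def positive_def increasing_def countably_subadditive_def
  using outer_empty outer_mono by (auto intro!: outer_UN dest!: subsetD)

text \<open>Caratheodory's condition need only be compared with an open superset \<open>V\<close> of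
  the test set. A clopen \<open>C\<close> inside \<open>V \<inter> U\<close> leaves the open
  remainder \<open>V - C\<close>, which contains \<open>V - U\<close>, and clopen subsets of the
  remainder are disjoint from \<open>C\<close>; additivity and suprema over both give the
  inequality.\<close>

lemma open_lambda_system:
  assumes U: "openin X U"
  shows "U \<in> lambda_system (topspace X) (Pow (topspace X)) outer"
proof -
  have "outer (U \<inter> E) + outer ((topspace X - U) \<inter> E) \<le> outer E" if E: "E \<subseteq> topspace X" for E
    unfolding outer_def[of E]
  proof (rule INF_greatest)
    fix V assume "V \<in> {U. openin X U \<and> E \<subseteq> U}"
    then have V: "openin X V" "E \<subseteq> V" by auto
    have 1: "ennreal (L C) + outer (V - U) \<le> inner V" if C: "clopenin X C" "C \<subseteq> V \<inter> U" for C
    proof -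
      have VC: "openin X (V - C)" using V C by (auto simp: clopenin_def openin_diff)
      have "ennreal (L C) + inner (V - C) = (SUP D\<in>{D. clopenin X D \<and> D \<subseteq> V - C}. ennreal (L C) + ennreal (L D))"
        unfolding inner_def using clopenin_empty[of X] by (subst ennreal_SUP_add_right) auto
      also have "\<dots> \<le> inner V"
      proof (rule SUP_least)
        fix D assume "D \<in> {D. clopenin X D \<and> D \<subseteq> V - C}"
        then have D: "clopenin X D" "D \<subseteq> V - C" by auto
        have "ennreal (L C) + ennreal (L D) = ennreal (L (C \<union> D))"
        proof -
          have "C \<inter> D = {}" using D(2) by blast
          then show ?thesis
            using add[OF C(1) D(1)] nn[OF C(1)] nn[OF D(1)] by simp
        qed
        also have "\<dots> \<le> inner V" unfolding inner_def
          using C D by (intro SUP_upper) (auto intro!: clopenin_Un)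
        finally show "ennreal (L C) + ennreal (L D) \<le> inner V" .
      qed
      finally have "ennreal (L C) + inner (V - C) \<le> inner V" .
      moreover have "outer (V - U) \<le> inner (V - C)"
        using outer_open[OF VC] C outer_mono[of "V - U" "V - C"] by auto
      ultimately show ?thesis by (meson add_left_mono order_trans)
    qed
    have "outer (U \<inter> E) + outer ((topspace X - U) \<inter> E) \<le> outer (V \<inter> U) + outer (V - U)"
      using V by (intro add_mono outer_mono) auto
    also have "\<dots> = inner (V \<inter> U) + outer (V - U)"
      using V U by (subst outer_open) auto
    also have "\<dots> = (SUP C\<in>{C. clopenin X C \<and> C \<subseteq> V \<inter> U}. ennreal (L C) + outer (V - U))"
      unfolding inner_def using clopenin_empty[of X] by (subst ennreal_SUP_add_left) auto
    also have "\<dots> \<le> inner V" using 1 by (intro SUP_least) auto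
    finally show "outer (U \<inter> E) + outer ((topspace X - U) \<inter> E) \<le> inner V" .
  qed
  moreover have "outer E \<le> outer (U \<inter> E) + outer ((topspace X - U) \<inter> E)" if E: "E \<subseteq> topspace X" for E
  proof -
    \<comment> \<open>Finite subadditivity is read off from the countable one by padding the two
      pieces with empty sets.\<close>
    define S where "S n = (if n = (0::nat) then U \<inter> E else if n = 1 then (topspace X - U) \<inter> E else {})" for n
    have "E \<subseteq> (\<Union>n. S n)"
    proof
      fix x assume "x \<in> E"
      then have "x \<in> S 0 \<or> x \<in> S 1" using E by (auto simp: S_def)
      then show "x \<in> (\<Union>n. S n)" by blast
    qed
    then have "outer E \<le> outer (\<Union>n. S n)" by (rule outer_mono)
    also have "\<dots> \<le> (\<Sum>n. outer (S n))"
      using E by (intro outer_UN) (auto simp: S_def)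
    also have "\<dots> = outer (U \<inter> E) + outer ((topspace X - U) \<inter> E)"
      by (subst suminf_finite[of "{0,1}"]) (auto simp: outer_empty S_def)
    finally show ?thesis .
  qed
  ultimately show ?thesis
    unfolding lambda_system_def using openin_subset[OF U] by (auto intro: antisym)
qed

text \<open>Outer regularity is built into \<open>outer\<close>. Inner regularity follows by
  applying it to the complement of the set: an open set around the complement has a closed, hence
  compact, complement inside the set.\<close>

lemma regular_measure_extension:
  obtains M where "space M = topspace X" "sets M = sigma_sets (topspace X) {U. openin X U}"
    "finite_measure M" "\<And>C. clopenin X C \<Longrightarrow> measure M C = L C"
    "regular_set_function X (sets M) (measure M)"
proof -
  let ?\<Omega> = "topspace X" and ?B = "sigma_sets (topspace X) {U. openin X U}"
  interpret pow: sigma_algebra ?\<Omega> "Pow ?\<Omega>" by (rule sigma_algebra_Pow)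
  have ms: "measure_space ?\<Omega> (lambda_system ?\<Omega> (Pow ?\<Omega>) outer) outer"
    by (rule pow.caratheodory_lemma[OF outer_measure_space_outer])
  have sub: "?B \<subseteq> lambda_system ?\<Omega> (Pow ?\<Omega>) outer"
    using ms open_lambda_system unfolding measure_space_def
    by (intro sigma_algebra.sigma_sets_subset) auto
  have ss: "sigma_algebra ?\<Omega> ?B"
    by (intro sigma_algebra_sigma_sets) (auto dest: openin_subset)
  have msB: "measure_space ?\<Omega> ?B outer"
    using ms sub ss unfolding measure_space_def positive_def countably_additive_def by blast
  define M where "M = measure_of ?\<Omega> ?B outer"
  have sp: "space M = ?\<Omega>" and st: "sets M = ?B"
    unfolding M_def using ss
    by (auto simp: sigma_algebra.space_measure_of_eq sigma_algebra.sets_measure_of_eq)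
  have em: "emeasure M E = outer E" if "E \<in> ?B" for E
    unfolding M_def using ss msB that unfolding measure_space_def
    by (intro emeasure_measure_of_sigma) auto
  have opB: "U \<in> ?B" if "openin X U" for U using that by auto
  have ec: "emeasure M C = ennreal (L C)" if "clopenin X C" for C
    using em[of C] opB[of C] outer_open[of C] inner_clopen[OF that] that by (simp add: clopenin_def)
  have fM: "finite_measure M"
    by (rule finite_measureI) (simp add: sp ec clopenin_topspace)
  then interpret finite_measure M .
  have outer_reg: "\<exists>U. openin X U \<and> E \<subseteq> U \<and> measure M U < measure M E + \<epsilon>" if "E \<in> ?B" "\<epsilon> > 0" for E \<epsilon>
  proof -
    have "outer E < ennreal (measure M E + \<epsilon>)"
      using em[OF that(1)] that(2) emeasure_eq_measure[of E] by (metis ennreal_lessI less_add_same_cancel1 measure_nonneg add_nonneg_pos)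
    then obtain U where "openin X U" "E \<subseteq> U" "inner U < ennreal (measure M E + \<epsilon>)"
      unfolding outer_def INF_less_iff by auto
    moreover from this have "ennreal (measure M U) < ennreal (measure M E + \<epsilon>)"
      using em[OF opB, of U] outer_open[of U] emeasure_eq_measure[of U] by simp
    ultimately show ?thesis
      using ennreal_less_iff[OF measure_nonneg, of M U] by blast
  qed
  have "regular_set_function X (sets M) (measure M)"
    unfolding regular_set_function_def
  proof (intro ballI allI impI)
    fix E and \<epsilon> :: real assume E: "E \<in> sets M" and e: "\<epsilon> > 0"
    then have EB: "E \<in> ?B" "?\<Omega> - E \<in> ?B" using st sp sets.compl_sets[of E M] by auto
    obtain U where U: "openin X U" "E \<subseteq> U" "measure M U < measure M E + \<epsilon> / 2"
      using outer_reg[OF EB(1), of "\<epsilon>/2"] e by auto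
    obtain V where V: "openin X V" "?\<Omega> - E \<subseteq> V" "measure M V < measure M (?\<Omega> - E) + \<epsilon> / 2"
      using outer_reg[OF EB(2), of "\<epsilon>/2"] e by auto
    have UM: "U \<in> sets M" "V \<in> sets M" using U V opB st by auto
    have K: "compactin X (?\<Omega> - V)"
      using V closedin_compact_space[OF compact] by (auto simp: closedin_diff)
    have EM: "E \<in> sets M" "?\<Omega> - E \<in> sets M" "?\<Omega> - V \<in> sets M"
      using EB st UM sp sets.compl_sets[of V M] by auto
    have sub: "U - (?\<Omega> - V) \<subseteq> (U - E) \<union> (V - (?\<Omega> - E))"
      using openin_subset[OF U(1)] by blast
    have "measure M (U - (?\<Omega> - V)) \<le> measure M ((U - E) \<union> (V - (?\<Omega> - E)))"
      by (rule finite_measure_mono[OF sub]) (rule sets.Un sets.Diff UM EM)+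
    also have "\<dots> \<le> measure M (U - E) + measure M (V - (?\<Omega> - E))"
      by (rule measure_Un_le) (rule sets.Diff UM EM)+
    also have "\<dots> = (measure M U - measure M E) + (measure M V - measure M (?\<Omega> - E))"
      by (simp only: finite_measure_Diff[OF UM(1) EM(1) U(2)] finite_measure_Diff[OF UM(2) EM(2) V(2)])
    also have "\<dots> < \<epsilon>" using U V by auto
    finally show "\<exists>K U. compactin X K \<and> openin X U \<and> K \<subseteq> E \<and> E \<subseteq> U \<and> measure M (U - K) < \<epsilon>"
      using K U V openin_subset[OF V(1)] sets.sets_into_space[OF E] sp by (intro exI[of _ "?\<Omega> - V"] exI[of _ U]) auto
  qed
  moreover have "measure M C = L C" if "clopenin X C" for C
    using ec[OF that] nn[OF that] by (simp add: measure_def)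
  ultimately show ?thesis using that[OF sp st fM] by blast
qed

end

section \<open>The cube and its Haar measure\<close>

definition cyl :: "'a set \<Rightarrow> 'a set \<Rightarrow> ('a \<Rightarrow> complex) \<Rightarrow> ('a \<Rightarrow> complex) set"
  where "cyl A F \<eta> = {\<omega> \<in> cube A. \<forall>\<alpha>\<in>F. \<omega> \<alpha> = \<eta> \<alpha>}"

definition cylindrical :: "'a set \<Rightarrow> (('a \<Rightarrow> complex) \<Rightarrow> 'c) \<Rightarrow> bool"
  where "cylindrical A h \<longleftrightarrow> (\<exists>F. finite F \<and> F \<subseteq> A \<and>
    (\<forall>\<omega>\<in>cube A. \<forall>\<omega>'\<in>cube A. (\<forall>\<alpha>\<in>F. \<omega> \<alpha> = \<omega>' \<alpha>) \<longrightarrow> h \<omega> = h \<omega>'))"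

lemma topspace_cube [simp]: "topspace (cube_topology A) = cube A"
  by (simp add: cube_topology_def cube_def)

lemma compact_cube: "compact_space (cube_topology A)"
  by (simp add: cube_topology_def compact_space_product_topology compact_space_discrete_topology)

lemma cube_values: "\<omega> \<in> cube A \<Longrightarrow> \<alpha> \<in> A \<Longrightarrow> \<omega> \<alpha> = 1 \<or> \<omega> \<alpha> = -1"
  by (auto simp: cube_def PiE_iff)

lemma clopenin_coordinate:
  assumes "\<alpha> \<in> A" shows "clopenin (cube_topology A) {\<omega> \<in> cube A. \<omega> \<alpha> = c}"
proof -
  have cont: "continuous_map (cube_topology A) (discrete_topology {-1, 1::complex}) (\<lambda>\<omega>. \<omega> \<alpha>)"
    unfolding cube_topology_def by (rule continuous_map_product_projection[OF assms])
  have "{\<omega> \<in> cube A. \<omega> \<alpha> = c} = {\<omega> \<in> topspace (cube_topology A). \<omega> \<alpha> \<in> {c} \<inter> {-1, 1}}"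
    using cube_values[OF _ assms] by auto
  then show ?thesis
    unfolding clopenin_def
    using openin_continuous_map_preimage[OF cont, of "{c} \<inter> {-1, 1}"]
      closedin_continuous_map_preimage[OF cont, of "{c} \<inter> {-1, 1}"] by simp
qed

lemma clopenin_cyl:
  assumes "finite F" "F \<subseteq> A" shows "clopenin (cube_topology A) (cyl A F \<eta>)"
  using assms
proof (induction F rule: finite_induct)
  case empty
  show ?case using clopenin_topspace[of "cube_topology A"] by (simp add: cyl_def)
next
  case (insert \<alpha> F)
  have "cyl A (insert \<alpha> F) \<eta> = {\<omega> \<in> cube A. \<omega> \<alpha> = \<eta> \<alpha>} \<inter> cyl A F \<eta>"
    by (auto simp: cyl_def)
  then show ?case using insert clopenin_coordinate[of \<alpha> A] by (auto intro: clopenin_Int)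
qed

lemma cyl_base:
  assumes U: "openin (cube_topology A) U" and \<omega>: "\<omega> \<in> U"
  obtains F where "finite F" "F \<subseteq> A" "cyl A F \<omega> \<subseteq> U"
proof -
  obtain V where V: "finite {i \<in> A. V i \<noteq> {-1, 1::complex}}" "\<omega> \<in> Pi\<^sub>E A V" "Pi\<^sub>E A V \<subseteq> U"
    using U \<omega> unfolding cube_topology_def openin_product_topology_alt by auto
  show ?thesis
  proof (rule that[OF V(1)])
    show "{i \<in> A. V i \<noteq> {- 1, 1}} \<subseteq> A" by auto
    show "cyl A {i \<in> A. V i \<noteq> {- 1, 1}} \<omega> \<subseteq> U"
    proof
      fix \<eta> assume \<eta>: "\<eta> \<in> cyl A {i \<in> A. V i \<noteq> {- 1, 1}} \<omega>"
      have "\<eta> i \<in> V i" if "i \<in> A" for i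
        using \<eta> V(2) that cube_values[of \<eta> A i] by (cases "V i = {-1, 1}") (auto simp: cyl_def PiE_iff)
      then have "\<eta> \<in> Pi\<^sub>E A V" using \<eta> by (auto simp: cyl_def cube_def PiE_iff)
      then show "\<eta> \<in> U" using V(3) by auto
    qed
  qed
qed

lemma mem_cyl_self: "\<omega> \<in> cube A \<Longrightarrow> \<omega> \<in> cyl A F \<omega>"
  by (simp add: cyl_def)

lemma compactin_cyl_cover:
  assumes K: "compactin (cube_topology A) K" and F: "\<And>\<omega>. \<omega> \<in> K \<Longrightarrow> finite (F \<omega>) \<and> F \<omega> \<subseteq> A"
  obtains S where "finite S" "S \<subseteq> K" "K \<subseteq> (\<Union>\<omega>\<in>S. cyl A (F \<omega>) \<omega>)"
proof -
  let ?c = "\<lambda>\<omega>. cyl A (F \<omega>) \<omega>"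
  have "K \<subseteq> \<Union>(?c ` K)"
    using mem_cyl_self compactin_subset_topspace[OF K] by fastforce
  moreover have "openin (cube_topology A) U" if U: "U \<in> ?c ` K" for U
  proof -
    from U obtain \<omega> where "\<omega> \<in> K" "U = ?c \<omega>" by auto
    then show ?thesis using clopenin_cyl[of "F \<omega>" A \<omega>] F[of \<omega>] by (simp add: clopenin_def)
  qed
  ultimately have "\<exists>\<F>. finite \<F> \<and> \<F> \<subseteq> ?c ` K \<and> K \<subseteq> \<Union>\<F>"
    using compactinD[OF K, of "?c ` K"] by simp
  then obtain \<F> where \<F>: "finite \<F>" "\<F> \<subseteq> ?c ` K" "K \<subseteq> \<Union>\<F>" by auto
  obtain S where "S \<subseteq> K" "finite S" "\<F> = ?c ` S"
    using finite_subset_image[OF \<F>(1,2)] by auto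
  with \<F>(3) show ?thesis using that by auto
qed

text \<open>Continuity makes \<open>g\<close> nearly constant on a cylinder around each point, and
  finitely many of these cylinders cover the compact cube. They involve a finite set
  \<open>G\<close> of coordinates, and replacing all other coordinates by 1 keeps a point in the
  same cylinder.\<close>

lemma continuous_cube_cylindrical:
  fixes g :: "('a \<Rightarrow> complex) \<Rightarrow> complex"
  assumes g: "continuous_map (cube_topology A) euclidean g" and e: "\<epsilon> > 0"
  obtains h where "cylindrical A h" "\<And>\<omega>. \<omega> \<in> cube A \<Longrightarrow> cmod (g \<omega> - h \<omega>) < \<epsilon>"
proof -
  have "\<exists>F. finite F \<and> F \<subseteq> A \<and> (\<forall>\<eta>\<in>cyl A F \<omega>. cmod (g \<eta> - g \<omega>) < \<epsilon> / 2)" if \<omega>: "\<omega> \<in> cube A" for \<omega>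
  proof -
    have "openin (cube_topology A) {\<eta> \<in> topspace (cube_topology A). g \<eta> \<in> ball (g \<omega>) (\<epsilon> / 2)}"
      by (rule openin_continuous_map_preimage[OF g]) simp
    from cyl_base[OF this, of \<omega>] obtain F where "finite F" "F \<subseteq> A"
      "cyl A F \<omega> \<subseteq> {\<eta> \<in> topspace (cube_topology A). g \<eta> \<in> ball (g \<omega>) (\<epsilon> / 2)}"
      using \<omega> e by auto
    then show ?thesis by (intro exI[of _ F]) (auto simp: dist_norm norm_minus_commute)
  qed
  then obtain F where F: "\<And>\<omega>. \<omega> \<in> cube A \<Longrightarrow> finite (F \<omega>) \<and> F \<omega> \<subseteq> A"
    "\<And>\<omega> \<eta>. \<omega> \<in> cube A \<Longrightarrow> \<eta> \<in> cyl A (F \<omega>) \<omega> \<Longrightarrow> cmod (g \<eta> - g \<omega>) < \<epsilon> / 2" by metis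
  have "compactin (cube_topology A) (cube A)" using compact_cube[of A] by (simp add: compact_space_def)
  then obtain S where S: "finite S" "S \<subseteq> cube A" "cube A \<subseteq> (\<Union>\<omega>\<in>S. cyl A (F \<omega>) \<omega>)"
    using compactin_cyl_cover[of A "cube A" F] F(1) by blast
  define G where "G = (\<Union>\<omega>\<in>S. F \<omega>)"
  define m where "m \<omega> = (\<lambda>\<alpha>\<in>A. if \<alpha> \<in> G then \<omega> \<alpha> else 1)" for \<omega> :: "'a \<Rightarrow> complex"
  have G: "finite G" "G \<subseteq> A" unfolding G_def using S F(1) by auto
  have mc: "m \<omega> \<in> cube A" if \<omega>: "\<omega> \<in> cube A" for \<omega>
  proof -
    have "m \<omega> \<alpha> \<in> {-1, 1}" if "\<alpha> \<in> A" for \<alpha>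
      using cube_values[OF \<omega> that] that by (auto simp: m_def)
    then show ?thesis by (simp add: cube_def m_def PiE_iff)
  qed
  show ?thesis
  proof (rule that)
    show "cylindrical A (\<lambda>\<omega>. g (m \<omega>))"
      unfolding cylindrical_def
    proof (intro exI[of _ G] conjI G ballI impI)
      fix \<omega> \<omega>' :: "'a \<Rightarrow> complex" assume "\<forall>\<alpha>\<in>G. \<omega> \<alpha> = \<omega>' \<alpha>"
      then have "m \<omega> = m \<omega>'" by (auto simp: m_def restrict_def)
      then show "g (m \<omega>) = g (m \<omega>')" by simp
    qed
    fix \<omega> assume \<omega>: "\<omega> \<in> cube A"
    then obtain \<eta> where \<eta>: "\<eta> \<in> S" "\<omega> \<in> cyl A (F \<eta>) \<eta>" using S(3) by auto
    then have "m \<omega> \<in> cyl A (F \<eta>) \<eta>"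
      using mc[OF \<omega>] G by (auto simp: cyl_def m_def G_def)
    then have "cmod (g (m \<omega>) - g \<eta>) < \<epsilon> / 2" "cmod (g \<omega> - g \<eta>) < \<epsilon> / 2"
      using F(2) \<eta> S by auto
    then show "cmod (g \<omega> - g (m \<omega>)) < \<epsilon>"
      using norm_triangle_ineq4[of "g \<omega> - g \<eta>" "g (m \<omega>) - g \<eta>"] by simp
  qed
qed

text \<open>The indicator is continuous. A function of finitely many coordinates that is closer to
  it than 1/2 separates its values 0 and 1, so the indicator depends on the same
  coordinates.\<close>

lemma clopenin_cylindrical:
  assumes "clopenin (cube_topology A) C"
  shows "cylindrical A (indicator C :: _ \<Rightarrow> complex)"
proof -
  have "continuous_map (cube_topology A) euclidean (indicator C :: _ \<Rightarrow> complex)"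
    unfolding continuous_map_def
  proof (intro conjI allI impI)
    fix U :: "complex set"
    have "{x \<in> topspace (cube_topology A). (indicator C x::complex) \<in> U}
      = (if 1 \<in> U then C else {}) \<union> (if 0 \<in> U then topspace (cube_topology A) - C else {})"
      using assms openin_subset[of "cube_topology A" C] by (auto simp: indicator_def clopenin_def)
    moreover have "openin (cube_topology A) ((if 1 \<in> U then C else {}) \<union> (if 0 \<in> U then topspace (cube_topology A) - C else {}))"
      using assms by (intro openin_Un) (auto simp: clopenin_def openin_diff simp del: topspace_cube)
    ultimately show "openin (cube_topology A) {x \<in> topspace (cube_topology A). (indicator C x::complex) \<in> U}"
      by simp
  qed simp
  then obtain h where h: "cylindrical A h" "\<And>\<omega>. \<omega> \<in> cube A \<Longrightarrow> cmod (indicator C \<omega> - h \<omega>) < 1/2"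
    using continuous_cube_cylindrical[of A "indicator C" "1/2"] by auto
  have "indicator C \<omega> = (indicator C \<omega>' :: complex)" if "\<omega> \<in> cube A" "\<omega>' \<in> cube A" "h \<omega> = h \<omega>'" for \<omega> \<omega>'
    using h(2)[OF that(1)] h(2)[OF that(2)] that(3)
      norm_triangle_ineq4[of "indicator C \<omega> - h \<omega>" "indicator C \<omega>' - h \<omega>'"]
    by (cases "\<omega> \<in> C"; cases "\<omega>' \<in> C") (auto simp: norm_minus_commute)
  with h(1) show ?thesis unfolding cylindrical_def by metis
qed

section \<open>Walsh expansions of cylindrical functions\<close>

text \<open>Induction on the coordinates: the mean and half the difference of the two values
  obtained by setting coordinate \<open>\<beta>\<close> to 1 and to -1 no longer depend on
  \<open>\<beta>\<close>, and
  \<open>h \<omega> = h0 \<omega> + \<omega> \<beta> * h1 \<omega>\<close> because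
  \<open>\<omega> \<beta>\<close> is 1 or -1.\<close>

lemma dependent_walsh_expansion:
  fixes h :: "('a \<Rightarrow> complex) \<Rightarrow> complex"
  assumes "finite F" "F \<subseteq> A"
    and "\<forall>\<omega>\<in>cube A. \<forall>\<omega>'\<in>cube A. (\<forall>\<alpha>\<in>F. \<omega> \<alpha> = \<omega>' \<alpha>) \<longrightarrow> h \<omega> = h \<omega>'"
  shows "\<exists>c. \<forall>\<omega>\<in>cube A. h \<omega> = (\<Sum>G\<in>Pow F. c G * (\<Prod>\<alpha>\<in>G. \<omega> \<alpha>))"
  using assms
proof (induction F arbitrary: h rule: finite_induct)
  case empty
  have "(\<lambda>\<alpha>\<in>A. 1) \<in> cube A" by (simp add: cube_def)
  then have "h \<omega> = h (\<lambda>\<alpha>\<in>A. 1)" if "\<omega> \<in> cube A" for \<omega>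
    using empty(2) that by blast
  then show ?case by (intro exI[of _ "\<lambda>_. h (\<lambda>\<alpha>\<in>A. 1)"]) simp
next
  case (insert \<beta> F)
  have \<beta>: "\<beta> \<in> A" and FA: "F \<subseteq> A" using insert.prems(1) by auto
  define h0 where "h0 \<omega> = (h (fun_upd \<omega> \<beta> 1) + h (fun_upd \<omega> \<beta> (-1))) / 2" for \<omega>
  define h1 where "h1 \<omega> = (h (fun_upd \<omega> \<beta> 1) - h (fun_upd \<omega> \<beta> (-1))) / 2" for \<omega>
  have up: "fun_upd \<omega> \<beta> s \<in> cube A" if "\<omega> \<in> cube A" "s = 1 \<or> s = -1" for \<omega> s
    using that \<beta> by (auto simp: cube_def PiE_iff extensional_def)
  have dep: "h (fun_upd \<omega> \<beta> s) = h (fun_upd \<omega>' \<beta> s)"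
    if "\<omega> \<in> cube A" "\<omega>' \<in> cube A" "\<forall>\<alpha>\<in>F. \<omega> \<alpha> = \<omega>' \<alpha>" "s = 1 \<or> s = -1" for \<omega> \<omega>' s
    by (rule insert.prems(2)[rule_format, OF up[OF that(1,4)] up[OF that(2,4)]]) (use that(3) in auto)
  have "h0 \<omega> = h0 \<omega>' \<and> h1 \<omega> = h1 \<omega>'" if "\<omega> \<in> cube A" "\<omega>' \<in> cube A" "\<forall>\<alpha>\<in>F. \<omega> \<alpha> = \<omega>' \<alpha>" for \<omega> \<omega>'
    unfolding h0_def h1_def dep[OF that disjI1[OF refl]] dep[OF that disjI2[OF refl]] by simp
  then have d0: "\<forall>\<omega>\<in>cube A. \<forall>\<omega>'\<in>cube A. (\<forall>\<alpha>\<in>F. \<omega> \<alpha> = \<omega>' \<alpha>) \<longrightarrow> h0 \<omega> = h0 \<omega>'"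
    and d1: "\<forall>\<omega>\<in>cube A. \<forall>\<omega>'\<in>cube A. (\<forall>\<alpha>\<in>F. \<omega> \<alpha> = \<omega>' \<alpha>) \<longrightarrow> h1 \<omega> = h1 \<omega>'"
    by blast+
  obtain c0 where c0: "\<forall>\<omega>\<in>cube A. h0 \<omega> = (\<Sum>G\<in>Pow F. c0 G * (\<Prod>\<alpha>\<in>G. \<omega> \<alpha>))"
    using insert.IH[OF FA d0] by blast
  obtain c1 where c1: "\<forall>\<omega>\<in>cube A. h1 \<omega> = (\<Sum>G\<in>Pow F. c1 G * (\<Prod>\<alpha>\<in>G. \<omega> \<alpha>))"
    using insert.IH[OF FA d1] by blast
  define c where "c G = (if \<beta> \<in> G then c1 (G - {\<beta>}) else c0 G)" for G
  have "h \<omega> = (\<Sum>G\<in>Pow (insert \<beta> F). c G * (\<Prod>\<alpha>\<in>G. \<omega> \<alpha>))" if \<omega>: "\<omega> \<in> cube A" for \<omega>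
  proof -
    have "h \<omega> = h0 \<omega> + \<omega> \<beta> * h1 \<omega>"
    proof -
      have "fun_upd \<omega> \<beta> 1 = \<omega>" if "\<omega> \<beta> = 1" using that by auto
      moreover have "fun_upd \<omega> \<beta> (-1) = \<omega>" if "\<omega> \<beta> = -1" using that by auto
      ultimately show ?thesis
        using cube_values[OF \<omega> \<beta>] unfolding h0_def h1_def by (elim disjE) (simp_all add: field_simps)
    qed
    moreover have "(\<Sum>G\<in>Pow (insert \<beta> F). c G * (\<Prod>\<alpha>\<in>G. \<omega> \<alpha>))
      = (\<Sum>G\<in>Pow F. c G * (\<Prod>\<alpha>\<in>G. \<omega> \<alpha>)) + (\<Sum>G\<in>insert \<beta> ` Pow F. c G * (\<Prod>\<alpha>\<in>G. \<omega> \<alpha>))"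
      unfolding Pow_insert by (rule sum.union_disjoint) (use insert.hyps in auto)
    moreover have "(\<Sum>G\<in>Pow F. c G * (\<Prod>\<alpha>\<in>G. \<omega> \<alpha>)) = h0 \<omega>"
      using c0 \<omega> insert.hyps(2) by (auto simp: c_def intro!: sum.cong)
    moreover have "(\<Sum>G\<in>insert \<beta> ` Pow F. c G * (\<Prod>\<alpha>\<in>G. \<omega> \<alpha>)) = \<omega> \<beta> * h1 \<omega>"
    proof -
      have inj: "inj_on (insert \<beta>) (Pow F)"
        using insert.hyps(2) by (auto simp: inj_on_def)
      have "(\<Sum>G\<in>insert \<beta> ` Pow F. c G * (\<Prod>\<alpha>\<in>G. \<omega> \<alpha>)) = (\<Sum>G\<in>Pow F. \<omega> \<beta> * (c1 G * (\<Prod>\<alpha>\<in>G. \<omega> \<alpha>)))"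
        unfolding sum.reindex[OF inj] o_def
      proof (rule sum.cong[OF refl])
        fix G assume "G \<in> Pow F"
        then have "\<beta> \<notin> G" "finite G" using insert.hyps finite_subset by auto
        then show "c (insert \<beta> G) * prod \<omega> (insert \<beta> G) = \<omega> \<beta> * (c1 G * prod \<omega> G)"
          by (simp add: c_def)
      qed
      then show ?thesis using c1 \<omega> by (simp add: sum_distrib_left)
    qed
    ultimately show ?thesis by simp
  qed
  then show ?case by blast
qed

lemma cylindrical_walsh_expansion:
  fixes h :: "('a \<Rightarrow> complex) \<Rightarrow> complex"
  assumes "cylindrical A h"
  obtains F c where "finite F" "F \<subseteq> A"
    "\<And>\<omega>. \<omega> \<in> cube A \<Longrightarrow> h \<omega> = (\<Sum>G\<in>Pow F. c G * (\<Prod>\<alpha>\<in>G. \<omega> \<alpha>))"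
proof -
  obtain F where F: "finite F" "F \<subseteq> A" "\<forall>\<omega>\<in>cube A. \<forall>\<omega>'\<in>cube A. (\<forall>\<alpha>\<in>F. \<omega> \<alpha> = \<omega>' \<alpha>) \<longrightarrow> h \<omega> = h \<omega>'"
    using assms unfolding cylindrical_def by blast
  from dependent_walsh_expansion[OF this] show ?thesis using that[OF F(1,2)] by blast
qed

lemma cylindrical_add:
  fixes g h :: "('a \<Rightarrow> complex) \<Rightarrow> complex"
  assumes "cylindrical A g" "cylindrical A h" shows "cylindrical A (\<lambda>\<omega>. g \<omega> + h \<omega>)"
proof -
  obtain F where F: "finite F" "F \<subseteq> A" "\<forall>\<omega>\<in>cube A. \<forall>\<omega>'\<in>cube A. (\<forall>\<alpha>\<in>F. \<omega> \<alpha> = \<omega>' \<alpha>) \<longrightarrow> g \<omega> = g \<omega>'"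
    using assms(1) unfolding cylindrical_def by blast
  obtain G where G: "finite G" "G \<subseteq> A" "\<forall>\<omega>\<in>cube A. \<forall>\<omega>'\<in>cube A. (\<forall>\<alpha>\<in>G. \<omega> \<alpha> = \<omega>' \<alpha>) \<longrightarrow> h \<omega> = h \<omega>'"
    using assms(2) unfolding cylindrical_def by blast
  show ?thesis
    unfolding cylindrical_def
  proof (intro exI[of _ "F \<union> G"] conjI ballI impI)
    fix \<omega> \<omega>' assume "\<omega> \<in> cube A" "\<omega>' \<in> cube A" "\<forall>\<alpha>\<in>F \<union> G. \<omega> \<alpha> = \<omega>' \<alpha>"
    then have "g \<omega> = g \<omega>'" "h \<omega> = h \<omega>'" using F(3) G(3) by blast+
    then show "g \<omega> + h \<omega> = g \<omega>' + h \<omega>'" by simp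
  qed (use F G in auto)
qed

lemma cylindrical_mult:
  assumes "cylindrical A g" shows "cylindrical A (\<lambda>\<omega>. c * g \<omega> :: complex)"
proof -
  obtain F where F: "finite F" "F \<subseteq> A" "\<forall>\<omega>\<in>cube A. \<forall>\<omega>'\<in>cube A. (\<forall>\<alpha>\<in>F. \<omega> \<alpha> = \<omega>' \<alpha>) \<longrightarrow> g \<omega> = g \<omega>'"
    using assms unfolding cylindrical_def by blast
  show ?thesis
    unfolding cylindrical_def
  proof (intro exI[of _ F] conjI ballI impI)
    fix \<omega> \<omega>' assume "\<omega> \<in> cube A" "\<omega>' \<in> cube A" "\<forall>\<alpha>\<in>F. \<omega> \<alpha> = \<omega>' \<alpha>"
    then have "g \<omega> = g \<omega>'" using F(3) by blast
    then show "c * g \<omega> = c * g \<omega>'" by simp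
  qed (use F in auto)
qed

section \<open>Borel measurability and products of coordinates\<close>

lemma space_cube_borel [simp]: "space (cube_borel A) = cube A"
  unfolding cube_borel_def by (rule space_measure_of) (use openin_subset[of "cube_topology A"] in auto)

lemma sets_cube_borel: "sets (cube_borel A) = sigma_sets (cube A) {U. openin (cube_topology A) U}"
  unfolding cube_borel_def by (rule sets_measure_of) (use openin_subset[of "cube_topology A"] in auto)

lemma openin_sets_cube: "openin (cube_topology A) U \<Longrightarrow> U \<in> sets (cube_borel A)"
  by (auto simp: sets_cube_borel)

lemma continuous_cube_measurable:
  fixes g :: "('a \<Rightarrow> complex) \<Rightarrow> complex"
  assumes "continuous_map (cube_topology A) euclidean g"
  shows "g \<in> borel_measurable (cube_borel A)"
proof (rule borel_measurableI)
  fix S :: "complex set" assume "open S"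
  then have "openin (cube_topology A) {\<omega> \<in> topspace (cube_topology A). g \<omega> \<in> S}"
    by (intro openin_continuous_map_preimage[OF assms]) simp
  then show "g -` S \<inter> space (cube_borel A) \<in> sets (cube_borel A)"
    by (intro openin_sets_cube) (simp add: vimage_def Int_def conj_commute)
qed

lemma coordinate_continuous:
  assumes "\<alpha> \<in> A" shows "continuous_map (cube_topology A) euclidean (\<lambda>\<omega>. \<omega> \<alpha> :: complex)"
proof -
  have "continuous_map (cube_topology A) (discrete_topology {-1, 1::complex}) (\<lambda>\<omega>. \<omega> \<alpha>)"
    unfolding cube_topology_def by (rule continuous_map_product_projection[OF assms])
  moreover have "continuous_map (discrete_topology {-1, 1::complex}) euclidean id" by simp
  ultimately have "continuous_map (cube_topology A) euclidean (id \<circ> (\<lambda>\<omega>. \<omega> \<alpha>))"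
    by (rule continuous_map_compose)
  then show ?thesis by simp
qed

lemma coordinate_measurable: "\<alpha> \<in> A \<Longrightarrow> (\<lambda>\<omega>. \<omega> \<alpha> :: complex) \<in> borel_measurable (cube_borel A)"
  by (intro continuous_cube_measurable coordinate_continuous)

lemma prod_coordinate_measurable:
  "F \<subseteq> A \<Longrightarrow> (\<lambda>\<omega>. \<Prod>\<alpha>\<in>F. \<omega> \<alpha> :: complex) \<in> borel_measurable (cube_borel A)"
  by (intro borel_measurable_prod coordinate_measurable) auto

lemma norm_prod_coordinate:
  assumes "\<omega> \<in> cube A" "F \<subseteq> A" shows "cmod (\<Prod>\<alpha>\<in>F. \<omega> \<alpha>) = 1"
  unfolding prod_norm[symmetric]
proof (rule prod.neutral, rule ballI)
  fix \<alpha> assume "\<alpha> \<in> F"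
  then have "\<alpha> \<in> A" using assms(2) by auto
  then show "cmod (\<omega> \<alpha>) = 1" using cube_values[OF assms(1), of \<alpha>] by auto
qed

lemma prod_coordinate_values:
  assumes "\<omega> \<in> cube A" "finite F" "F \<subseteq> A"
  shows "(\<Prod>\<alpha>\<in>F. \<omega> \<alpha>) = 1 \<or> (\<Prod>\<alpha>\<in>F. \<omega> \<alpha>) = -1"
  using assms(2,3)
proof (induction F rule: finite_induct)
  case (insert \<alpha> F)
  then show ?case using cube_values[OF assms(1), of \<alpha>] by auto
qed simp

text \<open>Coordinates square to 1, so common factors cancel and multiplication of characters
  becomes symmetric difference of index sets.\<close>

lemma prod_coordinate_mult:
  assumes "\<omega> \<in> cube A" "finite F" "finite G" "F \<subseteq> A" "G \<subseteq> A"
  shows "(\<Prod>\<alpha>\<in>F. \<omega> \<alpha>) * (\<Prod>\<alpha>\<in>G. \<omega> \<alpha>) = (\<Prod>\<alpha>\<in>(F - G) \<union> (G - F). \<omega> \<alpha>)"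
proof -
  have "(\<Prod>\<alpha>\<in>F. \<omega> \<alpha>) = (\<Prod>\<alpha>\<in>F - G. \<omega> \<alpha>) * (\<Prod>\<alpha>\<in>F \<inter> G. \<omega> \<alpha>)"
    using assms by (subst prod.union_disjoint[symmetric]) (auto intro!: prod.cong)
  moreover have "(\<Prod>\<alpha>\<in>G. \<omega> \<alpha>) = (\<Prod>\<alpha>\<in>G - F. \<omega> \<alpha>) * (\<Prod>\<alpha>\<in>F \<inter> G. \<omega> \<alpha>)"
    using assms by (subst prod.union_disjoint[symmetric]) (auto intro!: prod.cong)
  moreover have "(\<Prod>\<alpha>\<in>F \<inter> G. \<omega> \<alpha>) * (\<Prod>\<alpha>\<in>F \<inter> G. \<omega> \<alpha>) = 1"
    using prod_coordinate_values[OF assms(1) finite_Int[OF disjI1[OF assms(2)]], of G] assms(4)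
    by (metis le_infI1 minus_mult_minus mult_1)
  moreover have "(\<Prod>\<alpha>\<in>(F - G) \<union> (G - F). \<omega> \<alpha>) = (\<Prod>\<alpha>\<in>F - G. \<omega> \<alpha>) * (\<Prod>\<alpha>\<in>G - F. \<omega> \<alpha>)"
    using assms by (intro prod.union_disjoint) auto
  ultimately show ?thesis by (simp add: algebra_simps)
qed

section \<open>Orthogonality of characters and density results for Haar measure\<close>

locale haar_cube =
  fixes A :: "'a set" and P :: "('a \<Rightarrow> complex) measure"
  assumes haar: "normalized_haar A P"
begin

lemma space_P [simp]: "space P = cube A" and sets_P: "sets P = sets (cube_borel A)"
  using haar by (auto simp: normalized_haar_def)

sublocale prob_space P
  by (rule prob_spaceI) (use haar in \<open>simp add: normalized_haar_def\<close>)

lemma measurable_P [simp]: "borel_measurable P = borel_measurable (cube_borel A)"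
  by (rule measurable_cong_sets[OF sets_P refl])

text \<open>Translation by the point that is -1 at one \<open>\<beta> \<in> F\<close> and 1
  elsewhere exchanges the sets where the character is 1 and -1, so by invariance these have equal
  measure.\<close>

lemma integral_walsh:
  assumes F: "finite F" "F \<subseteq> A"
  shows "(\<integral>\<omega>. (\<Prod>\<alpha>\<in>F. \<omega> \<alpha>) \<partial>P) = (if F = {} then 1 else 0 :: complex)"
proof (cases "F = {}")
  case True
  then show ?thesis using prob_space by simp
next
  case False
  then obtain \<beta> where \<beta>: "\<beta> \<in> F" by auto
  define E where "E s = {\<omega> \<in> cube A. (\<Prod>\<alpha>\<in>F. \<omega> \<alpha>) = s}" for s :: complex
  define \<eta> :: "'a \<Rightarrow> complex" where "\<eta> = (\<lambda>\<alpha>\<in>A. if \<alpha> = \<beta> then -1 else 1)"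
  have \<eta>: "\<eta> \<in> cube A" by (auto simp: \<eta>_def cube_def)
  have E: "E s \<in> sets P" for s
  proof -
    have "(\<lambda>\<omega>. \<Prod>\<alpha>\<in>F. \<omega> \<alpha>) \<in> borel_measurable P" using prod_coordinate_measurable[OF F(2)] by simp
    from measurable_sets[OF this, of "{s}"] show ?thesis
      by (simp add: E_def vimage_def Int_def conj_commute)
  qed
  have prod\<eta>: "(\<Prod>\<alpha>\<in>F. cube_mult A \<eta> \<omega> \<alpha>) = - (\<Prod>\<alpha>\<in>F. \<omega> \<alpha>)" for \<omega>
  proof -
    have "(\<Prod>\<alpha>\<in>F. cube_mult A \<eta> \<omega> \<alpha>) = (\<Prod>\<alpha>\<in>F. \<eta> \<alpha> * \<omega> \<alpha>)"
      using F by (intro prod.cong) (auto simp: cube_mult_def)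
    moreover have "(\<Prod>\<alpha>\<in>F. \<eta> \<alpha>) = (\<Prod>\<alpha>\<in>F. if \<alpha> = \<beta> then -1 else 1)"
      using F by (intro prod.cong) (auto simp: \<eta>_def)
    ultimately show ?thesis using F \<beta> by (simp add: prod.distrib)
  qed
  have cm: "cube_mult A \<eta> \<omega> \<in> cube A" if "\<omega> \<in> cube A" for \<omega>
  proof -
    have "cube_mult A \<eta> \<omega> \<alpha> \<in> {-1, 1}" if "\<alpha> \<in> A" for \<alpha>
      using cube_values[OF \<open>\<omega> \<in> cube A\<close> that] that by (auto simp: cube_mult_def \<eta>_def)
    then show ?thesis by (simp add: cube_def cube_mult_def PiE_iff)
  qed
  have inv: "cube_mult A \<eta> (cube_mult A \<eta> \<omega>) = \<omega>" if "\<omega> \<in> cube A" for \<omega>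
    using that by (intro ext) (auto simp: cube_mult_def cube_def \<eta>_def PiE_iff extensional_def)
  have "cube_mult A \<eta> ` E 1 = E (-1)"
  proof (intro antisym subsetI)
    fix \<omega> assume "\<omega> \<in> cube_mult A \<eta> ` E 1"
    then show "\<omega> \<in> E (-1)" using cm prod\<eta> by (auto simp: E_def)
  next
    fix \<omega> assume \<omega>: "\<omega> \<in> E (-1)"
    then have "cube_mult A \<eta> \<omega> \<in> E 1" using cm prod\<eta> by (auto simp: E_def)
    then show "\<omega> \<in> cube_mult A \<eta> ` E 1" using inv[of \<omega>] \<omega> by (metis (mono_tags, lifting) E_def image_eqI mem_Collect_eq)
  qed
  then have eq: "measure P (E 1) = measure P (E (-1))"
    using haar \<eta> E[of 1] unfolding normalized_haar_def measure_def by metis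
  have "(\<integral>\<omega>. (\<Prod>\<alpha>\<in>F. \<omega> \<alpha>) \<partial>P) = (\<integral>\<omega>. indicator (E 1) \<omega> - indicator (E (-1)) \<omega> \<partial>P)"
    by (intro Bochner_Integration.integral_cong refl)
       (use prod_coordinate_values[OF _ F] in \<open>auto simp: E_def indicator_def\<close>)
  also have "\<dots> = (\<integral>\<omega>. indicator (E 1) \<omega> \<partial>P) - (\<integral>\<omega>. indicator (E (-1)) \<omega> \<partial>P)"
    by (intro Bochner_Integration.integral_diff integrable_const_bound[where B=1])
      (use E in \<open>auto simp: sets_P indicator_def\<close>)
  also have "\<dots> = complex_of_real (\<integral>\<omega>. indicator (E 1) \<omega> \<partial>P) - complex_of_real (\<integral>\<omega>. indicator (E (-1)) \<omega> \<partial>P)"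
    by (simp only: integral_complex_of_real[symmetric] of_real_indicator)
  also have "\<dots> = 0" using eq sets.sets_into_space[OF E, of 1] sets.sets_into_space[OF E, of "-1"]
    by (simp add: Int_absorb2)
  finally show ?thesis using False by simp
qed

lemma bounded_integrable:
  fixes f :: "('a \<Rightarrow> complex) \<Rightarrow> complex"
  assumes "f \<in> borel_measurable (cube_borel A)" "\<And>\<omega>. \<omega> \<in> cube A \<Longrightarrow> cmod (f \<omega>) \<le> C"
  shows "integrable P f"
  by (rule integrable_const_bound[where B=C]) (use assms in auto)

lemma integral_walsh_mult:
  assumes "finite F" "F \<subseteq> A" "finite G" "G \<subseteq> A"
  shows "(\<integral>\<omega>. (\<Prod>\<alpha>\<in>F. \<omega> \<alpha>) * (\<Prod>\<alpha>\<in>G. \<omega> \<alpha>) \<partial>P) = (if F = G then 1 else 0 :: complex)"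
proof -
  have "(\<integral>\<omega>. (\<Prod>\<alpha>\<in>F. \<omega> \<alpha>) * (\<Prod>\<alpha>\<in>G. \<omega> \<alpha>) \<partial>P) = (\<integral>\<omega>. (\<Prod>\<alpha>\<in>(F - G) \<union> (G - F). \<omega> \<alpha>) \<partial>P)"
    by (intro Bochner_Integration.integral_cong refl) (use assms prod_coordinate_mult in auto)
  also have "\<dots> = (if (F - G) \<union> (G - F) = {} then 1 else 0)"
    using assms by (intro integral_walsh) auto
  finally show ?thesis by (auto split: if_splits)
qed

text \<open>Expanding the product yields one character for each subset of \<open>B\<close>, and
  orthogonality picks out \<open>F\<close>. The value is the same for all \<open>B\<close>
  containing \<open>F\<close>, which makes infinite products accessible.\<close>

lemma integral_finite_product:
  fixes a :: "'a \<Rightarrow> complex"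
  assumes B: "finite B" "B \<subseteq> A" and F: "finite F" "F \<subseteq> A"
  shows "(\<integral>\<omega>. (\<Prod>\<alpha>\<in>B. 1 + a \<alpha> * \<omega> \<alpha>) * (\<Prod>\<alpha>\<in>F. \<omega> \<alpha>) \<partial>P) = (if F \<subseteq> B then \<Prod>\<alpha>\<in>F. a \<alpha> else 0)"
proof -
  have exp: "(\<Prod>\<alpha>\<in>B. 1 + a \<alpha> * \<omega> \<alpha>) = (\<Sum>G\<in>Pow B. (\<Prod>\<alpha>\<in>G. a \<alpha>) * (\<Prod>\<alpha>\<in>G. \<omega> \<alpha>))" for \<omega>
    using prod_add[OF B(1), of "\<lambda>\<alpha>. a \<alpha> * \<omega> \<alpha>" "\<lambda>_. 1"] by (simp add: prod.distrib add.commute)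
  have int: "integrable P (\<lambda>\<omega>. (\<Prod>\<alpha>\<in>G. a \<alpha>) * ((\<Prod>\<alpha>\<in>G. \<omega> \<alpha>) * (\<Prod>\<alpha>\<in>F. \<omega> \<alpha>)))" if "G \<in> Pow B" for G
  proof (intro integrable_mult_right bounded_integrable[where C=1])
    show "(\<lambda>\<omega>. prod \<omega> G * prod \<omega> F) \<in> borel_measurable (cube_borel A)"
      using that B F by (intro borel_measurable_times prod_coordinate_measurable) auto
    show "cmod (prod \<omega> G * prod \<omega> F) \<le> 1" if "\<omega> \<in> cube A" for \<omega>
      using norm_prod_coordinate[OF that, of G] norm_prod_coordinate[OF that, of F] \<open>G \<in> Pow B\<close> B F
      by (simp add: norm_mult)
  qed
  have "(\<integral>\<omega>. (\<Prod>\<alpha>\<in>B. 1 + a \<alpha> * \<omega> \<alpha>) * (\<Prod>\<alpha>\<in>F. \<omega> \<alpha>) \<partial>P)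
      = (\<integral>\<omega>. (\<Sum>G\<in>Pow B. (\<Prod>\<alpha>\<in>G. a \<alpha>) * ((\<Prod>\<alpha>\<in>G. \<omega> \<alpha>) * (\<Prod>\<alpha>\<in>F. \<omega> \<alpha>))) \<partial>P)"
    by (simp add: exp sum_distrib_right mult.assoc)
  also have "\<dots> = (\<Sum>G\<in>Pow B. (\<Prod>\<alpha>\<in>G. a \<alpha>) * (\<integral>\<omega>. (\<Prod>\<alpha>\<in>G. \<omega> \<alpha>) * (\<Prod>\<alpha>\<in>F. \<omega> \<alpha>) \<partial>P))"
    using int by (subst Bochner_Integration.integral_sum) auto
  also have "\<dots> = (\<Sum>G\<in>Pow B. if G = F then (\<Prod>\<alpha>\<in>F. a \<alpha>) else 0)"
    using B F by (intro sum.cong refl) (auto simp: integral_walsh_mult finite_subset dest: finite_subset)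
  also have "\<dots> = (if F \<subseteq> B then \<Prod>\<alpha>\<in>F. a \<alpha> else 0)"
    using B by (simp add: sum.delta)
  finally show ?thesis .
qed

text \<open>Regularity, part of the definition of Haar measure, reaches the Borel sets outside the
  sigma-algebra generated by the coordinates: between a compact set and an open set that squeeze
  \<open>E\<close> there is room for a finite union of cylinders.\<close>

lemma clopen_approximation:
  assumes E: "E \<in> sets P" and e: "\<epsilon> > 0"
  obtains C where "clopenin (cube_topology A) C" "measure P ((E - C) \<union> (C - E)) < \<epsilon>"
proof -
  obtain K U where KU: "compactin (cube_topology A) K" "openin (cube_topology A) U" "K \<subseteq> E" "E \<subseteq> U"
      "measure P (U - K) < \<epsilon>"
  proof -
    have "regular_set_function (cube_topology A) (sets P) (measure P)"
      using haar unfolding normalized_haar_def by (elim conjE)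
    from this[unfolded regular_set_function_def, rule_format, OF E e] show ?thesis using that by auto
  qed
  have "\<exists>F. finite F \<and> F \<subseteq> A \<and> cyl A F \<omega> \<subseteq> U" if "\<omega> \<in> K" for \<omega>
  proof -
    have "\<omega> \<in> U" using KU that by auto
    from cyl_base[OF KU(2) this] show ?thesis by metis
  qed
  then obtain F where F: "\<And>\<omega>. \<omega> \<in> K \<Longrightarrow> finite (F \<omega>) \<and> F \<omega> \<subseteq> A \<and> cyl A (F \<omega>) \<omega> \<subseteq> U" by metis
  have Kc: "K \<subseteq> cube A" using compactin_subset_topspace[OF KU(1)] by simp
  obtain S where S: "finite S" "S \<subseteq> K" "K \<subseteq> (\<Union>\<omega>\<in>S. cyl A (F \<omega>) \<omega>)"
    using compactin_cyl_cover[OF KU(1), of F] F by blast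
  define C where "C = (\<Union>\<omega>\<in>S. cyl A (F \<omega>) \<omega>)"
  have C: "clopenin (cube_topology A) C"
    unfolding C_def using S F by (intro clopenin_UN clopenin_cyl) auto
  have CU: "C \<subseteq> U" unfolding C_def using S F by blast
  have KC: "K \<subseteq> C" unfolding C_def by (rule S(3))
  have "closedin (cube_topology A) K"
    by (rule compactin_imp_closedin[OF _ KU(1)])
       (auto simp: cube_topology_def Hausdorff_space_product_topology Hausdorff_space_discrete_topology)
  then have "K \<in> sets P"
    using openin_sets_cube[of A "topspace (cube_topology A) - K"] Kc sets.compl_sets[of "cube A - K" P]
    by (auto simp: closedin_def sets_P double_diff)
  then have "U - K \<in> sets P" using openin_sets_cube[OF KU(2)] sets_P by auto
  moreover have "(E - C) \<union> (C - E) \<subseteq> U - K" using KC KU CU by blast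
  ultimately have "measure P ((E - C) \<union> (C - E)) \<le> measure P (U - K)"
    by (rule finite_measure_mono[rotated])
  then show ?thesis using that[OF C] KU(5) by simp
qed

lemma cylindrical_measurable:
  fixes h :: "('a \<Rightarrow> complex) \<Rightarrow> complex"
  assumes "cylindrical A h" shows "h \<in> borel_measurable (cube_borel A)"
    and "\<exists>C. \<forall>\<omega>\<in>cube A. cmod (h \<omega>) \<le> C"
proof -
  obtain F c where F: "finite F" "F \<subseteq> A"
    and h: "\<And>\<omega>. \<omega> \<in> cube A \<Longrightarrow> h \<omega> = (\<Sum>G\<in>Pow F. c G * (\<Prod>\<alpha>\<in>G. \<omega> \<alpha>))"
    using cylindrical_walsh_expansion[OF assms] by metis
  have "(\<lambda>\<omega>. \<Sum>G\<in>Pow F. c G * (\<Prod>\<alpha>\<in>G. \<omega> \<alpha>)) \<in> borel_measurable (cube_borel A)"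
    using F by (intro borel_measurable_sum borel_measurable_times prod_coordinate_measurable) auto
  then show "h \<in> borel_measurable (cube_borel A)"
    using h by (subst measurable_cong[of _ _ "\<lambda>\<omega>. \<Sum>G\<in>Pow F. c G * (\<Prod>\<alpha>\<in>G. \<omega> \<alpha>)"]) auto
  show "\<exists>C. \<forall>\<omega>\<in>cube A. cmod (h \<omega>) \<le> C"
  proof (intro exI ballI)
    fix \<omega> assume \<omega>: "\<omega> \<in> cube A"
    have "cmod (h \<omega>) \<le> (\<Sum>G\<in>Pow F. cmod (c G * (\<Prod>\<alpha>\<in>G. \<omega> \<alpha>)))"
      unfolding h[OF \<omega>] by (rule norm_sum)
    also have "\<dots> = (\<Sum>G\<in>Pow F. cmod (c G))"
      using F by (intro sum.cong refl) (auto simp: norm_mult norm_prod_coordinate[OF \<omega>])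
    finally show "cmod (h \<omega>) \<le> (\<Sum>G\<in>Pow F. cmod (c G))" .
  qed
qed

text \<open>Induction over integrable functions, starting from indicators of Borel sets, which
  clopen sets approximate in measure. The claim is carried for all positive errors at once, so that
  sums and limits can share the error among their parts.\<close>

lemma cylindrical_dense_L1:
  fixes g :: "('a \<Rightarrow> complex) \<Rightarrow> complex"
  assumes "integrable P g" "\<epsilon> > 0"
  shows "\<exists>h. cylindrical A h \<and> (\<integral>\<omega>. cmod (g \<omega> - h \<omega>) \<partial>P) < \<epsilon>"
proof -
  have ci: "integrable P h" if "cylindrical A h" for h :: "_ \<Rightarrow> complex"
    using cylindrical_measurable[OF that] bounded_integrable by blast
  have "\<forall>\<epsilon>>0. \<exists>h. cylindrical A h \<and> (\<integral>\<omega>. cmod (g \<omega> - h \<omega>) \<partial>P) < \<epsilon>"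
    using assms(1)
  proof (induction rule: integrable_induct)
    case (base E c)
    show ?case
    proof (intro allI impI)
      fix \<epsilon> :: real assume e: "\<epsilon> > 0"
      obtain C where C: "clopenin (cube_topology A) C" "measure P ((E - C) \<union> (C - E)) < \<epsilon> / (cmod c + 1)"
        using clopen_approximation[OF base(1), of "\<epsilon> / (cmod c + 1)"] e
        by (metis add_nonneg_pos divide_pos_pos norm_ge_zero zero_less_one)
      have Cs: "C \<in> sets P" using C(1) openin_sets_cube sets_P by (auto simp: clopenin_def)
      have "(\<integral>\<omega>. cmod (indicat_real E \<omega> *\<^sub>R c - c * indicator C \<omega>) \<partial>P)
          = (\<integral>\<omega>. cmod c * indicator ((E - C) \<union> (C - E)) \<omega> \<partial>P)"
        by (intro Bochner_Integration.integral_cong refl) (auto simp: indicator_def)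
      also have "\<dots> = cmod c * measure P ((E - C) \<union> (C - E))"
        using base Cs sets.sets_into_space[of "(E - C) \<union> (C - E)" P] by (simp add: Int_absorb2)
      also have "\<dots> \<le> (cmod c + 1) * measure P ((E - C) \<union> (C - E))"
        by (intro mult_right_mono) auto
      also have "\<dots> < \<epsilon>"
        using C(2) by (simp add: pos_less_divide_eq add_nonneg_pos mult.commute)
      finally show "\<exists>h. cylindrical A h \<and> (\<integral>\<omega>. cmod (indicat_real E \<omega> *\<^sub>R c - h \<omega>) \<partial>P) < \<epsilon>"
        using cylindrical_mult[OF clopenin_cylindrical[OF C(1)]] by blast
    qed
  next
    case (add f g)
    show ?case
    proof (intro allI impI)
      fix \<epsilon> :: real assume e: "\<epsilon> > 0"
      obtain h where h: "cylindrical A h" "(\<integral>\<omega>. cmod (f \<omega> - h \<omega>) \<partial>P) < \<epsilon> / 2"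
        using add.IH(1) e half_gt_zero by blast
      obtain k where k: "cylindrical A k" "(\<integral>\<omega>. cmod (g \<omega> - k \<omega>) \<partial>P) < \<epsilon> / 2"
        using add.IH(2) e half_gt_zero by blast
      have "(\<integral>\<omega>. cmod (f \<omega> + g \<omega> - (h \<omega> + k \<omega>)) \<partial>P) \<le> (\<integral>\<omega>. cmod (f \<omega> - h \<omega>) + cmod (g \<omega> - k \<omega>) \<partial>P)"
      proof (rule integral_mono)
        fix \<omega>
        show "cmod (f \<omega> + g \<omega> - (h \<omega> + k \<omega>)) \<le> cmod (f \<omega> - h \<omega>) + cmod (g \<omega> - k \<omega>)"
          using norm_triangle_ineq[of "f \<omega> - h \<omega>" "g \<omega> - k \<omega>"] by (simp add: algebra_simps)
      qed (use add ci h k in auto)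
      also have "\<dots> = (\<integral>\<omega>. cmod (f \<omega> - h \<omega>) \<partial>P) + (\<integral>\<omega>. cmod (g \<omega> - k \<omega>) \<partial>P)"
        using add ci h k by (intro Bochner_Integration.integral_add) auto
      finally show "\<exists>h. cylindrical A h \<and> (\<integral>\<omega>. cmod (f \<omega> + g \<omega> - h \<omega>) \<partial>P) < \<epsilon>"
        using h k cylindrical_add[OF h(1) k(1)] by (intro exI[of _ "\<lambda>\<omega>. h \<omega> + k \<omega>"] conjI) auto
    qed
  next
    case (lim f s)
    show ?case
    proof (intro allI impI)
      fix \<epsilon> :: real assume e: "\<epsilon> > 0"
      have "(\<lambda>i. \<integral>\<omega>. cmod (f \<omega> - s i \<omega>) \<partial>P) \<longlonglongrightarrow> (\<integral>\<omega>. 0 \<partial>P)"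
      \<comment> \<open>The approximants satisfy
        \<open>cmod (s i \<omega>) \<le> 2 * cmod (f \<omega>)\<close>, whence the factor 3 in the
        dominating function.\<close>
      proof (rule integral_dominated_convergence[where w="\<lambda>\<omega>. 3 * cmod (f \<omega>)"])
        show "AE \<omega> in P. (\<lambda>i. cmod (f \<omega> - s i \<omega>)) \<longlonglongrightarrow> 0"
        proof (rule AE_I2)
          fix \<omega> assume "\<omega> \<in> space P"
          then have "(\<lambda>i. f \<omega> - s i \<omega>) \<longlonglongrightarrow> f \<omega> - f \<omega>" using lim by (intro tendsto_diff) auto
          then show "(\<lambda>i. cmod (f \<omega> - s i \<omega>)) \<longlonglongrightarrow> 0" using tendsto_norm_zero by fastforce
        qed
        show "AE \<omega> in P. norm (cmod (f \<omega> - s i \<omega>)) \<le> 3 * cmod (f \<omega>)" for i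
        proof (rule AE_I2)
          fix \<omega> assume "\<omega> \<in> space P"
          then have "cmod (s i \<omega>) \<le> 2 * cmod (f \<omega>)" using lim(3) by auto
          then show "norm (cmod (f \<omega> - s i \<omega>)) \<le> 3 * cmod (f \<omega>)"
            using norm_triangle_ineq4[of "f \<omega>" "s i \<omega>"] by simp
        qed
        show "(\<lambda>\<omega>. cmod (f \<omega> - s i \<omega>)) \<in> borel_measurable P" for i
          by (rule measurable_compose[OF borel_measurable_diff[OF borel_measurable_integrable[OF lim(4)]
                borel_measurable_integrable[OF lim(1)]] borel_measurable_norm])
      qed (use lim in auto)
      then have "\<forall>\<^sub>F i in sequentially. (\<integral>\<omega>. cmod (f \<omega> - s i \<omega>) \<partial>P) < \<epsilon> / 2"
        using e by (intro order_tendstoD(2)) auto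
      then obtain i where i: "(\<integral>\<omega>. cmod (f \<omega> - s i \<omega>) \<partial>P) < \<epsilon> / 2"
        by (auto simp: eventually_sequentially)
      obtain h where h: "cylindrical A h" "(\<integral>\<omega>. cmod (s i \<omega> - h \<omega>) \<partial>P) < \<epsilon> / 2"
        using lim.IH e half_gt_zero by blast
      have "(\<integral>\<omega>. cmod (f \<omega> - h \<omega>) \<partial>P) \<le> (\<integral>\<omega>. cmod (f \<omega> - s i \<omega>) + cmod (s i \<omega> - h \<omega>) \<partial>P)"
      proof (rule integral_mono)
        fix \<omega>
        show "cmod (f \<omega> - h \<omega>) \<le> cmod (f \<omega> - s i \<omega>) + cmod (s i \<omega> - h \<omega>)"
          using norm_triangle_ineq[of "f \<omega> - s i \<omega>" "s i \<omega> - h \<omega>"] by simp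
      qed (use lim ci h in auto)
      also have "\<dots> = (\<integral>\<omega>. cmod (f \<omega> - s i \<omega>) \<partial>P) + (\<integral>\<omega>. cmod (s i \<omega> - h \<omega>) \<partial>P)"
        using lim ci h by (intro Bochner_Integration.integral_add) auto
      finally show "\<exists>h. cylindrical A h \<and> (\<integral>\<omega>. cmod (f \<omega> - h \<omega>) \<partial>P) < \<epsilon>"
        using h i by (intro exI[of _ h] conjI) auto
    qed
  qed
  then show ?thesis using assms(2) by blast
qed

end

section \<open>Riesz products\<close>

lemma clopenin_prod_coordinate:
  assumes "finite F" "F \<subseteq> A"
  shows "clopenin (cube_topology A) {\<omega> \<in> cube A. (\<Prod>\<alpha>\<in>F. \<omega> \<alpha>) = s}"
  using assms
proof (induction F arbitrary: s rule: finite_induct)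
  case empty
  show ?case using clopenin_topspace[of "cube_topology A"] clopenin_empty[of "cube_topology A"]
    by (cases "s = 1") auto
next
  case (insert \<beta> F)
  then have \<beta>: "\<beta> \<in> A" and F: "F \<subseteq> A" by auto
  have "{\<omega> \<in> cube A. (\<Prod>\<alpha>\<in>insert \<beta> F. \<omega> \<alpha>) = s} =
     ({\<omega> \<in> cube A. \<omega> \<beta> = 1} \<inter> {\<omega> \<in> cube A. (\<Prod>\<alpha>\<in>F. \<omega> \<alpha>) = s}) \<union>
     ({\<omega> \<in> cube A. \<omega> \<beta> = -1} \<inter> {\<omega> \<in> cube A. (\<Prod>\<alpha>\<in>F. \<omega> \<alpha>) = - s})" (is "?L = ?R")
  proof (rule set_eqI)
    fix \<omega>
    show "\<omega> \<in> ?L \<longleftrightarrow> \<omega> \<in> ?R"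
    proof (cases "\<omega> \<in> cube A")
      case True
      then show ?thesis using cube_values[OF True \<beta>] insert.hyps by (auto simp: minus_equation_iff)
    qed simp
  qed
  moreover have "clopenin (cube_topology A) ?R"
    using clopenin_coordinate[OF \<beta>] insert.IH[OF F] by (intro clopenin_Un clopenin_Int)
  ultimately show ?case by simp
qed

text \<open>The odd part of \<open>\<Prod>(1 + \<i> z r)\<close>, divided by \<open>\<i>\<close>, has these Walsh coefficients.\<close>

definition odd_sign :: "nat \<Rightarrow> real"
  where "odd_sign k = Im (\<i> ^ k)"

lemma odd_sign_even: "even k \<Longrightarrow> odd_sign k = 0"
  by (auto simp: odd_sign_def elim!: evenE)

context haar_cube
begin

lemma finite_product_measurable:
  "B \<subseteq> A \<Longrightarrow> (\<lambda>\<omega>. \<Prod>\<alpha>\<in>B. 1 + a \<alpha> * \<omega> \<alpha> :: complex) \<in> borel_measurable (cube_borel A)"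
  by (intro borel_measurable_prod borel_measurable_add borel_measurable_times coordinate_measurable) auto

lemma finite_product_bound:
  assumes "\<omega> \<in> cube A" "B \<subseteq> A"
  shows "cmod (\<Prod>\<alpha>\<in>B. 1 + a \<alpha> * \<omega> \<alpha>) \<le> (\<Prod>\<alpha>\<in>B. 1 + cmod (a \<alpha>))"
  unfolding prod_norm[symmetric]
proof (rule prod_mono)
  fix \<alpha> assume "\<alpha> \<in> B"
  then have "\<alpha> \<in> A" using assms by auto
  then have "cmod (\<omega> \<alpha>) = 1" using cube_values[OF assms(1), of \<alpha>] by auto
  then show "0 \<le> cmod (1 + a \<alpha> * \<omega> \<alpha>) \<and> cmod (1 + a \<alpha> * \<omega> \<alpha>) \<le> 1 + cmod (a \<alpha>)"
    using norm_triangle_ineq[of 1 "a \<alpha> * \<omega> \<alpha>"] by (simp add: norm_mult)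
qed

lemma finite_product_integrable:
  fixes h :: "_ \<Rightarrow> complex"
  assumes "B \<subseteq> A" "cylindrical A h"
  shows "integrable P (\<lambda>\<omega>. (\<Prod>\<alpha>\<in>B. 1 + a \<alpha> * \<omega> \<alpha>) * h \<omega>)"
proof -
  obtain C where C: "\<And>\<omega>. \<omega> \<in> cube A \<Longrightarrow> cmod (h \<omega>) \<le> C"
    using cylindrical_measurable(2)[OF assms(2)] by blast
  show ?thesis
  proof (rule bounded_integrable[where C="(\<Prod>\<alpha>\<in>B. 1 + cmod (a \<alpha>)) * C"])
    show "(\<lambda>\<omega>. (\<Prod>\<alpha>\<in>B. 1 + a \<alpha> * \<omega> \<alpha>) * h \<omega>) \<in> borel_measurable (cube_borel A)"
      using finite_product_measurable[OF assms(1)] cylindrical_measurable(1)[OF assms(2)]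
      by (rule borel_measurable_times)
    show "cmod ((\<Prod>\<alpha>\<in>B. 1 + a \<alpha> * \<omega> \<alpha>) * h \<omega>) \<le> (\<Prod>\<alpha>\<in>B. 1 + cmod (a \<alpha>)) * C" if "\<omega> \<in> cube A" for \<omega>
      unfolding norm_mult
      by (intro mult_mono finite_product_bound assms that C prod_nonneg) auto
  qed
qed

lemma cylindrical_walsh:
  assumes "finite F" "F \<subseteq> A" shows "cylindrical A (\<lambda>\<omega>. \<Prod>\<alpha>\<in>F. \<omega> \<alpha> :: complex)"
  unfolding cylindrical_def
proof (intro exI[of _ F] conjI assms ballI impI)
  fix \<omega> \<omega>' :: "'a \<Rightarrow> complex" assume "\<forall>\<alpha>\<in>F. \<omega> \<alpha> = \<omega>' \<alpha>"
  then show "prod \<omega> F = prod \<omega>' F" by (intro prod.cong) auto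
qed

text \<open>The Walsh expansion of \<open>h\<close> involves only subsets of a finite set
  \<open>F\<close>, so the integral is constant as soon as \<open>B\<close> contains
  \<open>F\<close>.\<close>

lemma finite_product_integral_tendsto:
  fixes h :: "_ \<Rightarrow> complex"
  assumes "cylindrical A h"
  shows "\<exists>v. ((\<lambda>B. \<integral>\<omega>. (\<Prod>\<alpha>\<in>B. 1 + a \<alpha> * \<omega> \<alpha>) * h \<omega> \<partial>P) \<longlongrightarrow> v) (finite_subsets_at_top A)"
proof -
  obtain F c where F: "finite F" "F \<subseteq> A"
    and h: "\<And>\<omega>. \<omega> \<in> cube A \<Longrightarrow> h \<omega> = (\<Sum>G\<in>Pow F. c G * (\<Prod>\<alpha>\<in>G. \<omega> \<alpha>))"
    using cylindrical_walsh_expansion[OF assms] by metis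
  have "(\<integral>\<omega>. (\<Prod>\<alpha>\<in>B. 1 + a \<alpha> * \<omega> \<alpha>) * h \<omega> \<partial>P) = (\<Sum>G\<in>Pow F. c G * (\<Prod>\<alpha>\<in>G. a \<alpha>))"
    if B: "finite B" "F \<subseteq> B" "B \<subseteq> A" for B
  proof -
    have "(\<integral>\<omega>. (\<Prod>\<alpha>\<in>B. 1 + a \<alpha> * \<omega> \<alpha>) * h \<omega> \<partial>P)
      = (\<integral>\<omega>. (\<Sum>G\<in>Pow F. c G * ((\<Prod>\<alpha>\<in>B. 1 + a \<alpha> * \<omega> \<alpha>) * (\<Prod>\<alpha>\<in>G. \<omega> \<alpha>))) \<partial>P)"
      by (intro Bochner_Integration.integral_cong refl) (simp add: h sum_distrib_left mult.left_commute)
    also have "\<dots> = (\<Sum>G\<in>Pow F. c G * (\<integral>\<omega>. (\<Prod>\<alpha>\<in>B. 1 + a \<alpha> * \<omega> \<alpha>) * (\<Prod>\<alpha>\<in>G. \<omega> \<alpha>) \<partial>P))"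
    proof (subst Bochner_Integration.integral_sum)
      fix G assume "G \<in> Pow F"
      then have "finite G" "G \<subseteq> A" using F finite_subset by auto
      then show "integrable P (\<lambda>\<omega>. c G * ((\<Prod>\<alpha>\<in>B. 1 + a \<alpha> * \<omega> \<alpha>) * (\<Prod>\<alpha>\<in>G. \<omega> \<alpha>)))"
        by (intro integrable_mult_right finite_product_integrable B cylindrical_walsh)
    qed simp
    also have "\<dots> = (\<Sum>G\<in>Pow F. c G * (\<Prod>\<alpha>\<in>G. a \<alpha>))"
    proof (intro sum.cong refl)
      fix G assume "G \<in> Pow F"
      then have "finite G" "G \<subseteq> A" "G \<subseteq> B" using F B finite_subset by auto
      then show "c G * (\<integral>\<omega>. (\<Prod>\<alpha>\<in>B. 1 + a \<alpha> * \<omega> \<alpha>) * (\<Prod>\<alpha>\<in>G. \<omega> \<alpha>) \<partial>P) = c G * (\<Prod>\<alpha>\<in>G. a \<alpha>)"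
        using integral_finite_product[OF B(1,3), of G a] by simp
    qed
    finally show ?thesis .
  qed
  then have "\<forall>\<^sub>F B in finite_subsets_at_top A. (\<integral>\<omega>. (\<Prod>\<alpha>\<in>B. 1 + a \<alpha> * \<omega> \<alpha>) * h \<omega> \<partial>P) = (\<Sum>G\<in>Pow F. c G * (\<Prod>\<alpha>\<in>G. a \<alpha>))"
    using F by (intro eventually_finite_subsets_at_top[THEN iffD2]) auto
  then show ?thesis by (intro exI tendsto_eventually)
qed

text \<open>The Riesz product with real coefficients \<open>z\<close> is the regular measure whose values on clopen
  sets are the eventually constant limits of those of the finite products.\<close>

lemma riesz_measure_exists:
  fixes z :: "'a \<Rightarrow> real"
  assumes z: "\<And>\<alpha>. \<alpha> \<in> A \<Longrightarrow> \<bar>z \<alpha>\<bar> \<le> 1"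
  shows "\<exists>M. sets M = sets (cube_borel A) \<and> finite_measure M \<and> measure M (cube A) = 1 \<and>
    regular_set_function (cube_topology A) (sets M) (measure M) \<and>
    (\<forall>F. finite F \<and> F \<subseteq> A \<longrightarrow> (\<integral>\<omega>. (\<Prod>\<alpha>\<in>F. \<omega> \<alpha>) \<partial>M) = complex_of_real (\<Prod>\<alpha>\<in>F. z \<alpha>))"
proof -
  define I where "I h B = (\<integral>\<omega>. (\<Prod>\<alpha>\<in>B. 1 + complex_of_real (z \<alpha>) * \<omega> \<alpha>) * h \<omega> \<partial>P)" for h B
  \<comment> \<open>\<open>V\<close> plays the role of the integral against the infinite product,
    available so far for cylindrical functions only.\<close>
  define V where "V h = Lim (finite_subsets_at_top A) (I h)" for h
  have V: "(I h \<longlongrightarrow> V h) (finite_subsets_at_top A)" if h: "cylindrical A h" for h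
  proof -
    obtain v where "(I h \<longlongrightarrow> v) (finite_subsets_at_top A)"
      using finite_product_integral_tendsto[OF h, of "\<lambda>\<alpha>. complex_of_real (z \<alpha>)"] by (auto simp: I_def[abs_def])
    moreover from this have "V h = v"
      unfolding V_def by (rule tendsto_Lim[OF finite_subsets_at_top_neq_bot])
    ultimately show ?thesis by simp
  qed
  have ev: "\<forall>\<^sub>F B in finite_subsets_at_top A. finite B \<and> B \<subseteq> A"
    by (rule eventually_finite_subsets_at_top_weakI) auto
  have Vadd: "V (\<lambda>\<omega>. g \<omega> + h \<omega>) = V g + V h" if gh: "cylindrical A g" "cylindrical A h" for g h
  proof (rule tendsto_unique[OF finite_subsets_at_top_neq_bot V[OF cylindrical_add[OF gh]]])
    have "\<forall>\<^sub>F B in finite_subsets_at_top A. I g B + I h B = I (\<lambda>\<omega>. g \<omega> + h \<omega>) B"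
      using ev
    proof eventually_elim
      case (elim B)
      then show ?case unfolding I_def
        using finite_product_integrable[OF _ gh(1), of B] finite_product_integrable[OF _ gh(2), of B]
        by (simp add: distrib_left)
    qed
    then show "(I (\<lambda>\<omega>. g \<omega> + h \<omega>) \<longlongrightarrow> V g + V h) (finite_subsets_at_top A)"
      by (rule Lim_transform_eventually[OF tendsto_add[OF V[OF gh(1)] V[OF gh(2)]]])
  qed
  have Vmult: "V (\<lambda>\<omega>. c * h \<omega>) = c * V h" if h: "cylindrical A h" for c h
  proof (rule tendsto_unique[OF finite_subsets_at_top_neq_bot V[OF cylindrical_mult[OF h]]])
    have "I (\<lambda>\<omega>. c * h \<omega>) = (\<lambda>B. c * I h B)"
      unfolding I_def by (simp add: mult.left_commute)
    then show "(I (\<lambda>\<omega>. c * h \<omega>) \<longlongrightarrow> c * V h) (finite_subsets_at_top A)"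
      using tendsto_mult_left[OF V[OF h]] by simp
  qed
  have Vwalsh: "V (\<lambda>\<omega>. \<Prod>\<alpha>\<in>F. \<omega> \<alpha>) = (\<Prod>\<alpha>\<in>F. z \<alpha>)" if F: "finite F" "F \<subseteq> A" for F
  proof (rule tendsto_unique[OF finite_subsets_at_top_neq_bot V[OF cylindrical_walsh[OF F]]])
    have "\<forall>\<^sub>F B in finite_subsets_at_top A. I (\<lambda>\<omega>. \<Prod>\<alpha>\<in>F. \<omega> \<alpha>) B = (\<Prod>\<alpha>\<in>F. z \<alpha>)"
      using F integral_finite_product[of _ F "\<lambda>\<alpha>. complex_of_real (z \<alpha>)"]
      by (intro eventually_finite_subsets_at_top[THEN iffD2] exI[of _ F]) (auto simp: I_def)
    then show "(I (\<lambda>\<omega>. \<Prod>\<alpha>\<in>F. \<omega> \<alpha>) \<longlongrightarrow> (\<Prod>\<alpha>\<in>F. z \<alpha>)) (finite_subsets_at_top A)"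
      by (rule tendsto_eventually)
  qed
  define L where "L C = Re (V (indicator C))" for C
  interpret content: clopen_content "cube_topology A" L
  proof
    show "compact_space (cube_topology A)" by (rule compact_cube)
    show "\<exists>C. clopenin (cube_topology A) C \<and> \<omega> \<in> C \<and> C \<subseteq> U"
      if U: "openin (cube_topology A) U" "\<omega> \<in> U" for U \<omega>
    proof -
      obtain F where "finite F" "F \<subseteq> A" "cyl A F \<omega> \<subseteq> U" using cyl_base[OF U] by metis
      moreover have "\<omega> \<in> cube A" using openin_subset[OF U(1)] U(2) by auto
      ultimately show ?thesis using clopenin_cyl mem_cyl_self by metis
    qed
    show "0 \<le> L C" if C: "clopenin (cube_topology A) C" for C
      unfolding L_def
    proof (rule tendsto_lowerbound[OF tendsto_Re[OF V[OF clopenin_cylindrical[OF C]]] _ finite_subsets_at_top_neq_bot])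
      show "\<forall>\<^sub>F B in finite_subsets_at_top A. 0 \<le> Re (I (indicator C) B)"
        using ev
      proof eventually_elim
        case (elim B)
        have "Re (I (indicator C) B) = (\<integral>\<omega>. Re ((\<Prod>\<alpha>\<in>B. 1 + complex_of_real (z \<alpha>) * \<omega> \<alpha>) * indicator C \<omega>) \<partial>P)"
          unfolding I_def using elim
          by (intro integral_Re[symmetric] finite_product_integrable clopenin_cylindrical C) auto
        also have "\<dots> \<ge> 0"
        proof (rule Bochner_Integration.integral_nonneg)
          fix \<omega> show "0 \<le> Re ((\<Prod>\<alpha>\<in>B. 1 + complex_of_real (z \<alpha>) * \<omega> \<alpha>) * indicator C \<omega>)"
          proof (cases "\<omega> \<in> C")
            case True
            then have \<omega>: "\<omega> \<in> cube A" using C openin_subset[of "cube_topology A" C] by (auto simp: clopenin_def)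
            have "(\<Prod>\<alpha>\<in>B. 1 + complex_of_real (z \<alpha>) * \<omega> \<alpha>) = complex_of_real (\<Prod>\<alpha>\<in>B. 1 + z \<alpha> * Re (\<omega> \<alpha>))"
              unfolding of_real_prod
            proof (rule prod.cong[OF refl])
              fix \<alpha> assume "\<alpha> \<in> B"
              then have "\<omega> \<alpha> = 1 \<or> \<omega> \<alpha> = -1" using elim cube_values[OF \<omega>, of \<alpha>] by auto
              then show "1 + complex_of_real (z \<alpha>) * \<omega> \<alpha> = complex_of_real (1 + z \<alpha> * Re (\<omega> \<alpha>))" by auto
            qed
            \<comment> \<open>Positivity of the Riesz product: every factor is
              \<open>1 + z \<alpha>\<close> or \<open>1 - z \<alpha>\<close>, nonnegative because
              the coefficients have modulus at most 1.\<close>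
            moreover have "0 \<le> (\<Prod>\<alpha>\<in>B. 1 + z \<alpha> * Re (\<omega> \<alpha>))"
            proof (rule prod_nonneg)
              fix \<alpha> assume "\<alpha> \<in> B"
              then have "\<alpha> \<in> A" using elim by auto
              then show "0 \<le> 1 + z \<alpha> * Re (\<omega> \<alpha>)" using cube_values[OF \<omega>, of \<alpha>] z[of \<alpha>] by auto
            qed
            ultimately show ?thesis using True by (simp del: of_real_prod)
          qed simp
        qed
        finally show ?case .
      qed
    qed
    show "L (C \<union> D) = L C + L D"
      if CD: "clopenin (cube_topology A) C" "clopenin (cube_topology A) D" "C \<inter> D = {}" for C D
    proof -
      have "(indicator (C \<union> D) :: _ \<Rightarrow> complex) = (\<lambda>\<omega>. indicator C \<omega> + indicator D \<omega>)"
        using CD(3) by (intro ext) (auto simp: indicator_def)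
      then show ?thesis
        using Vadd[OF clopenin_cylindrical[OF CD(1)] clopenin_cylindrical[OF CD(2)]] by (simp add: L_def)
    qed
  qed
  obtain M where M: "space M = topspace (cube_topology A)"
    "sets M = sigma_sets (topspace (cube_topology A)) {U. openin (cube_topology A) U}"
    "finite_measure M" "\<And>C. clopenin (cube_topology A) C \<Longrightarrow> measure M C = L C"
    "regular_set_function (cube_topology A) (sets M) (measure M)"
    using content.regular_measure_extension by metis
  have sM: "sets M = sets (cube_borel A)" using M(2) by (simp add: sets_cube_borel)
  interpret M: finite_measure M by fact
  have w: "(\<integral>\<omega>. (\<Prod>\<alpha>\<in>F. \<omega> \<alpha>) \<partial>M) = complex_of_real (\<Prod>\<alpha>\<in>F. z \<alpha>)" if F: "finite F" "F \<subseteq> A" for F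
  proof -
    define E where "E s = {\<omega> \<in> cube A. (\<Prod>\<alpha>\<in>F. \<omega> \<alpha>) = s}" for s :: complex
    have Ec: "clopenin (cube_topology A) (E s)" for s
      unfolding E_def by (rule clopenin_prod_coordinate[OF F])
    have E: "E s \<in> sets M" for s
      using Ec[of s] openin_sets_cube sM by (auto simp: clopenin_def)
    \<comment> \<open>The character is a combination of two indicators of clopen sets, on which the
      values of the new measure are known; linearity of \<open>V\<close> then transfers its value on
      the character to the integral.\<close>
    have dec: "(\<Prod>\<alpha>\<in>F. \<omega> \<alpha>) = indicator (E 1) \<omega> + (-1) * indicator (E (-1)) \<omega>" if "\<omega> \<in> cube A" for \<omega>
      using prod_coordinate_values[OF that F] that by (auto simp: E_def indicator_def)
    have "(\<integral>\<omega>. (\<Prod>\<alpha>\<in>F. \<omega> \<alpha>) \<partial>M) = (\<integral>\<omega>. complex_of_real (indicator (E 1) \<omega> - indicator (E (-1)) \<omega>) \<partial>M)"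
      by (intro Bochner_Integration.integral_cong refl) (use dec M(1) in \<open>auto simp: of_real_indicator\<close>)
    also have "\<dots> = complex_of_real (\<integral>\<omega>. indicator (E 1) \<omega> - indicator (E (-1)) \<omega> \<partial>M)"
      by (rule integral_complex_of_real)
    also have "(\<integral>\<omega>. indicator (E 1) \<omega> - indicator (E (-1)) \<omega> \<partial>M) = measure M (E 1) - measure M (E (-1))"
      using E M.emeasure_finite sets.sets_into_space[OF E, of 1] sets.sets_into_space[OF E, of "-1"]
      by (subst Bochner_Integration.integral_diff) (auto simp: Int_absorb2 less_top[symmetric])
    also have "\<dots> = L (E 1) - L (E (-1))" using M(4) Ec by simp
    also have "\<dots> = Re (V (\<lambda>\<omega>. indicator (E 1) \<omega> + (-1) * indicator (E (-1)) \<omega>))"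
      unfolding Vadd[OF clopenin_cylindrical[OF Ec] cylindrical_mult[OF clopenin_cylindrical[OF Ec]]]
        Vmult[OF clopenin_cylindrical[OF Ec]] by (simp add: L_def)
    also have "V (\<lambda>\<omega>. indicator (E 1) \<omega> + (-1) * indicator (E (-1)) \<omega>) = V (\<lambda>\<omega>. \<Prod>\<alpha>\<in>F. \<omega> \<alpha>)"
      unfolding V_def I_def
      by (intro arg_cong[where f="Lim _"] ext Bochner_Integration.integral_cong refl) (use dec in simp)
    also have "\<dots> = (\<Prod>\<alpha>\<in>F. z \<alpha>)" by (rule Vwalsh[OF F])
    finally show ?thesis by simp
  qed
  have one: "measure M (cube A) = 1"
    using w[of "{}"] M(1) by (simp add: scaleR_conv_of_real)
  show ?thesis using sM M(3,5) one w by blast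
qed

section \<open>Bounded functions from products with imaginary coefficients\<close>

text \<open>A coordinate takes the values 1 and -1, and for real z both \<open>1 + \<i> * z\<close>
  and \<open>1 - \<i> * z\<close> have squared modulus 1 + z^2. The product therefore has constant
  modulus, under control as soon as the coefficients are square summable.\<close>

lemma norm_imaginary_product:
  fixes z :: "'a \<Rightarrow> real"
  assumes "\<omega> \<in> cube A" "B \<subseteq> A"
  shows "(cmod (\<Prod>\<alpha>\<in>B. 1 + \<i> * complex_of_real (z \<alpha>) * \<omega> \<alpha>))\<^sup>2 = (\<Prod>\<alpha>\<in>B. 1 + (z \<alpha>)\<^sup>2)"
  unfolding prod_norm[symmetric] prod_power_distrib
proof (rule prod.cong[OF refl])
  fix \<alpha> assume "\<alpha> \<in> B"
  then have "\<alpha> \<in> A" using assms by auto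
  then show "(cmod (1 + \<i> * complex_of_real (z \<alpha>) * \<omega> \<alpha>))\<^sup>2 = 1 + (z \<alpha>)\<^sup>2"
    using cube_values[OF assms(1), of \<alpha>] by (auto simp: cmod_def)
qed

lemma prod_one_plus_le_exp:
  fixes t :: "'a \<Rightarrow> real"
  assumes "\<And>\<alpha>. \<alpha> \<in> B \<Longrightarrow> 0 \<le> t \<alpha>"
  shows "(\<Prod>\<alpha>\<in>B. 1 + t \<alpha>) \<le> exp (\<Sum>\<alpha>\<in>B. t \<alpha>)"
proof (cases "finite B")
  case True
  then show ?thesis unfolding exp_sum[OF True]
    by (intro prod_mono) (use assms exp_ge_add_one_self in \<open>auto simp: add_nonneg_nonneg\<close>)
qed simp

text \<open>The product has integral 1 and constant squared modulus \<open>K\<close>, so its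
  distance from 1 has second moment \<open>K - 1\<close>. The elementary inequality 2t \<le>
  \<epsilon> + t^2 / \<epsilon>, with \<epsilon> left free, passes from there to the first moment in
  the manner of the Cauchy-Schwarz inequality.\<close>

lemma integral_imaginary_product_minus_one:
  fixes z :: "'a \<Rightarrow> real"
  assumes B: "finite B" "B \<subseteq> A" and s: "(\<Sum>\<alpha>\<in>B. (z \<alpha>)\<^sup>2) \<le> s" and e: "0 < \<epsilon>"
  shows "(\<integral>\<omega>. cmod ((\<Prod>\<alpha>\<in>B. 1 + \<i> * complex_of_real (z \<alpha>) * \<omega> \<alpha>) - 1) \<partial>P) \<le> \<epsilon> / 2 + (exp s - 1) / (2 * \<epsilon>)"
proof -
  define g where "g \<omega> = (\<Prod>\<alpha>\<in>B. 1 + \<i> * complex_of_real (z \<alpha>) * \<omega> \<alpha>)" for \<omega>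
  define K where "K = (\<Prod>\<alpha>\<in>B. 1 + (z \<alpha>)\<^sup>2)"
  have gm: "g \<in> borel_measurable (cube_borel A)"
    unfolding g_def by (rule finite_product_measurable[OF B(2)])
  have g2: "(cmod (g \<omega>))\<^sup>2 = K" if "\<omega> \<in> cube A" for \<omega>
    unfolding g_def K_def by (rule norm_imaginary_product[OF that B(2)])
  have gb: "cmod (g \<omega>) \<le> sqrt K" if "\<omega> \<in> cube A" for \<omega>
    using g2[OF that] by (metis norm_ge_zero order_refl real_sqrt_abs abs_of_nonneg)
  have ig: "integrable P g" using gm gb by (rule bounded_integrable)
  have "(\<integral>\<omega>. g \<omega> * (\<Prod>\<alpha>\<in>{}. \<omega> \<alpha>) \<partial>P) = 1"
    using integral_finite_product[OF B, of "{}"] unfolding g_def by simp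
  then have ig1: "(\<integral>\<omega>. Re (g \<omega>) \<partial>P) = 1" using ig by simp
  have sq: "(cmod (g \<omega> - 1))\<^sup>2 = K + 1 - 2 * Re (g \<omega>)" if "\<omega> \<in> cube A" for \<omega>
    using g2[OF that] unfolding cmod_power2 by (simp add: power2_eq_square algebra_simps)
  have "(\<integral>\<omega>. cmod (g \<omega> - 1) \<partial>P) \<le> (\<integral>\<omega>. \<epsilon> / 2 + (K + 1 - 2 * Re (g \<omega>)) / (2 * \<epsilon>) \<partial>P)"
  proof (rule integral_mono)
    fix \<omega> assume "\<omega> \<in> space P"
    then have \<omega>: "\<omega> \<in> cube A" by simp
    have "0 \<le> (cmod (g \<omega> - 1) - \<epsilon>)\<^sup>2" by simp
    then have "2 * \<epsilon> * cmod (g \<omega> - 1) \<le> \<epsilon>\<^sup>2 + (cmod (g \<omega> - 1))\<^sup>2"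
      by (simp add: power2_eq_square algebra_simps)
    then show "cmod (g \<omega> - 1) \<le> \<epsilon> / 2 + (K + 1 - 2 * Re (g \<omega>)) / (2 * \<epsilon>)"
      unfolding sq[OF \<omega>, symmetric] using e by (simp add: field_simps power2_eq_square)
  qed (use ig in auto)
  also have "\<dots> = \<epsilon> / 2 + (K - 1) / (2 * \<epsilon>)"
  proof -
    have "(\<integral>\<omega>. \<epsilon> / 2 + (K + 1 - 2 * Re (g \<omega>)) / (2 * \<epsilon>) \<partial>P)
      = (\<integral>\<omega>. (\<epsilon> / 2 + (K + 1) / (2 * \<epsilon>)) - (1 / \<epsilon>) * Re (g \<omega>) \<partial>P)"
      using e by (intro Bochner_Integration.integral_cong refl) (simp add: field_simps)
    also have "\<dots> = (\<epsilon> / 2 + (K + 1) / (2 * \<epsilon>)) - 1 / \<epsilon>"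
      using ig ig1 prob_space by (subst Bochner_Integration.integral_diff) auto
    finally show ?thesis using e by (simp only:) (simp add: field_simps)
  qed
  also have "K \<le> exp s"
  proof -
    have "K \<le> exp (\<Sum>\<alpha>\<in>B. (z \<alpha>)\<^sup>2)" unfolding K_def by (rule prod_one_plus_le_exp) simp
    then show ?thesis using s by (meson exp_le_cancel_iff order_trans)
  qed
  then have "\<epsilon> / 2 + (K - 1) / (2 * \<epsilon>) \<le> \<epsilon> / 2 + (exp s - 1) / (2 * \<epsilon>)"
    using e by (intro add_left_mono divide_right_mono) auto
  finally show ?thesis unfolding g_def .
qed

text \<open>The increment is the product over \<open>B\<close>, which is bounded, times the
  deviation from 1 of the product over \<open>C - B\<close>, which is small in the mean when the
  squares over \<open>C - B\<close> have a small sum.\<close>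

lemma imaginary_product_cauchy:
  fixes z :: "'a \<Rightarrow> real"
  assumes z: "\<And>B. finite B \<Longrightarrow> B \<subseteq> A \<Longrightarrow> (\<Sum>\<alpha>\<in>B. (z \<alpha>)\<^sup>2) \<le> 1"
  defines "g \<equiv> \<lambda>B \<omega>. \<Prod>\<alpha>\<in>B. 1 + \<i> * complex_of_real (z \<alpha>) * \<omega> \<alpha>"
  assumes BC: "finite C" "C \<subseteq> A" "B \<subseteq> C" and s: "(\<Sum>\<alpha>\<in>C - B. (z \<alpha>)\<^sup>2) \<le> s" and e: "0 < \<epsilon>"
  shows "(\<integral>\<omega>. cmod (g C \<omega> - g B \<omega>) \<partial>P) \<le> exp 1 * (\<epsilon> / 2 + (exp s - 1) / (2 * \<epsilon>))"
proof -
  have fB: "finite B" "B \<subseteq> A" using BC finite_subset by auto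
  have fD: "finite (C - B)" "C - B \<subseteq> A" using BC by auto
  have gm: "g D \<in> borel_measurable (cube_borel A)" if "D \<subseteq> A" for D
    unfolding g_def by (rule finite_product_measurable[OF that])
  have split: "g C \<omega> = g B \<omega> * g (C - B) \<omega>" for \<omega>
    unfolding g_def using prod.subset_diff[OF BC(3,1)] by (simp add: mult.commute)
  have gb: "cmod (g D \<omega>) \<le> exp 1" if "\<omega> \<in> cube A" "finite D" "D \<subseteq> A" for \<omega> D
  proof -
    have "(cmod (g D \<omega>))\<^sup>2 \<le> exp (\<Sum>\<alpha>\<in>D. (z \<alpha>)\<^sup>2)"
      unfolding g_def norm_imaginary_product[OF that(1,3)] by (rule prod_one_plus_le_exp) simp
    also have "\<dots> \<le> exp 1" using z[OF that(2,3)] by simp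
    \<comment> \<open>The cruder bound \<open>exp 1\<close> in place of its square root is enough,
      as only the smallness of increments matters here.\<close>
    also have "\<dots> \<le> (exp 1)\<^sup>2" by (simp add: power2_eq_square flip: exp_add)
    finally show ?thesis by (rule power2_le_imp_le) simp
  qed
  have "(\<integral>\<omega>. cmod (g C \<omega> - g B \<omega>) \<partial>P) \<le> (\<integral>\<omega>. exp 1 * cmod (g (C - B) \<omega> - 1) \<partial>P)"
  proof (rule integral_mono)
    fix \<omega> assume "\<omega> \<in> space P"
    then have \<omega>: "\<omega> \<in> cube A" by simp
    have "g C \<omega> - g B \<omega> = g B \<omega> * (g (C - B) \<omega> - 1)" by (simp add: split algebra_simps)
    then show "cmod (g C \<omega> - g B \<omega>) \<le> exp 1 * cmod (g (C - B) \<omega> - 1)"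
      using gb[OF \<omega> fB] by (simp add: norm_mult mult_right_mono)
  next
    have i: "integrable P (g D)" if "finite D" "D \<subseteq> A" for D
      by (rule bounded_integrable[OF gm[OF that(2)] gb[OF _ that]])
    show "integrable P (\<lambda>\<omega>. cmod (g C \<omega> - g B \<omega>))"
      using i[OF BC(1,2)] i[OF fB] by simp
    show "integrable P (\<lambda>\<omega>. exp 1 * cmod (g (C - B) \<omega> - 1))"
      using i[OF fD] by simp
  qed
  also have "\<dots> = exp 1 * (\<integral>\<omega>. cmod (g (C - B) \<omega> - 1) \<partial>P)" by simp
  also have "\<dots> \<le> exp 1 * (\<epsilon> / 2 + (exp s - 1) / (2 * \<epsilon>))"
    unfolding g_def by (intro mult_left_mono integral_imaginary_product_minus_one fD s e) simp
  finally show ?thesis .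
qed

text \<open>A finite set whose sum nearly attains the supremum leaves little for any finite set
  disjoint from it. The sequence takes the place of the net of all finite subsets of a possibly
  uncountable \<open>A\<close>, because almost everywhere convergence is extracted along sequences.
  Its union contains every point where \<open>t\<close> is positive on \<open>A\<close>.\<close>

lemma exhausting_finite_sets:
  fixes t :: "'a \<Rightarrow> real"
  assumes t0: "\<And>\<alpha>. 0 \<le> t \<alpha>" and t: "\<And>B. finite B \<Longrightarrow> B \<subseteq> A \<Longrightarrow> (\<Sum>\<alpha>\<in>B. t \<alpha>) \<le> 1"
  obtains X :: "nat \<Rightarrow> 'a set" where "incseq X" "\<And>n. finite (X n)" "\<And>n. X n \<subseteq> A"
    "\<And>n C. finite C \<Longrightarrow> C \<subseteq> A \<Longrightarrow> C \<inter> X n = {} \<Longrightarrow> (\<Sum>\<alpha>\<in>C. t \<alpha>) \<le> 1 / real (Suc n)"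
proof -
  define S where "S = (SUP B\<in>{B. finite B \<and> B \<subseteq> A}. \<Sum>\<alpha>\<in>B. t \<alpha>)"
  have bdd: "bdd_above ((\<lambda>B. \<Sum>\<alpha>\<in>B. t \<alpha>) ` {B. finite B \<and> B \<subseteq> A})"
    using t by (intro bdd_aboveI[of _ 1]) auto
  have le: "(\<Sum>\<alpha>\<in>B. t \<alpha>) \<le> S" if "finite B" "B \<subseteq> A" for B
    unfolding S_def using that by (intro cSUP_upper bdd) auto
  have "\<exists>B. finite B \<and> B \<subseteq> A \<and> S - 1 / real (Suc n) < (\<Sum>\<alpha>\<in>B. t \<alpha>)" for n
  proof -
    have "S - 1 / real (Suc n) < S" by simp
    then show ?thesis unfolding S_def using bdd by (subst (asm) less_cSUP_iff) auto
  qed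
  then obtain Y where Y: "\<And>n. finite (Y n)" "\<And>n. Y n \<subseteq> A" "\<And>n. S - 1 / real (Suc n) < (\<Sum>\<alpha>\<in>Y n. t \<alpha>)"
    by metis
  show ?thesis
  proof (rule that[of "\<lambda>n. \<Union>k\<le>n. Y k"])
    show "incseq (\<lambda>n. \<Union>k\<le>n. Y k)" by (rule incseq_SucI) (auto intro: order_trans[OF _ le_SucI])
    fix n C assume C: "finite C" "C \<subseteq> A" "C \<inter> (\<Union>k\<le>n. Y k) = {}"
    then have "(\<Sum>\<alpha>\<in>C. t \<alpha>) + (\<Sum>\<alpha>\<in>Y n. t \<alpha>) = (\<Sum>\<alpha>\<in>C \<union> Y n. t \<alpha>)"
      using Y by (intro sum.union_disjoint[symmetric]) auto
    also have "\<dots> \<le> S" using C Y by (intro le) auto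
    finally show "(\<Sum>\<alpha>\<in>C. t \<alpha>) \<le> 1 / real (Suc n)" using Y(3)[of n] by simp
  qed (use Y in auto)
qed

text \<open>The products over the sets \<open>X n\<close> form a Cauchy sequence in L1, a
  subsequence converges almost everywhere, and \<open>f\<close> is the imaginary part of the limit.
  The coefficient on \<open>F\<close> is \<open>\<i> ^ card F\<close> times a real product, so
  taking imaginary parts retains exactly the odd sets, with sign \<open>odd_sign\<close>.\<close>

lemma imaginary_product_function_exists:
  fixes z :: "'a \<Rightarrow> real"
  assumes z: "\<And>B. finite B \<Longrightarrow> B \<subseteq> A \<Longrightarrow> (\<Sum>\<alpha>\<in>B. (z \<alpha>)\<^sup>2) \<le> 1"
  shows "\<exists>f. f \<in> borel_measurable (cube_borel A) \<and> (\<forall>\<omega>. \<bar>f \<omega>\<bar> \<le> sqrt (exp 1)) \<and>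
    (\<forall>F. finite F \<and> F \<subseteq> A \<longrightarrow> (\<integral>\<omega>. complex_of_real (f \<omega>) * (\<Prod>\<alpha>\<in>F. \<omega> \<alpha>) \<partial>P)
      = complex_of_real (odd_sign (card F) * (\<Prod>\<alpha>\<in>F. z \<alpha>)))"
proof -
  define g where "g = (\<lambda>B \<omega>. \<Prod>\<alpha>\<in>B. 1 + \<i> * complex_of_real (z \<alpha>) * \<omega> \<alpha>)"
  obtain X :: "nat \<Rightarrow> 'a set" where X: "incseq X" "\<And>n. finite (X n)" "\<And>n. X n \<subseteq> A"
    and Xs: "\<And>n C. finite C \<Longrightarrow> C \<subseteq> A \<Longrightarrow> C \<inter> X n = {} \<Longrightarrow> (\<Sum>\<alpha>\<in>C. (z \<alpha>)\<^sup>2) \<le> 1 / real (Suc n)"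
    using exhausting_finite_sets[of "\<lambda>\<alpha>. (z \<alpha>)\<^sup>2"] z by (metis zero_le_power2)
  have gm: "g B \<in> borel_measurable (cube_borel A)" if "B \<subseteq> A" for B
    unfolding g_def by (rule finite_product_measurable[OF that])
  have gb: "cmod (g B \<omega>) \<le> sqrt (exp 1)" if "\<omega> \<in> cube A" "finite B" "B \<subseteq> A" for \<omega> B
  proof (rule real_le_rsqrt)
    have "(cmod (g B \<omega>))\<^sup>2 \<le> exp (\<Sum>\<alpha>\<in>B. (z \<alpha>)\<^sup>2)"
      unfolding g_def norm_imaginary_product[OF that(1,3)] by (rule prod_one_plus_le_exp) simp
    also have "\<dots> \<le> exp 1" using z[OF that(2,3)] by simp
    finally show "(cmod (g B \<omega>))\<^sup>2 \<le> exp 1" .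
  qed
  have gi: "integrable P (g B)" if "finite B" "B \<subseteq> A" for B
    by (rule bounded_integrable[OF gm[OF that(2)] gb[OF _ that]])
  have "\<exists>N. \<forall>i\<ge>N. \<forall>j\<ge>N. (\<integral>\<omega>. norm (g (X i) \<omega> - g (X j) \<omega>) \<partial>P) < e" if e: "e > 0" for e
  proof -
    define \<epsilon> where "\<epsilon> = e / (2 * exp 1)"
    have \<epsilon>: "0 < \<epsilon>" "exp 1 * \<epsilon> = e / 2" using e by (simp_all add: \<epsilon>_def)
    have "(\<lambda>n. (exp (1 / real (Suc n)) - 1) / (2 * \<epsilon>)) \<longlonglongrightarrow> (exp 0 - 1) / (2 * \<epsilon>)"
      by (intro tendsto_intros LIMSEQ_Suc lim_1_over_n) (use \<epsilon> in auto)
    then have "\<forall>\<^sub>F n in sequentially. (exp (1 / real (Suc n)) - 1) / (2 * \<epsilon>) < \<epsilon> / 2"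
      by (rule order_tendstoD(2)) (use \<epsilon>(1) in auto)
    then obtain N where N: "(exp (1 / real (Suc N)) - 1) / (2 * \<epsilon>) < \<epsilon> / 2"
      by (auto simp: eventually_sequentially)
    have *: "(\<integral>\<omega>. norm (g (X i) \<omega> - g (X j) \<omega>) \<partial>P) < e" if "N \<le> j" "j \<le> i" for i j
    proof -
      have "X j \<subseteq> X i" "X N \<subseteq> X j" using X(1) that by (auto simp: incseq_def)
      then have "(\<integral>\<omega>. norm (g (X i) \<omega> - g (X j) \<omega>) \<partial>P) \<le> exp 1 * (\<epsilon> / 2 + (exp (1 / real (Suc N)) - 1) / (2 * \<epsilon>))"
        unfolding g_def
      proof (intro imaginary_product_cauchy z Xs)
        show "X i - X j \<subseteq> A" using X(3)[of i] by auto
        show "(X i - X j) \<inter> X N = {}" using \<open>X N \<subseteq> X j\<close> by auto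
      qed (use X \<epsilon>(1) in auto)
      also have "\<dots> < exp 1 * (\<epsilon> / 2 + \<epsilon> / 2)"
        using N by (intro mult_strict_left_mono add_strict_left_mono) auto
      also have "\<dots> < e" using \<epsilon>(2) e by (simp add: field_simps)
      finally show ?thesis .
    qed
    have "(\<integral>\<omega>. norm (g (X i) \<omega> - g (X j) \<omega>) \<partial>P) < e" if "N \<le> i" "N \<le> j" for i j
      using *[of i j] *[of j i] that by (cases "j \<le> i") (auto simp: norm_minus_commute)
    then show ?thesis by blast
  qed
  from cauchy_L1_AE_cauchy_subseq[OF gi[OF X(2,3)] this]
  obtain r where r: "strict_mono r" "AE \<omega> in P. Cauchy (\<lambda>i. g (X (r i)) \<omega>)" by blast
  \<comment> \<open>Clamping makes the bound hold at every point, including the null set where the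
    limit is arbitrary; almost everywhere it changes nothing.\<close>
  define f where "f \<omega> = max (- sqrt (exp 1)) (min (sqrt (exp 1)) (Im (lim (\<lambda>i. g (X (r i)) \<omega>))))" for \<omega>
  have fm: "f \<in> borel_measurable (cube_borel A)"
  proof -
    have "(\<lambda>\<omega>. lim (\<lambda>i. g (X (r i)) \<omega>)) \<in> borel_measurable (cube_borel A)"
      by (rule borel_measurable_lim_metric) (rule gm[OF X(3)])
    then show ?thesis unfolding f_def by measurable
  qed
  have conv: "AE \<omega> in P. (\<lambda>i. complex_of_real (Im (g (X (r i)) \<omega>)) * (\<Prod>\<alpha>\<in>F. \<omega> \<alpha>))
      \<longlonglongrightarrow> complex_of_real (f \<omega>) * (\<Prod>\<alpha>\<in>F. \<omega> \<alpha>)" for F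
    using r(2) AE_space
  proof eventually_elim
    case (elim \<omega>)
    then have \<omega>: "\<omega> \<in> cube A" by simp
    have "(\<lambda>i. g (X (r i)) \<omega>) \<longlonglongrightarrow> lim (\<lambda>i. g (X (r i)) \<omega>)"
      using elim(1) Cauchy_convergent convergent_LIMSEQ_iff by blast
    then have l: "(\<lambda>i. Im (g (X (r i)) \<omega>)) \<longlonglongrightarrow> Im (lim (\<lambda>i. g (X (r i)) \<omega>))" by (rule tendsto_Im)
    have "\<bar>Im (g (X (r i)) \<omega>)\<bar> \<le> sqrt (exp 1)" for i
      using gb[OF \<omega> X(2,3), of "r i"] abs_Im_le_cmod[of "g (X (r i)) \<omega>"] by simp
    then have "\<bar>Im (lim (\<lambda>i. g (X (r i)) \<omega>))\<bar> \<le> sqrt (exp 1)"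
      by (intro tendsto_upperbound[OF tendsto_rabs[OF l]]) auto
    then have "f \<omega> = Im (lim (\<lambda>i. g (X (r i)) \<omega>))" by (simp add: f_def)
    then show ?case using l by (intro tendsto_mult tendsto_of_real tendsto_const) simp
  qed
  have "(\<integral>\<omega>. complex_of_real (f \<omega>) * (\<Prod>\<alpha>\<in>F. \<omega> \<alpha>) \<partial>P) = complex_of_real (odd_sign (card F) * (\<Prod>\<alpha>\<in>F. z \<alpha>))"
    if F: "finite F" "F \<subseteq> A" for F
  proof (rule LIMSEQ_unique)
    show "(\<lambda>i. \<integral>\<omega>. complex_of_real (Im (g (X (r i)) \<omega>)) * (\<Prod>\<alpha>\<in>F. \<omega> \<alpha>) \<partial>P)
      \<longlonglongrightarrow> (\<integral>\<omega>. complex_of_real (f \<omega>) * (\<Prod>\<alpha>\<in>F. \<omega> \<alpha>) \<partial>P)"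
    proof (rule integral_dominated_convergence[where w="\<lambda>_. sqrt (exp 1)"])
      show "AE \<omega> in P. norm (complex_of_real (Im (g (X (r i)) \<omega>)) * (\<Prod>\<alpha>\<in>F. \<omega> \<alpha>)) \<le> sqrt (exp 1)" for i
      proof (rule AE_I2)
        fix \<omega> assume "\<omega> \<in> space P"
        then have \<omega>: "\<omega> \<in> cube A" by simp
        then show "norm (complex_of_real (Im (g (X (r i)) \<omega>)) * (\<Prod>\<alpha>\<in>F. \<omega> \<alpha>)) \<le> sqrt (exp 1)"
          using gb[OF \<omega> X(2,3), of "r i"] abs_Im_le_cmod[of "g (X (r i)) \<omega>"]
          by (simp add: norm_mult norm_prod_coordinate[OF \<omega> F(2)])
      qed
      show "(\<lambda>\<omega>. complex_of_real (Im (g (X (r i)) \<omega>)) * (\<Prod>\<alpha>\<in>F. \<omega> \<alpha>)) \<in> borel_measurable P" for i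
        using gm[OF X(3)] prod_coordinate_measurable[OF F(2)] by simp
      show "(\<lambda>\<omega>. complex_of_real (f \<omega>) * (\<Prod>\<alpha>\<in>F. \<omega> \<alpha>)) \<in> borel_measurable P"
        using fm prod_coordinate_measurable[OF F(2)] by simp
    qed (use conv in auto)
    have int: "(\<integral>\<omega>. complex_of_real (Im (g B \<omega>)) * (\<Prod>\<alpha>\<in>F. \<omega> \<alpha>) \<partial>P)
       = complex_of_real (if F \<subseteq> B then odd_sign (card F) * (\<Prod>\<alpha>\<in>F. z \<alpha>) else 0)" if B: "finite B" "B \<subseteq> A" for B
    proof -
      have i: "integrable P (\<lambda>\<omega>. g B \<omega> * (\<Prod>\<alpha>\<in>F. \<omega> \<alpha>))"
        unfolding g_def by (rule finite_product_integrable[OF B(2) cylindrical_walsh[OF F]])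
      have "(\<integral>\<omega>. complex_of_real (Im (g B \<omega>)) * (\<Prod>\<alpha>\<in>F. \<omega> \<alpha>) \<partial>P)
        = (\<integral>\<omega>. complex_of_real (Im (g B \<omega> * (\<Prod>\<alpha>\<in>F. \<omega> \<alpha>))) \<partial>P)"
        by (intro Bochner_Integration.integral_cong refl)
          (use prod_coordinate_values[OF _ F] in fastforce)
      also have "\<dots> = complex_of_real (Im (\<integral>\<omega>. g B \<omega> * (\<Prod>\<alpha>\<in>F. \<omega> \<alpha>) \<partial>P))"
        unfolding integral_complex_of_real integral_Im[OF i] ..
      also have "\<dots> = complex_of_real (if F \<subseteq> B then Im (\<Prod>\<alpha>\<in>F. \<i> * complex_of_real (z \<alpha>)) else 0)"
        unfolding g_def using integral_finite_product[OF B F] by simp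
      also have "(\<Prod>\<alpha>\<in>F. \<i> * complex_of_real (z \<alpha>)) = \<i> ^ card F * complex_of_real (\<Prod>\<alpha>\<in>F. z \<alpha>)"
        by (simp add: prod.distrib)
      finally show ?thesis by (simp add: odd_sign_def del: of_real_prod)
    qed
    have "\<exists>N. \<forall>i\<ge>N. (if F \<subseteq> X (r i) then odd_sign (card F) * (\<Prod>\<alpha>\<in>F. z \<alpha>) else 0) = odd_sign (card F) * (\<Prod>\<alpha>\<in>F. z \<alpha>)"
    proof (cases "F \<subseteq> (\<Union>n. X n)")
      case True
      have "\<exists>n. F \<subseteq> X n"
        using F(1) True
      proof (induction F rule: finite_induct)
        case (insert \<beta> F)
        then obtain m n where "F \<subseteq> X m" "\<beta> \<in> X n" by auto
        then have "insert \<beta> F \<subseteq> X (max m n)"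
          using incseqD[OF X(1), of m "max m n"] incseqD[OF X(1), of n "max m n"] by auto
        then show ?case by blast
      qed simp
      then obtain n where n: "F \<subseteq> X n" by blast
      have "F \<subseteq> X (r i)" if "i \<ge> n" for i
        using n X(1) strict_mono_imp_increasing[OF r(1), of i] that by (meson incseqD order_trans)
      then show ?thesis by auto
    next
      \<comment> \<open>An index missed by all \<open>X n\<close> has coefficient 0, so both sides
        vanish although the finite products never contain it.\<close>
      case False
      then obtain \<beta> where \<beta>: "\<beta> \<in> F" "\<And>n. \<beta> \<notin> X n" by auto
      have "(z \<beta>)\<^sup>2 \<le> 1 / real (Suc n)" for n using Xs[of "{\<beta>}" n] \<beta> F by auto
      then have "(z \<beta>)\<^sup>2 \<le> 0"
        by (intro LIMSEQ_le_const[OF LIMSEQ_Suc[OF lim_1_over_n]]) auto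
      then have "(\<Prod>\<alpha>\<in>F. z \<alpha>) = 0" using F \<beta> by auto
      then show ?thesis by simp
    qed
    then show "(\<lambda>i. \<integral>\<omega>. complex_of_real (Im (g (X (r i)) \<omega>)) * (\<Prod>\<alpha>\<in>F. \<omega> \<alpha>) \<partial>P)
      \<longlonglongrightarrow> complex_of_real (odd_sign (card F) * (\<Prod>\<alpha>\<in>F. z \<alpha>))"
      unfolding int[OF X(2,3)] by (intro tendsto_of_real tendsto_eventually) (auto simp: eventually_sequentially)
  qed
  moreover have "\<bar>f \<omega>\<bar> \<le> sqrt (exp 1)" for \<omega>
  proof -
    have "0 \<le> sqrt (exp 1 :: real)" by simp
    then show ?thesis unfolding f_def by linarith
  qed
  ultimately show ?thesis using fm by blast
qed

end

section \<open>Families of nonnegative numbers with bounded sums\<close>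

text \<open>For nonnegative families a bound on all finite partial sums expresses summability
  together with a bound on the sum. In this form it passes through reindexing, restriction and
  comparison without convergence arguments.\<close>

definition sums_le :: "('i \<Rightarrow> real) \<Rightarrow> 'i set \<Rightarrow> real \<Rightarrow> bool"
  where "sums_le f A S \<longleftrightarrow> (\<forall>B. finite B \<longrightarrow> B \<subseteq> A \<longrightarrow> sum f B \<le> S)"

definition odd_sets :: "'a set \<Rightarrow> 'a set set"
  where "odd_sets A = {F. finite F \<and> F \<subseteq> A \<and> odd (card F)}"

definition odd3_sets :: "'a set \<Rightarrow> 'a set set"
  where "odd3_sets A = {F. finite F \<and> F \<subseteq> A \<and> odd (card F) \<and> 3 \<le> card F}"

lemma sums_leD: "sums_le f A S \<Longrightarrow> finite B \<Longrightarrow> B \<subseteq> A \<Longrightarrow> sum f B \<le> S"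
  by (simp add: sums_le_def)

lemma sums_leI: "(\<And>B. finite B \<Longrightarrow> B \<subseteq> A \<Longrightarrow> sum f B \<le> S) \<Longrightarrow> sums_le f A S"
  by (simp add: sums_le_def)

lemma sums_le_mem: "sums_le f A S \<Longrightarrow> a \<in> A \<Longrightarrow> f a \<le> S"
  using sums_leD[of f A S "{a}"] by simp

lemma sums_le_mono:
  assumes "sums_le f A S" "S \<le> T" "A' \<subseteq> A" "\<And>i. i \<in> A' \<Longrightarrow> g i \<le> f i"
  shows "sums_le g A' T"
proof (rule sums_leI)
  fix B assume B: "finite B" "B \<subseteq> A'"
  have "sum g B \<le> sum f B" using B assms(4) by (intro sum_mono) auto
  also have "\<dots> \<le> S" using B assms(3) by (intro sums_leD[OF assms(1)]) auto
  finally show "sum g B \<le> T" using assms(2) by simp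
qed

lemma sums_le_add: "sums_le f A S \<Longrightarrow> sums_le g A T \<Longrightarrow> sums_le (\<lambda>i. f i + g i) A (S + T)"
  unfolding sums_le_def by (auto simp: sum.distrib intro!: add_mono)

lemma sums_le_cmult: "0 \<le> c \<Longrightarrow> sums_le f A S \<Longrightarrow> sums_le (\<lambda>i. c * f i) A (c * S)"
  unfolding sums_le_def by (auto simp: sum_distrib_left[symmetric] intro!: mult_left_mono)

lemma sums_le_reindex:
  assumes "sums_le f B S" "inj_on k A" "k ` A \<subseteq> B" "\<And>i. i \<in> A \<Longrightarrow> g i = f (k i)"
  shows "sums_le g A S"
proof (rule sums_leI)
  fix C assume C: "finite C" "C \<subseteq> A"
  then have "sum g C = sum f (k ` C)"
    using assms(4) inj_on_subset[OF assms(2) C(2)] by (subst sum.reindex) (auto intro!: sum.cong)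
  also have "\<dots> \<le> S" using C assms(3) by (intro sums_leD[OF assms(1)]) auto
  finally show "sum g C \<le> S" .
qed

lemma sums_le_Un:
  assumes "sums_le f A S" "sums_le f B T" "\<And>i. i \<in> A \<union> B \<Longrightarrow> 0 \<le> f i"
  shows "sums_le f (A \<union> B) (S + T)"
proof (rule sums_leI)
  fix C assume C: "finite C" "C \<subseteq> A \<union> B"
  have "sum f C = sum f (C \<inter> A) + sum f (C - A)"
    using C by (subst sum.union_disjoint[symmetric]) (auto intro!: sum.cong)
  also have "\<dots> \<le> S + T"
    using C by (intro add_mono sums_leD[OF assms(1)] sums_leD[OF assms(2)]) auto
  finally show "sum f C \<le> S + T" .
qed

section \<open>Sums of products over odd sets\<close>

lemma le_sinh:
  assumes "0 \<le> (x::real)" shows "x \<le> sinh x"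
proof -
  have "(\<lambda>x. sinh x - x) 0 \<le> (\<lambda>x. sinh x - x) x"
  proof (rule DERIV_nonneg_imp_nondecreasing[OF assms])
    fix y :: real
    show "\<exists>d. ((\<lambda>x. sinh x - x) has_real_derivative d) (at y) \<and> 0 \<le> d"
      by (intro exI[of _ "cosh y - 1"] conjI) (auto intro!: derivative_eq_intros simp: cosh_real_ge_1)
  qed
  then show ?thesis by simp
qed

text \<open>Adjoining an element to a set of even cardinality gives one of odd cardinality and vice versa,
  so the even and odd sums obey the addition theorems of \<open>cosh\<close> and \<open>sinh\<close>.\<close>

lemma sum_odd_even_subsets:
  fixes t :: "'a \<Rightarrow> real"
  assumes "finite B" "\<And>a. a \<in> B \<Longrightarrow> 0 \<le> t a"
  shows "(\<Sum>F\<in>{F\<in>Pow B. odd (card F)}. \<Prod>a\<in>F. t a) \<le> sinh (sum t B) \<and>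
         (\<Sum>F\<in>{F\<in>Pow B. even (card F)}. \<Prod>a\<in>F. t a) \<le> cosh (sum t B)"
  using assms
proof (induction B rule: finite_induct)
  case empty
  have "{F \<in> Pow ({}::'a set). odd (card F)} = {}" "{F \<in> Pow ({}::'a set). even (card F)} = {{}}" by auto
  then show ?case by simp
next
  case (insert b B)
  have fin: "finite F" "b \<notin> F" if "F \<in> Pow B" for F using that insert.hyps finite_subset by auto
  have step: "(\<Sum>F\<in>{F\<in>Pow (insert b B). R (card F)}. \<Prod>a\<in>F. t a)
     = (\<Sum>F\<in>{F\<in>Pow B. R (card F)}. \<Prod>a\<in>F. t a) + t b * (\<Sum>F\<in>{F\<in>Pow B. R (Suc (card F))}. \<Prod>a\<in>F. t a)"
    for R :: "nat \<Rightarrow> bool"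
  proof -
    have eq: "{F\<in>Pow (insert b B). R (card F)} = {F\<in>Pow B. R (card F)} \<union> insert b ` {F\<in>Pow B. R (Suc (card F))}"
      unfolding Pow_insert using fin by (auto simp: card_insert_if)
    have inj: "inj_on (insert b) {F\<in>Pow B. R (Suc (card F))}"
      using insert.hyps(2) by (auto simp: inj_on_def)
    have "(\<Sum>F\<in>insert b ` {F\<in>Pow B. R (Suc (card F))}. \<Prod>a\<in>F. t a)
      = (\<Sum>F\<in>{F\<in>Pow B. R (Suc (card F))}. t b * (\<Prod>a\<in>F. t a))"
      unfolding sum.reindex[OF inj] o_def by (intro sum.cong refl) (use fin in simp)
    then show ?thesis
      unfolding eq by (subst sum.union_disjoint) (use insert.hyps in \<open>auto simp: sum_distrib_left\<close>)
  qed
  define T where "T = sum t B"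
  have tb: "0 \<le> t b" and T: "0 \<le> T" using insert.prems by (auto simp: T_def intro: sum_nonneg)
  have IH: "(\<Sum>F\<in>{F\<in>Pow B. odd (card F)}. \<Prod>a\<in>F. t a) \<le> sinh T"
           "(\<Sum>F\<in>{F\<in>Pow B. even (card F)}. \<Prod>a\<in>F. t a) \<le> cosh T"
    using insert by (auto simp: T_def)
  have tt: "t b \<le> sinh (t b)" by (rule le_sinh[OF tb])
  have c: "0 \<le> cosh T" "0 \<le> sinh T" "1 \<le> cosh (t b)"
    using T cosh_real_ge_1[of T] cosh_real_ge_1[of "t b"] by auto
  have s: "sum t (insert b B) = T + t b" using insert.hyps by (simp add: T_def)
  have "(\<Sum>F\<in>{F\<in>Pow (insert b B). odd (card F)}. \<Prod>a\<in>F. t a) \<le> sinh T + t b * cosh T"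
    using IH tb unfolding step[of odd] by (auto intro!: add_mono mult_left_mono)
  also have "\<dots> \<le> sinh T * cosh (t b) + sinh (t b) * cosh T"
    by (rule add_mono) (use mult_left_mono[OF c(3,2)] mult_right_mono[OF tt c(1)] in simp_all)
  finally have 1: "(\<Sum>F\<in>{F\<in>Pow (insert b B). odd (card F)}. \<Prod>a\<in>F. t a) \<le> sinh (T + t b)"
    by (simp add: sinh_add mult.commute)
  have "(\<Sum>F\<in>{F\<in>Pow (insert b B). even (card F)}. \<Prod>a\<in>F. t a) \<le> cosh T + t b * sinh T"
    using IH tb unfolding step[of even] by (auto intro!: add_mono mult_left_mono)
  also have "\<dots> \<le> cosh T * cosh (t b) + sinh (t b) * sinh T"
    by (rule add_mono) (use mult_left_mono[OF c(3,1)] mult_right_mono[OF tt c(2)] in simp_all)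
  finally have 2: "(\<Sum>F\<in>{F\<in>Pow (insert b B). even (card F)}. \<Prod>a\<in>F. t a) \<le> cosh (T + t b)"
    by (simp add: cosh_add mult.commute)
  show ?case unfolding s using 1 2 by blast
qed

lemma sinh_le_linear:
  assumes "0 \<le> T" "T \<le> (1::real)" shows "sinh T \<le> T * sinh 1"
proof -
  have "convex_on {0..} (sinh :: real \<Rightarrow> real)"
    by (rule f''_ge0_imp_convex[where f'=cosh and f''=sinh]) (auto intro!: derivative_eq_intros)
  from convex_onD[OF this, of T 0 1] assms show ?thesis by simp
qed

lemma odd_sets_sum:
  fixes t :: "'a \<Rightarrow> real"
  assumes t: "\<And>a. a \<in> A \<Longrightarrow> 0 \<le> t a" and T: "sums_le t A T"
  shows "sums_le (\<lambda>F. \<Prod>a\<in>F. t a) (odd_sets A) (sinh T)"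
proof (rule sums_leI)
  fix \<F> assume \<F>: "finite \<F>" "\<F> \<subseteq> odd_sets A"
  then have B: "finite (\<Union>\<F>)" "\<Union>\<F> \<subseteq> A" by (auto simp: odd_sets_def)
  have tB: "0 \<le> t a" if "a \<in> \<Union>\<F>" for a using t B(2) that by auto
  have "(\<Sum>F\<in>\<F>. \<Prod>a\<in>F. t a) \<le> (\<Sum>F\<in>{F\<in>Pow (\<Union>\<F>). odd (card F)}. \<Prod>a\<in>F. t a)"
    using \<F> B(1) by (intro sum_mono2) (auto simp: odd_sets_def intro!: prod_nonneg tB)
  also have "\<dots> \<le> sinh (sum t (\<Union>\<F>))" using sum_odd_even_subsets[OF B(1), of t] t B(2) by auto
  also have "\<dots> \<le> sinh T" using sums_leD[OF T B] by simp
  finally show "(\<Sum>F\<in>\<F>. \<Prod>a\<in>F. t a) \<le> sinh T" .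
qed

text \<open>The singletons account for exactly \<open>U\<close>, the sum of \<open>t\<close>, within
  the sum over all odd sets, which is at most \<open>sinh U\<close>. Convexity gives
  \<open>sinh U \<le> U * sinh 1\<close> for \<open>U \<le> 1\<close>, so that the fraction
  \<open>sinh 1 - 1\<close> bounds what is left for the larger odd sets. This is the origin of
  \<delta>.\<close>

lemma odd3_sets_sum:
  fixes t :: "'a \<Rightarrow> real"
  assumes t: "\<And>a. a \<in> A \<Longrightarrow> 0 \<le> t a" and T: "sums_le t A T" "T \<le> 1"
  shows "sums_le (\<lambda>F. \<Prod>a\<in>F. t a) (odd3_sets A) ((sinh 1 - 1) * T)"
proof (rule sums_leI)
  fix \<F> assume \<F>: "finite \<F>" "\<F> \<subseteq> odd3_sets A"
  define B where "B = \<Union>\<F>"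
  have B: "finite B" "B \<subseteq> A" using \<F> by (auto simp: B_def odd3_sets_def)
  define U where "U = sum t B"
  have U: "0 \<le> U" "U \<le> T" using sums_leD[OF T(1) B] B t by (auto simp: U_def intro!: sum_nonneg)
  have sub: "\<F> \<union> (\<lambda>a. {a}) ` B \<subseteq> {F\<in>Pow B. odd (card F)}"
    using \<F> by (auto simp: odd3_sets_def B_def)
  have "(\<Sum>F\<in>\<F>. \<Prod>a\<in>F. t a) + U = (\<Sum>F\<in>\<F>. \<Prod>a\<in>F. t a) + (\<Sum>F\<in>(\<lambda>a. {a}) ` B. \<Prod>a\<in>F. t a)"
    by (simp add: U_def sum.reindex)
  also have "\<dots> = (\<Sum>F\<in>\<F> \<union> (\<lambda>a. {a}) ` B. \<Prod>a\<in>F. t a)"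
    using \<F> B by (intro sum.union_disjoint[symmetric]) (auto simp: odd3_sets_def)
  also have "\<dots> \<le> (\<Sum>F\<in>{F\<in>Pow B. odd (card F)}. \<Prod>a\<in>F. t a)"
    using B t by (intro sum_mono2 sub) (auto intro!: prod_nonneg)
  also have "\<dots> \<le> sinh U" using sum_odd_even_subsets[OF B(1), of t] t B(2) by (auto simp: U_def)
  also have "\<dots> \<le> U * sinh 1" using U T by (intro sinh_le_linear) auto
  finally have "(\<Sum>F\<in>\<F>. \<Prod>a\<in>F. t a) \<le> (sinh 1 - 1) * U" by (simp add: algebra_simps)
  also have "\<dots> \<le> (sinh 1 - 1) * T" using U le_sinh[of 1] by (intro mult_left_mono) auto
  finally show "(\<Sum>F\<in>\<F>. \<Prod>a\<in>F. t a) \<le> (sinh 1 - 1) * T" .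
qed

section \<open>Continuity of products with respect to sums of p-th powers\<close>

text \<open>By homogeneity this reduces to \<open>x powr p \<le> x\<close> for \<open>x\<close>
  between 0 and 1.\<close>

lemma powr_diff_le:
  fixes a b p :: real
  assumes "0 \<le> b" "b \<le> a" "1 \<le> p"
  shows "(a - b) powr p \<le> a powr p - b powr p"
proof (cases "a = 0")
  case False
  then have a: "0 < a" using assms by auto
  have "(a - b) powr p + b powr p = a powr p * (((a - b) / a) powr p + (b / a) powr p)"
    using assms a by (simp add: powr_divide distrib_left)
  also have "\<dots> \<le> a powr p * ((a - b) / a + b / a)"
  proof (intro mult_left_mono add_mono)
    have "x powr p \<le> x" if "0 \<le> x" "x \<le> 1" for x :: real
      using powr_mono'[of 1 p x] that assms(3) by (simp add: powr_one)
    then show "((a - b) / a) powr p \<le> (a - b) / a" "(b / a) powr p \<le> b / a"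
      using assms a by auto
  qed simp
  also have "\<dots> = a powr p" using a by (simp flip: add_divide_distrib)
  finally show ?thesis by simp
qed (use assms in auto)

text \<open>Convexity of the power, with weights \<open>1 - s\<close> and \<open>s\<close>. The
  coefficient of \<open>a powr p\<close> tends to 1 as \<open>s\<close> tends to 0, so that after
  subtracting \<open>a powr p\<close> the remainder is small for small \<open>h\<close>; the
  symmetric choice of weights does not give this.\<close>

lemma powr_add_le:
  fixes a h p s :: real
  assumes "0 \<le> a" "0 \<le> h" "1 \<le> p" "0 < s" "s < 1"
  shows "(a + h) powr p \<le> (1 - s) powr (1 - p) * a powr p + s powr (1 - p) * h powr p"
proof (cases "a = 0 \<or> h = 0")
  case True
  have "1 \<le> r powr (1 - p)" if "0 < r" "r < 1" for r :: real
    using powr_mono2'[of "1 - p" r 1] that assms(3) by simp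
  from this[of s] this[of "1 - s"] show ?thesis
    using True assms by (auto simp: mult_le_cancel_right1)
next
  case False
  then have pos: "0 < a" "0 < h" using assms by auto
  have cvx: "convex_on {0<..} (\<lambda>x::real. x powr p)" using assms(3) by (rule powr_convex)
  have "((1 - s) * (a / (1 - s)) + s * (h / s)) powr p \<le> (1 - s) * (a / (1 - s)) powr p + s * (h / s) powr p"
    using convex_onD[OF cvx, of s "a / (1 - s)" "h / s"] assms pos by simp
  moreover have "(1 - s) * (a / (1 - s)) powr p = (1 - s) powr (1 - p) * a powr p"
    using assms by (simp add: powr_divide powr_diff)
  moreover have "s * (h / s) powr p = s powr (1 - p) * h powr p"
    using assms by (simp add: powr_divide powr_diff)
  ultimately show ?thesis using assms by simp
qed

lemma powr_add_le_two:
  fixes a b p :: real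
  assumes "0 \<le> a" "0 \<le> b" "1 \<le> p"
  shows "(a + b) powr p \<le> 2 powr (p - 1) * (a powr p + b powr p)"
proof -
  have "((1::real) / 2) powr (1 - p) = 2 powr (p - 1)"
    by (simp add: powr_divide powr_diff)
  then show ?thesis using powr_add_le[OF assms, of "1/2"] by (simp add: distrib_left)
qed

text \<open>Induction, exchanging one factor at a time. The majorant is again a difference of
  products, now of nonnegative numbers, and can therefore be summed over all sets \<open>F\<close>
  in closed form.\<close>

lemma abs_prod_diff_le:
  fixes x y :: "'a \<Rightarrow> real"
  shows "\<bar>(\<Prod>a\<in>F. x a) - (\<Prod>a\<in>F. y a)\<bar> \<le> (\<Prod>a\<in>F. \<bar>x a\<bar> + \<bar>x a - y a\<bar>) - (\<Prod>a\<in>F. \<bar>x a\<bar>)"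
proof (cases "finite F")
  case True
  then show ?thesis
  proof (induction F rule: finite_induct)
    case (insert b F)
    let ?x = "\<Prod>a\<in>F. x a" and ?y = "\<Prod>a\<in>F. y a" and ?X = "\<Prod>a\<in>F. \<bar>x a\<bar>"
      and ?Y = "\<Prod>a\<in>F. \<bar>x a\<bar> + \<bar>x a - y a\<bar>" and ?h = "\<bar>x b - y b\<bar>"
    have ax: "\<bar>?x\<bar> = ?X" by (simp add: abs_prod)
    have yb: "\<bar>y b\<bar> \<le> \<bar>x b\<bar> + ?h" by linarith
    have "\<bar>x b * ?x - y b * ?y\<bar> = \<bar>(x b - y b) * ?x + y b * (?x - ?y)\<bar>" by (simp add: algebra_simps)
    also have "\<dots> \<le> ?h * ?X + \<bar>y b\<bar> * \<bar>?x - ?y\<bar>"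
      using abs_triangle_ineq[of "(x b - y b) * ?x" "y b * (?x - ?y)"] by (simp add: abs_mult ax)
    also have "\<dots> \<le> ?h * ?X + (\<bar>x b\<bar> + ?h) * (?Y - ?X)"
      using insert.IH yb by (intro add_left_mono mult_mono) auto
    also have "\<dots> = (\<bar>x b\<bar> + ?h) * ?Y - \<bar>x b\<bar> * ?X" by (simp add: algebra_simps)
    finally show ?case using insert.hyps by simp
  qed simp
qed simp

text \<open>With \<open>u\<close> the p-th powers and \<open>k\<close> their increments, each term
  is at most \<open>(\<Prod>a\<in>F. u a + k a) - (\<Prod>a\<in>F. u a)\<close>. This is
  nonnegative, so the sum may be extended to all subsets of a finite set, where it collapses to the
  difference of the products of \<open>1 + (u a + k a)\<close> and of
  \<open>1 + u a\<close>.\<close>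

lemma sum_abs_prod_diff_powr:
  fixes x y :: "'a \<Rightarrow> real"
  assumes p: "1 \<le> p" and S: "sums_le (\<lambda>a. \<bar>x a\<bar> powr p) A S"
    and K: "sums_le (\<lambda>a. (\<bar>x a\<bar> + \<bar>x a - y a\<bar>) powr p - \<bar>x a\<bar> powr p) A K"
  shows "sums_le (\<lambda>F. \<bar>(\<Prod>a\<in>F. x a) - (\<Prod>a\<in>F. y a)\<bar> powr p) {F. finite F \<and> F \<subseteq> A} (exp S * (exp K - 1))"
proof (rule sums_leI)
  fix \<F> assume \<F>: "finite \<F>" "\<F> \<subseteq> {F. finite F \<and> F \<subseteq> A}"
  define B where "B = \<Union>\<F>"
  have B: "finite B" "B \<subseteq> A" using \<F> by (auto simp: B_def)
  define u where "u a = \<bar>x a\<bar> powr p" for a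
  define k where "k a = (\<bar>x a\<bar> + \<bar>x a - y a\<bar>) powr p - u a" for a
  have k0: "0 \<le> k a" for a unfolding k_def u_def using p by (simp add: powr_mono2)
  have u0: "0 \<le> u a" for a by (simp add: u_def)
  have le: "\<bar>(\<Prod>a\<in>F. x a) - (\<Prod>a\<in>F. y a)\<bar> powr p \<le> (\<Prod>a\<in>F. u a + k a) - (\<Prod>a\<in>F. u a)" for F
  proof -
    have "\<bar>(\<Prod>a\<in>F. x a) - (\<Prod>a\<in>F. y a)\<bar> powr p \<le> ((\<Prod>a\<in>F. \<bar>x a\<bar> + \<bar>x a - y a\<bar>) - (\<Prod>a\<in>F. \<bar>x a\<bar>)) powr p"
      using p by (intro powr_mono2 abs_prod_diff_le) auto
    also have "\<dots> \<le> (\<Prod>a\<in>F. \<bar>x a\<bar> + \<bar>x a - y a\<bar>) powr p - (\<Prod>a\<in>F. \<bar>x a\<bar>) powr p"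
      using p by (intro powr_diff_le prod_nonneg prod_mono) auto
    also have "\<dots> = (\<Prod>a\<in>F. u a + k a) - (\<Prod>a\<in>F. u a)"
      by (simp add: prod_powr_distrib u_def k_def)
    finally show ?thesis .
  qed
  have exp1: "(\<Prod>a\<in>B. 1 + v a) = (\<Sum>F\<in>Pow B. \<Prod>a\<in>F. v a)" for v :: "'a \<Rightarrow> real"
    using prod_add[OF B(1), of v "\<lambda>_. 1"] by (simp add: add.commute)
  have "(\<Sum>F\<in>\<F>. \<bar>(\<Prod>a\<in>F. x a) - (\<Prod>a\<in>F. y a)\<bar> powr p) \<le> (\<Sum>F\<in>\<F>. (\<Prod>a\<in>F. u a + k a) - (\<Prod>a\<in>F. u a))"
    by (intro sum_mono le)
  also have "\<dots> \<le> (\<Sum>F\<in>Pow B. (\<Prod>a\<in>F. u a + k a) - (\<Prod>a\<in>F. u a))"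
    using B u0 k0 by (intro sum_mono2) (auto simp: B_def intro!: prod_mono)
  also have "\<dots> = (\<Prod>a\<in>B. 1 + (u a + k a)) - (\<Prod>a\<in>B. 1 + u a)"
    by (simp only: sum_subtractf exp1)
  also have "\<dots> \<le> (\<Prod>a\<in>B. (1 + u a) * (1 + k a)) - (\<Prod>a\<in>B. 1 + u a)"
    using u0 k0 by (intro diff_right_mono prod_mono) (auto simp: algebra_simps intro!: add_nonneg_nonneg)
  also have "\<dots> = (\<Prod>a\<in>B. 1 + u a) * ((\<Prod>a\<in>B. 1 + k a) - 1)"
    by (simp only: prod.distrib) (simp add: algebra_simps)
  also have "\<dots> \<le> exp S * (exp K - 1)"
  proof (intro mult_mono diff_right_mono)
    have "(\<Prod>a\<in>B. 1 + u a) \<le> (\<Prod>a\<in>B. exp (u a))" using u0 by (intro prod_mono) (auto simp: add_nonneg_nonneg)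
    also have "\<dots> \<le> exp S" using sums_leD[OF S B] by (simp add: u_def flip: exp_sum[OF B(1)])
    finally show "(\<Prod>a\<in>B. 1 + u a) \<le> exp S" .
    have "(\<Prod>a\<in>B. 1 + k a) \<le> (\<Prod>a\<in>B. exp (k a))" using k0 by (intro prod_mono) (auto simp: add_nonneg_nonneg)
    also have "\<dots> \<le> exp K" using sums_leD[OF K B] by (simp add: u_def k_def flip: exp_sum[OF B(1)])
    finally show "(\<Prod>a\<in>B. 1 + k a) \<le> exp K" .
    show "0 \<le> (\<Prod>a\<in>B. 1 + k a) - 1" using k0 by (simp add: prod_ge_1)
  qed simp
  finally show "(\<Sum>F\<in>\<F>. \<bar>(\<Prod>a\<in>F. x a) - (\<Prod>a\<in>F. y a)\<bar> powr p) \<le> exp S * (exp K - 1)" .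
qed

text \<open>The constants are chosen from the outside in: \<open>k\<close> makes
  \<open>exp S * (exp k - 1)\<close> small, \<open>s\<close> brings the coefficient of
  \<open>\<bar>x a\<bar> powr p\<close> close to 1, and \<eta> compensates the possibly large factor
  \<open>s powr (1 - p)\<close>. None of them depends on \<open>x\<close> or
  \<open>y\<close>.\<close>

lemma uniform_continuity_prod:
  assumes p: "1 \<le> p" and e: "0 < \<epsilon>" and S: "0 \<le> S"
  shows "\<exists>\<eta>>0. \<forall>x y :: 'a \<Rightarrow> real. sums_le (\<lambda>a. \<bar>x a\<bar> powr p) A S \<longrightarrow> sums_le (\<lambda>a. \<bar>x a - y a\<bar> powr p) A \<eta> \<longrightarrow>
    sums_le (\<lambda>F. \<bar>(\<Prod>a\<in>F. x a) - (\<Prod>a\<in>F. y a)\<bar> powr p) {F. finite F \<and> F \<subseteq> A} \<epsilon>"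
proof -
  have "((\<lambda>k. exp S * (exp k - 1)) \<longlongrightarrow> exp S * (exp 0 - 1)) (at_right (0::real))"
    by (intro tendsto_intros)
  then have "\<forall>\<^sub>F k in at_right (0::real). exp S * (exp k - 1) < \<epsilon>"
    by (rule order_tendstoD(2)) (use e in simp)
  then obtain k where k: "0 < k" "exp S * (exp k - 1) < \<epsilon>"
    unfolding eventually_at_right_field using dense by (metis)
  have "((\<lambda>s. ((1 - s) powr (1 - p) - 1) * S) \<longlongrightarrow> ((1 - 0) powr (1 - p) - 1) * S) (at_right (0::real))"
    by (intro tendsto_intros) auto
  then have "\<forall>\<^sub>F s in at_right (0::real). ((1 - s) powr (1 - p) - 1) * S < k / 2"
    by (rule order_tendstoD(2)) (use k in simp)
  then obtain b where b: "0 < b" "\<And>s. 0 < s \<Longrightarrow> s < b \<Longrightarrow> ((1 - s) powr (1 - p) - 1) * S < k / 2"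
    unfolding eventually_at_right_field by auto
  define s where "s = min (b / 2) (1 / 2)"
  have s: "0 < s" "s < 1" "((1 - s) powr (1 - p) - 1) * S < k / 2"
    using b by (auto simp: s_def min_def)
  define \<eta> where "\<eta> = k / 2 / s powr (1 - p)"
  show ?thesis
  proof (intro exI[of _ \<eta>] conjI allI impI)
    show "0 < \<eta>" using s k by (simp add: \<eta>_def)
    fix x y :: "'a \<Rightarrow> real"
    assume xS: "sums_le (\<lambda>a. \<bar>x a\<bar> powr p) A S" and xy: "sums_le (\<lambda>a. \<bar>x a - y a\<bar> powr p) A \<eta>"
    have "1 \<le> (1 - s) powr (1 - p)"
      using s p powr_mono2'[of "1 - p" "1 - s" 1] by simp
    then have "sums_le (\<lambda>a. ((1 - s) powr (1 - p) - 1) * \<bar>x a\<bar> powr p + s powr (1 - p) * \<bar>x a - y a\<bar> powr p) A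
        (((1 - s) powr (1 - p) - 1) * S + s powr (1 - p) * \<eta>)"
      by (intro sums_le_add sums_le_cmult xS xy) auto
    then have "sums_le (\<lambda>a. (\<bar>x a\<bar> + \<bar>x a - y a\<bar>) powr p - \<bar>x a\<bar> powr p) A k"
    proof (rule sums_le_mono)
      have "s powr (1 - p) * \<eta> = k / 2" using s by (simp add: \<eta>_def)
      then show "((1 - s) powr (1 - p) - 1) * S + s powr (1 - p) * \<eta> \<le> k" using s(3) by linarith
      show "(\<bar>x a\<bar> + \<bar>x a - y a\<bar>) powr p - \<bar>x a\<bar> powr p \<le> ((1 - s) powr (1 - p) - 1) * \<bar>x a\<bar> powr p + s powr (1 - p) * \<bar>x a - y a\<bar> powr p" for a
        using powr_add_le[of "\<bar>x a\<bar>" "\<bar>x a - y a\<bar>" p s] p s by (simp add: algebra_simps)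
    qed simp
    from sum_abs_prod_diff_powr[OF p xS this]
    show "sums_le (\<lambda>F. \<bar>(\<Prod>a\<in>F. x a) - (\<Prod>a\<in>F. y a)\<bar> powr p) {F. finite F \<and> F \<subseteq> A} \<epsilon>"
      by (rule sums_le_mono) (use k in auto)
  qed
qed

section \<open>Norms of l^p expressed by finite partial sums\<close>

lemma sums_le_summable:
  assumes "sums_le f A S" "\<And>i. i \<in> A \<Longrightarrow> 0 \<le> f i"
  shows "f summable_on A" "infsum f A \<le> S"
proof -
  show s: "f summable_on A"
    by (rule nonneg_bdd_above_summable_on) (use assms in \<open>auto simp: sums_le_def intro!: bdd_aboveI[of _ S]\<close>)
  show "infsum f A \<le> S"
    by (rule infsum_le_finite_sums[OF s]) (use assms in \<open>auto simp: sums_le_def\<close>)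
qed

lemma summable_sums_le:
  fixes f :: "'i \<Rightarrow> real"
  assumes "f summable_on A" "\<And>i. i \<in> A \<Longrightarrow> 0 \<le> f i"
  shows "sums_le f A (infsum f A)"
  by (rule sums_leI) (use assms in \<open>auto intro!: finite_sum_le_infsum\<close>)

lemma lp_spaceI:
  assumes "p \<noteq> \<infinity>" "sums_le (\<lambda>i. cmod (x i) powr enn2real p) S C" "\<And>i. i \<notin> S \<Longrightarrow> x i = 0"
  shows "x \<in> lp_space p S"
  using sums_le_summable(1)[OF assms(2)] assms by (simp add: lp_space_def)

lemma lp_norm_le:
  assumes "1 \<le> p" "p \<noteq> \<infinity>" "sums_le (\<lambda>i. cmod (x i) powr enn2real p) S (C powr enn2real p)" "0 \<le> C"
  shows "lp_norm p S x \<le> C"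
proof -
  have p: "1 \<le> enn2real p" using assms(1,2) by (cases p) auto
  have "infsum (\<lambda>i. cmod (x i) powr enn2real p) S powr (1 / enn2real p) \<le> (C powr enn2real p) powr (1 / enn2real p)"
    using sums_le_summable(2)[OF assms(3)] p by (intro powr_mono2) (auto intro!: infsum_nonneg)
  also have "\<dots> = C" using p assms(4) by (simp add: powr_powr)
  finally show ?thesis using assms(2) by (simp add: lp_norm_def)
qed

lemma lp_norm_sums_le:
  assumes "1 \<le> p" "p \<noteq> \<infinity>" "x \<in> lp_space p S" "lp_norm p S x \<le> C"
  shows "sums_le (\<lambda>i. cmod (x i) powr enn2real p) S (C powr enn2real p)"
proof -
  have p: "1 \<le> enn2real p" using assms(1,2) by (cases p) auto
  let ?s = "infsum (\<lambda>i. cmod (x i) powr enn2real p) S"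
  have "?s powr (1 / enn2real p) \<le> C" using assms(2,4) by (simp add: lp_norm_def)
  then have "(?s powr (1 / enn2real p)) powr enn2real p \<le> C powr enn2real p"
    using p by (intro powr_mono2) auto
  then have "?s \<le> C powr enn2real p" using p by (simp add: powr_powr infsum_nonneg)
  moreover have "sums_le (\<lambda>i. cmod (x i) powr enn2real p) S ?s"
    using assms(2,3) by (intro summable_sums_le) (auto simp: lp_space_def)
  ultimately show ?thesis by (auto intro: sums_le_mono)
qed

lemma lp_ball_sums_le:
  assumes "1 \<le> p" "p \<noteq> \<infinity>" "x \<in> lp_ball p S"
  shows "sums_le (\<lambda>i. cmod (x i) powr enn2real p) S 1"
  using lp_norm_sums_le[OF assms(1,2), of x S 1] assms(3) by (simp add: lp_ball_def)

lemma lp_ball_infinity: "x \<in> lp_ball \<infinity> S \<Longrightarrow> i \<in> S \<Longrightarrow> cmod (x i) \<le> 1"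
  by (auto simp: lp_ball_def lp_space_def lp_norm_def intro: order_trans[OF cSUP_upper])

section \<open>The level recursion\<close>

lemma card_of_lists_of_length:
  assumes "infinite A"
  shows "(card_of {xs. set xs \<subseteq> A \<and> length xs = n}, card_of A) \<in> ordLeq"
proof (induction n)
  case 0
  obtain a where "a \<in> A" using assms by (metis ex_in_conv finite.emptyI)
  then show ?case
    by (intro card_of_ordLeqI[of "\<lambda>_. a"]) (auto simp: inj_on_def)
next
  case (Suc n)
  let ?L = "\<lambda>n. {xs. set xs \<subseteq> A \<and> length xs = n}"
  have "(card_of (?L (Suc n)), card_of (A \<times> ?L n)) \<in> ordLeq"
  proof (rule card_of_ordLeqI[of "\<lambda>xs. (hd xs, tl xs)"])
    show "inj_on (\<lambda>xs. (hd xs, tl xs)) (?L (Suc n))"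
    proof (rule inj_onI)
      fix xs ys assume "xs \<in> ?L (Suc n)" "ys \<in> ?L (Suc n)" "(hd xs, tl xs) = (hd ys, tl ys)"
      then show "xs = ys" by (cases xs; cases ys) simp_all
    qed
    fix xs assume "xs \<in> ?L (Suc n)"
    then show "(hd xs, tl xs) \<in> A \<times> ?L n" by (cases xs) simp_all
  qed
  from ordLeq_ordIso_trans[OF ordLeq_transitive[OF this card_of_Times_mono2[OF Suc.IH]]
      card_of_Times_same_infinite[OF assms]]
  show ?case .
qed

text \<open>An infinite set has as many finite subsets as elements, and countably many copies of the
  family of finite subsets still fit into it. \<open>lvl\<close> and \<open>idx\<close> are the
  components of the inverse of such an embedding.\<close>

lemma finite_subsets_coding_exists:
  assumes A: "infinite A"
  shows "\<exists>(e :: nat \<Rightarrow> 'a set \<Rightarrow> 'a) lvl idx.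
    \<forall>j F. finite F \<and> F \<subseteq> A \<longrightarrow> e j F \<in> A \<and> lvl (e j F) = j \<and> idx (e j F) = F"
proof -
  let ?F = "{F. finite F \<and> F \<subseteq> A}"
  have nat: "(card_of (UNIV :: nat set), card_of A) \<in> ordLeq"
    using A by (simp add: infinite_iff_card_of_nat)
  have "(card_of (\<Union>n. {xs. set xs \<subseteq> A \<and> length xs = n}), card_of A) \<in> ordLeq"
    using card_of_lists_of_length[OF A] by (intro card_of_UNION_ordLeq_infinite[OF A nat]) auto
  from ordLeq_transitive[OF card_of_image this, of set]
  have "(card_of (set ` (\<Union>n. {xs. set xs \<subseteq> A \<and> length xs = n})), card_of A) \<in> ordLeq" .
  moreover have "set ` (\<Union>n. {xs. set xs \<subseteq> A \<and> length xs = n}) = ?F"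
  proof (intro antisym subsetI)
    fix F assume "F \<in> ?F"
    moreover from this obtain xs where "set xs = F" using finite_list by auto
    ultimately show "F \<in> set ` (\<Union>n. {xs. set xs \<subseteq> A \<and> length xs = n})" by blast
  qed auto
  ultimately have "(card_of ?F, card_of A) \<in> ordLeq" by simp
  then have "(card_of ((UNIV :: nat set) \<times> ?F), card_of A) \<in> ordLeq"
    by (intro card_of_Sigma_ordLeq_infinite[OF A nat] ballI)
  then have "\<exists>f. inj_on f ((UNIV :: nat set) \<times> ?F) \<and> f ` (UNIV \<times> ?F) \<subseteq> A"
    unfolding card_of_ordLeq .
  then obtain f where f: "inj_on f ((UNIV :: nat set) \<times> ?F)" "f ` (UNIV \<times> ?F) \<subseteq> A"
    by blast
  define g where "g = the_inv_into ((UNIV :: nat set) \<times> ?F) f"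
  have fg: "f (j, F) \<in> A" "g (f (j, F)) = (j, F)" if "finite F \<and> F \<subseteq> A" for j F
    using f(2) that the_inv_into_f_f[OF f(1), of "(j, F)"] by (auto simp: g_def)
  show ?thesis
    by (intro exI[of _ "\<lambda>j F. f (j, F)"] exI[of _ "\<lambda>a. fst (g a)"] exI[of _ "\<lambda>a. snd (g a)"])
      (simp add: fg)
qed

lemma sums_le_support:
  assumes "sums_le f A' S" "\<And>a. a \<in> A - A' \<Longrightarrow> f a \<le> 0"
  shows "sums_le f A S"
proof (rule sums_leI)
  fix B assume B: "finite B" "B \<subseteq> A"
  have "sum f B = sum f (B \<inter> A') + sum f (B - A')"
    using B by (subst sum.union_disjoint[symmetric]) (auto intro!: sum.cong)
  also have "sum f (B - A') \<le> 0" using B assms(2) by (intro sum_nonpos) auto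
  also have "sum f (B \<inter> A') \<le> S" using B by (intro sums_leD[OF assms(1)]) auto
  finally show "sum f B \<le> S" by simp
qed

text \<open>\<open>e\<close> splits \<open>A\<close> into infinitely many disjoint copies of the set of its finite subsets;
  \<open>e (j + 1) F\<close> is the coordinate of level \<open>j + 1\<close> on which the product over \<open>F\<close> of the
  coordinates of level \<open>j\<close> is recorded.\<close>

locale level_coding =
  fixes A :: "'a set" and e :: "nat \<Rightarrow> 'a set \<Rightarrow> 'a" and lvl :: "'a \<Rightarrow> nat" and idx :: "'a \<Rightarrow> 'a set"
  assumes e_mem: "\<And>j F. finite F \<Longrightarrow> F \<subseteq> A \<Longrightarrow> e j F \<in> A"
    and lvl_e: "\<And>j F. finite F \<Longrightarrow> F \<subseteq> A \<Longrightarrow> lvl (e j F) = j"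
    and idx_e: "\<And>j F. finite F \<Longrightarrow> F \<subseteq> A \<Longrightarrow> idx (e j F) = F"
begin

text \<open>The weight \<open>c\<close> depends on the cardinality of the recorded set only and is
  left open, because functions and measures run the same recursion with different weights.
  Coordinates that a level does not use get the value 0.\<close>

primrec level :: "(nat \<Rightarrow> real) \<Rightarrow> ('a \<Rightarrow> real) \<Rightarrow> nat \<Rightarrow> 'a \<Rightarrow> real" where
  "level c x 0 = (\<lambda>a. if \<exists>\<alpha>\<in>A. a = e 0 {\<alpha>} then x (the_elem (idx a)) else 0)"
| "level c x (Suc j) = (\<lambda>a. if idx a \<in> odd3_sets A \<and> a = e (Suc j) (idx a)
     then c (card (idx a)) * (\<Prod>b\<in>idx a. level c x j b) else 0)"

definition total :: "(nat \<Rightarrow> real) \<Rightarrow> ('a \<Rightarrow> real) \<Rightarrow> 'a \<Rightarrow> real"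
  where "total c x a = level c x (lvl a) a"

text \<open>Meant for sets contained in one level. For a set that mixes levels the value is the
  level of an arbitrary element, which is harmless: the product of the coordinates of any single
  level over such a set is 0.\<close>

definition flev :: "'a set \<Rightarrow> nat"
  where "flev F = lvl (SOME a. a \<in> F)"

definition up :: "'a set \<Rightarrow> 'a"
  where "up F = e (Suc (flev F)) F"

lemma odd3D: "F \<in> odd3_sets A \<Longrightarrow> finite F \<and> F \<subseteq> A \<and> odd (card F) \<and> 3 \<le> card F \<and> F \<noteq> {}"
  by (auto simp: odd3_sets_def)

lemma level_nonzero:
  assumes "level c x j a \<noteq> 0" shows "lvl a = j" "a \<in> A"
proof -
  have "lvl a = j \<and> a \<in> A"
  proof (cases j)
    case 0
    then obtain \<alpha> where "\<alpha> \<in> A" "a = e 0 {\<alpha>}" using assms by (auto split: if_splits)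
    then show ?thesis using 0 lvl_e[of "{\<alpha>}" 0] e_mem[of "{\<alpha>}" 0] by auto
  next
    case (Suc i)
    then have "idx a \<in> odd3_sets A" "a = e (Suc i) (idx a)" using assms by (auto split: if_splits)
    then show ?thesis using Suc odd3D lvl_e[of "idx a" j] e_mem[of "idx a" j] by metis
  qed
  then show "lvl a = j" "a \<in> A" by auto
qed

lemma level_zero_e:
  assumes "\<alpha> \<in> A" shows "level c x 0 (e 0 {\<alpha>}) = x \<alpha>"
proof -
  have "level c x 0 (e 0 {\<alpha>}) = x (the_elem (idx (e 0 {\<alpha>})))"
    unfolding level.simps by (rule if_P) (use assms in blast)
  also have "idx (e 0 {\<alpha>}) = {\<alpha>}" using assms by (intro idx_e) auto
  finally show ?thesis by simp
qed

lemma level_Suc_e: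
  assumes "F \<in> odd3_sets A"
  shows "level c x (Suc j) (e (Suc j) F) = c (card F) * (\<Prod>b\<in>F. level c x j b)"
proof -
  have i: "idx (e (Suc j) F) = F" using odd3D[OF assms] by (intro idx_e) auto
  have "idx (e (Suc j) F) \<in> odd3_sets A \<and> e (Suc j) F = e (Suc j) (idx (e (Suc j) F))"
    unfolding i using assms by blast
  then have "level c x (Suc j) (e (Suc j) F)
      = c (card (idx (e (Suc j) F))) * (\<Prod>b\<in>idx (e (Suc j) F). level c x j b)"
    unfolding level.simps by (rule if_P)
  then show ?thesis unfolding i .
qed

lemma level_zero_off:
  assumes "a \<notin> (\<lambda>\<alpha>. e 0 {\<alpha>}) ` A" shows "level c x 0 a = 0"
  unfolding level.simps by (rule if_not_P) (use assms in blast)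

lemma level_Suc_off:
  assumes "a \<notin> e (Suc j) ` odd3_sets A" shows "level c x (Suc j) a = 0"
proof -
  have "\<not> (idx a \<in> odd3_sets A \<and> a = e (Suc j) (idx a))" using assms by blast
  then show ?thesis by (simp only: level.simps if_False)
qed

text \<open>Every recorded set has odd cardinality, so a sign factors out at each step.\<close>

lemma level_minus: "level c (\<lambda>a. - x a) j a = - level c x j a"
proof (induction j arbitrary: a)
  case (Suc j)
  have "(\<Prod>b\<in>F. - level c x j b) = - (\<Prod>b\<in>F. level c x j b)" if "F \<in> odd3_sets A" for F
    using odd3D[OF that] prod_uminus[of "level c x j" F] by simp
  then have "(\<Prod>b\<in>F. level c (\<lambda>a. - x a) j b) = - (\<Prod>b\<in>F. level c x j b)" if "F \<in> odd3_sets A" for F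
    using that by (simp only: Suc.IH)
  then show ?case
    by (cases "a \<in> e (Suc j) ` odd3_sets A")
      (auto simp: level_Suc_e level_Suc_off simp del: level.simps)
qed auto

lemma flev_eq:
  assumes "F \<noteq> {}" "\<And>b. b \<in> F \<Longrightarrow> lvl b = j" shows "flev F = j"
proof -
  have "(SOME a. a \<in> F) \<in> F" using assms(1) by (simp add: some_in_eq)
  then show ?thesis unfolding flev_def by (rule assms(2))
qed

text \<open>A level vanishes off its own coordinates, so products taken at different levels are
  supported on disjoint families of sets.\<close>

lemma level_prod_nonzero:
  assumes "(\<Prod>b\<in>F. level c x j b) \<noteq> 0" "finite F" "F \<noteq> {}"
  shows "\<And>b. b \<in> F \<Longrightarrow> lvl b = j" "flev F = j"
proof -
  show l: "\<And>b. b \<in> F \<Longrightarrow> lvl b = j"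
    using assms level_nonzero(1) by (metis prod_zero)
  show "flev F = j" by (rule flev_eq[OF assms(3) l])
qed

lemma total_minus: "total c (\<lambda>a. - x a) a = - total c x a"
  unfolding total_def by (rule level_minus)

lemma inj_e_zero: "inj_on (\<lambda>\<alpha>. e 0 {\<alpha>}) A"
proof (rule inj_onI)
  fix \<alpha> \<beta> assume "\<alpha> \<in> A" "\<beta> \<in> A" "e 0 {\<alpha>} = e 0 {\<beta>}"
  then have "{\<alpha>} = {\<beta>}" using idx_e[of "{\<alpha>}" 0] idx_e[of "{\<beta>}" 0]
    by (metis empty_subsetI finite.emptyI finite.insertI insert_subset)
  then show "\<alpha> = \<beta>" by simp
qed

lemma up_mem:
  assumes "F \<in> odd3_sets A" shows "up F \<in> A \<and> lvl (up F) = Suc (flev F) \<and> idx (up F) = F"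
proof -
  have "finite F" "F \<subseteq> A" using odd3D[OF assms] by auto
  then show ?thesis unfolding up_def by (intro conjI e_mem lvl_e idx_e)
qed

lemma inj_up: "inj_on up (odd3_sets A)"
proof (rule inj_onI)
  fix F G assume "F \<in> odd3_sets A" "G \<in> odd3_sets A" "up F = up G"
  then show "F = G" using up_mem[of F] up_mem[of G] by metis
qed

lemma total_up:
  assumes "F \<in> odd3_sets A" shows "total c x (up F) = c (card F) * (\<Prod>b\<in>F. level c x (flev F) b)"
proof -
  have "total c x (up F) = level c x (Suc (flev F)) (up F)"
    using up_mem[OF assms] by (simp only: total_def)
  then show ?thesis unfolding up_def by (simp only: level_Suc_e[OF assms])
qed

section \<open>Size and continuity of the levels\<close>

lemma sums_le_level_zero:
  assumes x: "sums_le f A S" and f: "\<And>\<alpha>. \<alpha> \<in> A \<Longrightarrow> g (e 0 {\<alpha>}) = f \<alpha>" and g: "\<And>a. a \<notin> (\<lambda>\<alpha>. e 0 {\<alpha>}) ` A \<Longrightarrow> g a \<le> 0"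
  shows "sums_le g A S"
proof (rule sums_le_support)
  show "sums_le g ((\<lambda>\<alpha>. e 0 {\<alpha>}) ` A) S"
  proof (rule sums_le_reindex[OF x, where k="\<lambda>a. the_elem (idx a)"])
    show "inj_on (\<lambda>a. the_elem (idx a)) ((\<lambda>\<alpha>. e 0 {\<alpha>}) ` A)"
      by (rule inj_onI) (auto simp: idx_e)
  qed (auto simp: idx_e f)
qed (use g in auto)

lemma sums_le_level_Suc:
  assumes x: "sums_le f (odd3_sets A) S" and f: "\<And>F. F \<in> odd3_sets A \<Longrightarrow> g (e (Suc j) F) = f F"
    and g: "\<And>a. a \<notin> e (Suc j) ` odd3_sets A \<Longrightarrow> g a \<le> 0"
  shows "sums_le g A S"
proof (rule sums_le_support)
  have i: "idx (e (Suc j) F) = F" if "F \<in> odd3_sets A" for F using odd3D[OF that] by (simp add: idx_e)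
  show "sums_le g (e (Suc j) ` odd3_sets A) S"
  proof (rule sums_le_reindex[OF x, where k=idx])
    show "inj_on idx (e (Suc j) ` odd3_sets A)" by (rule inj_onI) (auto simp: i)
  qed (auto simp: i f)
qed (use g in auto)

text \<open>One step multiplies the sum of p-th powers by at most \<open>C * (sinh 1 - 1)\<close>.
  Two cases occur later: weights that undo the contraction, with \<open>\<theta> = 1\<close>, and
  weights bounded by 1, with \<open>\<theta> = sinh 1 - 1\<close>. The condition
  \<open>\<theta> \<le> 1\<close> keeps every level in the range where the linear bound for odd sets
  holds.\<close>

lemma level_sums_le:
  assumes p: "0 < p" and c: "\<And>k. \<bar>c k\<bar> powr p \<le> C" and \<theta>: "C * (sinh 1 - 1) \<le> \<theta>" "0 \<le> \<theta>" "\<theta> \<le> 1"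
    and x: "sums_le (\<lambda>a. \<bar>x a\<bar> powr p) A 1"
  shows "sums_le (\<lambda>a. \<bar>level c x j a\<bar> powr p) A (\<theta> ^ j)"
proof (induction j)
  case 0
  show ?case unfolding power_0
    by (rule sums_le_level_zero[OF x]) (use level_zero_e level_zero_off in auto)
next
  case (Suc j)
  have C: "0 \<le> C" using c[of 0] by (meson order_trans powr_ge_zero)
  have "\<theta> ^ j \<le> 1" using \<theta> by (simp add: power_le_one)
  have "sums_le (\<lambda>F. \<Prod>b\<in>F. \<bar>level c x j b\<bar> powr p) (odd3_sets A) ((sinh 1 - 1) * \<theta> ^ j)"
    using Suc.IH \<open>\<theta> ^ j \<le> 1\<close> by (intro odd3_sets_sum) auto
  then have "sums_le (\<lambda>F. C * (\<Prod>b\<in>F. \<bar>level c x j b\<bar> powr p)) (odd3_sets A) (C * ((sinh 1 - 1) * \<theta> ^ j))"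
    by (rule sums_le_cmult[OF C])
  then have 1: "sums_le (\<lambda>F. \<bar>c (card F) * (\<Prod>b\<in>F. level c x j b)\<bar> powr p) (odd3_sets A) (\<theta> ^ Suc j)"
  proof (rule sums_le_mono)
    show "C * ((sinh 1 - 1) * \<theta> ^ j) \<le> \<theta> ^ Suc j"
      using \<theta> mult_right_mono[OF \<theta>(1), of "\<theta> ^ j"] by (simp add: mult.assoc)
    show "\<bar>c (card F) * (\<Prod>b\<in>F. level c x j b)\<bar> powr p \<le> C * (\<Prod>b\<in>F. \<bar>level c x j b\<bar> powr p)" for F
      using c[of "card F"] by (auto simp: abs_mult abs_prod powr_mult prod_powr_distrib prod_nonneg intro!: mult_right_mono)
  qed simp
  show ?case
    by (rule sums_le_level_Suc[where j=j, OF 1]) (simp_all add: level_Suc_e level_Suc_off del: level.simps)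
qed

text \<open>Each step applies the product map, which is uniformly continuous on the unit ball for
  sums of p-th powers, and every level stays in that ball; the previous level supplies the closeness
  required.\<close>

lemma level_uniformly_continuous:
  assumes p: "1 \<le> p" and c: "\<And>k. \<bar>c k\<bar> powr p \<le> C" and \<theta>: "C * (sinh 1 - 1) \<le> \<theta>" "0 \<le> \<theta>" "\<theta> \<le> 1"
    and "0 < \<epsilon>"
  shows "\<exists>\<eta>>0. \<forall>x y. sums_le (\<lambda>a. \<bar>x a\<bar> powr p) A 1 \<longrightarrow> sums_le (\<lambda>a. \<bar>x a - y a\<bar> powr p) A \<eta> \<longrightarrow>
    sums_le (\<lambda>a. \<bar>level c x j a - level c y j a\<bar> powr p) A \<epsilon>"
  using \<open>0 < \<epsilon>\<close>
proof (induction j arbitrary: \<epsilon>)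
  case 0
  show ?case
  proof (intro exI[of _ \<epsilon>] conjI allI impI 0)
    fix x y assume "sums_le (\<lambda>a. \<bar>x a - y a\<bar> powr p) A \<epsilon>"
    then show "sums_le (\<lambda>a. \<bar>level c x 0 a - level c y 0 a\<bar> powr p) A \<epsilon>"
      by (rule sums_le_level_zero) (use level_zero_e level_zero_off in \<open>auto simp del: level.simps\<close>)
  qed
next
  case (Suc j)
  have C: "0 \<le> C" using c[of 0] by (meson order_trans powr_ge_zero)
  obtain \<epsilon>' where \<epsilon>': "0 < \<epsilon>'" "\<And>x y. sums_le (\<lambda>a. \<bar>x a\<bar> powr p) A 1 \<longrightarrow> sums_le (\<lambda>a. \<bar>x a - y a\<bar> powr p) A \<epsilon>' \<longrightarrow>
     sums_le (\<lambda>F. \<bar>(\<Prod>a\<in>F. x a) - (\<Prod>a\<in>F. y a)\<bar> powr p) {F. finite F \<and> F \<subseteq> A} (\<epsilon> / (C + 1))"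
    using uniform_continuity_prod[OF p, of "\<epsilon> / (C + 1)" 1 A] C Suc.prems by auto
  obtain \<eta> where \<eta>: "0 < \<eta>" "\<And>x y. sums_le (\<lambda>a. \<bar>x a\<bar> powr p) A 1 \<longrightarrow> sums_le (\<lambda>a. \<bar>x a - y a\<bar> powr p) A \<eta> \<longrightarrow>
    sums_le (\<lambda>a. \<bar>level c x j a - level c y j a\<bar> powr p) A \<epsilon>'"
    using Suc.IH[OF \<epsilon>'(1)] by blast
  show ?case
  proof (intro exI[of _ \<eta>] conjI allI impI \<eta>(1))
    fix x y assume x: "sums_le (\<lambda>a. \<bar>x a\<bar> powr p) A 1" and xy: "sums_le (\<lambda>a. \<bar>x a - y a\<bar> powr p) A \<eta>"
    have "sums_le (\<lambda>a. \<bar>level c x j a\<bar> powr p) A (\<theta> ^ j)"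
      using p by (intro level_sums_le[OF _ c \<theta> x]) auto
    then have "sums_le (\<lambda>a. \<bar>level c x j a\<bar> powr p) A 1"
      by (rule sums_le_mono) (use \<theta> in \<open>auto simp: power_le_one\<close>)
    then have "sums_le (\<lambda>F. \<bar>(\<Prod>a\<in>F. level c x j a) - (\<Prod>a\<in>F. level c y j a)\<bar> powr p) {F. finite F \<and> F \<subseteq> A} (\<epsilon> / (C + 1))"
      using \<epsilon>'(2) \<eta>(2) x xy by blast
    from sums_le_cmult[OF C this]
    have 1: "sums_le (\<lambda>F. \<bar>c (card F) * (\<Prod>a\<in>F. level c x j a) - c (card F) * (\<Prod>a\<in>F. level c y j a)\<bar> powr p) (odd3_sets A) \<epsilon>"
    proof (rule sums_le_mono)
      show "C * (\<epsilon> / (C + 1)) \<le> \<epsilon>" using C Suc.prems by (simp add: field_simps)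
      show "odd3_sets A \<subseteq> {F. finite F \<and> F \<subseteq> A}" by (auto simp: odd3_sets_def)
      show "\<bar>c (card F) * (\<Prod>a\<in>F. level c x j a) - c (card F) * (\<Prod>a\<in>F. level c y j a)\<bar> powr p
         \<le> C * \<bar>(\<Prod>a\<in>F. level c x j a) - (\<Prod>a\<in>F. level c y j a)\<bar> powr p" for F
        using c[of "card F"] unfolding right_diff_distrib[symmetric]
        by (auto simp: abs_mult powr_mult intro!: mult_right_mono)
    qed
    show "sums_le (\<lambda>a. \<bar>level c x (Suc j) a - level c y (Suc j) a\<bar> powr p) A \<epsilon>"
      by (rule sums_le_level_Suc[where j=j, OF 1]) (simp_all add: level_Suc_e level_Suc_off del: level.simps)
  qed
qed

text \<open>The damping \<open>lam ^ lvl a\<close> contributes the factor \<open>lam powr p\<close>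
  per level, so level \<open>j\<close> has power sum at most
  \<open>(lam powr p * \<theta>) ^ j \<le> r ^ j\<close>. The cut-off \<open>n\<close> serves for
  the tails in continuity arguments and, with \<open>n = 1\<close>, for the coordinates that record
  larger sets.\<close>

lemma total_sums_le:
  assumes p: "0 < p" and c: "\<And>k. \<bar>c k\<bar> powr p \<le> C" and \<theta>: "C * (sinh 1 - 1) \<le> \<theta>" "0 \<le> \<theta>" "\<theta> \<le> 1"
    and r: "0 \<le> r" "r < 1" and lam: "0 \<le> lam" "lam powr p * \<theta> \<le> r"
    and x: "sums_le (\<lambda>a. \<bar>x a\<bar> powr p) A 1"
  shows "sums_le (\<lambda>a. \<bar>lam ^ lvl a * total c x a\<bar> powr p) {a\<in>A. n \<le> lvl a} (r ^ n / (1 - r))"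
proof (rule sums_leI)
  fix B assume B: "finite B" "B \<subseteq> {a\<in>A. n \<le> lvl a}"
  \<comment> \<open>A finite \<open>B\<close> meets finitely many levels; the inserted 0 gives the
    maximum a value when \<open>B\<close> is empty.\<close>
  define N where "N = Suc (Max (insert 0 (lvl ` B)))"
  have N: "lvl ` B \<subseteq> {n..<N}" using B by (auto simp: N_def less_Suc_eq_le)
  have "(\<Sum>a\<in>B. \<bar>lam ^ lvl a * total c x a\<bar> powr p)
      = (\<Sum>j\<in>{n..<N}. \<Sum>a\<in>{a\<in>B. lvl a = j}. \<bar>lam ^ lvl a * total c x a\<bar> powr p)"
    by (rule sum.group[symmetric, OF B(1) _ N]) simp
  also have "\<dots> \<le> (\<Sum>j\<in>{n..<N}. r ^ j)"
  proof (rule sum_mono)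
    fix j
    have "(\<Sum>a\<in>{a\<in>B. lvl a = j}. \<bar>lam ^ lvl a * total c x a\<bar> powr p)
      = (\<Sum>a\<in>{a\<in>B. lvl a = j}. (lam ^ j) powr p * \<bar>level c x j a\<bar> powr p)"
      using lam by (intro sum.cong) (auto simp: total_def abs_mult powr_mult)
    also have "\<dots> = (lam ^ j) powr p * (\<Sum>a\<in>{a\<in>B. lvl a = j}. \<bar>level c x j a\<bar> powr p)"
      by (simp add: sum_distrib_left)
    also have "\<dots> \<le> (lam ^ j) powr p * \<theta> ^ j"
      using B by (intro mult_left_mono sums_leD[OF level_sums_le[OF p c \<theta> x]]) auto
    also have "(lam ^ j) powr p = (lam powr p) ^ j"
      using lam(1) by (induction j) (simp_all add: powr_mult)
    also have "(lam powr p) ^ j * \<theta> ^ j = (lam powr p * \<theta>) ^ j" by (simp add: power_mult_distrib)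
    also have "\<dots> \<le> r ^ j" using lam \<theta> by (intro power_mono) auto
    finally show "(\<Sum>a\<in>{a\<in>B. lvl a = j}. \<bar>lam ^ lvl a * total c x a\<bar> powr p) \<le> r ^ j" .
  qed
  also have "\<dots> \<le> r ^ n / (1 - r)"
  proof (cases "n \<le> N")
    case True
    then have "(1 - r) * (\<Sum>j\<in>{n..<N}. r ^ j) = r ^ n - r ^ N"
    proof (induction N rule: dec_induct)
      case (step m)
      have "(1 - r) * (\<Sum>j\<in>{n..<Suc m}. r ^ j) = (1 - r) * (\<Sum>j\<in>{n..<m}. r ^ j) + (1 - r) * r ^ m"
        using step.hyps by (simp add: distrib_left)
      then show ?case unfolding step.IH by (simp add: algebra_simps)
    qed simp
    also have "\<dots> \<le> r ^ n" using r by simp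
    finally show ?thesis using r by (simp add: pos_le_divide_eq mult.commute)
  qed (use r in auto)
  finally show "(\<Sum>a\<in>B. \<bar>lam ^ lvl a * total c x a\<bar> powr p) \<le> r ^ n / (1 - r)" .
qed

text \<open>The levels below some \<open>J\<close> are finitely many and uniformly continuous; the
  others are small by the geometric tail, uniformly over the unit ball.\<close>

lemma total_uniformly_continuous:
  assumes p: "1 \<le> p" and c: "\<And>k. \<bar>c k\<bar> powr p \<le> C" and \<theta>: "C * (sinh 1 - 1) \<le> \<theta>" "0 \<le> \<theta>" "\<theta> \<le> 1"
    and r: "0 \<le> r" "r < 1" and lam: "0 \<le> lam" "lam \<le> 1" "lam powr p * \<theta> \<le> r" and \<epsilon>: "0 < \<epsilon>"
  shows "\<exists>\<eta>>0. \<forall>x y. sums_le (\<lambda>a. \<bar>x a\<bar> powr p) A 1 \<longrightarrow> sums_le (\<lambda>a. \<bar>y a\<bar> powr p) A 1 \<longrightarrow>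
    sums_le (\<lambda>a. \<bar>x a - y a\<bar> powr p) A \<eta> \<longrightarrow>
    sums_le (\<lambda>a. \<bar>lam ^ lvl a * (total c x a - total c y a)\<bar> powr p) A \<epsilon>"
proof -
  let ?D = "\<lambda>x y a. \<bar>lam ^ lvl a * (total c x a - total c y a)\<bar> powr p"
  have head: "\<exists>\<eta>>0. \<forall>x y. sums_le (\<lambda>a. \<bar>x a\<bar> powr p) A 1 \<longrightarrow> sums_le (\<lambda>a. \<bar>x a - y a\<bar> powr p) A \<eta> \<longrightarrow>
      sums_le (?D x y) {a\<in>A. lvl a < J} \<epsilon>'" if "0 < \<epsilon>'" for J \<epsilon>'
    using that
  proof (induction J arbitrary: \<epsilon>')
    case 0
    then show ?case by (intro exI[of _ 1]) (auto simp: sums_le_def)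
  next
    case (Suc J)
    obtain \<eta>1 where \<eta>1: "0 < \<eta>1" "\<forall>x y. sums_le (\<lambda>a. \<bar>x a\<bar> powr p) A 1 \<longrightarrow> sums_le (\<lambda>a. \<bar>x a - y a\<bar> powr p) A \<eta>1 \<longrightarrow>
      sums_le (?D x y) {a\<in>A. lvl a < J} (\<epsilon>' / 2)" using Suc.IH[of "\<epsilon>' / 2"] Suc.prems by auto
    obtain \<eta>2 where \<eta>2: "0 < \<eta>2" "\<forall>x y. sums_le (\<lambda>a. \<bar>x a\<bar> powr p) A 1 \<longrightarrow> sums_le (\<lambda>a. \<bar>x a - y a\<bar> powr p) A \<eta>2 \<longrightarrow>
      sums_le (\<lambda>a. \<bar>level c x J a - level c y J a\<bar> powr p) A (\<epsilon>' / 2)"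
      using level_uniformly_continuous[where p=p and c=c and \<epsilon>="\<epsilon>' / 2" and j=J, OF p c \<theta>] Suc.prems by auto
    show ?case
    proof (intro exI[of _ "min \<eta>1 \<eta>2"] conjI allI impI)
      fix x y assume x: "sums_le (\<lambda>a. \<bar>x a\<bar> powr p) A 1" and xy: "sums_le (\<lambda>a. \<bar>x a - y a\<bar> powr p) A (min \<eta>1 \<eta>2)"
      have m: "sums_le (\<lambda>a. \<bar>x a - y a\<bar> powr p) A \<eta>1" "sums_le (\<lambda>a. \<bar>x a - y a\<bar> powr p) A \<eta>2"
        by (rule sums_le_mono[OF xy]; simp)+
      have "sums_le (?D x y) {a\<in>A. lvl a < J} (\<epsilon>' / 2)" using \<eta>1(2) x m(1) by blast
      moreover have "sums_le (?D x y) {a\<in>A. lvl a = J} (\<epsilon>' / 2)"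
      proof (rule sums_le_mono)
        show "sums_le (\<lambda>a. \<bar>level c x J a - level c y J a\<bar> powr p) A (\<epsilon>' / 2)" using \<eta>2(2) x m(2) by blast
        fix a assume a: "a \<in> {a\<in>A. lvl a = J}"
        have "\<bar>lam ^ J\<bar> \<le> 1" using lam by (simp add: power_le_one)
        then have "\<bar>lam ^ J * (level c x J a - level c y J a)\<bar> \<le> \<bar>level c x J a - level c y J a\<bar>"
          unfolding abs_mult by (intro mult_left_le_one_le) auto
        then show "?D x y a \<le> \<bar>level c x J a - level c y J a\<bar> powr p"
          using a p by (auto simp: total_def intro!: powr_mono2)
      qed auto
      ultimately have "sums_le (?D x y) ({a\<in>A. lvl a < J} \<union> {a\<in>A. lvl a = J}) (\<epsilon>' / 2 + \<epsilon>' / 2)"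
        by (rule sums_le_Un) simp
      then show "sums_le (?D x y) {a\<in>A. lvl a < Suc J} \<epsilon>'"
        by (rule sums_le_mono) auto
    qed (use \<eta>1 \<eta>2 in auto)
  qed
  \<comment> \<open>The factor \<open>2 powr p\<close> is \<open>2 powr (p - 1)\<close>, from
    splitting the power of a difference, times 2 for the tails of \<open>x\<close> and of
    \<open>y\<close>.\<close>
  have "(\<lambda>J. 2 powr p * (r ^ J / (1 - r))) \<longlonglongrightarrow> 2 powr p * (0 / (1 - r))"
    using r by (intro tendsto_intros LIMSEQ_realpow_zero) auto
  then have "\<forall>\<^sub>F J in sequentially. 2 powr p * (r ^ J / (1 - r)) < \<epsilon> / 2"
    by (rule order_tendstoD(2)) (use \<epsilon> in auto)
  then obtain J where J: "2 powr p * (r ^ J / (1 - r)) < \<epsilon> / 2" by (auto simp: eventually_sequentially)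
  obtain \<eta> where \<eta>: "0 < \<eta>" "\<forall>x y. sums_le (\<lambda>a. \<bar>x a\<bar> powr p) A 1 \<longrightarrow> sums_le (\<lambda>a. \<bar>x a - y a\<bar> powr p) A \<eta> \<longrightarrow>
      sums_le (?D x y) {a\<in>A. lvl a < J} (\<epsilon> / 2)" using head[of "\<epsilon> / 2" J] \<epsilon> by auto
  show ?thesis
  proof (intro exI[of _ \<eta>] conjI allI impI \<eta>(1))
    fix x y assume x: "sums_le (\<lambda>a. \<bar>x a\<bar> powr p) A 1" and y: "sums_le (\<lambda>a. \<bar>y a\<bar> powr p) A 1"
      and xy: "sums_le (\<lambda>a. \<bar>x a - y a\<bar> powr p) A \<eta>"
    have t: "sums_le (\<lambda>a. \<bar>lam ^ lvl a * total c x a\<bar> powr p) {a\<in>A. J \<le> lvl a} (r ^ J / (1 - r))"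
      if "sums_le (\<lambda>a. \<bar>x a\<bar> powr p) A 1" for x
      using p by (intro total_sums_le[OF _ c \<theta> r lam(1,3) that]) auto
    have "sums_le (\<lambda>a. 2 powr (p - 1) * (\<bar>lam ^ lvl a * total c x a\<bar> powr p + \<bar>lam ^ lvl a * total c y a\<bar> powr p)) {a\<in>A. J \<le> lvl a}
        (2 powr (p - 1) * (r ^ J / (1 - r) + r ^ J / (1 - r)))"
      by (intro sums_le_cmult sums_le_add t x y) simp
    then have "sums_le (?D x y) {a\<in>A. J \<le> lvl a} (\<epsilon> / 2)"
    proof (rule sums_le_mono)
      have "2 powr p = 2 powr (p - 1) * 2" by (simp add: powr_diff)
      then show "2 powr (p - 1) * (r ^ J / (1 - r) + r ^ J / (1 - r)) \<le> \<epsilon> / 2" using J by simp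
      fix a
      have "?D x y a \<le> (\<bar>lam ^ lvl a * total c x a\<bar> + \<bar>lam ^ lvl a * total c y a\<bar>) powr p"
        using p unfolding right_diff_distrib by (intro powr_mono2) auto
      also have "\<dots> \<le> 2 powr (p - 1) * (\<bar>lam ^ lvl a * total c x a\<bar> powr p + \<bar>lam ^ lvl a * total c y a\<bar> powr p)"
        by (rule powr_add_le_two) (use p in auto)
      finally show "?D x y a \<le> 2 powr (p - 1) * (\<bar>lam ^ lvl a * total c x a\<bar> powr p + \<bar>lam ^ lvl a * total c y a\<bar> powr p)" .
    qed simp
    moreover have "sums_le (?D x y) {a\<in>A. lvl a < J} (\<epsilon> / 2)" using \<eta>(2) x xy by blast
    ultimately have "sums_le (?D x y) ({a\<in>A. J \<le> lvl a} \<union> {a\<in>A. lvl a < J}) (\<epsilon> / 2 + \<epsilon> / 2)"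
      by (rule sums_le_Un) simp
    then show "sums_le (?D x y) A \<epsilon>" by (rule sums_le_mono) auto
  qed
qed

lemma level_bounded:
  assumes c: "\<And>k. \<bar>c k\<bar> \<le> 1" and x: "\<And>a. a \<in> A \<Longrightarrow> \<bar>x a\<bar> \<le> 1"
  shows "\<bar>level c x j a\<bar> \<le> 1"
proof (induction j arbitrary: a)
  case 0
  show ?case
  proof (cases "a \<in> (\<lambda>\<alpha>. e 0 {\<alpha>}) ` A")
    case True
    then show ?thesis using x level_zero_e by (auto simp del: level.simps)
  qed (simp add: level_zero_off del: level.simps)
next
  case (Suc j)
  show ?case
  proof (cases "a \<in> e (Suc j) ` odd3_sets A")
    case True
    then obtain F where F: "F \<in> odd3_sets A" "a = e (Suc j) F" by auto
    have "\<bar>c (card F)\<bar> * (\<Prod>b\<in>F. \<bar>level c x j b\<bar>) \<le> 1 * 1"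
      using Suc.IH by (intro mult_mono c prod_le_1 prod_nonneg) auto
    then show ?thesis by (simp add: F level_Suc_e abs_mult abs_prod del: level.simps)
  qed (simp add: level_Suc_off del: level.simps)
qed

text \<open>In the sup norm a product over k elements of modulus at most 1 is k-Lipschitz, and the
  weight absorbs the factor k. The constant is thus 1 at every level, uniformly, although nothing
  decays from level to level in this norm.\<close>

lemma level_lipschitz:
  assumes c: "\<And>k. \<bar>c k\<bar> \<le> 1" "\<And>k. odd k \<Longrightarrow> 3 \<le> k \<Longrightarrow> real k * \<bar>c k\<bar> \<le> 1"
    and x: "\<And>a. a \<in> A \<Longrightarrow> \<bar>x a\<bar> \<le> 1" and y: "\<And>a. a \<in> A \<Longrightarrow> \<bar>y a\<bar> \<le> 1"
    and xy: "\<And>a. a \<in> A \<Longrightarrow> \<bar>x a - y a\<bar> \<le> d" and d: "0 \<le> d"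
  shows "\<bar>level c x j a - level c y j a\<bar> \<le> d"
proof (induction j arbitrary: a)
  case 0
  show ?case
  proof (cases "a \<in> (\<lambda>\<alpha>. e 0 {\<alpha>}) ` A")
    case True
    then show ?thesis using xy level_zero_e by (auto simp del: level.simps)
  qed (simp add: level_zero_off d del: level.simps)
next
  case (Suc j)
  show ?case
  proof (cases "a \<in> e (Suc j) ` odd3_sets A")
    case True
    then obtain F where F: "F \<in> odd3_sets A" "a = e (Suc j) F" by auto
    have "\<bar>(\<Prod>b\<in>F. level c x j b) - (\<Prod>b\<in>F. level c y j b)\<bar> \<le> (\<Sum>b\<in>F. \<bar>level c x j b - level c y j b\<bar>)"
      using norm_prod_diff[of F "level c x j" "level c y j"] level_bounded[where c=c, OF c(1) x] level_bounded[where c=c, OF c(1) y] by simp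
    also have "\<dots> \<le> real (card F) * d"
      using Suc.IH sum_bounded_above[of F "\<lambda>b. \<bar>level c x j b - level c y j b\<bar>" d] by simp
    finally have "\<bar>c (card F)\<bar> * \<bar>(\<Prod>b\<in>F. level c x j b) - (\<Prod>b\<in>F. level c y j b)\<bar> \<le> \<bar>c (card F)\<bar> * (real (card F) * d)"
      by (intro mult_left_mono) auto
    also have "\<dots> = (real (card F) * \<bar>c (card F)\<bar>) * d" by simp
    also have "\<dots> \<le> 1 * d" using odd3D[OF F(1)] d by (intro mult_right_mono c(2)) auto
    finally show ?thesis
      unfolding F(2) level_Suc_e[OF F(1)] right_diff_distrib[symmetric] abs_mult by simp
  qed (simp add: level_Suc_off d del: level.simps)
qed

text \<open>Every coordinate of every level is built from finitely many coordinates of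
  \<open>u t\<close> by multiplication, so coordinatewise continuity is enough. In the applications
  \<open>T\<close> is a weak topology.\<close>

lemma level_continuous:
  fixes u :: "'t \<Rightarrow> 'a \<Rightarrow> real"
  assumes u: "\<And>\<alpha>. \<alpha> \<in> A \<Longrightarrow> continuous_map T euclidean (\<lambda>t. u t \<alpha>)"
  shows "continuous_map T euclidean (\<lambda>t. level c (u t) j a)"
proof (induction j arbitrary: a)
  case 0
  show ?case
  proof (cases "a \<in> (\<lambda>\<alpha>. e 0 {\<alpha>}) ` A")
    case True
    then show ?thesis using u level_zero_e by (auto simp del: level.simps)
  qed (simp add: level_zero_off del: level.simps)
next
  case (Suc j)
  show ?case
  proof (cases "a \<in> e (Suc j) ` odd3_sets A")
    case True
    then obtain F where F: "F \<in> odd3_sets A" "a = e (Suc j) F" by auto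
    show ?thesis unfolding F(2) level_Suc_e[OF F(1)]
      by (intro continuous_map_real_mult continuous_map_prod Suc.IH) (use odd3D[OF F(1)] in auto)
  qed (simp add: level_Suc_off del: level.simps)
qed

text \<open>\<open>m j k\<close> is the joint multiplier of the two families on a set of k elements
  in level j. On singletons the terms are \<open>h a\<close> and add up to \<open>H0 + H1\<close>,
  level 0 and the levels above. By \<open>m3\<close> a larger odd set \<open>F\<close> carries minus
  the term of the coordinate \<open>up F\<close>, and these coordinates exhaust the nonzero terms
  above level 0, so the larger sets add up to \<open>- H1\<close>. What survives is
  \<open>H0\<close>, the original pairing. The assumption \<open>S\<close> supplies the absolute
  summability behind the rearrangement.\<close>

lemma paired_products_has_sum:
  fixes x y :: "'a \<Rightarrow> real" and m :: "nat \<Rightarrow> nat \<Rightarrow> complex" and lam :: complex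
  assumes m1: "\<And>j. m j 1 = lam ^ j"
    and m3: "\<And>j k. odd k \<Longrightarrow> 3 \<le> k \<Longrightarrow> m j k = - (lam ^ Suc j * complex_of_real (c k * c' k))"
    and S: "sums_le (\<lambda>a. cmod (lam ^ lvl a * complex_of_real (total c x a * total c' y a))) A S"
  shows "((\<lambda>F. m (flev F) (card F) * complex_of_real ((\<Prod>b\<in>F. level c x (flev F) b) * (\<Prod>b\<in>F. level c' y (flev F) b)))
     has_sum (\<Sum>\<^sub>\<infinity>\<alpha>\<in>A. complex_of_real (x \<alpha> * y \<alpha>))) (odd_sets A)"
proof -
  define h where "h a = lam ^ lvl a * complex_of_real (total c x a * total c' y a)" for a
  define g where "g F = m (flev F) (card F) * complex_of_real ((\<Prod>b\<in>F. level c x (flev F) b) * (\<Prod>b\<in>F. level c' y (flev F) b))" for F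
  have "(\<lambda>a. cmod (h a)) summable_on A" unfolding h_def by (rule sums_le_summable(1)[OF S]) simp
  then have hs: "h summable_on A" by (rule abs_summable_summable)
  have hs': "h summable_on B" if "B \<subseteq> A" for B using summable_on_subset[OF hs that] by simp
  define A0 where "A0 = {a\<in>A. lvl a = 0}"
  define A1 where "A1 = {a\<in>A. lvl a \<noteq> 0}"
  define H0 where "H0 = infsum h A0"
  define H1 where "H1 = infsum h A1"
  have h0: "(h has_sum H0) A0" and h1: "(h has_sum H1) A1"
    unfolding H0_def H1_def using hs' by (auto simp: A0_def A1_def intro!: has_sum_infsum)
  have "A0 \<union> A1 = A" "A0 \<inter> A1 = {}" by (auto simp: A0_def A1_def)
  then have hA: "(h has_sum (H0 + H1)) A"
    using has_sum_Un_disjoint[OF h0 h1] by simp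
  have "(h has_sum H0) ((\<lambda>\<alpha>. e 0 {\<alpha>}) ` A)"
  proof (rule has_sum_cong_neutral[THEN iffD1, OF _ _ _ h0])
    show "h a = 0" if "a \<in> A0 - (\<lambda>\<alpha>. e 0 {\<alpha>}) ` A" for a
      using that level_zero_off[of a] by (simp add: h_def total_def A0_def del: level.simps)
    show "h a = 0" if "a \<in> (\<lambda>\<alpha>. e 0 {\<alpha>}) ` A - A0" for a
      using that by (auto simp: A0_def e_mem lvl_e)
  qed simp
  then have "((\<lambda>\<alpha>. h (e 0 {\<alpha>})) has_sum H0) A"
    by (simp add: has_sum_reindex[OF inj_e_zero] o_def)
  moreover have "h (e 0 {\<alpha>}) = complex_of_real (x \<alpha> * y \<alpha>)" if "\<alpha> \<in> A" for \<alpha>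
    using that by (simp add: h_def total_def lvl_e level_zero_e del: level.simps)
  ultimately have "((\<lambda>\<alpha>. complex_of_real (x \<alpha> * y \<alpha>)) has_sum H0) A"
    by (subst has_sum_cong[symmetric]) auto
  then have H0: "(\<Sum>\<^sub>\<infinity>\<alpha>\<in>A. complex_of_real (x \<alpha> * y \<alpha>)) = H0" by (rule infsumI)
  have "(h has_sum H1) (up ` odd3_sets A)"
  proof (rule has_sum_cong_neutral[THEN iffD1, OF _ _ _ h1])
    show "h a = 0" if a: "a \<in> A1 - up ` odd3_sets A" for a
    proof (rule ccontr)
      assume "h a \<noteq> 0"
      then have nz: "total c x a \<noteq> 0" by (auto simp: h_def)
      obtain j where j: "lvl a = Suc j" using a by (auto simp: A1_def gr0_conv_Suc)
      have "a \<in> e (Suc j) ` odd3_sets A" using nz level_Suc_off[of a j c x] j by (auto simp: total_def simp del: level.simps)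
      then obtain F where F: "F \<in> odd3_sets A" "a = e (Suc j) F" by auto
      \<comment> \<open>A nonzero product pins the level of \<open>F\<close> to \<open>j\<close>, so
        that \<open>a\<close> is \<open>up F\<close> and not the copy of \<open>F\<close> at some
        other level.\<close>
      have "(\<Prod>b\<in>F. level c x j b) \<noteq> 0"
      proof -
        have "total c x a = level c x (Suc j) (e (Suc j) F)" by (simp only: total_def j F(2)[symmetric])
        then show ?thesis using nz level_Suc_e[OF F(1), of c x j] by (auto simp del: level.simps)
      qed
      from level_prod_nonzero(2)[OF this] have "flev F = j" using odd3D[OF F(1)] by auto
      then have "a = up F" using F(2) by (simp add: up_def)
      then show False using a F(1) by auto
    qed
    show "h a = 0" if "a \<in> up ` odd3_sets A - A1" for a
      using that up_mem by (auto simp: A1_def)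
  qed simp
  then have "((\<lambda>F. - h (up F)) has_sum - H1) (odd3_sets A)"
    by (simp add: has_sum_reindex[OF inj_up] o_def has_sum_uminus)
  moreover have "g F = - h (up F)" if F: "F \<in> odd3_sets A" for F
  proof -
    have "h (up F) = lam ^ Suc (flev F) * complex_of_real ((c (card F) * (\<Prod>b\<in>F. level c x (flev F) b)) * (c' (card F) * (\<Prod>b\<in>F. level c' y (flev F) b)))"
      unfolding h_def total_up[OF F] using up_mem[OF F] by simp
    then show ?thesis using m3[of "card F" "flev F"] odd3D[OF F] by (simp add: g_def mult_ac)
  qed
  ultimately have g3: "(g has_sum - H1) (odd3_sets A)" by (subst has_sum_cong) auto
  have g1': "g {a} = h a" for a
  proof -
    have "flev {a} = lvl a" by (rule flev_eq) auto
    then show ?thesis using m1[of "lvl a"] by (simp add: g_def h_def total_def)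
  qed
  have "(g has_sum (H0 + H1)) ((\<lambda>a. {a}) ` A)"
    using hA by (subst has_sum_reindex) (auto simp: o_def g1' inj_on_def)
  moreover have "(\<lambda>a. {a}) ` A \<inter> odd3_sets A = {}" by (auto simp: odd3_sets_def)
  ultimately have "(g has_sum (H0 + H1 + - H1)) ((\<lambda>a. {a}) ` A \<union> odd3_sets A)"
    by (intro has_sum_Un_disjoint g3)
  moreover have "(\<lambda>a. {a}) ` A \<union> odd3_sets A = odd_sets A"
  proof (intro antisym subsetI)
    fix F assume F: "F \<in> odd_sets A"
    show "F \<in> (\<lambda>a. {a}) ` A \<union> odd3_sets A"
    proof (cases "card F = 1")
      case True
      then obtain a where "F = {a}" by (rule card_1_singletonE)
      then show ?thesis using F by (auto simp: odd_sets_def)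
    next
      case False
      then have "3 \<le> card F" using F by (auto simp: odd_sets_def elim!: oddE)
      then show ?thesis using F by (auto simp: odd_sets_def odd3_sets_def)
    qed
  qed (auto simp: odd_sets_def odd3_sets_def)
  ultimately show ?thesis unfolding H0 g_def by simp
qed

end

section \<open>Walsh transforms of combinations of Riesz products\<close>

definition walsh_fun :: "'a set \<Rightarrow> 'a set \<Rightarrow> ('a \<Rightarrow> complex) \<Rightarrow> complex"
  where "walsh_fun A F = (\<lambda>\<omega>\<in>cube A. \<Prod>\<alpha>\<in>F. rademacher \<alpha> \<omega>)"

lemma walsh_eq_image: "walsh A = walsh_fun A ` {F. finite F \<and> F \<subseteq> A}"
  by (auto simp: walsh_def walsh_fun_def)

lemma walsh_fun_apply: "\<omega> \<in> cube A \<Longrightarrow> walsh_fun A F \<omega> = (\<Prod>\<alpha>\<in>F. \<omega> \<alpha>)"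
  by (simp add: walsh_fun_def rademacher_def)

text \<open>The point with -1 at \<alpha> and 1 elsewhere detects whether \<alpha> belongs to the
  index set.\<close>

lemma inj_walsh_fun: "inj_on (walsh_fun A) {F. finite F \<and> F \<subseteq> A}"
proof (rule inj_onI)
  fix F G assume F: "F \<in> {F. finite F \<and> F \<subseteq> A}" and G: "G \<in> {F. finite F \<and> F \<subseteq> A}"
    and eq: "walsh_fun A F = walsh_fun A G"
  have "\<alpha> \<in> F \<longleftrightarrow> \<alpha> \<in> G" if \<alpha>: "\<alpha> \<in> A" for \<alpha>
  proof -
    define \<omega> :: "'a \<Rightarrow> complex" where "\<omega> = (\<lambda>\<beta>\<in>A. if \<beta> = \<alpha> then -1 else 1)"
    have \<omega>: "\<omega> \<in> cube A" by (auto simp: \<omega>_def cube_def)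
    have *: "(\<Prod>\<beta>\<in>H. \<omega> \<beta>) = (if \<alpha> \<in> H then -1 else 1)" if "H \<in> {F. finite F \<and> F \<subseteq> A}" for H
    proof -
      have "(\<Prod>\<beta>\<in>H. \<omega> \<beta>) = (\<Prod>\<beta>\<in>H. if \<beta> = \<alpha> then -1 else 1)"
        using that by (intro prod.cong) (auto simp: \<omega>_def)
      then show ?thesis using that by simp
    qed
    have "(\<Prod>\<beta>\<in>F. \<omega> \<beta>) = (\<Prod>\<beta>\<in>G. \<omega> \<beta>)"
      using fun_cong[OF eq, of \<omega>] by (simp add: walsh_fun_apply[OF \<omega>])
    then show ?thesis using *[OF F] *[OF G] by (auto split: if_splits)
  qed
  then show "F = G" using F G by blast
qed

lemma sums_le_walsh:
  assumes "sums_le (\<lambda>F. g (walsh_fun A F)) {F. finite F \<and> F \<subseteq> A} S"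
  shows "sums_le g (walsh A) S"
proof (rule sums_leI)
  fix B assume B: "finite B" "B \<subseteq> walsh A"
  then obtain C where C: "C \<subseteq> {F. finite F \<and> F \<subseteq> A}" "finite C" "B = walsh_fun A ` C"
    using finite_subset_image[OF B(1) B(2)[unfolded walsh_eq_image]] by auto
  have "sum g B = (\<Sum>F\<in>C. g (walsh_fun A F))"
    unfolding C(3) by (rule sum.reindex_cong[OF inj_on_subset[OF inj_walsh_fun C(1)]]) auto
  also have "\<dots> \<le> S" by (rule sums_leD[OF assms C(2,1)])
  finally show "sum g B \<le> S" .
qed

lemma walsh_fun_measurable: "F \<subseteq> A \<Longrightarrow> walsh_fun A F \<in> borel_measurable (cube_borel A)"
  by (subst measurable_cong[of _ _ "\<lambda>\<omega>. \<Prod>\<alpha>\<in>F. \<omega> \<alpha>"])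
    (auto simp: walsh_fun_apply intro: prod_coordinate_measurable)

lemma continuous_uniform_approximation:
  fixes h :: "'t \<Rightarrow> complex"
  assumes "\<And>\<epsilon>. 0 < \<epsilon> \<Longrightarrow> \<exists>k. continuous_map T euclidean k \<and> (\<forall>x\<in>topspace T. cmod (h x - k x) < \<epsilon>)"
  shows "continuous_map T euclidean h"
proof -
  have "\<exists>k. continuous_map T euclidean k \<and> (\<forall>x\<in>topspace T. cmod (h x - k x) < 1 / real (Suc n))" for n
    by (rule assms) simp
  then obtain k where k: "\<And>n. continuous_map T euclidean (k n)"
    "\<And>n x. x \<in> topspace T \<Longrightarrow> cmod (h x - k n x) < 1 / real (Suc n)" by metis
  have "continuous_map T Met_TC.mtopology h"
  proof (rule Met_TC.continuous_map_uniform_limit[where F=sequentially and X=T and f=k])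
    show "\<forall>\<^sub>F n in sequentially. continuous_map T Met_TC.mtopology (k n)" using k(1) by simp
    fix \<epsilon> :: real assume "0 < \<epsilon>"
    then have "\<forall>\<^sub>F n in sequentially. 1 / real (Suc n) < \<epsilon>"
      by (intro order_tendstoD(2)[OF LIMSEQ_Suc[OF lim_1_over_n]]) auto
    then show "\<forall>\<^sub>F n in sequentially. \<forall>x\<in>topspace T. h x \<in> UNIV \<and> dist (k n x) (h x) < \<epsilon>"
    proof eventually_elim
      case (elim n)
      show ?case
      proof (intro ballI conjI UNIV_I)
        fix x assume "x \<in> topspace T"
        from k(2)[OF this, of n] elim show "dist (k n x) (h x) < \<epsilon>"
          by (simp add: dist_norm norm_minus_commute)
      qed
    qed
  qed simp
  then show ?thesis by simp
qed

lemma continuous_map_complex_linear_combination: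
  fixes f :: "'i \<Rightarrow> 't \<Rightarrow> complex"
  assumes "finite I" "\<And>i. i \<in> I \<Longrightarrow> continuous_map T euclidean (f i)"
  shows "continuous_map T euclidean (\<lambda>x. \<Sum>i\<in>I. c i * f i x)"
  using assms
proof (induction I rule: finite_induct)
  case (insert i I)
  have "continuous_map T euclidean (\<lambda>x. c i * f i x)"
    using continuous_map_compose[of T euclidean "f i" euclidean "\<lambda>z. c i * z"] insert.prems
    by (simp add: o_def continuous_on_mult_left)
  then show ?case using insert by (simp add: continuous_map_add)
qed simp

section \<open>Complex measures as combinations of four finite measures\<close>

definition complex_combination ::
    "'b measure \<Rightarrow> 'b measure \<Rightarrow> 'b measure \<Rightarrow> 'b measure \<Rightarrow> 'b set \<Rightarrow> complex"
  where "complex_combination N1 N2 N3 N4 E =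
    complex_of_real (measure N1 E - measure N2 E) + \<i> * complex_of_real (measure N3 E - measure N4 E)"

lemma total_variation_combination_le:
  assumes fin: "finite_measure N1" "finite_measure N2" "finite_measure N3" "finite_measure N4"
    and s: "sets N1 = sets M" "sets N2 = sets M" "sets N3 = sets M" "sets N4 = sets M"
    and E: "E \<in> sets M"
  shows "total_variation M (complex_combination N1 N2 N3 N4) E
    \<le> measure N1 E + measure N2 E + measure N3 E + measure N4 E"
  unfolding total_variation_def
proof (rule cSUP_least)
  have "{E} \<in> {\<P>. finite \<P> \<and> disjoint \<P> \<and> \<P> \<subseteq> sets M \<and> \<Union>\<P> = E}" using E by auto
  then show "{\<P>. finite \<P> \<and> disjoint \<P> \<and> \<P> \<subseteq> sets M \<and> \<Union>\<P> = E} \<noteq> {}" by blast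
  fix \<P> assume "\<P> \<in> {\<P>. finite \<P> \<and> disjoint \<P> \<and> \<P> \<subseteq> sets M \<and> \<Union>\<P> = E}"
  then have P: "finite \<P>" "disjoint \<P>" "\<P> \<subseteq> sets M" "\<Union>\<P> = E" by auto
  have m: "(\<Sum>F\<in>\<P>. measure N F) = measure N E" if N: "finite_measure N" "sets N = sets M" for N
  proof -
    interpret finite_measure N by fact
    have "measure N (\<Union>F\<in>\<P>. F) = (\<Sum>F\<in>\<P>. measure N F)"
      using P N by (intro finite_measure_finite_Union) (auto simp: disjoint_def disjoint_family_on_def)
    then show ?thesis using P(4) by simp
  qed
  have "cmod (complex_combination N1 N2 N3 N4 F)
      \<le> measure N1 F + measure N2 F + measure N3 F + measure N4 F" for F
  proof -
    have "cmod (complex_combination N1 N2 N3 N4 F)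
      \<le> cmod (complex_of_real (measure N1 F - measure N2 F)) + cmod (\<i> * complex_of_real (measure N3 F - measure N4 F))"
      unfolding complex_combination_def by (rule norm_triangle_ineq)
    also have "\<dots> = \<bar>measure N1 F - measure N2 F\<bar> + \<bar>measure N3 F - measure N4 F\<bar>"
      by (simp only: norm_mult norm_of_real norm_ii mult_1)
    also have "\<dots> \<le> measure N1 F + measure N2 F + measure N3 F + measure N4 F"
      using measure_nonneg[of N1 F] measure_nonneg[of N2 F] measure_nonneg[of N3 F] measure_nonneg[of N4 F]
      by linarith
    finally show ?thesis .
  qed
  then have "(\<Sum>F\<in>\<P>. cmod (complex_combination N1 N2 N3 N4 F))
      \<le> (\<Sum>F\<in>\<P>. measure N1 F + measure N2 F + measure N3 F + measure N4 F)"
    by (rule sum_mono)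
  also have "\<dots> = measure N1 E + measure N2 E + measure N3 E + measure N4 E"
    by (simp only: sum.distrib m[OF fin(1) s(1)] m[OF fin(2) s(2)] m[OF fin(3) s(3)] m[OF fin(4) s(4)])
  finally show "(\<Sum>F\<in>\<P>. cmod (complex_combination N1 N2 N3 N4 F))
      \<le> measure N1 E + measure N2 E + measure N3 E + measure N4 E" .
qed

text \<open>The union of four compact sets and the intersection of four open sets serve all measures
  at once, and the total variation is at most the sum of the four measures.\<close>

lemma complex_combination_regular:
  assumes fin: "finite_measure N1" "finite_measure N2" "finite_measure N3" "finite_measure N4"
    and s: "sets N1 = sets (cube_borel A)" "sets N2 = sets (cube_borel A)"
      "sets N3 = sets (cube_borel A)" "sets N4 = sets (cube_borel A)"
    and r: "regular_set_function (cube_topology A) (sets N1) (measure N1)"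
      "regular_set_function (cube_topology A) (sets N2) (measure N2)"
      "regular_set_function (cube_topology A) (sets N3) (measure N3)"
      "regular_set_function (cube_topology A) (sets N4) (measure N4)"
  shows "complex_combination N1 N2 N3 N4 \<in> regular_complex_measures A"
proof -
  let ?M = "cube_borel A" and ?\<mu> = "complex_combination N1 N2 N3 N4"
  have haus: "Hausdorff_space (cube_topology A)"
    by (auto simp: cube_topology_def Hausdorff_space_product_topology Hausdorff_space_discrete_topology)
  have "?\<mu> \<in> complex_measures ?M"
    unfolding complex_measures_def
  proof (intro CollectI conjI allI impI)
    fix E assume "E \<notin> sets ?M"
    then show "?\<mu> E = 0" using s by (simp add: complex_combination_def measure_notin_sets)
  next
    fix E :: "nat \<Rightarrow> _" assume E: "range E \<subseteq> sets ?M \<and> disjoint_family E"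
    have "(\<lambda>n. measure N (E n)) sums measure N (\<Union>n. E n)"
      if "finite_measure N" "sets N = sets ?M" for N
      using finite_measure.finite_measure_UNION[OF that(1), of E] E that by auto
    then show "(\<lambda>n. ?\<mu> (E n)) sums ?\<mu> (\<Union>n. E n)"
      unfolding complex_combination_def
      by (intro sums_add sums_mult sums_of_real sums_diff) (use fin s in auto)
  qed
  moreover have "regular_set_function (cube_topology A) (sets ?M) (total_variation ?M ?\<mu>)"
    unfolding regular_set_function_def
  proof (intro ballI allI impI)
    fix E and \<epsilon> :: real assume E: "E \<in> sets ?M" and e: "\<epsilon> > 0"
    have "\<exists>K U. compactin (cube_topology A) K \<and> openin (cube_topology A) U \<and> K \<subseteq> E \<and> E \<subseteq> U \<and> measure N (U - K) < \<epsilon> / 4"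
      if "regular_set_function (cube_topology A) (sets N) (measure N)" "sets N = sets ?M" for N
      using that E e unfolding regular_set_function_def by (metis zero_less_divide_iff zero_less_numeral)
    from this[OF r(1) s(1)] this[OF r(2) s(2)] this[OF r(3) s(3)] this[OF r(4) s(4)]
    obtain K1 U1 K2 U2 K3 U3 K4 U4 where
      KU1: "compactin (cube_topology A) K1" "openin (cube_topology A) U1" "K1 \<subseteq> E" "E \<subseteq> U1" "measure N1 (U1 - K1) < \<epsilon> / 4" and
      KU2: "compactin (cube_topology A) K2" "openin (cube_topology A) U2" "K2 \<subseteq> E" "E \<subseteq> U2" "measure N2 (U2 - K2) < \<epsilon> / 4" and
      KU3: "compactin (cube_topology A) K3" "openin (cube_topology A) U3" "K3 \<subseteq> E" "E \<subseteq> U3" "measure N3 (U3 - K3) < \<epsilon> / 4" and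
      KU4: "compactin (cube_topology A) K4" "openin (cube_topology A) U4" "K4 \<subseteq> E" "E \<subseteq> U4" "measure N4 (U4 - K4) < \<epsilon> / 4"
      by (elim exE conjE) blast
    define K where "K = K1 \<union> K2 \<union> K3 \<union> K4"
    define U where "U = U1 \<inter> U2 \<inter> U3 \<inter> U4"
    have K: "compactin (cube_topology A) K" unfolding K_def using KU1 KU2 KU3 KU4 by (intro compactin_Un)
    have U: "openin (cube_topology A) U" unfolding U_def using KU1 KU2 KU3 KU4 by (intro openin_Int)
    have KE: "K \<subseteq> E" "E \<subseteq> U" unfolding K_def U_def using KU1 KU2 KU3 KU4 by auto
    have sU: "V - C \<in> sets ?M" if "compactin (cube_topology A) C" "openin (cube_topology A) V" for C V
      using openin_sets_cube[OF openin_diff[OF that(2) compactin_imp_closedin[OF haus that(1)]]] .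
    have le: "measure N (U - K) < \<epsilon> / 4"
      if "finite_measure N" "sets N = sets ?M" "measure N (U' - K') < \<epsilon> / 4" "K' \<subseteq> K" "U \<subseteq> U'"
        "compactin (cube_topology A) K'" "openin (cube_topology A) U'" for N K' U'
    proof -
      have "measure N (U - K) \<le> measure N (U' - K')"
        using that sU[OF that(6,7)] by (intro finite_measure.finite_measure_mono[OF that(1)]) auto
      then show ?thesis using that(3) by simp
    qed
    have "measure N1 (U - K) < \<epsilon> / 4" by (rule le[OF fin(1) s(1) KU1(5) _ _ KU1(1,2)]) (auto simp: K_def U_def)
    moreover have "measure N2 (U - K) < \<epsilon> / 4" by (rule le[OF fin(2) s(2) KU2(5) _ _ KU2(1,2)]) (auto simp: K_def U_def)
    moreover have "measure N3 (U - K) < \<epsilon> / 4" by (rule le[OF fin(3) s(3) KU3(5) _ _ KU3(1,2)]) (auto simp: K_def U_def)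
    moreover have "measure N4 (U - K) < \<epsilon> / 4" by (rule le[OF fin(4) s(4) KU4(5) _ _ KU4(1,2)]) (auto simp: K_def U_def)
    ultimately have "total_variation ?M ?\<mu> (U - K) < \<epsilon>"
      using total_variation_combination_le[OF fin s sU[OF K U]] by linarith
    then show "\<exists>K U. compactin (cube_topology A) K \<and> openin (cube_topology A) U \<and> K \<subseteq> E \<and> E \<subseteq> U \<and>
        total_variation ?M ?\<mu> (U - K) < \<epsilon>"
      using K U KE by blast
  qed
  ultimately show ?thesis by (simp add: regular_complex_measures_def)
qed

context haar_cube
begin

lemma walsh_transform_density:
  assumes f: "f \<in> borel_measurable (cube_borel A)" "\<And>\<omega>. \<omega> \<in> cube A \<Longrightarrow> cmod (f \<omega>) \<le> D"
    and F: "finite F" "F \<subseteq> A"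
  shows "walsh_transform A (density_measure P f) (walsh_fun A F) = (\<integral>\<omega>. f \<omega> * (\<Prod>\<alpha>\<in>F. \<omega> \<alpha>) \<partial>P)"
proof -
  have "walsh_fun A F \<in> walsh A" using F by (auto simp: walsh_eq_image)
  moreover have "complex_measure_integral (cube_borel A) (density_measure P f) (walsh_fun A F)
      = (\<integral>\<omega>. f \<omega> * walsh_fun A F \<omega> \<partial>P)"
    by (rule complex_measure_integral_density[where D=D and C=1])
      (use f F in \<open>auto simp: sets_P finite_measure_axioms walsh_fun_measurable walsh_fun_apply norm_prod_coordinate\<close>)
  moreover have "(\<integral>\<omega>. f \<omega> * walsh_fun A F \<omega> \<partial>P) = (\<integral>\<omega>. f \<omega> * (\<Prod>\<alpha>\<in>F. \<omega> \<alpha>) \<partial>P)"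
    by (intro Bochner_Integration.integral_cong refl) (simp add: walsh_fun_apply)
  ultimately show ?thesis by (simp add: walsh_transform_def)
qed

section \<open>The odd parts of the two kinds of products\<close>

definition is_phi :: "('a \<Rightarrow> real) \<Rightarrow> (('a \<Rightarrow> complex) \<Rightarrow> real) \<Rightarrow> bool"
  where "is_phi z f \<longleftrightarrow> f \<in> borel_measurable (cube_borel A) \<and> (\<forall>\<omega>. \<bar>f \<omega>\<bar> \<le> sqrt (exp 1)) \<and>
    (\<forall>F. finite F \<and> F \<subseteq> A \<longrightarrow> (\<integral>\<omega>. complex_of_real (f \<omega>) * (\<Prod>\<alpha>\<in>F. \<omega> \<alpha>) \<partial>P)
      = complex_of_real (odd_sign (card F) * (\<Prod>\<alpha>\<in>F. z \<alpha>)))"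

definition phi0 :: "('a \<Rightarrow> real) \<Rightarrow> ('a \<Rightarrow> complex) \<Rightarrow> real"
  where "phi0 z = (SOME f. is_phi z f)"

text \<open>Antisymmetrised, because the choice of \<open>phi0\<close> need not commute with \<open>z \<mapsto> - z\<close>.\<close>

definition phi :: "('a \<Rightarrow> real) \<Rightarrow> ('a \<Rightarrow> complex) \<Rightarrow> real"
  where "phi z \<omega> = (phi0 z \<omega> - phi0 (\<lambda>\<alpha>. - z \<alpha>) \<omega>) / 2"

lemma phi_minus: "phi (\<lambda>\<alpha>. - z \<alpha>) \<omega> = - phi z \<omega>"
  by (simp add: phi_def minus_divide_left)

text \<open>On odd sets the coefficients for \<open>z\<close> and \<open>- z\<close> are opposite
  and on even sets both are 0, so antisymmetrising the chosen functions changes no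
  coefficient.\<close>

lemma phi:
  assumes z: "sums_le (\<lambda>\<alpha>. (z \<alpha>)\<^sup>2) A 1"
  shows phi_measurable: "phi z \<in> borel_measurable (cube_borel A)"
    and phi_bound: "\<bar>phi z \<omega>\<bar> \<le> sqrt (exp 1)"
    and phi_walsh: "finite F \<Longrightarrow> F \<subseteq> A \<Longrightarrow> (\<integral>\<omega>. complex_of_real (phi z \<omega>) * (\<Prod>\<alpha>\<in>F. \<omega> \<alpha>) \<partial>P)
      = complex_of_real (odd_sign (card F) * (\<Prod>\<alpha>\<in>F. z \<alpha>))"
proof -
  have *: "is_phi y (phi0 y)" if "sums_le (\<lambda>\<alpha>. (y \<alpha>)\<^sup>2) A 1" for y
  proof -
    have "\<exists>f. is_phi y f"
      unfolding is_phi_def by (rule imaginary_product_function_exists) (rule sums_leD[OF that])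
    then show ?thesis unfolding phi0_def by (rule someI_ex)
  qed
  have z': "sums_le (\<lambda>\<alpha>. (- z \<alpha>)\<^sup>2) A 1" using z by simp
  have p: "phi0 z \<in> borel_measurable (cube_borel A)" "\<bar>phi0 z \<omega>\<bar> \<le> sqrt (exp 1)"
    "finite F \<Longrightarrow> F \<subseteq> A \<Longrightarrow> (\<integral>\<omega>. complex_of_real (phi0 z \<omega>) * (\<Prod>\<alpha>\<in>F. \<omega> \<alpha>) \<partial>P)
      = complex_of_real (odd_sign (card F) * (\<Prod>\<alpha>\<in>F. z \<alpha>))" for \<omega> F
    using *[OF z] unfolding is_phi_def by blast+
  have m: "phi0 (\<lambda>\<alpha>. - z \<alpha>) \<in> borel_measurable (cube_borel A)" "\<bar>phi0 (\<lambda>\<alpha>. - z \<alpha>) \<omega>\<bar> \<le> sqrt (exp 1)"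
    "finite F \<Longrightarrow> F \<subseteq> A \<Longrightarrow> (\<integral>\<omega>. complex_of_real (phi0 (\<lambda>\<alpha>. - z \<alpha>) \<omega>) * (\<Prod>\<alpha>\<in>F. \<omega> \<alpha>) \<partial>P)
      = complex_of_real (odd_sign (card F) * (\<Prod>\<alpha>\<in>F. - z \<alpha>))" for \<omega> F
    using *[OF z'] unfolding is_phi_def by blast+
  have pm: "phi z = (\<lambda>\<omega>. (phi0 z \<omega> - phi0 (\<lambda>\<alpha>. - z \<alpha>) \<omega>) / 2)" by (simp add: phi_def fun_eq_iff)
  show "phi z \<in> borel_measurable (cube_borel A)"
    unfolding pm using p(1) m(1) by (intro borel_measurable_divide borel_measurable_diff) auto
  show "\<bar>phi z \<omega>\<bar> \<le> sqrt (exp 1)"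
    using p(2)[of \<omega>] m(2)[of \<omega>] unfolding phi_def by (simp add: abs_le_iff)
  assume F: "finite F" "F \<subseteq> A"
  have i: "integrable P (\<lambda>\<omega>. complex_of_real (f \<omega>) * (\<Prod>\<alpha>\<in>F. \<omega> \<alpha>))"
    if "f \<in> borel_measurable (cube_borel A)" "\<And>\<omega>. \<bar>f \<omega>\<bar> \<le> sqrt (exp 1)" for f
  proof (rule bounded_integrable[where C="sqrt (exp 1)"])
    show "(\<lambda>\<omega>. complex_of_real (f \<omega>) * (\<Prod>\<alpha>\<in>F. \<omega> \<alpha>)) \<in> borel_measurable (cube_borel A)"
      using that(1) prod_coordinate_measurable[OF F(2)] by simp
    show "cmod (complex_of_real (f \<omega>) * (\<Prod>\<alpha>\<in>F. \<omega> \<alpha>)) \<le> sqrt (exp 1)" if "\<omega> \<in> cube A" for \<omega>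
      using \<open>\<And>\<omega>. \<bar>f \<omega>\<bar> \<le> sqrt (exp 1)\<close>[of \<omega>] by (simp add: norm_mult norm_prod_coordinate[OF that F(2)])
  qed
  have "(\<integral>\<omega>. complex_of_real (phi z \<omega>) * (\<Prod>\<alpha>\<in>F. \<omega> \<alpha>) \<partial>P)
     = (\<integral>\<omega>. (complex_of_real (phi0 z \<omega>) * (\<Prod>\<alpha>\<in>F. \<omega> \<alpha>) - complex_of_real (phi0 (\<lambda>\<alpha>. - z \<alpha>) \<omega>) * (\<Prod>\<alpha>\<in>F. \<omega> \<alpha>)) / 2 \<partial>P)"
    unfolding pm by (intro Bochner_Integration.integral_cong refl) (simp add: diff_divide_distrib left_diff_distrib)
  also have "\<dots> = ((\<integral>\<omega>. complex_of_real (phi0 z \<omega>) * (\<Prod>\<alpha>\<in>F. \<omega> \<alpha>) \<partial>P)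
      - (\<integral>\<omega>. complex_of_real (phi0 (\<lambda>\<alpha>. - z \<alpha>) \<omega>) * (\<Prod>\<alpha>\<in>F. \<omega> \<alpha>) \<partial>P)) / 2"
    unfolding Bochner_Integration.integral_divide_zero
    by (subst Bochner_Integration.integral_diff[OF i[OF p(1,2)] i[OF m(1,2)]]) simp
  also have "\<dots> = complex_of_real ((odd_sign (card F) * (\<Prod>\<alpha>\<in>F. z \<alpha>) - odd_sign (card F) * (\<Prod>\<alpha>\<in>F. - z \<alpha>)) / 2)"
    using p(3)[of F] m(3)[of F] F by (simp only: of_real_divide of_real_diff) simp
  also have "(odd_sign (card F) * (\<Prod>\<alpha>\<in>F. z \<alpha>) - odd_sign (card F) * (\<Prod>\<alpha>\<in>F. - z \<alpha>)) / 2
      = odd_sign (card F) * (\<Prod>\<alpha>\<in>F. z \<alpha>)"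
    by (cases "even (card F)") (simp_all add: odd_sign_even prod_uminus)
  finally show "(\<integral>\<omega>. complex_of_real (phi z \<omega>) * (\<Prod>\<alpha>\<in>F. \<omega> \<alpha>) \<partial>P)
      = complex_of_real (odd_sign (card F) * (\<Prod>\<alpha>\<in>F. z \<alpha>))" .
qed

definition is_riesz :: "('a \<Rightarrow> real) \<Rightarrow> ('a \<Rightarrow> complex) measure \<Rightarrow> bool"
  where "is_riesz z M \<longleftrightarrow> sets M = sets (cube_borel A) \<and> finite_measure M \<and> measure M (cube A) = 1 \<and>
    regular_set_function (cube_topology A) (sets M) (measure M) \<and>
    (\<forall>F. finite F \<and> F \<subseteq> A \<longrightarrow> (\<integral>\<omega>. (\<Prod>\<alpha>\<in>F. \<omega> \<alpha>) \<partial>M) = complex_of_real (\<Prod>\<alpha>\<in>F. z \<alpha>))"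

definition riesz :: "('a \<Rightarrow> real) \<Rightarrow> ('a \<Rightarrow> complex) measure"
  where "riesz z = (SOME M. is_riesz z M)"

lemma riesz:
  assumes "\<forall>\<alpha>\<in>A. \<bar>z \<alpha>\<bar> \<le> 1"
  shows "sets (riesz z) = sets (cube_borel A)" "finite_measure (riesz z)" "measure (riesz z) (cube A) = 1"
    "regular_set_function (cube_topology A) (sets (riesz z)) (measure (riesz z))"
    "finite F \<Longrightarrow> F \<subseteq> A \<Longrightarrow> (\<integral>\<omega>. (\<Prod>\<alpha>\<in>F. \<omega> \<alpha>) \<partial>riesz z) = complex_of_real (\<Prod>\<alpha>\<in>F. z \<alpha>)"
proof -
  have "\<exists>M. is_riesz z M"
    unfolding is_riesz_def by (rule riesz_measure_exists) (use assms in blast)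
  then have "is_riesz z (riesz z)" unfolding riesz_def by (rule someI_ex)
  then show "sets (riesz z) = sets (cube_borel A)" "finite_measure (riesz z)" "measure (riesz z) (cube A) = 1"
    "regular_set_function (cube_topology A) (sets (riesz z)) (measure (riesz z))"
    "finite F \<Longrightarrow> F \<subseteq> A \<Longrightarrow> (\<integral>\<omega>. (\<Prod>\<alpha>\<in>F. \<omega> \<alpha>) \<partial>riesz z) = complex_of_real (\<Prod>\<alpha>\<in>F. z \<alpha>)"
    unfolding is_riesz_def by blast+
qed

text \<open>The difference of the Riesz measures for \<open>y / 2\<close> and
  \<open>- (y / 2)\<close> keeps the odd sets, with coefficient
  \<open>2 * (\<Prod>\<alpha>\<in>F. y \<alpha> / 2)\<close>, hence exactly
  \<open>y \<alpha>\<close> on a singleton. It is odd in \<open>y\<close> by its form, however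
  \<open>riesz\<close> chooses. Four measures of mass 1 explain the bound 4 on the variation, and
  the halving provides the decay \<open>2 / 2 ^ k\<close> on sets of k elements.\<close>

definition riesz_combination :: "('a \<Rightarrow> real) \<Rightarrow> ('a \<Rightarrow> real) \<Rightarrow> ('a \<Rightarrow> complex) set \<Rightarrow> complex"
  where "riesz_combination y z = complex_combination (riesz (\<lambda>\<alpha>. y \<alpha> / 2)) (riesz (\<lambda>\<alpha>. - (y \<alpha> / 2)))
    (riesz (\<lambda>\<alpha>. z \<alpha> / 2)) (riesz (\<lambda>\<alpha>. - (z \<alpha> / 2)))"

definition riesz_coeff :: "('a \<Rightarrow> real) \<Rightarrow> 'a set \<Rightarrow> real"
  where "riesz_coeff z F = (if odd (card F) then 2 * (\<Prod>\<alpha>\<in>F. z \<alpha> / 2) else 0)"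

lemma riesz_combination_minus:
  "riesz_combination (\<lambda>\<alpha>. - y \<alpha>) (\<lambda>\<alpha>. - z \<alpha>) E = - riesz_combination y z E"
  by (simp add: riesz_combination_def complex_combination_def algebra_simps)

lemma riesz_combination:
  assumes y: "\<And>\<alpha>. \<alpha> \<in> A \<Longrightarrow> \<bar>y \<alpha>\<bar> \<le> 1" and z: "\<And>\<alpha>. \<alpha> \<in> A \<Longrightarrow> \<bar>z \<alpha>\<bar> \<le> 1"
  shows "riesz_combination y z \<in> regular_complex_measures A"
    and "variation_norm A (riesz_combination y z) \<le> 4"
    and "finite F \<Longrightarrow> F \<subseteq> A \<Longrightarrow> walsh_transform A (riesz_combination y z) (walsh_fun A F)
      = complex_of_real (riesz_coeff y F) + \<i> * complex_of_real (riesz_coeff z F)"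
    and "g \<in> borel_measurable (cube_borel A) \<Longrightarrow> (\<And>\<omega>. \<omega> \<in> cube A \<Longrightarrow> cmod (g \<omega>) \<le> C) \<Longrightarrow>
      cmod (complex_measure_integral (cube_borel A) (riesz_combination y z) g) \<le> 4 * C"
    and "g \<in> borel_measurable (cube_borel A) \<Longrightarrow> (\<And>\<omega>. \<omega> \<in> cube A \<Longrightarrow> cmod (g \<omega>) \<le> C) \<Longrightarrow>
      complex_measure_integral (cube_borel A) (riesz_combination y z) g =
      (\<integral>\<omega>. g \<omega> \<partial>riesz (\<lambda>\<alpha>. y \<alpha> / 2)) - (\<integral>\<omega>. g \<omega> \<partial>riesz (\<lambda>\<alpha>. - (y \<alpha> / 2)))
      + \<i> * ((\<integral>\<omega>. g \<omega> \<partial>riesz (\<lambda>\<alpha>. z \<alpha> / 2)) - (\<integral>\<omega>. g \<omega> \<partial>riesz (\<lambda>\<alpha>. - (z \<alpha> / 2))))"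
proof -
  have b: "\<forall>\<alpha>\<in>A. \<bar>y \<alpha> / 2\<bar> \<le> 1" "\<forall>\<alpha>\<in>A. \<bar>- (y \<alpha> / 2)\<bar> \<le> 1"
      "\<forall>\<alpha>\<in>A. \<bar>z \<alpha> / 2\<bar> \<le> 1" "\<forall>\<alpha>\<in>A. \<bar>- (z \<alpha> / 2)\<bar> \<le> 1"
    using y z by fastforce+
  let ?N1 = "riesz (\<lambda>\<alpha>. y \<alpha> / 2)" and ?N2 = "riesz (\<lambda>\<alpha>. - (y \<alpha> / 2))"
    and ?N3 = "riesz (\<lambda>\<alpha>. z \<alpha> / 2)" and ?N4 = "riesz (\<lambda>\<alpha>. - (z \<alpha> / 2))"
  note r1 = riesz[of "\<lambda>\<alpha>. y \<alpha> / 2", OF b(1)] and r2 = riesz[of "\<lambda>\<alpha>. - (y \<alpha> / 2)", OF b(2)]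
    and r3 = riesz[of "\<lambda>\<alpha>. z \<alpha> / 2", OF b(3)] and r4 = riesz[of "\<lambda>\<alpha>. - (z \<alpha> / 2)", OF b(4)]
  have cube: "cube A \<in> sets (cube_borel A)" using sets.top[of "cube_borel A"] by simp
  show "riesz_combination y z \<in> regular_complex_measures A"
    unfolding riesz_combination_def
    by (intro complex_combination_regular r1(1,2,4) r2(1,2,4) r3(1,2,4) r4(1,2,4))
  show "variation_norm A (riesz_combination y z) \<le> 4"
    unfolding variation_norm_def riesz_combination_def
    using total_variation_combination_le[OF r1(2) r2(2) r3(2) r4(2) r1(1) r2(1) r3(1) r4(1) cube]
    unfolding r1(3) r2(3) r3(3) r4(3) by simp
  have int: "complex_measure_integral (cube_borel A) (riesz_combination y z) k =
      (\<integral>\<omega>. k \<omega> \<partial>?N1) - (\<integral>\<omega>. k \<omega> \<partial>?N2) + \<i> * ((\<integral>\<omega>. k \<omega> \<partial>?N3) - (\<integral>\<omega>. k \<omega> \<partial>?N4))"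
    if "k \<in> borel_measurable (cube_borel A)" "\<And>\<omega>. \<omega> \<in> cube A \<Longrightarrow> cmod (k \<omega>) \<le> D" for k D
    by (rule complex_measure_integral_eq[OF r1(2) r2(2) r3(2) r4(2) r1(1) r2(1) r3(1) r4(1)])
      (use that in \<open>simp_all add: riesz_combination_def complex_combination_def\<close>)
  show "complex_measure_integral (cube_borel A) (riesz_combination y z) g =
      (\<integral>\<omega>. g \<omega> \<partial>?N1) - (\<integral>\<omega>. g \<omega> \<partial>?N2) + \<i> * ((\<integral>\<omega>. g \<omega> \<partial>?N3) - (\<integral>\<omega>. g \<omega> \<partial>?N4))"
    if "g \<in> borel_measurable (cube_borel A)" "\<And>\<omega>. \<omega> \<in> cube A \<Longrightarrow> cmod (g \<omega>) \<le> C"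
    by (rule int[OF that])
  show "cmod (complex_measure_integral (cube_borel A) (riesz_combination y z) g) \<le> 4 * C"
    if g: "g \<in> borel_measurable (cube_borel A)" "\<And>\<omega>. \<omega> \<in> cube A \<Longrightarrow> cmod (g \<omega>) \<le> C"
  proof -
    have le: "cmod (\<integral>\<omega>. g \<omega> \<partial>N) \<le> C" if N: "sets N = sets (cube_borel A)" "finite_measure N" "measure N (cube A) = 1" for N
    proof -
      interpret finite_measure N by fact
      have sp: "space N = cube A" using sets_eq_imp_space_eq[OF N(1)] by simp
      have gN: "g \<in> borel_measurable N" using g(1) N(1) by (simp cong: measurable_cong_sets)
      have "integrable N g" by (rule integrable_const_bound[where B=C]) (use g gN sp in auto)
      then have i: "integrable N (\<lambda>\<omega>. cmod (g \<omega>))" by simp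
      have "cmod (\<integral>\<omega>. g \<omega> \<partial>N) \<le> (\<integral>\<omega>. cmod (g \<omega>) \<partial>N)" by (rule integral_norm_bound)
      also have "\<dots> \<le> (\<integral>\<omega>. C \<partial>N)" by (rule integral_mono[OF i]) (use g sp in auto)
      also have "\<dots> = C" using N(3) sp by simp
      finally show ?thesis .
    qed
    have "cmod (complex_measure_integral (cube_borel A) (riesz_combination y z) g)
      \<le> cmod (\<integral>\<omega>. g \<omega> \<partial>?N1) + cmod (\<integral>\<omega>. g \<omega> \<partial>?N2) + (cmod (\<integral>\<omega>. g \<omega> \<partial>?N3) + cmod (\<integral>\<omega>. g \<omega> \<partial>?N4))"
    proof -
      have eq: "complex_measure_integral (cube_borel A) (riesz_combination y z) g =
          (\<integral>\<omega>. g \<omega> \<partial>?N1) - (\<integral>\<omega>. g \<omega> \<partial>?N2) + \<i> * ((\<integral>\<omega>. g \<omega> \<partial>?N3) - (\<integral>\<omega>. g \<omega> \<partial>?N4))"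
        using g by (rule int)
      have "cmod (a - b + \<i> * (c - d)) \<le> cmod a + cmod b + (cmod c + cmod d)" for a b c d
        using norm_triangle_ineq[of "a - b" "\<i> * (c - d)"] norm_triangle_ineq4[of a b] norm_triangle_ineq4[of c d]
        by (simp add: norm_mult)
      then show ?thesis unfolding eq .
    qed
    also have "\<dots> \<le> C + C + (C + C)"
      by (intro add_mono le r1(1-3) r2(1-3) r3(1-3) r4(1-3))
    finally show ?thesis by simp
  qed
  show "walsh_transform A (riesz_combination y z) (walsh_fun A F)
      = complex_of_real (riesz_coeff y F) + \<i> * complex_of_real (riesz_coeff z F)" if F: "finite F" "F \<subseteq> A"
  proof -
    have "walsh_fun A F \<in> walsh A" using F by (auto simp: walsh_eq_image)
    then have "walsh_transform A (riesz_combination y z) (walsh_fun A F)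
      = complex_measure_integral (cube_borel A) (riesz_combination y z) (walsh_fun A F)"
      by (simp add: walsh_transform_def)
    also have "\<dots> = (\<integral>\<omega>. walsh_fun A F \<omega> \<partial>?N1) - (\<integral>\<omega>. walsh_fun A F \<omega> \<partial>?N2)
       + \<i> * ((\<integral>\<omega>. walsh_fun A F \<omega> \<partial>?N3) - (\<integral>\<omega>. walsh_fun A F \<omega> \<partial>?N4))"
    proof -
      have "cmod (walsh_fun A F \<omega>) \<le> 1" if "\<omega> \<in> cube A" for \<omega>
        using F that by (simp add: walsh_fun_apply norm_prod_coordinate)
      with walsh_fun_measurable[OF F(2)] show ?thesis by (rule int)
    qed
    finally have eq: "walsh_transform A (riesz_combination y z) (walsh_fun A F)
      = (\<integral>\<omega>. walsh_fun A F \<omega> \<partial>?N1) - (\<integral>\<omega>. walsh_fun A F \<omega> \<partial>?N2)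
       + \<i> * ((\<integral>\<omega>. walsh_fun A F \<omega> \<partial>?N3) - (\<integral>\<omega>. walsh_fun A F \<omega> \<partial>?N4))" .
    have w: "(\<integral>\<omega>. walsh_fun A F \<omega> \<partial>N) = (\<integral>\<omega>. (\<Prod>\<alpha>\<in>F. \<omega> \<alpha>) \<partial>N)" if "sets N = sets (cube_borel A)" for N
      by (intro Bochner_Integration.integral_cong refl)
        (use sets_eq_imp_space_eq[OF that] walsh_fun_apply in auto)
    show ?thesis
      unfolding eq w[OF r1(1)] w[OF r2(1)] w[OF r3(1)] w[OF r4(1)]
        r1(5)[OF F] r2(5)[OF F] r3(5)[OF F] r4(5)[OF F] riesz_coeff_def
      by (cases "even (card F)") (simp_all only: prod_uminus if_True if_False, simp_all)
  qed
qed

end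

section \<open>Pairings of Walsh coefficients\<close>

text \<open>The square of \<delta>: the fraction of a power sum that can pass from singletons to
  larger odd sets.\<close>

definition excess :: real
  where "excess = sinh 1 - 1"

text \<open>The value is about 0.175; the bounds 5/2 and 3 for e suffice for both
  inequalities.\<close>

lemma excess: "0 < excess" "excess \<le> 1 / 2"
proof -
  have e: "5 / 2 \<le> exp (1::real)" "exp (1::real) \<le> 3"
    using exp_lower_Taylor_quadratic[of 1] exp_le by auto
  have s: "sinh (1::real) = (exp 1 - inverse (exp 1)) / 2" by (simp add: sinh_def exp_minus)
  have "inverse (exp (1::real)) \<le> inverse (5 / 2)" "0 < inverse (exp (1::real))"
    using le_imp_inverse_le[OF e(1)] by simp_all
  then have i: "inverse (exp (1::real)) \<le> 2 / 5" "0 < inverse (exp (1::real))" by simp_all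
  have "0 < (E - I) / 2 - 1 \<and> (E - I) / 2 - 1 \<le> 1 / 2"
    if "5 / 2 \<le> E" "E \<le> 3" "I \<le> 2 / 5" "0 < I" for E I :: real
    using that by (simp add: field_simps)
  from this[OF e i] show "0 < excess" "excess \<le> 1 / 2" by (simp_all add: excess_def s)
qed

lemma odd_sign_squared: "odd k \<Longrightarrow> odd_sign k * odd_sign k = 1"
  and odd_sign_one: "odd_sign 1 = 1"
  and abs_odd_sign_le: "\<bar>odd_sign k\<bar> \<le> 1"
proof -
  show "odd_sign 1 = 1" by (simp add: odd_sign_def)
  have "\<bar>odd_sign k\<bar> \<le> cmod (\<i> ^ k)" unfolding odd_sign_def by (rule abs_Im_le_cmod)
  then show "\<bar>odd_sign k\<bar> \<le> 1" by (simp add: norm_power)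
  assume "odd k"
  then obtain m where "k = Suc (2 * m)" by (auto elim!: oddE)
  then have "\<i> ^ k = \<i> * complex_of_real ((-1) ^ m)" by (simp add: power_mult)
  then have "odd_sign k = (-1) ^ m" by (simp add: odd_sign_def)
  then show "odd_sign k * odd_sign k = 1" by (simp flip: power_add)
qed

lemma complex_sums_le:
  assumes q: "1 \<le> q" and f: "sums_le (\<lambda>i. cmod (f i) powr q) S a" and g: "sums_le (\<lambda>i. cmod (g i) powr q) S b"
  shows "sums_le (\<lambda>i. cmod (f i + \<i> * g i) powr q) S (2 powr (q - 1) * (a + b))"
proof (rule sums_le_mono[OF sums_le_cmult[OF _ sums_le_add[OF f g]]])
  fix i
  have "cmod (f i + \<i> * g i) powr q \<le> (cmod (f i) + cmod (g i)) powr q"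
    using q norm_triangle_ineq[of "f i" "\<i> * g i"] by (intro powr_mono2) (auto simp: norm_mult)
  also have "\<dots> \<le> 2 powr (q - 1) * (cmod (f i) powr q + cmod (g i) powr q)"
    by (rule powr_add_le_two) (use q in auto)
  finally show "cmod (f i + \<i> * g i) powr q \<le> 2 powr (q - 1) * (cmod (f i) powr q + cmod (g i) powr q)" .
qed auto

text \<open>Young's inequality term by term, with the denominators p and q dropped, since only
  absolute summability of a pairing is at stake.\<close>

lemma dual_sums_le:
  fixes f g :: "'i \<Rightarrow> real"
  assumes pq: "1 < p" "1 < q" "1 / p + 1 / q = 1"
    and f: "sums_le (\<lambda>i. \<bar>f i\<bar> powr p) S a" and g: "sums_le (\<lambda>i. \<bar>g i\<bar> powr q) S b"
  shows "sums_le (\<lambda>i. \<bar>f i * g i\<bar>) S (a + b)"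
proof (rule sums_le_mono[OF sums_le_add[OF f g]])
  fix i
  have "\<bar>f i\<bar> * \<bar>g i\<bar> \<le> \<bar>f i\<bar> powr p / p + \<bar>g i\<bar> powr q / q"
    by (rule Youngs_inequality) (use pq in auto)
  also have "\<dots> \<le> \<bar>f i\<bar> powr p / 1 + \<bar>g i\<bar> powr q / 1"
    using pq by (intro add_mono divide_left_mono) auto
  finally show "\<bar>f i * g i\<bar> \<le> \<bar>f i\<bar> powr p + \<bar>g i\<bar> powr q" by (simp add: abs_mult)
qed auto

lemma dual_sums_le_one:
  fixes f g :: "'i \<Rightarrow> real"
  assumes f: "sums_le (\<lambda>i. \<bar>f i\<bar>) S a" and g: "\<And>i. i \<in> S \<Longrightarrow> \<bar>g i\<bar> \<le> 1"
  shows "sums_le (\<lambda>i. \<bar>f i * g i\<bar>) S a"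
  by (rule sums_le_mono[OF f]) (use g in \<open>auto simp: abs_mult mult_left_le\<close>)

locale haar_levels = haar_cube A P + level_coding A e lvl idx
  for A :: "'a set" and P e lvl idx
begin

text \<open>Singletons are compared with the coordinates themselves and larger odd sets with the
  coordinates recording them, \<open>up\<close> being injective into the levels from 1 on. A sum
  over all Walsh coefficients is thereby bounded by two sums over coordinates.\<close>

lemma hat_sums_le:
  assumes "sums_le V A S" "sums_le V {a\<in>A. 1 \<le> lvl a} S1"
    and one: "\<And>a. a \<in> A \<Longrightarrow> g {a} \<le> V a" and three: "\<And>F. F \<in> odd3_sets A \<Longrightarrow> g F \<le> V (up F)"
    and even: "\<And>F. finite F \<Longrightarrow> F \<subseteq> A \<Longrightarrow> even (card F) \<Longrightarrow> g F = 0"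
    and nn: "\<And>F. 0 \<le> g F"
  shows "sums_le g {F. finite F \<and> F \<subseteq> A} (S + S1)"
proof (rule sums_le_support)
  have "sums_le g ((\<lambda>a. {a}) ` A) S"
  proof (rule sums_le_reindex[where k=the_elem])
    show "sums_le (\<lambda>a. g {a}) A S" by (rule sums_le_mono[OF assms(1)]) (use one in auto)
  qed (auto simp: inj_on_def)
  moreover have "sums_le g (odd3_sets A) S1"
  proof (rule sums_le_mono)
    show "sums_le (\<lambda>F. V (up F)) (odd3_sets A) S1"
      by (rule sums_le_reindex[OF assms(2) inj_up]) (use up_mem in auto)
  qed (use three in auto)
  ultimately show "sums_le g ((\<lambda>a. {a}) ` A \<union> odd3_sets A) (S + S1)"
    by (rule sums_le_Un) (rule nn)
  fix F assume F: "F \<in> {F. finite F \<and> F \<subseteq> A} - ((\<lambda>a. {a}) ` A \<union> odd3_sets A)"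
  have "even (card F)"
  proof (rule ccontr)
    assume "odd (card F)"
    moreover have "card F \<noteq> 1" using F by (auto simp: card_1_singleton_iff)
    ultimately have "3 \<le> card F" by (auto elim!: oddE)
    then show False using F \<open>odd (card F)\<close> by (auto simp: odd3_sets_def)
  qed
  then show "g F \<le> 0" using even[of F] F by auto
qed

section \<open>The series of bounded functions over the levels\<close>

text \<open>The weight \<open>1 / rho\<close> keeps each level in the unit ball, so that each term
  of the series has a product bounded by \<open>sqrt (exp 1)\<close>; the factor
  \<open>rho ^ j\<close> then restores the decay. \<open>kap\<close> is a phase of modulus 1, by
  which signs can alternate in pairings.\<close>

definition phi_series :: "real \<Rightarrow> complex \<Rightarrow> ('a \<Rightarrow> real) \<Rightarrow> ('a \<Rightarrow> complex) \<Rightarrow> complex"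
  where "phi_series rho kap u \<omega> =
    (\<Sum>j. (kap * complex_of_real rho) ^ j * complex_of_real (phi (level (\<lambda>_. 1 / rho) u j) \<omega>))"

definition phi_coeff :: "real \<Rightarrow> complex \<Rightarrow> ('a \<Rightarrow> real) \<Rightarrow> 'a set \<Rightarrow> complex"
  where "phi_coeff rho kap u F = (kap * complex_of_real rho) ^ flev F *
    complex_of_real (odd_sign (card F) * (\<Prod>b\<in>F. level (\<lambda>_. 1 / rho) u (flev F) b))"

lemma phi_series_minus:
  assumes "0 < rho" "rho < 1" "cmod kap = 1" "\<And>j. sums_le (\<lambda>a. (level (\<lambda>_. 1 / rho) u j a)\<^sup>2) A 1"
  shows "phi_series rho kap (\<lambda>a. - u a) \<omega> = - phi_series rho kap u \<omega>"
proof -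
  have l: "level (\<lambda>_. 1 / rho) (\<lambda>a. - u a) j = (\<lambda>a. - level (\<lambda>_. 1 / rho) u j a)" for j
    by (rule ext) (rule level_minus)
  have "summable (\<lambda>j. (kap * complex_of_real rho) ^ j * complex_of_real (phi (level (\<lambda>_. 1 / rho) u j) \<omega>))"
  proof (rule summable_comparison_test')
    show "summable (\<lambda>j. rho ^ j * sqrt (exp 1))" using assms by (intro summable_mult2 summable_geometric) auto
    show "cmod ((kap * complex_of_real rho) ^ j * complex_of_real (phi (level (\<lambda>_. 1 / rho) u j) \<omega>)) \<le> rho ^ j * sqrt (exp 1)" for j
      using assms phi_bound[OF assms(4)] by (auto simp: norm_mult norm_power intro!: mult_left_mono)
  qed
  from suminf_minus[OF this] show ?thesis unfolding phi_series_def l phi_minus by simp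
qed

lemma phi_series:
  assumes rho: "0 < rho" "rho < 1" and kap: "cmod kap = 1"
    and sq: "\<And>j. sums_le (\<lambda>a. (level (\<lambda>_. 1 / rho) u j a)\<^sup>2) A 1"
  shows "phi_series rho kap u \<in> borel_measurable (cube_borel A)"
    and "cmod (phi_series rho kap u \<omega>) \<le> sqrt (exp 1) / (1 - rho)"
    and "finite F \<Longrightarrow> F \<subseteq> A \<Longrightarrow> (\<integral>\<omega>. phi_series rho kap u \<omega> * (\<Prod>\<alpha>\<in>F. \<omega> \<alpha>) \<partial>P) = phi_coeff rho kap u F"
proof -
  define f where "f j \<omega> = (kap * complex_of_real rho) ^ j * complex_of_real (phi (level (\<lambda>_. 1 / rho) u j) \<omega>)" for j \<omega>
  have ps: "phi_series rho kap u = (\<lambda>\<omega>. \<Sum>j. f j \<omega>)" by (simp add: phi_series_def f_def fun_eq_iff)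
  have fb: "cmod (f j \<omega>) \<le> sqrt (exp 1) * rho ^ j" for j \<omega>
    using rho phi_bound[OF sq[of j], of \<omega>] kap
    by (auto simp: f_def norm_mult norm_power mult.commute intro!: mult_right_mono)
  have sb: "(\<lambda>j. sqrt (exp 1) * rho ^ j) sums (sqrt (exp 1) * (1 / (1 - rho)))"
    using rho by (intro sums_mult geometric_sums) auto
  have fm: "f j \<in> borel_measurable (cube_borel A)" for j
    unfolding f_def using phi_measurable[OF sq[of j]] by measurable
  show "phi_series rho kap u \<in> borel_measurable (cube_borel A)"
    unfolding ps using fm by (rule borel_measurable_suminf)
  show "cmod (phi_series rho kap u \<omega>) \<le> sqrt (exp 1) / (1 - rho)"
  proof -
    have "cmod (\<Sum>j. f j \<omega>) \<le> (\<Sum>j. sqrt (exp 1) * rho ^ j)"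
    proof -
      have s: "summable (\<lambda>j. cmod (f j \<omega>))"
        by (rule summable_comparison_test'[OF sums_summable[OF sb], of 0]) (use fb in auto)
      from summable_norm[OF this] suminf_le[OF fb s sums_summable[OF sb]] show ?thesis
        by (rule order_trans)
    qed
    then show ?thesis unfolding ps sums_unique[OF sb, symmetric] by simp
  qed
  assume F: "finite F" "F \<subseteq> A"
  define W where "W \<omega> = (\<Prod>\<alpha>\<in>F. \<omega> \<alpha>)" for \<omega> :: "'a \<Rightarrow> complex"
  have W: "W \<in> borel_measurable (cube_borel A)" "\<And>\<omega>. \<omega> \<in> cube A \<Longrightarrow> cmod (W \<omega>) = 1"
    unfolding W_def using prod_coordinate_measurable[OF F(2)] norm_prod_coordinate[OF _ F(2)] by auto
  have fW: "cmod (f j \<omega> * W \<omega>) \<le> sqrt (exp 1) * rho ^ j" if "\<omega> \<in> cube A" for j \<omega>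
    using fb[of j \<omega>] W(2)[OF that] by (simp add: norm_mult)
  have fWm: "(\<lambda>\<omega>. f j \<omega> * W \<omega>) \<in> borel_measurable (cube_borel A)" for j
    using fm W(1) by (rule borel_measurable_times)
  have fWi: "integrable P (\<lambda>\<omega>. f j \<omega> * W \<omega>)" for j
    using fWm fW by (rule bounded_integrable)
  have summ: "summable (\<lambda>j. cmod (f j \<omega> * W \<omega>))" if "\<omega> \<in> cube A" for \<omega>
    by (rule summable_comparison_test'[OF sums_summable[OF sb], of 0]) (use fW[OF that] in auto)
  have "(\<integral>\<omega>. phi_series rho kap u \<omega> * W \<omega> \<partial>P) = (\<integral>\<omega>. (\<Sum>j. f j \<omega> * W \<omega>) \<partial>P)"
  proof (intro Bochner_Integration.integral_cong refl)
    fix \<omega> assume "\<omega> \<in> space P"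
    have "summable (\<lambda>j. f j \<omega>)"
      by (rule summable_comparison_test'[OF sums_summable[OF sb], of 0]) (use fb in auto)
    from suminf_mult2[OF this, of "W \<omega>"] show "phi_series rho kap u \<omega> * W \<omega> = (\<Sum>j. f j \<omega> * W \<omega>)"
      unfolding ps .
  qed
  also have "\<dots> = (\<Sum>j. \<integral>\<omega>. f j \<omega> * W \<omega> \<partial>P)"
  proof (rule integral_suminf[OF fWi])
    show "AE \<omega> in P. summable (\<lambda>j. cmod (f j \<omega> * W \<omega>))" by (rule AE_I2) (use summ in auto)
    show "summable (\<lambda>j. \<integral>\<omega>. cmod (f j \<omega> * W \<omega>) \<partial>P)"
    proof (rule summable_comparison_test'[OF sums_summable[OF sb], of 0])
      fix j
      have "(\<integral>\<omega>. cmod (f j \<omega> * W \<omega>) \<partial>P) \<le> (\<integral>\<omega>. sqrt (exp 1) * rho ^ j \<partial>P)"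
        using fWi[of j] fW by (intro integral_mono) auto
      then show "norm (\<integral>\<omega>. cmod (f j \<omega> * W \<omega>) \<partial>P) \<le> sqrt (exp 1) * rho ^ j"
        using prob_space by simp
    qed
  qed
  also have "\<dots> = (\<Sum>j. (kap * complex_of_real rho) ^ j * complex_of_real (odd_sign (card F) * (\<Prod>b\<in>F. level (\<lambda>_. 1 / rho) u j b)))"
    unfolding f_def W_def using phi_walsh[OF sq F] by (simp add: mult.assoc)
  also have "\<dots> = phi_coeff rho kap u F"
  proof (cases "F = {}")
    case True
    then show ?thesis by (simp add: phi_coeff_def odd_sign_even)
  next
    case False
    \<comment> \<open>The coefficient series has a single nonzero term at most, since the product
      over \<open>F\<close> vanishes at every level other than that of \<open>F\<close>.\<close>
    have "(\<Prod>b\<in>F. level (\<lambda>_. 1 / rho) u j b) = 0" if "j \<noteq> flev F" for j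
      using level_prod_nonzero(2)[of "\<lambda>_. 1 / rho" u j F] F False that by auto
    then show ?thesis
      unfolding phi_coeff_def by (subst suminf_finite[of "{flev F}"]) auto
  qed
  finally show "(\<integral>\<omega>. phi_series rho kap u \<omega> * (\<Prod>\<alpha>\<in>F. \<omega> \<alpha>) \<partial>P) = phi_coeff rho kap u F"
    unfolding W_def .
qed

lemma phi_coeff_even: "even (card F) \<Longrightarrow> phi_coeff rho kap u F = 0"
  by (simp add: phi_coeff_def odd_sign_even)

lemma phi_coeff_diff_one:
  assumes "cmod kap = 1" "0 < rho"
  shows "cmod (phi_coeff rho kap u {a} - phi_coeff rho kap v {a})
    = \<bar>rho ^ lvl a * (total (\<lambda>_. 1 / rho) u a - total (\<lambda>_. 1 / rho) v a)\<bar>"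
proof -
  have "flev {a} = lvl a" by (rule flev_eq) auto
  then have "phi_coeff rho kap u {a} - phi_coeff rho kap v {a}
    = (kap * complex_of_real rho) ^ lvl a * complex_of_real (total (\<lambda>_. 1 / rho) u a - total (\<lambda>_. 1 / rho) v a)"
    using odd_sign_one by (simp add: phi_coeff_def total_def right_diff_distrib)
  then show ?thesis using assms by (simp only: norm_mult norm_power norm_of_real abs_mult) (simp add: abs_mult)
qed

text \<open>The weight \<open>1 / rho\<close> recorded at \<open>up F\<close> compensates the
  additional factor \<open>rho\<close> of the higher level, so a coefficient on \<open>F\<close> has
  the modulus of the damped coordinate \<open>up F\<close>. With \<open>v\<close> equal to 0 this
  measures single coefficients, and in general it measures their continuity.\<close>

lemma phi_coeff_diff_three:
  assumes kap: "cmod kap = 1" and rho: "0 < rho" and F: "F \<in> odd3_sets A"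
  shows "cmod (phi_coeff rho kap u F - phi_coeff rho kap v F)
    = \<bar>rho ^ lvl (up F) * (total (\<lambda>_. 1 / rho) u (up F) - total (\<lambda>_. 1 / rho) v (up F))\<bar>"
proof -
  have "\<bar>odd_sign (card F)\<bar> = 1"
  proof -
    have "\<bar>odd_sign (card F)\<bar> * \<bar>odd_sign (card F)\<bar> = 1"
      using odd_sign_squared[of "card F"] odd3D[OF F] by (simp flip: abs_mult)
    then show ?thesis by (metis abs_ge_zero mult_cancel_left2 power2_eq_square power2_eq_1_iff abs_of_nonneg abs_minus_cancel abs_1)
  qed
  moreover have "phi_coeff rho kap u F - phi_coeff rho kap v F = (kap * complex_of_real rho) ^ flev F *
      complex_of_real (odd_sign (card F) * ((\<Prod>b\<in>F. level (\<lambda>_. 1 / rho) u (flev F) b) - (\<Prod>b\<in>F. level (\<lambda>_. 1 / rho) v (flev F) b)))"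
    unfolding phi_coeff_def by (simp add: right_diff_distrib)
  ultimately have "cmod (phi_coeff rho kap u F - phi_coeff rho kap v F) = rho ^ flev F *
     \<bar>(\<Prod>b\<in>F. level (\<lambda>_. 1 / rho) u (flev F) b) - (\<Prod>b\<in>F. level (\<lambda>_. 1 / rho) v (flev F) b)\<bar>"
    using kap rho by (simp only: norm_mult norm_power norm_of_real abs_mult) simp
  also have "\<dots> = \<bar>rho ^ lvl (up F) * (total (\<lambda>_. 1 / rho) u (up F) - total (\<lambda>_. 1 / rho) v (up F))\<bar>"
    using up_mem[OF F] rho unfolding total_up[OF F] right_diff_distrib[symmetric] abs_mult by simp
  finally show ?thesis .
qed

lemma phi_coeff_zero: "phi_coeff rho kap (\<lambda>_. 0) F = 0" if "finite F"
proof (cases "F = {}")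
  case True
  then show ?thesis by (simp add: phi_coeff_even)
next
  case False
  have "level c (\<lambda>_. 0) j a = 0" for c j a
    using level_minus[of c "\<lambda>_. 0" j a] by simp
  then show ?thesis using False that by (auto simp: phi_coeff_def)
qed

text \<open>Dictated by the cancellation: on a set of k elements in level j the pairing carries
  \<open>rho ^ j * odd_sign k * 2 / 2 ^ k\<close>, while the coordinate recording the set
  contributes \<open>rho ^ Suc j * (1 / rho) * psi_weight k\<close>, and the two have to be
  opposite.\<close>

definition psi_weight :: "nat \<Rightarrow> real"
  where "psi_weight k = - odd_sign k * 2 / 2 ^ k"

text \<open>The second bound rests on 2k \<le> 2^k for k \<ge> 3 and is the one that keeps the
  levels Lipschitz in the sup norm.\<close>

lemma psi_weight: "\<bar>psi_weight k\<bar> \<le> 1" "odd k \<Longrightarrow> 3 \<le> k \<Longrightarrow> real k * \<bar>psi_weight k\<bar> \<le> 1"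
proof -
  have le: "\<bar>psi_weight k\<bar> \<le> 2 / 2 ^ k"
    using abs_odd_sign_le[of k] by (simp add: psi_weight_def abs_mult divide_right_mono)
  show "\<bar>psi_weight k\<bar> \<le> 1"
  proof (cases k)
    case (Suc m)
    have "(2::real) / 2 ^ k \<le> 1" by (simp add: Suc)
    then show ?thesis using le by linarith
  qed (simp add: psi_weight_def odd_sign_even)
  assume k: "3 \<le> k"
  have "2 * real n \<le> 2 ^ n" if "3 \<le> n" for n
    using that by (induction n rule: nat_induct_at_least) auto
  from this[OF k] have "real k * (2 / 2 ^ k) \<le> 1" by (simp add: field_simps)
  then show "real k * \<bar>psi_weight k\<bar> \<le> 1"
    using mult_left_mono[OF le of_nat_0_le_iff, of k] by linarith
qed

lemma psi_total_bounded:
  assumes "\<And>a. a \<in> A \<Longrightarrow> \<bar>u a\<bar> \<le> 1" shows "\<bar>total psi_weight u a\<bar> \<le> 1"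
  unfolding total_def by (rule level_bounded) (use psi_weight(1) assms in auto)

text \<open>With the phase \<i> in both factors the damping multiplies to
  \<open>(- excess) ^ j\<close>, and \<open>odd_sign\<close> squares to 1 on odd sets. The weight
  \<open>1 / rho\<close> enters twice and gives \<open>1 / excess\<close>, so the passage from level
  j to level j + 1 changes the sign and nothing else, as the cancellation requires.\<close>

lemma phi_phi_has_sum:
  fixes u v :: "'a \<Rightarrow> real"
  assumes u: "sums_le (\<lambda>a. \<bar>u a\<bar> powr 2) A 1" and v: "sums_le (\<lambda>a. \<bar>v a\<bar> powr 2) A 1"
  defines "rho \<equiv> excess powr (1 / 2)"
  shows "((\<lambda>F. phi_coeff rho \<i> u F * phi_coeff rho \<i> v F) has_sum (\<Sum>\<^sub>\<infinity>\<alpha>\<in>A. complex_of_real (u \<alpha> * v \<alpha>))) (odd_sets A)"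
proof -
  have rho: "0 < rho" "rho * rho = excess" "rho powr 2 = excess"
    using excess by (simp_all add: rho_def powr_powr flip: powr_add)
  let ?c = "\<lambda>_::nat. 1 / rho"
  have cc: "\<bar>1 / rho\<bar> powr 2 \<le> 1 / excess" using rho by (simp add: powr_divide)
  have \<theta>: "1 / excess * (sinh 1 - 1) \<le> 1" using excess(1) by (simp flip: excess_def)
  have t: "sums_le (\<lambda>a. \<bar>rho ^ lvl a * total ?c w a\<bar> powr 2) A (1 / (1 - excess))"
    if "sums_le (\<lambda>a. \<bar>w a\<bar> powr 2) A 1" for w
    using total_sums_le[where c="?c" and C="1 / excess" and \<theta>=1 and p=2 and r=excess and lam=rho and x=w and n=0]
      cc \<theta> excess rho that by simp
  have S: "sums_le (\<lambda>a. cmod ((- complex_of_real excess) ^ lvl a * complex_of_real (total ?c u a * total ?c v a))) A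
     (1 / (1 - excess) + 1 / (1 - excess))"
  proof (rule sums_le_mono[OF dual_sums_le[OF _ _ _ t[OF u] t[OF v]]])
    fix a
    have "rho ^ lvl a * rho ^ lvl a = excess ^ lvl a" by (simp flip: rho(2) power_mult_distrib)
    then have "\<bar>rho ^ lvl a * total ?c u a * (rho ^ lvl a * total ?c v a)\<bar> = excess ^ lvl a * \<bar>total ?c u a * total ?c v a\<bar>"
    proof -
      have "rho ^ lvl a * total ?c u a * (rho ^ lvl a * total ?c v a)
          = (rho ^ lvl a * rho ^ lvl a) * (total ?c u a * total ?c v a)" by (simp only: ac_simps)
      also have "\<bar>\<dots>\<bar> = excess ^ lvl a * \<bar>total ?c u a * total ?c v a\<bar>"
        using excess(1) unfolding \<open>rho ^ lvl a * rho ^ lvl a = excess ^ lvl a\<close> abs_mult by simp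
      finally show ?thesis .
    qed
    then show "cmod ((- complex_of_real excess) ^ lvl a * complex_of_real (total ?c u a * total ?c v a))
        \<le> \<bar>rho ^ lvl a * total ?c u a * (rho ^ lvl a * total ?c v a)\<bar>"
      using excess by (simp only: norm_mult norm_power norm_minus_cancel norm_of_real)
  qed auto
  have "((\<lambda>F. (- complex_of_real excess) ^ flev F * complex_of_real ((\<Prod>b\<in>F. level ?c u (flev F) b) * (\<Prod>b\<in>F. level ?c v (flev F) b)))
     has_sum (\<Sum>\<^sub>\<infinity>\<alpha>\<in>A. complex_of_real (u \<alpha> * v \<alpha>))) (odd_sets A)"
  proof (rule paired_products_has_sum[where m="\<lambda>j k. (- complex_of_real excess) ^ j" and c="?c" and c'="?c", OF _ _ S])
    fix j k
    have "1 / rho * (1 / rho) = 1 / excess" by (simp add: rho(2))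
    then show "(- complex_of_real excess) ^ j = - ((- complex_of_real excess) ^ Suc j * complex_of_real (1 / rho * (1 / rho)))"
      using excess(1) by simp
  qed simp
  moreover have "phi_coeff rho \<i> u F * phi_coeff rho \<i> v F
     = (- complex_of_real excess) ^ flev F * complex_of_real ((\<Prod>b\<in>F. level ?c u (flev F) b) * (\<Prod>b\<in>F. level ?c v (flev F) b))"
    if "F \<in> odd_sets A" for F
  proof -
    have s: "odd_sign (card F) * odd_sign (card F) = 1" using that by (intro odd_sign_squared) (simp add: odd_sets_def)
    have "(\<i> * complex_of_real rho) * (\<i> * complex_of_real rho) = - complex_of_real excess"
      using rho(2) by (simp add: mult.left_commute mult.assoc[symmetric] flip: of_real_mult)
    then have k: "(\<i> * complex_of_real rho) ^ flev F * (\<i> * complex_of_real rho) ^ flev F = (- complex_of_real excess) ^ flev F"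
      by (simp flip: power_mult_distrib)
    have "phi_coeff rho \<i> u F * phi_coeff rho \<i> v F = ((\<i> * complex_of_real rho) ^ flev F * (\<i> * complex_of_real rho) ^ flev F) *
       complex_of_real ((odd_sign (card F) * odd_sign (card F)) * ((\<Prod>b\<in>F. level ?c u (flev F) b) * (\<Prod>b\<in>F. level ?c v (flev F) b)))"
      unfolding phi_coeff_def by (simp only: of_real_mult mult_ac)
    then show ?thesis unfolding k s by simp
  qed
  ultimately show ?thesis by (subst has_sum_cong) auto
qed

text \<open>The coefficients of the measure may be nonzero on sets that mix levels, but those of the
  function vanish there. In the pairing, products of \<open>total psi_weight v\<close> are therefore
  seen at one level at a time.\<close>

lemma phi_riesz_has_sum:
  fixes u v :: "'a \<Rightarrow> real"
  assumes rho: "0 < rho"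
    and S: "sums_le (\<lambda>a. \<bar>(rho ^ lvl a * total (\<lambda>_. 1 / rho) u a) * total psi_weight v a\<bar>) A S"
  shows "((\<lambda>F. phi_coeff rho 1 u F * complex_of_real (riesz_coeff (total psi_weight v) F))
     has_sum (\<Sum>\<^sub>\<infinity>\<alpha>\<in>A. complex_of_real (u \<alpha> * v \<alpha>))) (odd_sets A)"
proof -
  let ?c = "\<lambda>_::nat. 1 / rho"
  define m where "m j k = complex_of_real (rho ^ j * (odd_sign k * 2 / 2 ^ k))" for j k
  have S': "sums_le (\<lambda>a. cmod (complex_of_real rho ^ lvl a * complex_of_real (total ?c u a * total psi_weight v a))) A S"
    by (rule sums_le_mono[OF S]) (use rho in \<open>auto simp: norm_mult norm_power abs_mult\<close>)
  have "((\<lambda>F. m (flev F) (card F) * complex_of_real ((\<Prod>b\<in>F. level ?c u (flev F) b) * (\<Prod>b\<in>F. level psi_weight v (flev F) b)))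
     has_sum (\<Sum>\<^sub>\<infinity>\<alpha>\<in>A. complex_of_real (u \<alpha> * v \<alpha>))) (odd_sets A)"
  proof (rule paired_products_has_sum[where m=m and c="?c" and c'=psi_weight, OF _ _ S'])
    show "m j 1 = complex_of_real rho ^ j" for j using odd_sign_one by (simp add: m_def)
    show "m j k = - (complex_of_real rho ^ Suc j * complex_of_real (1 / rho * psi_weight k))" for j k
      using rho by (simp add: m_def psi_weight_def)
  qed
  moreover have "phi_coeff rho 1 u F * complex_of_real (riesz_coeff (total psi_weight v) F)
     = m (flev F) (card F) * complex_of_real ((\<Prod>b\<in>F. level ?c u (flev F) b) * (\<Prod>b\<in>F. level psi_weight v (flev F) b))"
    if F: "F \<in> odd_sets A" for F
  proof (cases "(\<Prod>b\<in>F. level ?c u (flev F) b) = 0")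
    case True
    then show ?thesis by (simp add: phi_coeff_def)
  next
    case False
    have ne: "finite F" "F \<noteq> {}" "odd (card F)" using F by (auto simp: odd_sets_def)
    have "total psi_weight v b = level psi_weight v (flev F) b" if "b \<in> F" for b
      using level_prod_nonzero(1)[OF False ne(1,2) that] by (simp add: total_def)
    then have "(\<Prod>b\<in>F. total psi_weight v b / 2) = (\<Prod>b\<in>F. level psi_weight v (flev F) b / 2)" by (intro prod.cong) auto
    also have "\<dots> = (\<Prod>b\<in>F. level psi_weight v (flev F) b) / 2 ^ card F"
      by (simp add: prod_dividef)
    finally have "riesz_coeff (total psi_weight v) F = 2 * ((\<Prod>b\<in>F. level psi_weight v (flev F) b) / 2 ^ card F)"
      using ne(3) by (simp add: riesz_coeff_def)
    then show ?thesis by (simp add: phi_coeff_def m_def)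
  qed
  ultimately show ?thesis by (subst has_sum_cong) auto
qed

end

section \<open>The bounded functions\<close>

lemma powr_le_one_imp_le_one:
  fixes t q :: real
  assumes "0 < q" "t powr q \<le> 1" shows "t \<le> 1"
proof (rule ccontr)
  assume "\<not> t \<le> 1"
  then have "1 powr q < t powr q" using assms(1) by (intro powr_less_mono2) auto
  then show False using assms(2) by simp
qed

text \<open>The norm is informative only inside the space, as an infinite sum that does not converge
  has the value 0. Hence membership of the difference is secured before its norm is used.\<close>

lemma lp_diff_sums_le:
  assumes p: "1 \<le> p" "p \<noteq> \<infinity>" and x: "x \<in> lp_ball p S" and y: "y \<in> lp_ball p S"
    and le: "lp_norm p S (\<lambda>i. x i - y i) \<le> C"
  shows "sums_le (\<lambda>i. cmod (x i - y i) powr enn2real p) S (C powr enn2real p)"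
proof (rule lp_norm_sums_le[OF p _ le])
  have q: "1 \<le> enn2real p" using p by (cases p) auto
  have "sums_le (\<lambda>i. 2 powr (enn2real p - 1) * (cmod (x i) powr enn2real p + cmod (y i) powr enn2real p)) S (2 powr (enn2real p - 1) * (1 + 1))"
    by (intro sums_le_cmult sums_le_add lp_ball_sums_le p x y) simp
  then have "sums_le (\<lambda>i. cmod (x i - y i) powr enn2real p) S (2 powr (enn2real p - 1) * (1 + 1))"
  proof (rule sums_le_mono)
    fix i
    have "cmod (x i - y i) powr enn2real p \<le> (cmod (x i) + cmod (y i)) powr enn2real p"
      using q norm_triangle_ineq4[of "x i" "y i"] by (intro powr_mono2) auto
    also have "\<dots> \<le> 2 powr (enn2real p - 1) * (cmod (x i) powr enn2real p + cmod (y i) powr enn2real p)"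
      by (rule powr_add_le_two) (use q in auto)
    finally show "cmod (x i - y i) powr enn2real p \<le> 2 powr (enn2real p - 1) * (cmod (x i) powr enn2real p + cmod (y i) powr enn2real p)" .
  qed auto
  then show "(\<lambda>i. x i - y i) \<in> lp_space p S"
    by (rule lp_spaceI[OF p(2)]) (use x y in \<open>simp add: lp_ball_def lp_space_def\<close>)
qed

context haar_levels
begin

definition unit_ball :: "ennreal \<Rightarrow> ('a \<Rightarrow> real) \<Rightarrow> bool"
  where "unit_ball p u \<longleftrightarrow> (if p = \<infinity> then \<forall>a\<in>A. \<bar>u a\<bar> \<le> 1 else sums_le (\<lambda>a. \<bar>u a\<bar> powr enn2real p) A 1)"

lemma enn2real_ge_one: "1 \<le> p \<Longrightarrow> p \<noteq> \<infinity> \<Longrightarrow> 1 \<le> enn2real p"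
  by (cases p) auto

lemma unit_ball_abs_le:
  assumes "1 \<le> p" "unit_ball p u" "a \<in> A" shows "\<bar>u a\<bar> \<le> 1"
proof (cases "p = \<infinity>")
  case False
  then have q: "1 \<le> enn2real p" using assms(1) enn2real_ge_one by blast
  have "\<bar>u a\<bar> powr enn2real p \<le> 1"
    using assms False sums_le_mem[of "\<lambda>a. \<bar>u a\<bar> powr enn2real p" A 1 a] by (simp add: unit_ball_def)
  then show ?thesis
    using q powr_le_one_imp_le_one[of "enn2real p" "\<bar>u a\<bar>"] by simp
qed (use assms in \<open>simp add: unit_ball_def\<close>)

lemma unit_ball_Re_Im:
  assumes p: "1 \<le> p" and x: "x \<in> lp_ball p A"
  shows "unit_ball p (\<lambda>a. Re (x a))" "unit_ball p (\<lambda>a. Im (x a))"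
proof -
  have "unit_ball p (\<lambda>a. Re (x a)) \<and> unit_ball p (\<lambda>a. Im (x a))"
  proof (cases "p = \<infinity>")
    case True
    then show ?thesis unfolding unit_ball_def
      using lp_ball_infinity[of x A] x order_trans[OF abs_Re_le_cmod[of "x _"]] order_trans[OF abs_Im_le_cmod[of "x _"]] by simp
  next
    case False
    show ?thesis unfolding unit_ball_def
      using False sums_le_mono[OF lp_ball_sums_le[OF p False x], of 1 A "\<lambda>a. \<bar>Re (x a)\<bar> powr enn2real p"]
        sums_le_mono[OF lp_ball_sums_le[OF p False x], of 1 A "\<lambda>a. \<bar>Im (x a)\<bar> powr enn2real p"]
      by (simp add: powr_mono2 abs_Re_le_cmod abs_Im_le_cmod)
  qed
  then show "unit_ball p (\<lambda>a. Re (x a))" "unit_ball p (\<lambda>a. Im (x a))" by auto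
qed

lemma lp_ball_cnj: "y \<in> lp_ball p A \<Longrightarrow> (\<lambda>\<alpha>. cnj (y \<alpha>)) \<in> lp_ball p A"
  by (simp add: lp_ball_def lp_space_def lp_norm_def split: if_splits)

text \<open>Equal to \<delta>^(2/p), chosen so that its p-th power is \<open>excess\<close>.\<close>

definition ratio :: "ennreal \<Rightarrow> real"
  where "ratio p = excess powr (1 / enn2real p)"

text \<open>The factor \<open>\<i>\<close> per level makes the self-dual case \<open>p = 2\<close> work: there the same
  coordinates are fed into both factors of Parseval's formula, so that the signs needed for the
  cancellation cannot be put on one of them.\<close>

definition twist :: "ennreal \<Rightarrow> complex"
  where "twist p = (if p = 2 then \<i> else 1)"

text \<open>Real and imaginary parts run through the recursion separately; bilinearity of the
  pairing recovers the complex form.\<close>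

definition Phi :: "ennreal \<Rightarrow> ('a \<Rightarrow> complex) \<Rightarrow> ('a \<Rightarrow> complex) \<Rightarrow> complex"
  where "Phi p x \<omega> = phi_series (ratio p) (twist p) (\<lambda>a. Re (x a)) \<omega>
    + \<i> * phi_series (ratio p) (twist p) (\<lambda>a. Im (x a)) \<omega>"

definition Psi :: "('a \<Rightarrow> complex) \<Rightarrow> ('a \<Rightarrow> complex) set \<Rightarrow> complex"
  where "Psi x = riesz_combination (total psi_weight (\<lambda>a. Re (x a))) (total psi_weight (\<lambda>a. Im (x a)))"

definition Phi_hat :: "ennreal \<Rightarrow> ('a \<Rightarrow> complex) \<Rightarrow> 'a set \<Rightarrow> complex"
  where "Phi_hat p x F = phi_coeff (ratio p) (twist p) (\<lambda>a. Re (x a)) F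
    + \<i> * phi_coeff (ratio p) (twist p) (\<lambda>a. Im (x a)) F"

definition Psi_hat :: "('a \<Rightarrow> complex) \<Rightarrow> 'a set \<Rightarrow> complex"
  where "Psi_hat x F = complex_of_real (riesz_coeff (total psi_weight (\<lambda>a. Re (x a))) F)
    + \<i> * complex_of_real (riesz_coeff (total psi_weight (\<lambda>a. Im (x a))) F)"

lemma twist: "cmod (twist p) = 1"
  by (simp add: twist_def)

context
  fixes p :: ennreal
  assumes p: "1 \<le> p" "p \<le> 2"
begin

lemma p_real: "p \<noteq> \<infinity>" "1 \<le> enn2real p" "enn2real p \<le> 2"
proof -
  show ne: "p \<noteq> \<infinity>" using p(2) by (auto simp: top_unique)
  then show "1 \<le> enn2real p" using p(1) enn2real_ge_one by blast
  show "enn2real p \<le> 2" using p(2) ne enn2real_mono[of p 2] by simp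
qed

lemma ratio: "0 < ratio p" "ratio p < 1" "ratio p powr enn2real p = excess"
proof -
  show "0 < ratio p" using excess by (simp add: ratio_def)
  have "excess powr (1 / enn2real p) < 1 powr (1 / enn2real p)"
    using excess p_real by (intro powr_less_mono2) auto
  then show "ratio p < 1" by (simp add: ratio_def)
  show "ratio p powr enn2real p = excess" using excess p_real by (simp add: ratio_def powr_powr)
qed

lemma weight_bound: "\<bar>1 / ratio p\<bar> powr enn2real p \<le> 1 / excess" "1 / excess * (sinh 1 - 1) \<le> 1"
  using ratio excess(1) by (simp_all add: powr_divide flip: excess_def)

lemma unit_ball_sums: "unit_ball p u \<longleftrightarrow> sums_le (\<lambda>a. \<bar>u a\<bar> powr enn2real p) A 1"
  using p_real by (simp add: unit_ball_def)

text \<open>The weight \<open>1 / ratio p\<close> offsets the contraction exactly, so no level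
  leaves the unit ball for p-th powers. Its entries are then at most 1 in modulus, and for
  \<open>p \<le> 2\<close> squares are dominated by p-th powers.\<close>

lemma level_square_sums:
  assumes "unit_ball p u" shows "sums_le (\<lambda>a. (level (\<lambda>_. 1 / ratio p) u j a)\<^sup>2) A 1"
proof -
  have q: "0 < enn2real p" using p_real by simp
  have s: "sums_le (\<lambda>a. \<bar>level (\<lambda>_. 1 / ratio p) u j a\<bar> powr enn2real p) A 1"
    using level_sums_le[OF q weight_bound _ _ assms[unfolded unit_ball_sums], of j] by simp
  show ?thesis
  proof (rule sums_le_mono[OF s])
    fix a assume "a \<in> A"
    from sums_le_mem[OF s this] have "\<bar>level (\<lambda>_. 1 / ratio p) u j a\<bar> powr enn2real p \<le> 1" .
    then have le: "\<bar>level (\<lambda>_. 1 / ratio p) u j a\<bar> \<le> 1"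
      using p_real powr_le_one_imp_le_one[of "enn2real p" "\<bar>level (\<lambda>_. 1 / ratio p) u j a\<bar>"] by simp
    have "(level (\<lambda>_. 1 / ratio p) u j a)\<^sup>2 = \<bar>level (\<lambda>_. 1 / ratio p) u j a\<bar> powr 2" by simp
    also have "\<dots> \<le> \<bar>level (\<lambda>_. 1 / ratio p) u j a\<bar> powr enn2real p"
      using p_real le by (intro powr_mono') auto
    finally show "(level (\<lambda>_. 1 / ratio p) u j a)\<^sup>2 \<le> \<bar>level (\<lambda>_. 1 / ratio p) u j a\<bar> powr enn2real p" .
  qed auto
qed

lemma scaled_total_sums:
  assumes "unit_ball p u"
  shows "sums_le (\<lambda>a. \<bar>ratio p ^ lvl a * total (\<lambda>_. 1 / ratio p) u a\<bar> powr enn2real p) {a\<in>A. n \<le> lvl a} (excess ^ n / (1 - excess))"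
  using total_sums_le[where c="\<lambda>_. 1 / ratio p" and C="1 / excess" and \<theta>=1 and p="enn2real p" and r=excess and lam="ratio p" and x=u and n=n]
    weight_bound excess ratio p_real assms[unfolded unit_ball_sums] by simp

text \<open>Singletons contribute the geometric sum \<open>1 / (1 - excess)\<close> over all levels,
  larger odd sets the sum \<open>excess / (1 - excess)\<close> over the levels from 1 on.\<close>

lemma phi_coeff_sums:
  assumes u: "unit_ball p u"
  shows "sums_le (\<lambda>F. cmod (phi_coeff (ratio p) (twist p) u F) powr enn2real p) {F. finite F \<and> F \<subseteq> A}
    ((1 + excess) / (1 - excess))"
proof -
  have t0: "total c (\<lambda>_. 0) a = 0" for c a using total_minus[of c "\<lambda>_. 0" a] by simp
  have "sums_le (\<lambda>F. cmod (phi_coeff (ratio p) (twist p) u F) powr enn2real p) {F. finite F \<and> F \<subseteq> A}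
    (1 / (1 - excess) + excess / (1 - excess))"
  proof (rule hat_sums_le)
    show "sums_le (\<lambda>a. \<bar>ratio p ^ lvl a * total (\<lambda>_. 1 / ratio p) u a\<bar> powr enn2real p) A (1 / (1 - excess))"
      using scaled_total_sums[OF u, of 0] by simp
    show "sums_le (\<lambda>a. \<bar>ratio p ^ lvl a * total (\<lambda>_. 1 / ratio p) u a\<bar> powr enn2real p) {a\<in>A. 1 \<le> lvl a} (excess / (1 - excess))"
      using scaled_total_sums[OF u, of 1] by simp
    show "cmod (phi_coeff (ratio p) (twist p) u {a}) powr enn2real p \<le> \<bar>ratio p ^ lvl a * total (\<lambda>_. 1 / ratio p) u a\<bar> powr enn2real p" for a
      using phi_coeff_diff_one[OF twist ratio(1), of p u a "\<lambda>_. 0"] by (simp add: phi_coeff_zero t0)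
    show "cmod (phi_coeff (ratio p) (twist p) u F) powr enn2real p \<le> \<bar>ratio p ^ lvl (up F) * total (\<lambda>_. 1 / ratio p) u (up F)\<bar> powr enn2real p"
      if F: "F \<in> odd3_sets A" for F
      using phi_coeff_diff_three[OF twist ratio(1) F, of p u "\<lambda>_. 0"] odd3D[OF F] by (simp add: phi_coeff_zero t0)
  qed (simp_all add: phi_coeff_even)
  then show ?thesis by (simp add: add_divide_distrib)
qed

lemma phi_coeff_uniformly_continuous:
  assumes e: "0 < \<epsilon>"
  shows "\<exists>\<eta>>0. \<forall>u v. unit_ball p u \<longrightarrow> unit_ball p v \<longrightarrow> sums_le (\<lambda>a. \<bar>u a - v a\<bar> powr enn2real p) A \<eta> \<longrightarrow>
    sums_le (\<lambda>F. cmod (phi_coeff (ratio p) (twist p) u F - phi_coeff (ratio p) (twist p) v F) powr enn2real p)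
      {F. finite F \<and> F \<subseteq> A} \<epsilon>"
proof -
  let ?D = "\<lambda>u v a. \<bar>ratio p ^ lvl a * (total (\<lambda>_. 1 / ratio p) u a - total (\<lambda>_. 1 / ratio p) v a)\<bar> powr enn2real p"
  obtain \<eta> where \<eta>: "0 < \<eta>" "\<forall>u v. unit_ball p u \<longrightarrow> unit_ball p v \<longrightarrow> sums_le (\<lambda>a. \<bar>u a - v a\<bar> powr enn2real p) A \<eta> \<longrightarrow>
      sums_le (?D u v) A (\<epsilon> / 2)"
    using total_uniformly_continuous[where c="\<lambda>_. 1 / ratio p" and C="1 / excess" and \<theta>=1 and p="enn2real p" and r=excess and lam="ratio p" and \<epsilon>="\<epsilon> / 2"]
      weight_bound excess ratio p_real e unfolding unit_ball_sums by auto
  show ?thesis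
  proof (intro exI[of _ \<eta>] conjI allI impI \<eta>(1))
    fix u v assume uv: "unit_ball p u" "unit_ball p v" "sums_le (\<lambda>a. \<bar>u a - v a\<bar> powr enn2real p) A \<eta>"
    then have D: "sums_le (?D u v) A (\<epsilon> / 2)" using \<eta>(2) by blast
    have "sums_le (\<lambda>F. cmod (phi_coeff (ratio p) (twist p) u F - phi_coeff (ratio p) (twist p) v F) powr enn2real p)
      {F. finite F \<and> F \<subseteq> A} (\<epsilon> / 2 + \<epsilon> / 2)"
    proof (rule hat_sums_le[OF D])
      show "sums_le (?D u v) {a\<in>A. 1 \<le> lvl a} (\<epsilon> / 2)" by (rule sums_le_mono[OF D]) auto
    qed (simp_all add: phi_coeff_diff_one[OF twist ratio(1)] phi_coeff_diff_three[OF twist ratio(1)] phi_coeff_even)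
    then show "sums_le (\<lambda>F. cmod (phi_coeff (ratio p) (twist p) u F - phi_coeff (ratio p) (twist p) v F) powr enn2real p)
      {F. finite F \<and> F \<subseteq> A} \<epsilon>" by simp
  qed
qed

lemma Phi_properties:
  assumes x: "x \<in> lp_ball p A"
  shows Phi_measurable: "Phi p x \<in> borel_measurable (cube_borel A)"
    and Phi_bound: "cmod (Phi p x \<omega>) \<le> 2 * sqrt (exp 1) / (1 - ratio p)"
    and Phi_walsh: "finite F \<Longrightarrow> F \<subseteq> A \<Longrightarrow> (\<integral>\<omega>. Phi p x \<omega> * (\<Prod>\<alpha>\<in>F. \<omega> \<alpha>) \<partial>P) = Phi_hat p x F"
    and Phi_minus: "Phi p (\<lambda>a. - x a) \<omega> = - Phi p x \<omega>"
proof -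
  note u = unit_ball_Re_Im(1)[OF p(1) x] and v = unit_ball_Re_Im(2)[OF p(1) x]
  note su = level_square_sums[OF u] and sv = level_square_sums[OF v]
  let ?f = "phi_series (ratio p) (twist p) (\<lambda>a. Re (x a))" and ?g = "phi_series (ratio p) (twist p) (\<lambda>a. Im (x a))"
  note f = phi_series[OF ratio(1,2) twist su] and g = phi_series[OF ratio(1,2) twist sv]
  have Pd: "Phi p x = (\<lambda>\<omega>. ?f \<omega> + \<i> * ?g \<omega>)" by (simp add: Phi_def fun_eq_iff)
  show "Phi p x \<in> borel_measurable (cube_borel A)"
    unfolding Pd by (intro borel_measurable_add borel_measurable_times f(1) g(1)) simp
  have "cmod (Phi p x \<omega>) \<le> cmod (?f \<omega>) + cmod (?g \<omega>)"
    using norm_triangle_ineq[of "?f \<omega>" "\<i> * ?g \<omega>"] by (simp add: Pd norm_mult)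
  also have "\<dots> \<le> sqrt (exp 1) / (1 - ratio p) + sqrt (exp 1) / (1 - ratio p)"
    by (intro add_mono f(2) g(2))
  finally show "cmod (Phi p x \<omega>) \<le> 2 * sqrt (exp 1) / (1 - ratio p)" by simp
  show "Phi p (\<lambda>a. - x a) \<omega> = - Phi p x \<omega>"
    using phi_series_minus[OF ratio(1,2) twist su] phi_series_minus[OF ratio(1,2) twist sv]
    by (simp add: Phi_def)
  assume F: "finite F" "F \<subseteq> A"
  define W where "W \<omega> = (\<Prod>\<alpha>\<in>F. \<omega> \<alpha>)" for \<omega> :: "'a \<Rightarrow> complex"
  have i: "integrable P (\<lambda>\<omega>. h \<omega> * W \<omega>)"
    if "h \<in> borel_measurable (cube_borel A)" "\<And>\<omega>. cmod (h \<omega>) \<le> sqrt (exp 1) / (1 - ratio p)" for h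
  proof (rule bounded_integrable)
    show "(\<lambda>\<omega>. h \<omega> * W \<omega>) \<in> borel_measurable (cube_borel A)"
      unfolding W_def using that(1) prod_coordinate_measurable[OF F(2)] by (rule borel_measurable_times)
    show "cmod (h \<omega> * W \<omega>) \<le> sqrt (exp 1) / (1 - ratio p)" if "\<omega> \<in> cube A" for \<omega>
      using \<open>\<And>\<omega>. cmod (h \<omega>) \<le> sqrt (exp 1) / (1 - ratio p)\<close>[of \<omega>] norm_prod_coordinate[OF that F(2)] by (simp add: norm_mult W_def)
  qed
  have "(\<integral>\<omega>. Phi p x \<omega> * W \<omega> \<partial>P) = (\<integral>\<omega>. ?f \<omega> * W \<omega> + \<i> * (?g \<omega> * W \<omega>) \<partial>P)"
    by (simp add: Pd distrib_right mult.assoc)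
  also have "\<dots> = (\<integral>\<omega>. ?f \<omega> * W \<omega> \<partial>P) + \<i> * (\<integral>\<omega>. ?g \<omega> * W \<omega> \<partial>P)"
    using i[OF f(1,2)] i[OF g(1,2)]
    by (simp only: Bochner_Integration.integral_add integrable_mult_right integral_mult_right_zero)
  also have "\<dots> = Phi_hat p x F"
    unfolding W_def Phi_hat_def f(3)[OF F] g(3)[OF F] ..
  finally show "(\<integral>\<omega>. Phi p x \<omega> * (\<Prod>\<alpha>\<in>F. \<omega> \<alpha>) \<partial>P) = Phi_hat p x F" unfolding W_def .
qed

lemma Phi_transform:
  assumes "x \<in> lp_ball p A" "finite F" "F \<subseteq> A"
  shows "walsh_transform A (density_measure P (Phi p x)) (walsh_fun A F) = Phi_hat p x F"
  using walsh_transform_density[OF Phi_measurable[OF assms(1)] Phi_bound[OF assms(1)] assms(2,3)]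
    Phi_walsh[OF assms] by simp

lemma Phi_hat_sums:
  assumes x: "x \<in> lp_ball p A"
  shows "sums_le (\<lambda>F. cmod (Phi_hat p x F) powr enn2real p) {F. finite F \<and> F \<subseteq> A}
    ((2 * ((1 + excess) / (1 - excess))) powr enn2real p)"
proof -
  define K where "K = (1 + excess) / (1 - excess)"
  have K: "1 \<le> K" using excess by (simp add: K_def)
  note u = unit_ball_Re_Im(1)[OF p(1) x] and v = unit_ball_Re_Im(2)[OF p(1) x]
  have "sums_le (\<lambda>F. cmod (Phi_hat p x F) powr enn2real p) {F. finite F \<and> F \<subseteq> A} (2 powr (enn2real p - 1) * (K + K))"
    unfolding Phi_hat_def K_def by (rule complex_sums_le[OF p_real(2) phi_coeff_sums[OF u] phi_coeff_sums[OF v]])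
  then show ?thesis unfolding K_def[symmetric]
  proof (rule sums_le_mono)
    have "2 powr (enn2real p - 1) * (K + K) = 2 powr enn2real p * K" by (simp add: powr_diff)
    also have "K \<le> K powr enn2real p" using K p_real powr_mono[of 1 "enn2real p" K] by simp
    then have "2 powr enn2real p * K \<le> 2 powr enn2real p * K powr enn2real p" by simp
    also have "\<dots> = (2 * K) powr enn2real p" using K by (simp add: powr_mult)
    finally show "2 powr (enn2real p - 1) * (K + K) \<le> (2 * K) powr enn2real p" .
  qed auto
qed

text \<open>The bound on the transform has to fit under the one on the sup norm. For the numerators,
  \<open>1 + excess = sinh 1 \<le> exp 1 / 2 \<le> sqrt (exp 1)\<close>, the last step because
  \<open>sqrt (exp 1) \<le> 2\<close>; for the denominators,
  \<open>excess \<le> ratio p\<close>.\<close>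

lemma constant_bound: "2 * ((1 + excess) / (1 - excess)) \<le> 2 * sqrt (exp 1) / (1 - ratio p)"
proof -
  have "excess \<le> ratio p"
  proof -
    have "excess powr 1 \<le> excess powr (1 / enn2real p)"
      using excess p_real by (intro powr_mono') auto
    then show ?thesis using excess by (simp add: ratio_def)
  qed
  define s where "s = exp (1 / 2 :: real)"
  have s: "s * s = exp 1" "0 < s" by (simp_all add: s_def flip: exp_add)
  have "s \<le> 2"
  proof (rule ccontr)
    assume "\<not> s \<le> 2"
    then have "2 * 2 < s * s" by (intro mult_strict_mono) auto
    then show False using s exp_le by simp
  qed
  have "1 + excess = sinh 1" by (simp add: excess_def)
  also have "\<dots> \<le> exp 1 / 2" by (simp add: sinh_def)
  also have "\<dots> \<le> s" using \<open>s \<le> 2\<close> s by (simp flip: s(1))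
  also have "s = sqrt (exp 1)" using s by (metis real_sqrt_mult_self real_sqrt_abs2 abs_of_pos)
  finally have "1 + excess \<le> sqrt (exp 1)" .
  then have "(1 + excess) / (1 - excess) \<le> sqrt (exp 1) / (1 - ratio p)"
    using \<open>excess \<le> ratio p\<close> excess ratio by (intro frac_le) auto
  then show ?thesis by (simp only: times_divide_eq_right[symmetric] mult_le_cancel_left_pos zero_less_numeral)
qed

lemma Phi_transform_sums:
  assumes "x \<in> lp_ball p A"
  shows "sums_le (\<lambda>w. cmod (walsh_transform A (density_measure P (Phi p x)) w) powr enn2real p) (walsh A)
    ((2 * ((1 + excess) / (1 - excess))) powr enn2real p)"
  by (rule sums_le_walsh, rule sums_le_mono[OF Phi_hat_sums[OF assms]])
    (use Phi_transform[OF assms] in auto)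

lemma Phi_Linf_space: 
  assumes x: "x \<in> lp_ball p A"
  shows "Phi p x \<in> Linf_p_space A P p"
    and "Linf_p_norm A P p (Phi p x) \<le> 2 * sqrt (exp 1) / (1 - ratio p)"
proof -
  define C where "C = 2 * sqrt (exp 1) / (1 - ratio p)"
  have C: "0 \<le> C" using ratio by (simp add: C_def)
  have m: "Phi p x \<in> borel_measurable P" using Phi_measurable[OF x] by simp
  have es: "esssup P (\<lambda>\<omega>. ereal (cmod (Phi p x \<omega>))) \<le> ereal C"
  proof (rule esssup_I)
    show "(\<lambda>\<omega>. ereal (cmod (Phi p x \<omega>))) \<in> borel_measurable P" using m by measurable
  qed (use Phi_bound[OF x] in \<open>simp add: C_def\<close>)
  then have "esssup P (\<lambda>\<omega>. ereal (cmod (Phi p x \<omega>))) < \<infinity>" by (rule le_less_trans) simp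
  then have "Phi p x \<in> Linf_space P" unfolding Linf_space_def using m by blast
  moreover have "walsh_transform A (density_measure P (Phi p x)) \<in> lp_space p (walsh A)"
    by (rule lp_spaceI[OF p_real(1) Phi_transform_sums[OF x]]) (simp add: walsh_transform_def)
  ultimately show "Phi p x \<in> Linf_p_space A P p" by (simp add: Linf_p_space_def)
  have "Linf_norm P (Phi p x) \<le> C"
    unfolding Linf_norm_def using es C by (cases "esssup P (\<lambda>\<omega>. ereal (cmod (Phi p x \<omega>)))") auto
  moreover have "lp_norm p (walsh A) (walsh_transform A (density_measure P (Phi p x))) \<le> 2 * ((1 + excess) / (1 - excess))"
    by (rule lp_norm_le[OF p(1) p_real(1) Phi_transform_sums[OF x]]) (use excess in auto)
  ultimately show "Linf_p_norm A P p (Phi p x) \<le> 2 * sqrt (exp 1) / (1 - ratio p)"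
    unfolding Linf_p_norm_def using constant_bound by (simp add: C_def)
qed

lemma Phi_hat_level_zero:
  assumes "\<alpha> \<in> A" shows "Phi_hat p x {e 0 {\<alpha>}} = x \<alpha>"
proof -
  have "flev {e 0 {\<alpha>}} = 0" by (rule flev_eq) (use assms in \<open>auto simp: lvl_e\<close>)
  then have "phi_coeff (ratio p) (twist p) u {e 0 {\<alpha>}} = complex_of_real (u \<alpha>)" for u
    using odd_sign_one level_zero_e[OF assms] by (simp add: phi_coeff_def del: level.simps)
  then show ?thesis by (simp only: Phi_hat_def complex_eq[of "x \<alpha>", symmetric])
qed

text \<open>The Walsh coefficient on the singleton of a level 0 coordinate is an entry of the
  vector, and coefficients depend on a function only up to null sets.\<close>

lemma Phi_inj:
  assumes x: "x \<in> lp_ball p A" and y: "y \<in> lp_ball p A" and ae: "AE \<omega> in P. Phi p x \<omega> = Phi p y \<omega>"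
  shows "x = y"
proof
  fix \<alpha>
  show "x \<alpha> = y \<alpha>"
  proof (cases "\<alpha> \<in> A")
    case True
    then have F: "finite {e 0 {\<alpha>}}" "{e 0 {\<alpha>}} \<subseteq> A" using e_mem by auto
    have "(\<integral>\<omega>. Phi p x \<omega> * (\<Prod>\<alpha>\<in>{e 0 {\<alpha>}}. \<omega> \<alpha>) \<partial>P) = (\<integral>\<omega>. Phi p y \<omega> * (\<Prod>\<alpha>\<in>{e 0 {\<alpha>}}. \<omega> \<alpha>) \<partial>P)"
    proof (rule integral_cong_AE)
      show "(\<lambda>\<omega>. Phi p x \<omega> * (\<Prod>\<alpha>\<in>{e 0 {\<alpha>}}. \<omega> \<alpha>)) \<in> borel_measurable P"
        using borel_measurable_times[OF Phi_measurable[OF x] prod_coordinate_measurable[OF F(2)]] by simp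
      show "(\<lambda>\<omega>. Phi p y \<omega> * (\<Prod>\<alpha>\<in>{e 0 {\<alpha>}}. \<omega> \<alpha>)) \<in> borel_measurable P"
        using borel_measurable_times[OF Phi_measurable[OF y] prod_coordinate_measurable[OF F(2)]] by simp
      show "AE \<omega> in P. Phi p x \<omega> * (\<Prod>\<alpha>\<in>{e 0 {\<alpha>}}. \<omega> \<alpha>) = Phi p y \<omega> * (\<Prod>\<alpha>\<in>{e 0 {\<alpha>}}. \<omega> \<alpha>)"
        using ae by eventually_elim simp
    qed
    then show ?thesis
      unfolding Phi_walsh[OF x F] Phi_walsh[OF y F] Phi_hat_level_zero[OF True] .
  next
    case False
    then show ?thesis using x y by (simp add: lp_ball_def lp_space_def)
  qed
qed

lemma Phi_transform_continuous:
  assumes x: "x \<in> lp_ball p A" and \<epsilon>: "0 < \<epsilon>"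
  shows "\<exists>\<eta>>0. \<forall>y\<in>lp_ball p A. lp_norm p A (\<lambda>\<alpha>. x \<alpha> - y \<alpha>) < \<eta> \<longrightarrow>
    lp_norm p (walsh A) (\<lambda>w. walsh_transform A (density_measure P (Phi p x)) w - walsh_transform A (density_measure P (Phi p y)) w) < \<epsilon>"
proof -
  let ?q = "enn2real p"
  \<comment> \<open>Recombining real and imaginary parts costs
    \<open>2 powr (?q - 1) * (b + b)\<close>, which this choice turns into
    \<open>(\<epsilon> / 2) powr ?q\<close>; the half makes the final inequality strict.\<close>
  define b where "b = (\<epsilon> / 2) powr ?q / 2 powr ?q"
  have b: "0 < b" using \<epsilon> by (simp add: b_def)
  obtain \<eta> where \<eta>: "0 < \<eta>" "\<forall>u v. unit_ball p u \<longrightarrow> unit_ball p v \<longrightarrow> sums_le (\<lambda>a. \<bar>u a - v a\<bar> powr ?q) A \<eta> \<longrightarrow>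
    sums_le (\<lambda>F. cmod (phi_coeff (ratio p) (twist p) u F - phi_coeff (ratio p) (twist p) v F) powr ?q)
      {F. finite F \<and> F \<subseteq> A} b" using phi_coeff_uniformly_continuous[OF b] by blast
  show ?thesis
  proof (intro exI[of _ "\<eta> powr (1 / ?q)"] conjI ballI impI)
    show "0 < \<eta> powr (1 / ?q)" using \<eta>(1) by simp
    fix y assume y: "y \<in> lp_ball p A" and xy: "lp_norm p A (\<lambda>\<alpha>. x \<alpha> - y \<alpha>) < \<eta> powr (1 / ?q)"
    have d: "sums_le (\<lambda>a. cmod (x a - y a) powr ?q) A \<eta>"
      using lp_diff_sums_le[OF p(1) p_real(1) x y less_imp_le[OF xy]] \<eta>(1) p_real by (simp add: powr_powr)
    have "sums_le (\<lambda>a. \<bar>Re (x a) - Re (y a)\<bar> powr ?q) A \<eta>" "sums_le (\<lambda>a. \<bar>Im (x a) - Im (y a)\<bar> powr ?q) A \<eta>"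
      by (rule sums_le_mono[OF d];
          use abs_Re_le_cmod[of "x _ - y _"] abs_Im_le_cmod[of "x _ - y _"] p_real in \<open>auto intro!: powr_mono2\<close>)+
    then have c: "sums_le (\<lambda>F. cmod (phi_coeff (ratio p) (twist p) (\<lambda>a. Re (x a)) F - phi_coeff (ratio p) (twist p) (\<lambda>a. Re (y a)) F) powr ?q)
        {F. finite F \<and> F \<subseteq> A} b"
      "sums_le (\<lambda>F. cmod (phi_coeff (ratio p) (twist p) (\<lambda>a. Im (x a)) F - phi_coeff (ratio p) (twist p) (\<lambda>a. Im (y a)) F) powr ?q)
        {F. finite F \<and> F \<subseteq> A} b"
      using \<eta>(2) unit_ball_Re_Im[OF p(1) x] unit_ball_Re_Im[OF p(1) y] by blast+
    have "sums_le (\<lambda>F. cmod (Phi_hat p x F - Phi_hat p y F) powr ?q) {F. finite F \<and> F \<subseteq> A} (2 powr (?q - 1) * (b + b))"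
      by (rule sums_le_mono[OF complex_sums_le[OF p_real(2) c]]) (auto simp: Phi_hat_def algebra_simps)
    moreover have "2 powr (?q - 1) * (b + b) = (\<epsilon> / 2) powr ?q" by (simp add: b_def powr_diff)
    ultimately have "sums_le (\<lambda>F. cmod (Phi_hat p x F - Phi_hat p y F) powr ?q) {F. finite F \<and> F \<subseteq> A} ((\<epsilon> / 2) powr ?q)" by simp
    then have "sums_le (\<lambda>w. cmod (walsh_transform A (density_measure P (Phi p x)) w - walsh_transform A (density_measure P (Phi p y)) w) powr ?q)
       (walsh A) ((\<epsilon> / 2) powr ?q)"
      by (intro sums_le_walsh, elim sums_le_mono) (use Phi_transform[OF x] Phi_transform[OF y] in auto)
    from lp_norm_le[OF p(1) p_real(1) this] \<epsilon>
    show "lp_norm p (walsh A) (\<lambda>w. walsh_transform A (density_measure P (Phi p x)) w - walsh_transform A (density_measure P (Phi p y)) w) < \<epsilon>"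
      by simp
  qed
qed

end

end

section \<open>The measures and Parseval's formula\<close>

lemma sinh_half_le: "sinh (1 / 2 :: real) \<le> 1"
proof -
  have "2 * sinh (1 / 2 :: real) \<le> 2 * sinh (1 / 2) * cosh (1 / 2)" using cosh_real_ge_1[of "1 / 2"] by simp
  also have "\<dots> = sinh 1" using sinh_double[of "1 / 2 :: real"] by simp
  also have "\<dots> \<le> 2" using excess(2) by (simp add: excess_def)
  finally show ?thesis by simp
qed

lemma two_mult_le_two_power: "1 \<le> k \<Longrightarrow> 2 * real k \<le> 2 ^ k"
proof (induction k rule: dec_induct)
  case (step k)
  have "1 \<le> real k" using step(1) by simp
  then show ?case using step(3) by simp
qed simp

lemma sums_le_odd_sets:
  assumes "sums_le f (odd_sets A) S" "\<And>F. even (card F) \<Longrightarrow> f F = 0"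
  shows "sums_le f {F. finite F \<and> F \<subseteq> A} S"
proof (rule sums_leI)
  fix \<F> assume \<F>: "finite \<F>" "\<F> \<subseteq> {F. finite F \<and> F \<subseteq> A}"
  have "sum f \<F> = sum f {F\<in>\<F>. odd (card F)}"
    using \<F>(1) assms(2) by (intro sum.mono_neutral_right) auto
  also have "\<dots> \<le> S" using \<F> by (intro sums_leD[OF assms(1)]) (auto simp: odd_sets_def)
  finally show "sum f \<F> \<le> S" .
qed

text \<open>Characters correspond injectively to finite index sets, and the even ones drop out of
  the sum.\<close>

lemma infsum_walsh:
  assumes h: "\<And>F. finite F \<Longrightarrow> F \<subseteq> A \<Longrightarrow> h (walsh_fun A F) = k F"
    and even: "\<And>F. even (card F) \<Longrightarrow> k F = 0" and k: "(k has_sum s) (odd_sets A)"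
  shows "infsum h (walsh A) = s"
proof -
  have "infsum h (walsh A) = infsum (h \<circ> walsh_fun A) {F. finite F \<and> F \<subseteq> A}"
    unfolding walsh_eq_image by (rule infsum_reindex[OF inj_walsh_fun])
  also have "\<dots> = infsum k (odd_sets A)"
    by (rule infsum_cong_neutral) (use h even in \<open>auto simp: odd_sets_def\<close>)
  also have "\<dots> = s" using k by (rule infsumI)
  finally show ?thesis .
qed

text \<open>Four real pairings are combined by bilinearity. The form is bilinear and not
  sesquilinear: the conjugate in the inner product is applied to the vector beforehand.\<close>

lemma complex_product_has_sum:
  fixes x y :: "'a \<Rightarrow> complex" and G H :: "('a \<Rightarrow> real) \<Rightarrow> 'f \<Rightarrow> complex"
  assumes s: "\<And>u v. u \<in> {\<lambda>a. Re (x a), \<lambda>a. Im (x a)} \<Longrightarrow> v \<in> {\<lambda>a. Re (y a), \<lambda>a. Im (y a)} \<Longrightarrow>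
      (\<lambda>a. complex_of_real (u a * v a)) summable_on A"
    and h: "\<And>u v. u \<in> {\<lambda>a. Re (x a), \<lambda>a. Im (x a)} \<Longrightarrow> v \<in> {\<lambda>a. Re (y a), \<lambda>a. Im (y a)} \<Longrightarrow>
      ((\<lambda>F. G u F * H v F) has_sum (\<Sum>\<^sub>\<infinity>a\<in>A. complex_of_real (u a * v a))) O'"
  shows "((\<lambda>F. (G (\<lambda>a. Re (x a)) F + \<i> * G (\<lambda>a. Im (x a)) F) * (H (\<lambda>a. Re (y a)) F + \<i> * H (\<lambda>a. Im (y a)) F))
    has_sum (\<Sum>\<^sub>\<infinity>a\<in>A. x a * y a)) O'"
proof -
  define X where "X u v = (\<Sum>\<^sub>\<infinity>a\<in>A. complex_of_real (u a * v a))" for u v :: "'a \<Rightarrow> real"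
  let ?s = "X (\<lambda>a. Re (x a)) (\<lambda>a. Re (y a)) + \<i> * X (\<lambda>a. Re (x a)) (\<lambda>a. Im (y a))
    + \<i> * X (\<lambda>a. Im (x a)) (\<lambda>a. Re (y a)) + (- 1) * X (\<lambda>a. Im (x a)) (\<lambda>a. Im (y a))"
  have "((\<lambda>a. complex_of_real (Re (x a) * Re (y a)) + \<i> * complex_of_real (Re (x a) * Im (y a))
    + \<i> * complex_of_real (Im (x a) * Re (y a)) + (- 1) * complex_of_real (Im (x a) * Im (y a))) has_sum ?s) A"
    unfolding X_def by (intro has_sum_add has_sum_cmult_right has_sum_infsum s) auto
  moreover have "complex_of_real (Re (x a) * Re (y a)) + \<i> * complex_of_real (Re (x a) * Im (y a))
    + \<i> * complex_of_real (Im (x a) * Re (y a)) + (- 1) * complex_of_real (Im (x a) * Im (y a)) = x a * y a" for a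
    by (simp add: complex_eq_iff)
  ultimately have "((\<lambda>a. x a * y a) has_sum ?s) A" by simp
  then have s: "(\<Sum>\<^sub>\<infinity>a\<in>A. x a * y a) = ?s" by (rule infsumI)
  have "((\<lambda>F. G (\<lambda>a. Re (x a)) F * H (\<lambda>a. Re (y a)) F + \<i> * (G (\<lambda>a. Re (x a)) F * H (\<lambda>a. Im (y a)) F)
    + \<i> * (G (\<lambda>a. Im (x a)) F * H (\<lambda>a. Re (y a)) F) + (- 1) * (G (\<lambda>a. Im (x a)) F * H (\<lambda>a. Im (y a)) F)) has_sum ?s) O'"
    unfolding X_def by (intro has_sum_add has_sum_cmult_right h) auto
  moreover have "g * h + \<i> * (g * h') + \<i> * (g' * h) + (- 1) * (g' * h') = (g + \<i> * g') * (h + \<i> * h')" for g g' h h' :: complex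
    by (simp add: algebra_simps)
  ultimately show ?thesis unfolding s by simp
qed

lemma ennreal_conjugate:
  assumes "1 \<le> p" "p \<le> 2" "1 / p + 1 / q = (1 :: ennreal)" "2 \<le> q"
  shows "q \<noteq> \<infinity> \<Longrightarrow> 1 / enn2real p + 1 / enn2real q = 1" and "q = \<infinity> \<Longrightarrow> p = 1"
proof -
  obtain r where r: "p = ennreal r" "1 \<le> r" using assms(1,2) by (cases p) (auto simp: top_unique)
  have rp: "1 / p = ennreal (1 / r)" using r by (simp add: divide_ennreal flip: ennreal_1)
  show "p = 1" if "q = \<infinity>"
  proof -
    have "ennreal (1 / r) = ennreal 1" using assms(3) rp that by simp
    then have "r = 1" using r by (subst (asm) ennreal_inj) auto
    then show ?thesis using r by simp
  qed
  assume "q \<noteq> \<infinity>"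
  then obtain s where s: "q = ennreal s" "2 \<le> s" using assms(4) by (cases q) auto
  have "1 / q = ennreal (1 / s)" using s by (simp add: divide_ennreal flip: ennreal_1)
  then have "ennreal (1 / r + 1 / s) = ennreal 1" using assms(3) rp r s by simp
  then have "1 / r + 1 / s = 1" using r s by (subst (asm) ennreal_inj) auto
  then show "1 / enn2real p + 1 / enn2real q = 1" using r s by simp
qed

context haar_levels
begin

section \<open>Walsh coefficients of the measures\<close>

lemma abs_riesz_coeff_le:
  assumes z: "\<And>a. a \<in> A \<Longrightarrow> \<bar>z a\<bar> \<le> 1" and F: "finite F" "F \<subseteq> A"
  shows "\<bar>riesz_coeff z F\<bar> \<le> 1"
proof (cases "odd (card F)")
  case True
  have "(\<Prod>a\<in>F. \<bar>z a / 2\<bar>) \<le> (\<Prod>a\<in>F. 1 / 2)"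
    by (rule prod_mono) (use z F in \<open>auto simp: subset_iff\<close>)
  also have "\<dots> = (1 / 2) ^ card F" by simp
  also have "\<dots> \<le> (1 / 2) ^ 1" using True by (intro power_decreasing) (auto elim: oddE)
  finally show ?thesis using True by (simp add: riesz_coeff_def abs_mult abs_prod)
qed (simp add: riesz_coeff_def)

text \<open>A product over k numbers of modulus at most 1 is k-Lipschitz, and the factor 2 / 2^k
  from the halving compensates, since 2k \<le> 2^k.\<close>

lemma riesz_coeff_lipschitz:
  assumes z: "\<And>a. a \<in> A \<Longrightarrow> \<bar>z a\<bar> \<le> 1" and w: "\<And>a. a \<in> A \<Longrightarrow> \<bar>w a\<bar> \<le> 1"
    and d: "\<And>a. a \<in> A \<Longrightarrow> \<bar>z a - w a\<bar> \<le> d" "0 \<le> d" and F: "finite F" "F \<subseteq> A"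
  shows "\<bar>riesz_coeff z F - riesz_coeff w F\<bar> \<le> d"
proof (cases "odd (card F)")
  case True
  have "norm ((\<Prod>a\<in>F. z a) - (\<Prod>a\<in>F. w a)) \<le> (\<Sum>a\<in>F. norm (z a - w a))"
    by (rule norm_prod_diff) (use z w F in \<open>auto simp: subset_iff\<close>)
  also have "\<dots> \<le> (\<Sum>a\<in>F. d)" by (rule sum_mono) (use d F in auto)
  finally have D: "\<bar>(\<Prod>a\<in>F. z a) - (\<Prod>a\<in>F. w a)\<bar> \<le> real (card F) * d" by simp
  have eq: "riesz_coeff z F - riesz_coeff w F = 2 * ((\<Prod>a\<in>F. z a) - (\<Prod>a\<in>F. w a)) / 2 ^ card F"
    using True by (simp add: riesz_coeff_def prod_dividef right_diff_distrib diff_divide_distrib)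
  have "\<bar>riesz_coeff z F - riesz_coeff w F\<bar> = 2 * \<bar>(\<Prod>a\<in>F. z a) - (\<Prod>a\<in>F. w a)\<bar> / 2 ^ card F"
    by (simp only: eq abs_divide abs_mult power_abs abs_numeral)
  also have "\<dots> \<le> (2 * real (card F)) * d / 2 ^ card F" using D by (intro divide_right_mono) auto
  also have "\<dots> \<le> 2 ^ card F * d / 2 ^ card F"
    using True d(2) two_mult_le_two_power[of "card F"] by (intro divide_right_mono mult_right_mono) (auto elim: oddE)
  also have "\<dots> = d" by simp
  finally show ?thesis .
qed (simp add: riesz_coeff_def d)

text \<open>The factor 2 of the odd part becomes \<open>2 powr q\<close>, and the remaining sum of
  products over odd sets is at most \<open>sinh (1 / 2) \<le> 1\<close>.\<close>

lemma riesz_coeff_sums: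
  fixes q :: real
  assumes "sums_le (\<lambda>a. \<bar>z a / 2\<bar> powr q) A (1 / 2)"
  shows "sums_le (\<lambda>F. \<bar>riesz_coeff z F\<bar> powr q) {F. finite F \<and> F \<subseteq> A} (2 powr q)"
proof (rule sums_le_odd_sets)
  have "sums_le (\<lambda>F. 2 powr q * (\<Prod>a\<in>F. \<bar>z a / 2\<bar> powr q)) (odd_sets A) (2 powr q * sinh (1 / 2))"
    by (intro sums_le_cmult odd_sets_sum assms) auto
  then show "sums_le (\<lambda>F. \<bar>riesz_coeff z F\<bar> powr q) (odd_sets A) (2 powr q)"
    by (rule sums_le_mono)
      (use sinh_half_le in \<open>auto simp: riesz_coeff_def odd_sets_def abs_mult abs_prod powr_mult prod_nonneg prod_powr_distrib\<close>)
qed (simp add: riesz_coeff_def)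

lemma psi_total_abs_le:
  assumes "1 \<le> q" "x \<in> lp_ball q A"
  shows "\<bar>total psi_weight (\<lambda>a. Re (x a)) b\<bar> \<le> 1" "\<bar>total psi_weight (\<lambda>a. Im (x a)) b\<bar> \<le> 1"
  by (rule psi_total_bounded, rule unit_ball_abs_le[OF assms(1)], rule unit_ball_Re_Im[OF assms], assumption)+

lemma Psi_transform:
  assumes "1 \<le> q" "x \<in> lp_ball q A" "finite F" "F \<subseteq> A"
  shows "walsh_transform A (Psi x) (walsh_fun A F) = Psi_hat x F"
  unfolding Psi_def Psi_hat_def
  by (rule riesz_combination(3)) (use psi_total_abs_le[OF assms(1,2)] assms(3,4) in auto)

lemma Psi_minus: "Psi (\<lambda>a. - x a) E = - Psi x E"
proof -
  have "total c (\<lambda>a. - u a) = (\<lambda>a. - total c u a)" for c u by (simp add: total_minus fun_eq_iff)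
  then show ?thesis by (simp add: Psi_def riesz_combination_minus)
qed

lemma Psi_hat_level_zero:
  assumes "\<alpha> \<in> A" shows "Psi_hat x {e 0 {\<alpha>}} = x \<alpha>"
proof -
  have "total c u (e 0 {\<alpha>}) = u \<alpha>" for c u
    using level_zero_e[OF assms] lvl_e[of "{\<alpha>}" 0] assms by (simp add: total_def del: level.simps)
  then show ?thesis by (simp add: Psi_hat_def riesz_coeff_def complex_eq[symmetric])
qed

lemma Psi_inj:
  assumes q: "1 \<le> q" shows "inj_on Psi (lp_ball q A)"
proof (rule inj_onI)
  fix x y assume x: "x \<in> lp_ball q A" and y: "y \<in> lp_ball q A" and eq: "Psi x = Psi y"
  show "x = y"
  proof
    fix \<alpha>
    show "x \<alpha> = y \<alpha>"
    proof (cases "\<alpha> \<in> A")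
      case True
      then have F: "finite {e 0 {\<alpha>}}" "{e 0 {\<alpha>}} \<subseteq> A" using e_mem by auto
      have "Psi_hat x {e 0 {\<alpha>}} = Psi_hat y {e 0 {\<alpha>}}"
        using Psi_transform[OF q x F] Psi_transform[OF q y F] eq by simp
      then show ?thesis unfolding Psi_hat_level_zero[OF True] .
    next
      case False
      then show ?thesis using x y by (simp add: lp_ball_def lp_space_def)
    qed
  qed
qed

lemma cmod_Psi_hat_le:
  assumes "1 \<le> q" "x \<in> lp_ball q A" "finite F" "F \<subseteq> A"
  shows "cmod (Psi_hat x F) \<le> 2"
proof -
  have "\<bar>riesz_coeff (total psi_weight (\<lambda>a. Re (x a))) F\<bar> \<le> 1" "\<bar>riesz_coeff (total psi_weight (\<lambda>a. Im (x a))) F\<bar> \<le> 1"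
    by (rule abs_riesz_coeff_le; use psi_total_abs_le[OF assms(1,2)] assms(3,4) in auto)+
  then show ?thesis
    unfolding Psi_hat_def
    by (intro order_trans[OF norm_triangle_ineq]) (simp add: norm_mult)
qed

lemma psi_weight_powr: "0 < q \<Longrightarrow> \<bar>psi_weight k\<bar> powr q \<le> 1"
  using psi_weight(1)[of k] powr_mono2[of q "\<bar>psi_weight k\<bar>" 1] by simp

text \<open>The weights are at most 1 in modulus, so each level shrinks by
  \<open>excess \<le> 1 / 2\<close> and the levels add up to at most 2. Halving the entries divides
  by \<open>2 powr q\<close>, which is at least 4 because \<open>q\<close> is at least 2.\<close>

lemma psi_total_sums:
  fixes q :: real
  assumes q: "2 \<le> q" and u: "sums_le (\<lambda>a. \<bar>u a\<bar> powr q) A 1"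
  shows "sums_le (\<lambda>a. \<bar>total psi_weight u a\<bar> powr q) A 2"
    and "sums_le (\<lambda>a. \<bar>total psi_weight u a / 2\<bar> powr q) A (1 / 2)"
proof -
  have "sums_le (\<lambda>a. \<bar>1 ^ lvl a * total psi_weight u a\<bar> powr q) {a\<in>A. 0 \<le> lvl a} (excess ^ 0 / (1 - excess))"
    by (rule total_sums_le[where C=1 and \<theta>=excess])
      (use q u excess psi_weight_powr in \<open>auto simp: excess_def\<close>)
  then have s: "sums_le (\<lambda>a. \<bar>total psi_weight u a\<bar> powr q) A (1 / (1 - excess))" by simp
  have e: "1 / (1 - excess) \<le> 2" using excess by (simp add: field_simps)
  show s2: "sums_le (\<lambda>a. \<bar>total psi_weight u a\<bar> powr q) A 2"
    using s by (rule sums_le_mono) (use e in auto)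
  have "2 powr 2 \<le> (2 :: real) powr q" using q by (intro powr_mono) auto
  then have q4: "4 \<le> (2 :: real) powr q" by simp
  have "sums_le (\<lambda>a. 1 / 2 powr q * \<bar>total psi_weight u a\<bar> powr q) A (1 / 2 powr q * 2)"
    by (rule sums_le_cmult[OF _ s2]) simp
  then show "sums_le (\<lambda>a. \<bar>total psi_weight u a / 2\<bar> powr q) A (1 / 2)"
    by (rule sums_le_mono) (use q4 in \<open>auto simp: powr_divide field_simps\<close>)
qed

lemma enn2real_ge_two: "2 < q \<Longrightarrow> q \<noteq> \<infinity> \<Longrightarrow> 2 \<le> enn2real q"
  by (cases q) (auto simp: ennreal_less_iff simp flip: ennreal_numeral)

lemma unit_ball_finite: "q \<noteq> \<infinity> \<Longrightarrow> unit_ball q u \<Longrightarrow> sums_le (\<lambda>a. \<bar>u a\<bar> powr enn2real q) A 1"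
  by (simp add: unit_ball_def)

lemma Psi_hat_sums:
  assumes q: "2 < q" "q \<noteq> \<infinity>" and x: "x \<in> lp_ball q A"
  shows "sums_le (\<lambda>F. cmod (Psi_hat x F) powr enn2real q) {F. finite F \<and> F \<subseteq> A} (4 powr enn2real q)"
proof -
  define r where "r = enn2real q"
  have r: "2 \<le> r" unfolding r_def by (rule enn2real_ge_two[OF q])
  have q1: "1 \<le> q" using q(1) by (meson less_imp_le order_trans one_le_numeral)
  have s: "sums_le (\<lambda>a. \<bar>Re (x a)\<bar> powr r) A 1" "sums_le (\<lambda>a. \<bar>Im (x a)\<bar> powr r) A 1"
    unfolding r_def using unit_ball_finite[OF q(2)] unit_ball_Re_Im[OF q1 x] by blast+
  have "sums_le (\<lambda>F. cmod (complex_of_real (riesz_coeff (total psi_weight (\<lambda>a. Re (x a))) F)) powr r)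
     {F. finite F \<and> F \<subseteq> A} (2 powr r)"
    "sums_le (\<lambda>F. cmod (complex_of_real (riesz_coeff (total psi_weight (\<lambda>a. Im (x a))) F)) powr r)
     {F. finite F \<and> F \<subseteq> A} (2 powr r)"
    using riesz_coeff_sums[OF psi_total_sums(2)[OF r s(1)]] riesz_coeff_sums[OF psi_total_sums(2)[OF r s(2)]]
    by simp_all
  from complex_sums_le[OF _ this] r
  have "sums_le (\<lambda>F. cmod (Psi_hat x F) powr r) {F. finite F \<and> F \<subseteq> A} (2 powr (r - 1) * (2 powr r + 2 powr r))"
    by (simp add: Psi_hat_def)
  moreover have "2 powr (r - 1) * (2 powr r + 2 powr r) = (2 * 2 :: real) powr r"
    by (subst powr_mult) (simp_all add: powr_diff)
  ultimately show ?thesis by (simp add: r_def)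
qed

lemma Psi_hat_norm_le:
  assumes h: "\<And>F. finite F \<Longrightarrow> F \<subseteq> A \<Longrightarrow> cmod (h (walsh_fun A F)) \<le> C"
  shows "bdd_above ((\<lambda>w. cmod (h w)) ` walsh A)" "lp_norm \<infinity> (walsh A) h \<le> C"
proof -
  have le: "cmod (h w) \<le> C" if "w \<in> walsh A" for w using that h by (auto simp: walsh_eq_image)
  show "bdd_above ((\<lambda>w. cmod (h w)) ` walsh A)" by (rule bdd_aboveI2[OF le])
  have "walsh A \<noteq> {}" by (auto simp: walsh_eq_image)
  then show "lp_norm \<infinity> (walsh A) h \<le> C" by (simp add: lp_norm_def cSUP_least le)
qed

text \<open>The variation is bounded by 4 because four measures of mass 1 are combined. For the
  transform, the odd part and the passage to complex vectors cost a factor 2 each.\<close>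

lemma Psi_M_space:
  assumes q: "2 < q" and x: "x \<in> lp_ball q A"
  shows "Psi x \<in> M_p_space A q" "M_p_norm A q (Psi x) \<le> 4"
proof -
  have q1: "1 \<le> q" using q by (meson less_imp_le order_trans one_le_numeral)
  note R = riesz_combination[of "total psi_weight (\<lambda>a. Re (x a))" "total psi_weight (\<lambda>a. Im (x a))", OF psi_total_abs_le[OF q1 x], folded Psi_def]
  have "walsh_transform A (Psi x) \<in> lp_space q (walsh A) \<and> lp_norm q (walsh A) (walsh_transform A (Psi x)) \<le> 4"
  proof (cases "q = \<infinity>")
    case True
    have "cmod (walsh_transform A (Psi x) (walsh_fun A F)) \<le> 4" if "finite F" "F \<subseteq> A" for F
      using cmod_Psi_hat_le[OF q1 x that] Psi_transform[OF q1 x that] by simp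
    then show ?thesis using Psi_hat_norm_le[of "walsh_transform A (Psi x)" 4] True
      by (simp add: lp_space_def walsh_transform_def)
  next
    case False
    have s: "sums_le (\<lambda>w. cmod (walsh_transform A (Psi x) w) powr enn2real q) (walsh A) (4 powr enn2real q)"
      by (rule sums_le_walsh, rule sums_le_mono[OF Psi_hat_sums[OF q False x]])
        (use Psi_transform[OF q1 x] in auto)
    have "walsh_transform A (Psi x) w = 0" if "w \<notin> walsh A" for w using that by (simp add: walsh_transform_def)
    then show ?thesis using lp_spaceI[OF False s] lp_norm_le[OF q1 False s] by simp
  qed
  then show "Psi x \<in> M_p_space A q" "M_p_norm A q (Psi x) \<le> 4"
    using R(1,2) by (simp_all add: M_p_space_def M_p_norm_def)
qed

lemma riesz_coeff_uniformly_continuous: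
  fixes r :: real
  assumes r: "2 \<le> r" and \<epsilon>: "0 < \<epsilon>"
  shows "\<exists>\<eta>>0. \<forall>u v. sums_le (\<lambda>a. \<bar>u a\<bar> powr r) A 1 \<longrightarrow> sums_le (\<lambda>a. \<bar>v a\<bar> powr r) A 1 \<longrightarrow> sums_le (\<lambda>a. \<bar>u a - v a\<bar> powr r) A \<eta> \<longrightarrow>
    sums_le (\<lambda>F. \<bar>riesz_coeff (total psi_weight u) F - riesz_coeff (total psi_weight v) F\<bar> powr r)
      {F. finite F \<and> F \<subseteq> A} \<epsilon>"
proof -
  have r1: "1 \<le> r" using r by simp
  have e2: "0 < \<epsilon> / 2 powr r" using \<epsilon> by simp
  obtain \<eta>1 where \<eta>1: "0 < \<eta>1" "\<And>z w :: 'a \<Rightarrow> real. sums_le (\<lambda>a. \<bar>z a\<bar> powr r) A (1 / 2) \<Longrightarrow> sums_le (\<lambda>a. \<bar>z a - w a\<bar> powr r) A \<eta>1 \<Longrightarrow>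
    sums_le (\<lambda>F. \<bar>(\<Prod>a\<in>F. z a) - (\<Prod>a\<in>F. w a)\<bar> powr r) {F. finite F \<and> F \<subseteq> A} (\<epsilon> / 2 powr r)"
    using uniform_continuity_prod[OF r1 e2, where S="1/2" and A = A] by auto
  have "\<exists>\<eta>>0. \<forall>x y. sums_le (\<lambda>a. \<bar>x a\<bar> powr r) A 1 \<longrightarrow> sums_le (\<lambda>a. \<bar>y a\<bar> powr r) A 1 \<longrightarrow>
    sums_le (\<lambda>a. \<bar>x a - y a\<bar> powr r) A \<eta> \<longrightarrow>
    sums_le (\<lambda>a. \<bar>1 ^ lvl a * (total psi_weight x a - total psi_weight y a)\<bar> powr r) A \<eta>1"
    by (rule total_uniformly_continuous[where C=1 and \<theta>=excess and r=excess])
      (use r1 \<eta>1(1) excess psi_weight_powr in \<open>auto simp: excess_def\<close>)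
  then obtain \<eta> where \<eta>: "0 < \<eta>" "\<And>x y. sums_le (\<lambda>a. \<bar>x a\<bar> powr r) A 1 \<Longrightarrow> sums_le (\<lambda>a. \<bar>y a\<bar> powr r) A 1 \<Longrightarrow>
    sums_le (\<lambda>a. \<bar>x a - y a\<bar> powr r) A \<eta> \<Longrightarrow> sums_le (\<lambda>a. \<bar>total psi_weight x a - total psi_weight y a\<bar> powr r) A \<eta>1" by auto
  show ?thesis
  proof (intro exI[of _ \<eta>] conjI allI impI \<eta>(1))
    fix u v assume u: "sums_le (\<lambda>a. \<bar>u a\<bar> powr r) A 1" and v: "sums_le (\<lambda>a. \<bar>v a\<bar> powr r) A 1"
      and uv: "sums_le (\<lambda>a. \<bar>u a - v a\<bar> powr r) A \<eta>"
    let ?z = "\<lambda>a. total psi_weight u a / 2" and ?w = "\<lambda>a. total psi_weight v a / 2"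
    have "sums_le (\<lambda>a. \<bar>?z a - ?w a\<bar> powr r) A \<eta>1"
      by (rule sums_le_mono[OF \<eta>(2)[OF u v uv]]) (use r in \<open>auto intro!: powr_mono2\<close>)
    then have "sums_le (\<lambda>F. 2 powr r * \<bar>(\<Prod>a\<in>F. ?z a) - (\<Prod>a\<in>F. ?w a)\<bar> powr r) {F. finite F \<and> F \<subseteq> A} (2 powr r * (\<epsilon> / 2 powr r))"
      by (intro sums_le_cmult \<eta>1(2) psi_total_sums(2)[OF r u]) auto
    then show "sums_le (\<lambda>F. \<bar>riesz_coeff (total psi_weight u) F - riesz_coeff (total psi_weight v) F\<bar> powr r)
      {F. finite F \<and> F \<subseteq> A} \<epsilon>"
    proof (rule sums_le_mono)
      fix F
      show "\<bar>riesz_coeff (total psi_weight u) F - riesz_coeff (total psi_weight v) F\<bar> powr r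
        \<le> 2 powr r * \<bar>(\<Prod>a\<in>F. ?z a) - (\<Prod>a\<in>F. ?w a)\<bar> powr r"
      proof (cases "odd (card F)")
        case True
        then have eq: "riesz_coeff (total psi_weight u) F - riesz_coeff (total psi_weight v) F
          = 2 * ((\<Prod>a\<in>F. ?z a) - (\<Prod>a\<in>F. ?w a))" by (simp add: riesz_coeff_def right_diff_distrib)
        show ?thesis unfolding eq abs_mult by (subst powr_mult) simp_all
      qed (simp add: riesz_coeff_def)
    qed auto
  qed
qed

text \<open>Two regimes. For \<open>q = \<infinity>\<close> the recursion and the Riesz coefficients
  are both 1-Lipschitz in the sup norm; for finite \<open>q\<close> both are uniformly continuous
  with respect to sums of q-th powers.\<close>

lemma Psi_transform_continuous:
  assumes q: "2 < q" and x: "x \<in> lp_ball q A" and \<epsilon>: "0 < \<epsilon>"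
  shows "\<exists>\<eta>>0. \<forall>y\<in>lp_ball q A. lp_norm q A (\<lambda>\<alpha>. x \<alpha> - y \<alpha>) < \<eta> \<longrightarrow>
    lp_norm q (walsh A) (\<lambda>w. walsh_transform A (Psi x) w - walsh_transform A (Psi y) w) < \<epsilon>"
proof -
  have q1: "1 \<le> q" using q by (meson less_imp_le order_trans one_le_numeral)
  show ?thesis
  proof (cases "q = \<infinity>")
    case True
    show ?thesis
    \<comment> \<open>Real and imaginary parts contribute a third of \<epsilon> each, which leaves
      the final inequality strict.\<close>
    proof (intro exI[of _ "\<epsilon> / 3"] conjI ballI impI)
      fix y assume y: "y \<in> lp_ball q A" and xy: "lp_norm q A (\<lambda>\<alpha>. x \<alpha> - y \<alpha>) < \<epsilon> / 3"
      have "bdd_above ((\<lambda>a. cmod (x a - y a)) ` A)"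
      proof (rule bdd_aboveI2)
        show "cmod (x a - y a) \<le> 1 + 1" if "a \<in> A" for a
          using lp_ball_infinity[of x A a] lp_ball_infinity[of y A a] x y that True
          by (intro order_trans[OF norm_triangle_ineq4] add_mono) auto
      qed
      then have d: "cmod (x a - y a) \<le> \<epsilon> / 3" if "a \<in> A" for a
        using cSUP_upper[OF that, of "\<lambda>a. cmod (x a - y a)"] xy True by (simp add: lp_norm_def)
      have dR: "\<bar>Re (x a) - Re (y a)\<bar> \<le> \<epsilon> / 3" "\<bar>Im (x a) - Im (y a)\<bar> \<le> \<epsilon> / 3" if "a \<in> A" for a
        using d[OF that] abs_Re_le_cmod[of "x a - y a"] abs_Im_le_cmod[of "x a - y a"] by auto
      have b: "\<bar>Re (x a)\<bar> \<le> 1" "\<bar>Im (x a)\<bar> \<le> 1" "\<bar>Re (y a)\<bar> \<le> 1" "\<bar>Im (y a)\<bar> \<le> 1" if "a \<in> A" for a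
        using unit_ball_abs_le[OF q1 _ that] unit_ball_Re_Im[OF q1 x] unit_ball_Re_Im[OF q1 y] by blast+
      have t: "\<bar>total psi_weight (\<lambda>a. Re (x a)) a - total psi_weight (\<lambda>a. Re (y a)) a\<bar> \<le> \<epsilon> / 3"
        "\<bar>total psi_weight (\<lambda>a. Im (x a)) a - total psi_weight (\<lambda>a. Im (y a)) a\<bar> \<le> \<epsilon> / 3" for a
        unfolding total_def by (rule level_lipschitz; use psi_weight dR b \<epsilon> in simp)+
      have "lp_norm \<infinity> (walsh A) (\<lambda>w. walsh_transform A (Psi x) w - walsh_transform A (Psi y) w) \<le> \<epsilon> / 3 + \<epsilon> / 3"
      proof (rule Psi_hat_norm_le(2))
        fix F assume F: "finite F" "F \<subseteq> A"
        have c: "\<bar>riesz_coeff (total psi_weight (\<lambda>a. Re (x a))) F - riesz_coeff (total psi_weight (\<lambda>a. Re (y a))) F\<bar> \<le> \<epsilon> / 3"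
          "\<bar>riesz_coeff (total psi_weight (\<lambda>a. Im (x a))) F - riesz_coeff (total psi_weight (\<lambda>a. Im (y a))) F\<bar> \<le> \<epsilon> / 3"
          by (rule riesz_coeff_lipschitz; use t psi_total_abs_le[OF q1 x] psi_total_abs_le[OF q1 y] F \<epsilon> in simp)+
        have "Psi_hat x F - Psi_hat y F
          = complex_of_real (riesz_coeff (total psi_weight (\<lambda>a. Re (x a))) F - riesz_coeff (total psi_weight (\<lambda>a. Re (y a))) F)
          + \<i> * complex_of_real (riesz_coeff (total psi_weight (\<lambda>a. Im (x a))) F - riesz_coeff (total psi_weight (\<lambda>a. Im (y a))) F)"
          by (simp add: Psi_hat_def algebra_simps)
        then have "cmod (Psi_hat x F - Psi_hat y F)
          \<le> cmod (complex_of_real (riesz_coeff (total psi_weight (\<lambda>a. Re (x a))) F - riesz_coeff (total psi_weight (\<lambda>a. Re (y a))) F))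
          + cmod (\<i> * complex_of_real (riesz_coeff (total psi_weight (\<lambda>a. Im (x a))) F - riesz_coeff (total psi_weight (\<lambda>a. Im (y a))) F))"
          by (simp only: norm_triangle_ineq)
        also have "\<dots> \<le> \<epsilon> / 3 + \<epsilon> / 3" unfolding norm_mult norm_of_real using c by simp
        finally show "cmod (walsh_transform A (Psi x) (walsh_fun A F) - walsh_transform A (Psi y) (walsh_fun A F)) \<le> \<epsilon> / 3 + \<epsilon> / 3"
          using Psi_transform[OF q1 x F] Psi_transform[OF q1 y F] by simp
      qed
      then show "lp_norm q (walsh A) (\<lambda>w. walsh_transform A (Psi x) w - walsh_transform A (Psi y) w) < \<epsilon>"
        using \<epsilon> True by simp
    qed (use \<epsilon> in simp)
  next
    case False
    define r where "r = enn2real q"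
    have r: "2 \<le> r" "1 \<le> r" unfolding r_def using enn2real_ge_two[OF q False] by auto
    define b where "b = (\<epsilon> / 2) powr r / 2 powr r"
    have b: "0 < b" using \<epsilon> by (simp add: b_def)
    obtain \<eta> where \<eta>: "0 < \<eta>" "\<forall>u v. sums_le (\<lambda>a. \<bar>u a\<bar> powr r) A 1 \<longrightarrow> sums_le (\<lambda>a. \<bar>v a\<bar> powr r) A 1 \<longrightarrow> sums_le (\<lambda>a. \<bar>u a - v a\<bar> powr r) A \<eta> \<longrightarrow>
      sums_le (\<lambda>F. \<bar>riesz_coeff (total psi_weight u) F - riesz_coeff (total psi_weight v) F\<bar> powr r)
      {F. finite F \<and> F \<subseteq> A} b" using riesz_coeff_uniformly_continuous[OF r(1) b] by blast
    have s: "sums_le (\<lambda>a. \<bar>Re (z a)\<bar> powr r) A 1" "sums_le (\<lambda>a. \<bar>Im (z a)\<bar> powr r) A 1" if "z \<in> lp_ball q A" for z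
      unfolding r_def using unit_ball_finite[OF False] unit_ball_Re_Im[OF q1 that] by blast+
    show ?thesis
    proof (intro exI[of _ "\<eta> powr (1 / r)"] conjI ballI impI)
      show "0 < \<eta> powr (1 / r)" using \<eta>(1) by simp
      fix y assume y: "y \<in> lp_ball q A" and xy: "lp_norm q A (\<lambda>\<alpha>. x \<alpha> - y \<alpha>) < \<eta> powr (1 / r)"
      have d: "sums_le (\<lambda>a. cmod (x a - y a) powr r) A \<eta>"
        using lp_diff_sums_le[OF q1 False x y less_imp_le[OF xy]] \<eta>(1) r by (simp add: powr_powr flip: r_def)
      have di: "sums_le (\<lambda>a. \<bar>Re (x a) - Re (y a)\<bar> powr r) A \<eta>" "sums_le (\<lambda>a. \<bar>Im (x a) - Im (y a)\<bar> powr r) A \<eta>"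
        by (rule sums_le_mono[OF d];
          use abs_Re_le_cmod[of "x _ - y _"] abs_Im_le_cmod[of "x _ - y _"] r in \<open>auto intro!: powr_mono2\<close>)+
      have "sums_le (\<lambda>F. \<bar>riesz_coeff (total psi_weight (\<lambda>a. Re (x a))) F - riesz_coeff (total psi_weight (\<lambda>a. Re (y a))) F\<bar> powr r)
        {F. finite F \<and> F \<subseteq> A} b"
        "sums_le (\<lambda>F. \<bar>riesz_coeff (total psi_weight (\<lambda>a. Im (x a))) F - riesz_coeff (total psi_weight (\<lambda>a. Im (y a))) F\<bar> powr r)
        {F. finite F \<and> F \<subseteq> A} b"
        using \<eta>(2)[rule_format, OF s(1)[OF x] s(1)[OF y] di(1)] \<eta>(2)[rule_format, OF s(2)[OF x] s(2)[OF y] di(2)] by simp_all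
      then have c: "sums_le (\<lambda>F. cmod (complex_of_real (riesz_coeff (total psi_weight (\<lambda>a. Re (x a))) F - riesz_coeff (total psi_weight (\<lambda>a. Re (y a))) F)) powr r)
        {F. finite F \<and> F \<subseteq> A} b"
        "sums_le (\<lambda>F. cmod (complex_of_real (riesz_coeff (total psi_weight (\<lambda>a. Im (x a))) F - riesz_coeff (total psi_weight (\<lambda>a. Im (y a))) F)) powr r)
        {F. finite F \<and> F \<subseteq> A} b" by (simp_all only: norm_of_real)
      have "sums_le (\<lambda>F. cmod (Psi_hat x F - Psi_hat y F) powr r) {F. finite F \<and> F \<subseteq> A} (2 powr (r - 1) * (b + b))"
        by (rule sums_le_mono[OF complex_sums_le[OF r(2) c]]) (auto simp: Psi_hat_def algebra_simps)
      moreover have "2 powr (r - 1) * (b + b) = (\<epsilon> / 2) powr r" by (simp add: b_def powr_diff)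
      ultimately have "sums_le (\<lambda>F. cmod (Psi_hat x F - Psi_hat y F) powr r) {F. finite F \<and> F \<subseteq> A} ((\<epsilon> / 2) powr r)" by simp
      then have "sums_le (\<lambda>w. cmod (walsh_transform A (Psi x) w - walsh_transform A (Psi y) w) powr r)
       (walsh A) ((\<epsilon> / 2) powr r)"
        by (intro sums_le_walsh, elim sums_le_mono) (use Psi_transform[OF q1 x] Psi_transform[OF q1 y] in auto)
      from lp_norm_le[OF q1 False this[unfolded r_def]] \<epsilon>
      show "lp_norm q (walsh A) (\<lambda>w. walsh_transform A (Psi x) w - walsh_transform A (Psi y) w) < \<epsilon>" by simp
    qed
  qed
qed

section \<open>Parseval's formula as a sum over odd sets\<close>

lemma ratio_two: "ratio 2 = excess powr (1 / 2)"
  by (simp add: ratio_def)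

lemma parseval_two:
  assumes x: "x \<in> lp_ball 2 A" and y: "y \<in> lp_ball 2 A"
  shows "((\<lambda>F. Phi_hat 2 x F * Phi_hat 2 y F) has_sum (\<Sum>\<^sub>\<infinity>\<alpha>\<in>A. x \<alpha> * y \<alpha>)) (odd_sets A)"
  unfolding Phi_hat_def
proof (rule complex_product_has_sum)
  fix u v assume uv: "u \<in> {\<lambda>a. Re (x a), \<lambda>a. Im (x a)}" "v \<in> {\<lambda>a. Re (y a), \<lambda>a. Im (y a)}"
  have "unit_ball 2 u" "unit_ball 2 v"
    using uv unit_ball_Re_Im[OF _ x] unit_ball_Re_Im[OF _ y] by auto
  then have s: "sums_le (\<lambda>a. \<bar>u a\<bar> powr 2) A 1" "sums_le (\<lambda>a. \<bar>v a\<bar> powr 2) A 1"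
    using unit_ball_finite[of 2] by force+
  then have "sums_le (\<lambda>a. \<bar>u a * v a\<bar>) A (1 + 1)" by (intro dual_sums_le[of 2 2]) auto
  then have "(\<lambda>a. cmod (complex_of_real (u a * v a))) summable_on A"
    using sums_le_summable(1)[of "\<lambda>a. \<bar>u a * v a\<bar>"] by (simp del: of_real_mult)
  then show "(\<lambda>a. complex_of_real (u a * v a)) summable_on A" by (rule abs_summable_summable)
  show "((\<lambda>F. phi_coeff (ratio 2) (twist 2) u F * phi_coeff (ratio 2) (twist 2) v F) has_sum (\<Sum>\<^sub>\<infinity>a\<in>A. complex_of_real (u a * v a))) (odd_sets A)"
    using phi_phi_has_sum[OF s] by (simp only: ratio_two twist_def if_True simp_thms)
qed

lemma parseval:
  assumes pq: "1 \<le> p" "p \<le> 2" "2 < q" "1 / p + 1 / q = 1" and x: "x \<in> lp_ball p A" and y: "y \<in> lp_ball q A"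
  shows "((\<lambda>F. Phi_hat p x F * Psi_hat y F) has_sum (\<Sum>\<^sub>\<infinity>\<alpha>\<in>A. x \<alpha> * y \<alpha>)) (odd_sets A)"
  unfolding Phi_hat_def Psi_hat_def
proof (rule complex_product_has_sum[where H="\<lambda>v F. complex_of_real (riesz_coeff (total psi_weight v) F)"])
  have q1: "1 \<le> q" using pq(3) by (meson less_imp_le order_trans one_le_numeral)
  have q2: "2 \<le> q" using pq(3) by simp
  note conj = ennreal_conjugate[OF pq(1,2,4) q2]
  note pr = p_real[OF pq(1,2)]
  \<comment> \<open>The exponent 2 is its own conjugate, so here \<open>p\<close> is below 2 and the
    phase of \<open>Phi p\<close> is 1. All signs that the cancellation needs sit in
    \<open>psi_weight\<close>.\<close>
  have p2: "p \<noteq> 2"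
  proof
    assume "p = 2"
    then have "q \<noteq> \<infinity>" using conj(2) by auto
    then show False using conj(1) \<open>p = 2\<close> pq(3) by (cases q) (auto simp: ennreal_less_iff field_simps simp flip: ennreal_numeral)
  qed
  fix u v assume uv: "u \<in> {\<lambda>a. Re (x a), \<lambda>a. Im (x a)}" "v \<in> {\<lambda>a. Re (y a), \<lambda>a. Im (y a)}"
  have u: "unit_ball p u" and v: "unit_ball q v"
    using uv unit_ball_Re_Im[OF pq(1) x] unit_ball_Re_Im[OF q1 y] by auto
  have vb: "\<bar>v a\<bar> \<le> 1" if "a \<in> A" for a using unit_ball_abs_le[OF q1 v that] .
  have tb: "\<bar>total psi_weight v a\<bar> \<le> 1" for a using psi_total_bounded[OF vb] .
  have us: "sums_le (\<lambda>a. \<bar>u a\<bar> powr enn2real p) A 1" using unit_ball_finite[OF pr(1) u] .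
  have ts: "sums_le (\<lambda>a. \<bar>ratio p ^ lvl a * total (\<lambda>_. 1 / ratio p) u a\<bar> powr enn2real p) A (1 / (1 - excess))"
    using scaled_total_sums[OF pq(1,2) u, of 0] by simp
  have "\<exists>S T. sums_le (\<lambda>a. \<bar>u a * v a\<bar>) A S \<and>
    sums_le (\<lambda>a. \<bar>(ratio p ^ lvl a * total (\<lambda>_. 1 / ratio p) u a) * total psi_weight v a\<bar>) A T"
  proof (cases "q = \<infinity>")
    case True
    then have "p = 1" using conj(2) by simp
    then have us1: "sums_le (\<lambda>a. \<bar>u a\<bar>) A 1"
      and ts1: "sums_le (\<lambda>a. \<bar>ratio p ^ lvl a * total (\<lambda>_. 1 / ratio p) u a\<bar>) A (1 / (1 - excess))"
      using us ts by simp_all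
    show ?thesis
      by (intro exI conjI) (rule dual_sums_le_one[OF us1], erule vb, rule dual_sums_le_one[OF ts1], rule tb)
  next
    case False
    have q: "2 \<le> enn2real q" by (rule enn2real_ge_two[OF pq(3) False])
    have c: "1 / enn2real p + 1 / enn2real q = 1" using conj(1)[OF False] .
    have "1 \<noteq> enn2real p" using c q by auto
    then have p1: "1 < enn2real p" "1 < enn2real q" using le_neq_trans[OF pr(2)] q by simp_all
    have vs: "sums_le (\<lambda>a. \<bar>v a\<bar> powr enn2real q) A 1" using unit_ball_finite[OF False v] .
    show ?thesis
      by (intro exI conjI) (rule dual_sums_le[OF p1 c us vs], rule dual_sums_le[OF p1 c ts psi_total_sums(1)[OF q vs]])
  qed
  then obtain S T where S: "sums_le (\<lambda>a. \<bar>u a * v a\<bar>) A S"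
    and T: "sums_le (\<lambda>a. \<bar>(ratio p ^ lvl a * total (\<lambda>_. 1 / ratio p) u a) * total psi_weight v a\<bar>) A T" by blast
  have "(\<lambda>a. cmod (complex_of_real (u a * v a))) summable_on A"
    using sums_le_summable(1)[OF S] by (simp del: of_real_mult)
  then show "(\<lambda>a. complex_of_real (u a * v a)) summable_on A" by (rule abs_summable_summable)
  show "((\<lambda>F. phi_coeff (ratio p) (twist p) u F * complex_of_real (riesz_coeff (total psi_weight v) F))
    has_sum (\<Sum>\<^sub>\<infinity>a\<in>A. complex_of_real (u a * v a))) (odd_sets A)"
    using phi_riesz_has_sum[OF ratio(1)[OF pq(1,2)] T] p2 by (simp only: twist_def if_False simp_thms)
qed

lemma Phi_hat_even: "even (card F) \<Longrightarrow> Phi_hat p x F = 0"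
  by (simp add: Phi_hat_def phi_coeff_even)

end

section \<open>Weak continuity\<close>

lemma topspace_initial_topology: "topspace (initial_topology S I e) = S"
  by (auto simp: initial_topology_def topspace_pullback_topology)

lemma continuous_map_initial:
  assumes "i \<in> I" shows "continuous_map (initial_topology S I e) euclidean (e i)"
proof -
  have "continuous_map (initial_topology S I e) euclidean ((\<lambda>\<phi>. \<phi> i) \<circ> (\<lambda>s. \<lambda>i\<in>I. e i s))"
    unfolding initial_topology_def
    by (rule continuous_map_pullback) (use continuous_map_product_projection[OF assms] in blast)
  then show ?thesis using assms by (simp add: o_def)
qed

lemma continuous_map_into_initial:
  assumes "\<And>x. x \<in> topspace T \<Longrightarrow> f x \<in> S" "\<And>i. i \<in> I \<Longrightarrow> continuous_map T euclidean (\<lambda>x. e i (f x))"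
  shows "continuous_map T (initial_topology S I e) f"
  unfolding initial_topology_def
proof (rule continuous_map_pullback')
  show "continuous_map T (product_topology (\<lambda>i. euclidean) I) ((\<lambda>s. \<lambda>i\<in>I. e i s) \<circ> f)"
    unfolding continuous_map_componentwise using assms(2) by (auto cong: restrict_cong)
  show "topspace T \<subseteq> f -` S" using assms(1) by auto
qed

lemma continuous_map_complex_affine:
  fixes f :: "'t \<Rightarrow> real"
  assumes "continuous_map T euclidean f" shows "continuous_map T euclidean (\<lambda>t. c * complex_of_real (f t))"
  using continuous_map_compose[OF assms, of euclidean "\<lambda>r. c * complex_of_real r"]
  by (simp add: o_def continuous_intros)

text \<open>Weak continuity enters the proof through coordinates alone, also for
  \<open>p = \<infinity>\<close>, where the dual is much larger.\<close>

lemma coordinate_in_lp_dual: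
  assumes p: "1 \<le> p" and \<alpha>: "\<alpha> \<in> S" shows "(\<lambda>x. x \<alpha>) \<in> lp_dual p S"
proof -
  have "cmod (x \<alpha>) \<le> lp_norm p S x" if x: "x \<in> lp_space p S" for x
  proof (cases "p = \<infinity>")
    case True
    then show ?thesis using x cSUP_upper[OF \<alpha>, of "\<lambda>i. cmod (x i)"] by (simp add: lp_space_def lp_norm_def)
  next
    case False
    have q: "1 \<le> enn2real p" using p False by (cases p) auto
    have n: "0 \<le> lp_norm p S x" using False by (simp add: lp_norm_def)
    have le: "cmod (x \<alpha>) powr enn2real p \<le> lp_norm p S x powr enn2real p"
      by (rule sums_le_mem[OF lp_norm_sums_le[OF p False x order_refl] \<alpha>])
    show ?thesis
    proof (rule ccontr)
      assume "\<not> cmod (x \<alpha>) \<le> lp_norm p S x"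
      then have "lp_norm p S x powr enn2real p < cmod (x \<alpha>) powr enn2real p"
        using q n by (intro powr_less_mono2) auto
      with le show False by simp
    qed
  qed
  then have "\<exists>C. \<forall>x\<in>lp_space p S. cmod (x \<alpha>) \<le> C * lp_norm p S x" by (intro exI[of _ 1]) simp
  then show ?thesis by (simp add: lp_dual_def)
qed

lemma weak_ball_coordinate_continuous:
  assumes p: "1 \<le> p" and \<alpha>: "\<alpha> \<in> S"
  shows "continuous_map (weak_ball_topology p S) euclidean (\<lambda>x. Re (x \<alpha>))"
    and "continuous_map (weak_ball_topology p S) euclidean (\<lambda>x. Im (x \<alpha>))"
proof -
  have c: "continuous_map (weak_ball_topology p S) euclidean (\<lambda>x. x \<alpha>)"
    unfolding weak_ball_topology_def by (rule continuous_map_initial[OF coordinate_in_lp_dual[OF p \<alpha>]])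
  show "continuous_map (weak_ball_topology p S) euclidean (\<lambda>x. Re (x \<alpha>))"
    using continuous_map_compose[OF c, of euclidean Re] by (simp add: o_def continuous_intros)
  show "continuous_map (weak_ball_topology p S) euclidean (\<lambda>x. Im (x \<alpha>))"
    using continuous_map_compose[OF c, of euclidean Im] by (simp add: o_def continuous_intros)
qed

context haar_cube
begin

section \<open>Integrals of Walsh polynomials against the measures\<close>

lemma riesz_integrable:
  fixes f :: "('a \<Rightarrow> complex) \<Rightarrow> complex"
  assumes z: "\<forall>\<alpha>\<in>A. \<bar>z \<alpha>\<bar> \<le> 1" and f: "f \<in> borel_measurable (cube_borel A)" "\<And>\<omega>. \<omega> \<in> cube A \<Longrightarrow> cmod (f \<omega>) \<le> C"
  shows "integrable (riesz z) f"
proof -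
  note r = riesz[OF z]
  have sp: "space (riesz z) = cube A" using sets_eq_imp_space_eq[OF r(1)] by simp
  show ?thesis
  proof (rule finite_measure.integrable_const_bound[OF r(2)])
    show "AE \<omega> in riesz z. norm (f \<omega>) \<le> C" using f(2) by (intro AE_I2) (simp add: sp)
    show "f \<in> borel_measurable (riesz z)" using f(1) measurable_cong_sets[OF r(1) refl] by blast
  qed
qed

text \<open>Linearity in the integrand is inherited from the representation by four finite measures,
  against which bounded measurable functions are integrable.\<close>

lemma riesz_combination_linear:
  fixes f g :: "('a \<Rightarrow> complex) \<Rightarrow> complex"
  assumes y: "\<And>\<alpha>. \<alpha> \<in> A \<Longrightarrow> \<bar>y \<alpha>\<bar> \<le> 1" and z: "\<And>\<alpha>. \<alpha> \<in> A \<Longrightarrow> \<bar>z \<alpha>\<bar> \<le> 1"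
    and f: "f \<in> borel_measurable (cube_borel A)" "\<And>\<omega>. \<omega> \<in> cube A \<Longrightarrow> cmod (f \<omega>) \<le> C"
    and g: "g \<in> borel_measurable (cube_borel A)" "\<And>\<omega>. \<omega> \<in> cube A \<Longrightarrow> cmod (g \<omega>) \<le> D"
  shows "complex_measure_integral (cube_borel A) (riesz_combination y z) (\<lambda>\<omega>. f \<omega> + c * g \<omega>)
    = complex_measure_integral (cube_borel A) (riesz_combination y z) f
    + c * complex_measure_integral (cube_borel A) (riesz_combination y z) g"
proof -
  have m: "(\<lambda>\<omega>. f \<omega> + c * g \<omega>) \<in> borel_measurable (cube_borel A)"
    using f(1) g(1) by (intro borel_measurable_add borel_measurable_times) auto
  have b: "cmod (f \<omega> + c * g \<omega>) \<le> C + cmod c * D" if "\<omega> \<in> cube A" for \<omega>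
    using f(2)[OF that] g(2)[OF that]
    by (intro order_trans[OF norm_triangle_ineq]) (auto simp: norm_mult intro!: add_mono mult_left_mono)
  have i: "(\<integral>\<omega>. f \<omega> + c * g \<omega> \<partial>riesz w) = (\<integral>\<omega>. f \<omega> \<partial>riesz w) + c * (\<integral>\<omega>. g \<omega> \<partial>riesz w)"
    if w: "\<forall>\<alpha>\<in>A. \<bar>w \<alpha>\<bar> \<le> 1" for w
    using riesz_integrable[OF w f] riesz_integrable[OF w g]
    by (simp only: Bochner_Integration.integral_add integrable_mult_right integral_mult_right_zero)
  have w: "\<forall>\<alpha>\<in>A. \<bar>y \<alpha> / 2\<bar> \<le> 1" "\<forall>\<alpha>\<in>A. \<bar>- (y \<alpha> / 2)\<bar> \<le> 1" "\<forall>\<alpha>\<in>A. \<bar>z \<alpha> / 2\<bar> \<le> 1" "\<forall>\<alpha>\<in>A. \<bar>- (z \<alpha> / 2)\<bar> \<le> 1"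
    using y z by force+
  define I where "I h = (\<integral>\<omega>. h \<omega> \<partial>riesz (\<lambda>\<alpha>. y \<alpha> / 2)) - (\<integral>\<omega>. h \<omega> \<partial>riesz (\<lambda>\<alpha>. - (y \<alpha> / 2)))
    + \<i> * ((\<integral>\<omega>. h \<omega> \<partial>riesz (\<lambda>\<alpha>. z \<alpha> / 2)) - (\<integral>\<omega>. h \<omega> \<partial>riesz (\<lambda>\<alpha>. - (z \<alpha> / 2))))"
    for h :: "('a \<Rightarrow> complex) \<Rightarrow> complex"
  have I: "complex_measure_integral (cube_borel A) (riesz_combination y z) h = I h"
    if "h \<in> borel_measurable (cube_borel A)" "\<forall>\<omega>\<in>cube A. cmod (h \<omega>) \<le> B" for h B
    unfolding I_def by (rule riesz_combination(5)) (use y z that in auto)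
  have "I (\<lambda>\<omega>. f \<omega> + c * g \<omega>) = I f + c * I g"
    unfolding I_def i[OF w(1)] i[OF w(2)] i[OF w(3)] i[OF w(4)] by (simp add: algebra_simps)
  moreover have "\<forall>\<omega>\<in>cube A. cmod (f \<omega> + c * g \<omega>) \<le> C + cmod c * D" "\<forall>\<omega>\<in>cube A. cmod (f \<omega>) \<le> C"
    "\<forall>\<omega>\<in>cube A. cmod (g \<omega>) \<le> D" using b f(2) g(2) by simp_all
  ultimately show ?thesis by (simp only: I[OF m] I[OF f(1)] I[OF g(1)])
qed

lemma walsh_fun_bound: "finite F \<Longrightarrow> F \<subseteq> A \<Longrightarrow> \<omega> \<in> cube A \<Longrightarrow> cmod (walsh_fun A F \<omega>) \<le> 1"
  by (simp add: walsh_fun_apply norm_prod_coordinate)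

lemma riesz_combination_walsh_sum:
  assumes y: "\<And>\<alpha>. \<alpha> \<in> A \<Longrightarrow> \<bar>y \<alpha>\<bar> \<le> 1" and z: "\<And>\<alpha>. \<alpha> \<in> A \<Longrightarrow> \<bar>z \<alpha>\<bar> \<le> 1"
    and S: "finite S" "\<And>F. F \<in> S \<Longrightarrow> finite F \<and> F \<subseteq> A"
  shows "complex_measure_integral (cube_borel A) (riesz_combination y z) (\<lambda>\<omega>. \<Sum>F\<in>S. c F * walsh_fun A F \<omega>)
    = (\<Sum>F\<in>S. c F * walsh_transform A (riesz_combination y z) (walsh_fun A F))"
  using S
proof (induction S rule: finite_induct)
  case empty
  have "cmod (complex_measure_integral (cube_borel A) (riesz_combination y z) (\<lambda>\<omega>. 0)) \<le> 4 * 0"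
    by (rule riesz_combination(4)) (use y z in auto)
  then show ?case by simp
next
  case (insert G S)
  have G: "finite G" "G \<subseteq> A" using insert.prems by auto
  have m: "(\<lambda>\<omega>. \<Sum>F\<in>S. c F * walsh_fun A F \<omega>) \<in> borel_measurable (cube_borel A)"
    by (intro borel_measurable_sum borel_measurable_times walsh_fun_measurable) (use insert.prems in auto)
  have b: "cmod (\<Sum>F\<in>S. c F * walsh_fun A F \<omega>) \<le> (\<Sum>F\<in>S. cmod (c F))" if "\<omega> \<in> cube A" for \<omega>
    by (rule order_trans[OF norm_sum], rule sum_mono)
      (use insert.prems that in \<open>auto simp: norm_mult walsh_fun_bound mult_left_le\<close>)
  have "complex_measure_integral (cube_borel A) (riesz_combination y z) (\<lambda>\<omega>. \<Sum>F\<in>insert G S. c F * walsh_fun A F \<omega>)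
    = complex_measure_integral (cube_borel A) (riesz_combination y z) (\<lambda>\<omega>. (\<Sum>F\<in>S. c F * walsh_fun A F \<omega>) + c G * walsh_fun A G \<omega>)"
    using insert.hyps by (simp add: add.commute)
  also have "\<dots> = complex_measure_integral (cube_borel A) (riesz_combination y z) (\<lambda>\<omega>. \<Sum>F\<in>S. c F * walsh_fun A F \<omega>)
    + c G * complex_measure_integral (cube_borel A) (riesz_combination y z) (walsh_fun A G)"
    by (rule riesz_combination_linear[OF y z m b walsh_fun_measurable[OF G(2)] walsh_fun_bound[OF G]])
  also have "complex_measure_integral (cube_borel A) (riesz_combination y z) (walsh_fun A G)
    = walsh_transform A (riesz_combination y z) (walsh_fun A G)"
    using G by (auto simp: walsh_transform_def walsh_eq_image)
  finally show ?case using insert by (simp add: add.commute)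
qed

lemma riesz_combination_cong:
  assumes y: "\<And>\<alpha>. \<alpha> \<in> A \<Longrightarrow> \<bar>y \<alpha>\<bar> \<le> 1" and z: "\<And>\<alpha>. \<alpha> \<in> A \<Longrightarrow> \<bar>z \<alpha>\<bar> \<le> 1"
    and f: "f \<in> borel_measurable (cube_borel A)" "\<And>\<omega>. \<omega> \<in> cube A \<Longrightarrow> cmod (f \<omega>) \<le> C"
    and g: "g \<in> borel_measurable (cube_borel A)" "\<And>\<omega>. \<omega> \<in> cube A \<Longrightarrow> cmod (g \<omega>) \<le> D"
    and fg: "\<And>\<omega>. \<omega> \<in> cube A \<Longrightarrow> cmod (f \<omega> - g \<omega>) \<le> \<epsilon>"
  shows "cmod (complex_measure_integral (cube_borel A) (riesz_combination y z) f
    - complex_measure_integral (cube_borel A) (riesz_combination y z) g) \<le> 4 * \<epsilon>"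
proof -
  have "cmod (complex_measure_integral (cube_borel A) (riesz_combination y z) (\<lambda>\<omega>. f \<omega> + (- 1) * g \<omega>)) \<le> 4 * \<epsilon>"
    by (rule riesz_combination(4)[OF y z]) (use f(1) g(1) fg in auto)
  then show ?thesis by (subst (asm) riesz_combination_linear[OF y z f g]) simp_all
qed

end

context haar_levels
begin

lemma level_prod_continuous:
  fixes u :: "'t \<Rightarrow> 'a \<Rightarrow> real"
  assumes "\<And>\<alpha>. \<alpha> \<in> A \<Longrightarrow> continuous_map T euclidean (\<lambda>t. u t \<alpha>)" "finite F"
  shows "continuous_map T euclidean (\<lambda>t. \<Prod>b\<in>F. level c (u t) (j b) b)"
  by (intro continuous_map_prod level_continuous assms)

lemma Phi_hat_continuous:
  assumes p: "1 \<le> p" and F: "finite F"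
  shows "continuous_map (weak_ball_topology p A) euclidean (\<lambda>x. Phi_hat p x F)"
proof -
  define k where "k = (twist p * complex_of_real (ratio p)) ^ flev F * complex_of_real (odd_sign (card F))"
  have "Phi_hat p x F = k * complex_of_real (\<Prod>b\<in>F. level (\<lambda>_. 1 / ratio p) (\<lambda>a. Re (x a)) (flev F) b)
     + (\<i> * k) * complex_of_real (\<Prod>b\<in>F. level (\<lambda>_. 1 / ratio p) (\<lambda>a. Im (x a)) (flev F) b)" for x
    by (simp add: Phi_hat_def phi_coeff_def k_def)
  then show ?thesis
    by (simp only:) (intro continuous_map_add continuous_map_complex_affine level_prod_continuous
        weak_ball_coordinate_continuous p F)
qed

lemma Psi_hat_continuous:
  assumes p: "1 \<le> p" and F: "finite F"
  shows "continuous_map (weak_ball_topology p A) euclidean (\<lambda>x. Psi_hat x F)"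
proof -
  define k :: complex where "k = (if odd (card F) then 2 / 2 ^ card F else 0)"
  have r: "complex_of_real (riesz_coeff z F) = k * complex_of_real (\<Prod>b\<in>F. z b)" for z
    by (simp add: riesz_coeff_def k_def prod_dividef)
  have "Psi_hat x F = k * complex_of_real (\<Prod>b\<in>F. level psi_weight (\<lambda>a. Re (x a)) (lvl b) b)
     + (\<i> * k) * complex_of_real (\<Prod>b\<in>F. level psi_weight (\<lambda>a. Im (x a)) (lvl b) b)" for x
    unfolding Psi_hat_def r total_def by (simp only: mult.assoc)
  then show ?thesis
    by (simp only:) (intro continuous_map_add continuous_map_complex_affine level_prod_continuous
        weak_ball_coordinate_continuous p F)
qed

lemma topspace_weak_ball [simp]: "topspace (weak_ball_topology p A) = lp_ball p A"
  by (simp add: weak_ball_topology_def topspace_initial_topology)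

lemma Phi_weakly_continuous:
  assumes p: "1 \<le> p" "p \<le> 2"
  shows "continuous_map (weak_ball_topology p A) (weak_star_Linf_topology A P p) (Phi p)"
  unfolding weak_star_Linf_topology_def
proof (rule continuous_map_into_initial)
  fix x assume "x \<in> topspace (weak_ball_topology p A)"
  then show "Phi p x \<in> Linf_p_space A P p" using Phi_Linf_space(1)[OF p] by simp
next
  fix g :: "('a \<Rightarrow> complex) \<Rightarrow> complex" assume "g \<in> {g. integrable P g}"
  then have g: "integrable P g" by simp
  define C where "C = 2 * sqrt (exp 1) / (1 - ratio p)"
  have C: "0 < C" using ratio[OF p] by (simp add: C_def)
  show "continuous_map (weak_ball_topology p A) euclidean (\<lambda>x. \<integral>\<omega>. Phi p x \<omega> * g \<omega> \<partial>P)"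
  proof (rule continuous_uniform_approximation)
    fix \<epsilon> :: real assume \<epsilon>: "0 < \<epsilon>"
    obtain h where h: "cylindrical A h" "(\<integral>\<omega>. cmod (g \<omega> - h \<omega>) \<partial>P) < \<epsilon> / C"
      using cylindrical_dense_L1[OF g, of "\<epsilon> / C"] \<epsilon> C by auto
    obtain F c where F: "finite F" "F \<subseteq> A" and hF: "\<And>\<omega>. \<omega> \<in> cube A \<Longrightarrow> h \<omega> = (\<Sum>G\<in>Pow F. c G * (\<Prod>\<alpha>\<in>G. \<omega> \<alpha>))"
      using cylindrical_walsh_expansion[OF h(1)] by metis
    obtain D where D: "\<And>\<omega>. \<omega> \<in> cube A \<Longrightarrow> cmod (h \<omega>) \<le> D" using cylindrical_measurable(2)[OF h(1)] by blast
    have hi: "integrable P h" by (rule bounded_integrable[OF cylindrical_measurable(1)[OF h(1)] D])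
    show "\<exists>k. continuous_map (weak_ball_topology p A) euclidean k \<and>
      (\<forall>x\<in>topspace (weak_ball_topology p A). cmod ((\<integral>\<omega>. Phi p x \<omega> * g \<omega> \<partial>P) - k x) < \<epsilon>)"
    proof (intro exI[of _ "\<lambda>x. \<Sum>G\<in>Pow F. c G * Phi_hat p x G"] conjI ballI)
      show "continuous_map (weak_ball_topology p A) euclidean (\<lambda>x. \<Sum>G\<in>Pow F. c G * Phi_hat p x G)"
        by (rule continuous_map_complex_linear_combination)
          (use F in \<open>auto intro!: Phi_hat_continuous p intro: finite_subset\<close>)
      fix x assume "x \<in> topspace (weak_ball_topology p A)"
      then have x: "x \<in> lp_ball p A" by simp
      note m = Phi_measurable[OF p x] and b = Phi_bound[OF p x, folded C_def]
      have pi: "integrable P (\<lambda>\<omega>. Phi p x \<omega> * f \<omega>)" if f: "integrable P f" for f :: "('a \<Rightarrow> complex) \<Rightarrow> complex"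
      proof (rule Bochner_Integration.integrable_bound)
        show "integrable P (\<lambda>\<omega>. C * cmod (f \<omega>))" using f by (intro integrable_mult_right integrable_norm)
        show "(\<lambda>\<omega>. Phi p x \<omega> * f \<omega>) \<in> borel_measurable P"
          using borel_measurable_times[of "Phi p x" P f] m borel_measurable_integrable[OF f] by simp
        show "AE \<omega> in P. norm (Phi p x \<omega> * f \<omega>) \<le> norm (C * cmod (f \<omega>))"
          using b C by (intro AE_I2) (simp add: norm_mult mult_right_mono)
      qed
      have wi: "integrable P (\<lambda>\<omega>. \<Prod>\<alpha>\<in>G. \<omega> \<alpha> :: complex)" if "G \<subseteq> F" for G
        by (rule bounded_integrable[where C=1]) (use that F prod_coordinate_measurable[of G A] norm_prod_coordinate[of _ A G] in auto)
      have "(\<integral>\<omega>. Phi p x \<omega> * h \<omega> \<partial>P) = (\<integral>\<omega>. (\<Sum>G\<in>Pow F. c G * (Phi p x \<omega> * (\<Prod>\<alpha>\<in>G. \<omega> \<alpha>))) \<partial>P)"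
        by (rule Bochner_Integration.integral_cong) (auto simp: hF sum_distrib_left mult.left_commute)
      also have "\<dots> = (\<Sum>G\<in>Pow F. \<integral>\<omega>. c G * (Phi p x \<omega> * (\<Prod>\<alpha>\<in>G. \<omega> \<alpha>)) \<partial>P)"
        by (rule Bochner_Integration.integral_sum) (intro integrable_mult_right pi wi, auto)
      also have "\<dots> = (\<Sum>G\<in>Pow F. c G * Phi_hat p x G)"
      proof (rule sum.cong[OF refl])
        fix G assume "G \<in> Pow F"
        then have "finite G" "G \<subseteq> A" using F finite_subset by auto
        then show "(\<integral>\<omega>. c G * (Phi p x \<omega> * (\<Prod>\<alpha>\<in>G. \<omega> \<alpha>)) \<partial>P) = c G * Phi_hat p x G"
          using Phi_walsh[OF p x] by simp
      qed
      finally have eq: "(\<integral>\<omega>. Phi p x \<omega> * h \<omega> \<partial>P) = (\<Sum>G\<in>Pow F. c G * Phi_hat p x G)" .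
      have "(\<integral>\<omega>. Phi p x \<omega> * g \<omega> \<partial>P) - (\<integral>\<omega>. Phi p x \<omega> * h \<omega> \<partial>P) = (\<integral>\<omega>. Phi p x \<omega> * g \<omega> - Phi p x \<omega> * h \<omega> \<partial>P)"
        by (rule Bochner_Integration.integral_diff[symmetric]) (intro pi g hi)+
      also have "cmod \<dots> \<le> (\<integral>\<omega>. cmod (Phi p x \<omega> * g \<omega> - Phi p x \<omega> * h \<omega>) \<partial>P)"
        by (rule integral_norm_bound)
      also have "\<dots> \<le> (\<integral>\<omega>. C * cmod (g \<omega> - h \<omega>) \<partial>P)"
      proof (rule integral_mono)
        show "integrable P (\<lambda>\<omega>. cmod (Phi p x \<omega> * g \<omega> - Phi p x \<omega> * h \<omega>))"
          by (intro integrable_norm Bochner_Integration.integrable_diff pi g hi)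
        show "integrable P (\<lambda>\<omega>. C * cmod (g \<omega> - h \<omega>))"
          by (intro integrable_mult_right integrable_norm Bochner_Integration.integrable_diff g hi)
        show "cmod (Phi p x \<omega> * g \<omega> - Phi p x \<omega> * h \<omega>) \<le> C * cmod (g \<omega> - h \<omega>)" for \<omega>
          using mult_right_mono[OF b[of \<omega>] norm_ge_zero[of "g \<omega> - h \<omega>"]]
          by (simp only: right_diff_distrib[symmetric] norm_mult)
      qed
      also have "\<dots> = C * (\<integral>\<omega>. cmod (g \<omega> - h \<omega>) \<partial>P)" by simp
      also have "\<dots> < \<epsilon>" using h(2) C by (simp add: pos_less_divide_eq mult.commute)
      finally show "cmod ((\<integral>\<omega>. Phi p x \<omega> * g \<omega> \<partial>P) - (\<Sum>G\<in>Pow F. c G * Phi_hat p x G)) < \<epsilon>"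
        unfolding eq .
    qed
  qed
qed

lemma Psi_weakly_continuous:
  assumes q: "2 < q"
  shows "continuous_map (weak_ball_topology q A) (weak_star_M_topology A q) Psi"
  unfolding weak_star_M_topology_def
proof (rule continuous_map_into_initial)
  fix x assume "x \<in> topspace (weak_ball_topology q A)"
  then show "Psi x \<in> M_p_space A q" using Psi_M_space(1)[OF q] by simp
next
  have q1: "1 \<le> q" using q by (meson less_imp_le order_trans one_le_numeral)
  fix g :: "('a \<Rightarrow> complex) \<Rightarrow> complex" assume "g \<in> {g. continuous_map (cube_topology A) euclidean g}"
  then have g: "continuous_map (cube_topology A) euclidean g" by simp
  show "continuous_map (weak_ball_topology q A) euclidean (\<lambda>x. complex_measure_integral (cube_borel A) (Psi x) g)"
  proof (rule continuous_uniform_approximation)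
    fix \<epsilon> :: real assume \<epsilon>: "0 < \<epsilon>"
    \<comment> \<open>Four measures of mass 1 multiply a uniform error by 4 at most, so a fifth of
      \<epsilon> leaves the inequality strict.\<close>
    obtain h where h: "cylindrical A h" "\<And>\<omega>. \<omega> \<in> cube A \<Longrightarrow> cmod (g \<omega> - h \<omega>) < \<epsilon> / 5"
      using continuous_cube_cylindrical[OF g, of "\<epsilon> / 5"] \<epsilon> by auto
    obtain F c where F: "finite F" "F \<subseteq> A" and hF: "\<And>\<omega>. \<omega> \<in> cube A \<Longrightarrow> h \<omega> = (\<Sum>G\<in>Pow F. c G * (\<Prod>\<alpha>\<in>G. \<omega> \<alpha>))"
      using cylindrical_walsh_expansion[OF h(1)] by metis
    define k where "k \<omega> = (\<Sum>G\<in>Pow F. c G * walsh_fun A G \<omega>)" for \<omega>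
    have hk: "h \<omega> = k \<omega>" if "\<omega> \<in> cube A" for \<omega> using that by (simp add: hF k_def walsh_fun_apply)
    obtain D where D: "\<And>\<omega>. \<omega> \<in> cube A \<Longrightarrow> cmod (h \<omega>) \<le> D" using cylindrical_measurable(2)[OF h(1)] by blast
    have km: "k \<in> borel_measurable (cube_borel A)"
      unfolding k_def by (intro borel_measurable_sum borel_measurable_times walsh_fun_measurable) (use F in auto)
    have kD: "cmod (k \<omega>) \<le> D" if "\<omega> \<in> cube A" for \<omega> using D[OF that] hk[OF that] by simp
    have gk: "cmod (g \<omega> - k \<omega>) \<le> \<epsilon> / 5" if "\<omega> \<in> cube A" for \<omega> using h(2)[OF that] hk[OF that] by simp
    have gD: "cmod (g \<omega>) \<le> D + \<epsilon> / 5" if "\<omega> \<in> cube A" for \<omega>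
      using norm_triangle_ineq[of "k \<omega>" "g \<omega> - k \<omega>"] kD[OF that] gk[OF that] by simp
    have P: "finite G \<and> G \<subseteq> A" if "G \<in> Pow F" for G using that F finite_subset by auto
    show "\<exists>k. continuous_map (weak_ball_topology q A) euclidean k \<and>
      (\<forall>x\<in>topspace (weak_ball_topology q A). cmod (complex_measure_integral (cube_borel A) (Psi x) g - k x) < \<epsilon>)"
    proof (intro exI[of _ "\<lambda>x. \<Sum>G\<in>Pow F. c G * Psi_hat x G"] conjI ballI)
      show "continuous_map (weak_ball_topology q A) euclidean (\<lambda>x. \<Sum>G\<in>Pow F. c G * Psi_hat x G)"
        by (rule continuous_map_complex_linear_combination)
          (use F in \<open>auto intro!: Psi_hat_continuous q1 intro: finite_subset\<close>)
      fix x assume "x \<in> topspace (weak_ball_topology q A)"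
      then have x: "x \<in> lp_ball q A" by simp
      note t = psi_total_abs_le[OF q1 x]
      have "complex_measure_integral (cube_borel A) (Psi x) k = (\<Sum>G\<in>Pow F. c G * walsh_transform A (Psi x) (walsh_fun A G))"
        unfolding k_def[abs_def] Psi_def
        by (rule riesz_combination_walsh_sum[OF t finite_Pow_iff[THEN iffD2, OF F(1)] P])
      also have "\<dots> = (\<Sum>G\<in>Pow F. c G * Psi_hat x G)"
        using Psi_transform[OF q1 x] P by (intro sum.cong) auto
      finally have eq: "complex_measure_integral (cube_borel A) (Psi x) k = (\<Sum>G\<in>Pow F. c G * Psi_hat x G)" .
      have "cmod (complex_measure_integral (cube_borel A) (Psi x) g - complex_measure_integral (cube_borel A) (Psi x) k) \<le> 4 * (\<epsilon> / 5)"
        unfolding Psi_def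
        by (rule riesz_combination_cong[OF t continuous_cube_measurable[OF g] gD km kD gk])
      then show "cmod (complex_measure_integral (cube_borel A) (Psi x) g - (\<Sum>G\<in>Pow F. c G * Psi_hat x G)) < \<epsilon>"
        unfolding eq using \<epsilon> by simp
    qed
  qed
qed

lemma walsh_parseval:
  assumes pq: "1 \<le> p" "p \<le> 2" "2 \<le> q" "1 / p + 1 / q = 1" and x: "x \<in> lp_ball p A" and y: "y \<in> lp_ball q A"
  shows "(\<Sum>\<^sub>\<infinity>\<alpha>\<in>A. x \<alpha> * y \<alpha>) = (\<Sum>\<^sub>\<infinity>w\<in>walsh A. walsh_transform A (density_measure P (Phi p x)) w *
    walsh_transform A (if q \<le> 2 then density_measure P (Phi q y) else Psi y) w)"
proof (cases "q = 2")
  case True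
  then have q2: "q \<noteq> \<infinity>" "enn2real q = 2" by simp_all
  have "1 / enn2real p + 1 / 2 = 1" using ennreal_conjugate(1)[OF pq(1,2,4,3) q2(1)] unfolding q2(2) .
  then have "1 / enn2real p = 1 / 2" by linarith
  then have "enn2real p = 2" by (simp only: divide_inverse mult_1 inverse_eq_iff_eq)
  then have "p = ennreal 2" using ennreal_enn2real[of p] p_real[OF pq(1,2)] by (simp add: less_top)
  then have "p = 2" by simp
  have le: "1 \<le> (2::ennreal)" "(2::ennreal) \<le> 2" by simp_all
  show ?thesis
    by (rule infsum_walsh[OF _ _ parseval_two, symmetric])
      (use x y True \<open>p = 2\<close> Phi_transform[OF le] Phi_hat_even in auto)
next
  case False
  then have q: "2 < q" "\<not> q \<le> 2" using pq(3) by auto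
  have q1: "1 \<le> q" using q by (meson less_imp_le order_trans one_le_numeral)
  show ?thesis
    by (rule infsum_walsh[OF _ _ parseval[OF pq(1,2) q(1) pq(4) x y], symmetric])
      (use q Phi_transform[OF pq(1,2) x] Psi_transform[OF q1 y] Phi_hat_even in auto)
qed

end

theorem theorem9p1:
  fixes A :: "'a set" and P :: "('a \<Rightarrow> complex) measure" and \<delta> :: real
  assumes "infinite A"
    and "normalized_haar A P"
    and "\<delta> = sqrt (sinh 1 - 1)"
  shows "\<exists>(\<Phi> :: ennreal \<Rightarrow> ('a \<Rightarrow> complex) \<Rightarrow> ('a \<Rightarrow> complex) \<Rightarrow> complex)
      (\<Psi> :: ennreal \<Rightarrow> ('a \<Rightarrow> complex) \<Rightarrow> ('a \<Rightarrow> complex) set \<Rightarrow> complex).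
    let hat = (\<lambda>p x. walsh_transform A (if p \<le> 2 then density_measure P (\<Phi> p x) else \<Psi> p x)) in
    (\<forall>p. 1 \<le> p \<and> p \<le> 2 \<longrightarrow>
      \<Phi> p \<in> lp_ball p A \<rightarrow> Linf_p_space A P p \<and>
      (\<forall>x\<in>lp_ball p A. \<forall>y\<in>lp_ball p A. (AE \<omega> in P. \<Phi> p x \<omega> = \<Phi> p y \<omega>) \<longrightarrow> x = y) \<and>
      (\<forall>x\<in>lp_ball p A.
        Linf_p_norm A P p (\<Phi> p x) \<le> 2 * sqrt (exp 1) / (1 - \<delta> powr enn2real (2 / p))) \<and>
      (\<forall>x\<in>lp_ball p A. AE \<omega> in P. \<Phi> p (\<lambda>\<alpha>. - x \<alpha>) \<omega> = - \<Phi> p x \<omega>) \<and>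
      continuous_map (weak_ball_topology p A) (weak_star_Linf_topology A P p) (\<Phi> p)) \<and>
    (\<forall>p. 2 < p \<longrightarrow>
      \<Psi> p \<in> lp_ball p A \<rightarrow> M_p_space A p \<and>
      inj_on (\<Psi> p) (lp_ball p A) \<and>
      (\<forall>x\<in>lp_ball p A.
        M_p_norm A p (\<Psi> p x) \<le> 4 * ((1 + \<delta>\<^sup>2) / (1 - \<delta>\<^sup>2)) powr enn2real (1 / p)) \<and>
      (\<forall>x\<in>lp_ball p A. \<Psi> p (\<lambda>\<alpha>. - x \<alpha>) = (\<lambda>E. - \<Psi> p x E)) \<and>
      continuous_map (weak_ball_topology p A) (weak_star_M_topology A p) (\<Psi> p)) \<and>
    (\<forall>p q. 1 \<le> p \<and> p \<le> 2 \<and> 2 \<le> q \<and> 1 / p + 1 / q = 1 \<longrightarrow>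
      (\<forall>x\<in>lp_ball p A. \<forall>y\<in>lp_ball q A.
        (\<Sum>\<^sub>\<infinity>\<alpha>\<in>A. x \<alpha> * cnj (y \<alpha>)) =
        (\<Sum>\<^sub>\<infinity>w\<in>walsh A. hat p x w * hat q (\<lambda>\<alpha>. cnj (y \<alpha>)) w))) \<and>
    (\<forall>p. 1 \<le> p \<longrightarrow>
      (\<forall>x\<in>lp_ball p A. \<forall>\<epsilon>>0. \<exists>\<eta>>0. \<forall>y\<in>lp_ball p A.
        lp_norm p A (\<lambda>\<alpha>. x \<alpha> - y \<alpha>) < \<eta> \<longrightarrow>
        lp_norm p (walsh A) (\<lambda>w. hat p x w - hat p y w) < \<epsilon>))"
proof -
  obtain e :: "nat \<Rightarrow> 'a set \<Rightarrow> 'a" and lvl idx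
    where e: "\<And>j F. finite F \<Longrightarrow> F \<subseteq> A \<Longrightarrow> e j F \<in> A \<and> lvl (e j F) = j \<and> idx (e j F) = F"
    using finite_subsets_coding_exists[OF assms(1)] by metis
  interpret haar_levels A P e lvl idx
    by unfold_locales (use assms(2) e in auto)
  have \<delta>: "\<delta> = excess powr (1 / 2)" "\<delta>\<^sup>2 = excess"
    using excess by (simp_all add: assms(3) powr_half_sqrt flip: excess_def)
  have \<delta>p: "\<delta> powr enn2real (2 / p) = ratio p" if p: "1 \<le> p" "p \<le> 2" for p
  proof -
    obtain r where r: "p = ennreal r" "1 \<le> r" using p by (cases p) (auto simp: top_unique)
    have "2 / p = ennreal 2 / ennreal r" using r by simp
    also have "\<dots> = ennreal (2 / r)" using r by (intro divide_ennreal) auto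
    finally have "enn2real (2 / p) = 2 / r" using r by simp
    then show ?thesis using r by (simp add: \<delta>(1) ratio_def powr_powr)
  qed
  \<comment> \<open>The required bound is at least 4, since the base is at least 1 and the exponent
    is nonnegative; for \<open>p = \<infinity>\<close> the exponent \<open>enn2real (1 / p)\<close>
    is 0.\<close>
  have M: "4 \<le> 4 * ((1 + \<delta>\<^sup>2) / (1 - \<delta>\<^sup>2)) powr r" if "0 \<le> r" for r
    using excess that ge_one_powr_ge_zero[of "(1 + excess) / (1 - excess)" r] by (simp add: \<delta>(2))
  have 1: "Phi p \<in> lp_ball p A \<rightarrow> Linf_p_space A P p \<and>
      (\<forall>x\<in>lp_ball p A. \<forall>y\<in>lp_ball p A. (AE \<omega> in P. Phi p x \<omega> = Phi p y \<omega>) \<longrightarrow> x = y) \<and>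
      (\<forall>x\<in>lp_ball p A. Linf_p_norm A P p (Phi p x) \<le> 2 * sqrt (exp 1) / (1 - \<delta> powr enn2real (2 / p))) \<and>
      (\<forall>x\<in>lp_ball p A. AE \<omega> in P. Phi p (\<lambda>\<alpha>. - x \<alpha>) \<omega> = - Phi p x \<omega>) \<and>
      continuous_map (weak_ball_topology p A) (weak_star_Linf_topology A P p) (Phi p)"
    if p: "1 \<le> p" "p \<le> 2" for p
    using Phi_Linf_space[OF p] Phi_inj[OF p] Phi_minus[OF p] Phi_weakly_continuous[OF p]
    unfolding \<delta>p[OF p] by (intro conjI funcsetI ballI impI AE_I2) auto
  have 2: "Psi \<in> lp_ball p A \<rightarrow> M_p_space A p \<and> inj_on Psi (lp_ball p A) \<and>
      (\<forall>x\<in>lp_ball p A. M_p_norm A p (Psi x) \<le> 4 * ((1 + \<delta>\<^sup>2) / (1 - \<delta>\<^sup>2)) powr enn2real (1 / p)) \<and>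
      (\<forall>x\<in>lp_ball p A. Psi (\<lambda>\<alpha>. - x \<alpha>) = (\<lambda>E. - Psi x E)) \<and>
      continuous_map (weak_ball_topology p A) (weak_star_M_topology A p) Psi"
    if p: "2 < p" for p
  proof -
    have "1 \<le> p" using p by (meson less_imp_le order_trans one_le_numeral)
    from Psi_inj[OF this] show ?thesis
      using Psi_M_space[OF p] Psi_minus Psi_weakly_continuous[OF p] order_trans[OF _ M[of "enn2real (1 / p)"]]
      by (intro conjI funcsetI ballI ext) auto
  qed
  have 3: "(\<Sum>\<^sub>\<infinity>\<alpha>\<in>A. x \<alpha> * cnj (y \<alpha>)) =
      (\<Sum>\<^sub>\<infinity>w\<in>walsh A. walsh_transform A (if p \<le> 2 then density_measure P (Phi p x) else Psi x) w *
        walsh_transform A (if q \<le> 2 then density_measure P (Phi q (\<lambda>\<alpha>. cnj (y \<alpha>))) else Psi (\<lambda>\<alpha>. cnj (y \<alpha>))) w)"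
    if pq: "1 \<le> p" "p \<le> 2" "2 \<le> q" "1 / p + 1 / q = 1" and "x \<in> lp_ball p A" "y \<in> lp_ball q A" for p q x y
    using walsh_parseval[OF pq that(5) lp_ball_cnj[OF that(6)]] pq(2) by (simp only: if_True simp_thms)
  have 4: "\<exists>\<eta>>0. \<forall>y\<in>lp_ball p A. lp_norm p A (\<lambda>\<alpha>. x \<alpha> - y \<alpha>) < \<eta> \<longrightarrow>
      lp_norm p (walsh A) (\<lambda>w. walsh_transform A (if p \<le> 2 then density_measure P (Phi p x) else Psi x) w
        - walsh_transform A (if p \<le> 2 then density_measure P (Phi p y) else Psi y) w) < \<epsilon>"
    if "1 \<le> p" "x \<in> lp_ball p A" "0 < \<epsilon>" for p x \<epsilon>
    using Phi_transform_continuous[OF that(1) _ that(2,3)] Psi_transform_continuous[OF _ that(2,3)]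
    by (cases "p \<le> 2") (auto simp: not_le)
  show ?thesis
    unfolding Let_def
    \<comment> \<open>A single map \<open>Psi\<close> serves every exponent above 2; the exponent
      appears only in the domain, the range and the norms.\<close>
    by (rule exI[of _ Phi], rule exI[of _ "\<lambda>_. Psi"], intro conjI; intro allI impI ballI; (elim conjE)?;
        ((rule 1; assumption) | (rule 2; assumption) | (rule 3; assumption) | (rule 4; assumption)))
qed

end
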